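(* For any $(z,\nu)\in\mathbb{R}^m\times S^{n-1}$ one has $$g(z,\nu)=\lim_{T\to\infty}\ \inf_{(u,v)\in\mathcal{U}^T_{z,\nu}}\frac1{T^{n-1}}\mathcal{F}^\infty_1(u,v;Q^\nu_T)$$ (in particular the limit exists), where $$\mathcal{U}^T_{z,\nu}:=\Big\{(u,v)\in W^{1,2}(Q^\nu_T;\mathbb{R}^{m+1}):\ 0\le v\le1,\ v=\chi_{\{|x\cdot\nu|\ge2\}}*\varphi_1\text{ and }u=(z\chi_{\{x\cdot\nu>0\}})*\varphi_1\text{ on }\partial Q^\nu_T\Big\}.$$
   Context: Data. $m,n\ge1$ are integers, $\ell>0$; $|\cdot|$ is the Euclidean (Frobenius) norm. $\Psi:\mathbb{R}^{m\times n}\to[0,\infty)$ is continuous and there is $c\ge1$ with $\max\{\frac1c|\xi|^2-c,0\}\le\Psi(\xi)\le c(|\xi|^2+1)$ for all $\xi$. The limit $\Psi_\infty(\xi):=\lim_{t\to\infty}\Psi(t\xi)/t^2$ is assumed to exist, uniformly on $\{|\xi|=1\}$. $f(s):=\frac{\ell s}{1-s}$ for $s\in[0,1)$. For every $\nu\in S^{n-1}$ fix an (open) cube $Q^\nu\subset\mathbb{R}^n$ of side length 1, centered at the origin, with one side parallel to $\nu$; $Q^\nu_r:=rQ^\nu$. For $A\subseteq\mathbb{R}^n$ open, $u\in W^{1,2}(A;\mathbb{R}^m)$, $v\in W^{1,2}(A;[0,1])$, $\varepsilon>0$, let $$\mathcal{F}^\infty_\varepsilon(u,v;A):=\int_A\Big(\varepsilon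 f^2(v)\Psi_\infty(\nabla u)+\frac{(1-v)^2}{4\varepsilon}+\varepsilon|\nabla v|^2\Big)dx,$$ the first term being interpreted as zero where $\nabla u=0$, even if $v=1$. For $(z,\nu)\in\mathbb{R}^m\times S^{n-1}$, $$g(z,\nu):=\inf\{\liminf_{j\to\infty}\mathcal{F}^\infty_{\varepsilon_j}(u_j,v_j;Q^\nu):\ \|u_j-z\chi_{\{x\cdot\nu>0\}}\|_{L^1(Q^\nu)}\to0,\ \varepsilon_j\to0\},$$ with $u_j\in W^{1,2}(Q^\nu;\mathbb{R}^m)$, $v_j\in W^{1,2}(Q^\nu;[0,1])$. $\varphi_1\in C_c^\infty(B_1)$ is a fixed mollifier: $\varphi_1\ge0$, $\int_{B_1}\varphi_1\,dx=1$, where $B_1\subset\mathbb{R}^n$ is the unit ball. Boundary values are in the sense of traces. *)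

theory Defs
  imports "HOL-Analysis.Analysis"
begin

definition grad :: "(real^'n \<Rightarrow> real) \<Rightarrow> real^'n \<Rightarrow> real^'n" where
  "grad f x = (\<chi> j. frechet_derivative f (at x) (axis j 1))"

primrec C_diff :: "nat \<Rightarrow> (real^'n \<Rightarrow> real) \<Rightarrow> bool" where
  "C_diff 0 f \<longleftrightarrow> continuous_on UNIV f"
| "C_diff (Suc k) f \<longleftrightarrow> f differentiable_on UNIV \<and> (\<forall>j. C_diff k (\<lambda>x. grad f x $ j))"

definition smooth :: "(real^'n \<Rightarrow> real) \<Rightarrow> bool" where
  "smooth f \<longleftrightarrow> (\<forall>k. C_diff k f)"

definition test_fun :: "(real^'n) set \<Rightarrow> (real^'n \<Rightarrow> real) \<Rightarrow> bool" where
  "test_fun A \<phi> \<longleftrightarrow> smooth \<phi> \<and> compact (closure {x. \<phi> x \<noteq> 0}) \<and> closure {x. \<phi> x \<noteq> 0} \<subseteq> A"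

definition sq_integrable :: "(real^'n) set \<Rightarrow> (real^'n \<Rightarrow> 'b::euclidean_space) \<Rightarrow> bool" where
  "sq_integrable A f \<longleftrightarrow>
     f \<in> borel_measurable (lebesgue_on A) \<and> integrable (lebesgue_on A) (\<lambda>x. (norm (f x))\<^sup>2)"

definition is_weak_grad ::
  "(real^'n) set \<Rightarrow> (real^'n \<Rightarrow> real) \<Rightarrow> (real^'n \<Rightarrow> real^'n) \<Rightarrow> bool" where
  "is_weak_grad A v G \<longleftrightarrow> sq_integrable A G \<and>
     (\<forall>\<phi> j. test_fun A \<phi> \<longrightarrow>
        (LINT x|lebesgue_on A. v x * grad \<phi> x $ j) = - (LINT x|lebesgue_on A. G x $ j * \<phi> x))"

definition W12 :: "(real^'n) set \<Rightarrow> (real^'n \<Rightarrow> real) \<Rightarrow> bool" where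
  "W12 A v \<longleftrightarrow> sq_integrable A v \<and> (\<exists>G. is_weak_grad A v G)"

text \<open>A representative of the weak gradient, which is unique up to null sets for \<open>v\<close> in
  \<open>W12 A\<close> with \<open>A\<close> open; all uses below are insensitive to null sets.\<close>

definition weak_grad :: "(real^'n) set \<Rightarrow> (real^'n \<Rightarrow> real) \<Rightarrow> real^'n \<Rightarrow> real^'n" where
  "weak_grad A v = (SOME G. is_weak_grad A v G)"

definition W12_vec :: "(real^'n) set \<Rightarrow> (real^'n \<Rightarrow> real^'m) \<Rightarrow> bool" where
  "W12_vec A u \<longleftrightarrow> (\<forall>i. W12 A (\<lambda>x. u x $ i))"

text \<open>Row \<open>i\<close> is the gradient of the \<open>i\<close>-th component. The norm of \<open>real^'n^'m\<close> is the
  Frobenius norm.\<close>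

definition weak_jacobian :: "(real^'n) set \<Rightarrow> (real^'n \<Rightarrow> real^'m) \<Rightarrow> real^'n \<Rightarrow> real^'n^'m" where
  "weak_jacobian A u x = (\<chi> i. weak_grad A (\<lambda>y. u y $ i) x)"

definition unit_cube :: "(real^'n) set" where
  "unit_cube = {y. \<forall>j. \<bar>y $ j\<bar> < 1 / 2}"

text \<open>A cube with one side parallel to \<open>\<nu>\<close> is given by an orthogonal map \<open>R\<close> taking one of the
  coordinate vectors to \<open>\<nu>\<close>; \<open>cube R r\<close> is the corresponding open cube of side length \<open>r\<close>
  centred at the origin.\<close>

definition cube_frame :: "real^'n \<Rightarrow> (real^'n \<Rightarrow> real^'n) \<Rightarrow> bool" where
  "cube_frame \<nu> R \<longleftrightarrow> orthogonal_transformation R \<and> (\<exists>k. R (axis k 1) = \<nu>)"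

definition cube :: "(real^'n \<Rightarrow> real^'n) \<Rightarrow> real \<Rightarrow> (real^'n) set" where
  "cube R r = (\<lambda>y. r *\<^sub>R R y) ` unit_cube"

text \<open>The integral of \<open>h\<close> over the boundary of \<open>cube R r\<close> with respect to the \<open>(n-1)\<close>-dimensional
  surface measure, as a sum over the \<open>2n\<close> faces. The face \<open>y $ i = s/2\<close> of the unit cube is
  parametrised by the remaining coordinates; since the integrand does not depend on \<open>y $ i\<close>, which
  ranges over an interval of length one, integrating over the whole unit cube gives the
  \<open>(n-1)\<close>-dimensional integral. The factor \<open>r ^ (n-1)\<close> is the Jacobian of the dilation.\<close>

definition cube_boundary_integral ::
  "(real^'n \<Rightarrow> real^'n) \<Rightarrow> real \<Rightarrow> (real^'n \<Rightarrow> ennreal) \<Rightarrow> ennreal" where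
  "cube_boundary_integral R r h =
     (\<Sum>i\<in>UNIV. \<Sum>s\<in>{-1, 1}. ennreal (r ^ (CARD('n) - 1)) *
        (\<integral>\<^sup>+ y. h (r *\<^sub>R R (\<chi> j. if j = i then s / 2 else y $ j)) \<partial>lebesgue_on unit_cube))"

text \<open>The graph of the trace operator from \<open>W\<^sup>1\<^sup>,\<^sup>2\<close> of the cube to \<open>L\<^sup>2\<close> of its boundary, i.e. of
  the continuous extension of the restriction map \<open>w \<mapsto> w|\<^sub>\<partial>\<^sub>Q\<close> defined on functions smooth up to
  the boundary.\<close>

definition has_trace ::
  "(real^'n \<Rightarrow> real^'n) \<Rightarrow> real \<Rightarrow> (real^'n \<Rightarrow> real) \<Rightarrow> (real^'n \<Rightarrow> real) \<Rightarrow> bool" where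
  "has_trace R r v h \<longleftrightarrow>
     (\<exists>w :: nat \<Rightarrow> real^'n \<Rightarrow> real. (\<forall>k. smooth (w k)) \<and>
        (\<lambda>k. \<integral>\<^sup>+ x. ennreal ((w k x - v x)\<^sup>2) \<partial>lebesgue_on (cube R r)) \<longlonglongrightarrow> 0 \<and>
        (\<lambda>k. \<integral>\<^sup>+ x. ennreal ((norm (grad (w k) x - weak_grad (cube R r) v x))\<^sup>2)
               \<partial>lebesgue_on (cube R r)) \<longlonglongrightarrow> 0 \<and>
        (\<lambda>k. cube_boundary_integral R r (\<lambda>x. ennreal ((w k x - h x)\<^sup>2))) \<longlonglongrightarrow> 0)"

definition recession :: "(real^'n^'m \<Rightarrow> real) \<Rightarrow> real^'n^'m \<Rightarrow> real" where
  "recession \<Psi> \<xi> = Lim at_top (\<lambda>t::real. \<Psi> (t *\<^sub>R \<xi>) / t\<^sup>2)"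

text \<open>The function \<open>f\<close> of the model, extended by its limit \<open>\<infinity>\<close> at \<open>s = 1\<close>.\<close>

definition degr_f :: "real \<Rightarrow> real \<Rightarrow> ennreal" where
  "degr_f l s = (if s < 1 then ennreal (l * s / (1 - s)) else \<infinity>)"

definition F_inf ::
  "real \<Rightarrow> (real^'n^'m \<Rightarrow> real) \<Rightarrow> real \<Rightarrow> (real^'n \<Rightarrow> real^'m) \<Rightarrow> (real^'n \<Rightarrow> real) \<Rightarrow>
   (real^'n) set \<Rightarrow> ennreal" where
  "F_inf l \<Psi> \<epsilon> u v A =
     (\<integral>\<^sup>+ x. (if weak_jacobian A u x = 0 then 0
            else ennreal \<epsilon> * (degr_f l (v x))\<^sup>2 * ennreal (recession \<Psi> (weak_jacobian A u x)))
          + ennreal ((1 - v x)\<^sup>2 / (4 * \<epsilon>))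
          + ennreal (\<epsilon> * (norm (weak_grad A v x))\<^sup>2) \<partial>lebesgue_on A)"

definition g_energy ::
  "real \<Rightarrow> (real^'n^'m \<Rightarrow> real) \<Rightarrow> (real^'n) set \<Rightarrow> real^'m \<Rightarrow> real^'n \<Rightarrow> ennreal" where
  "g_energy l \<Psi> Q z \<nu> =
     Inf {liminf (\<lambda>j. F_inf l \<Psi> (\<epsilon> j) (u j) (v j) Q) | (\<epsilon> :: nat \<Rightarrow> real) u v.
        (\<forall>j. 0 < \<epsilon> j \<and> W12_vec Q (u j) \<and> W12 Q (v j) \<and>
             (AE x in lebesgue_on Q. 0 \<le> v j x \<and> v j x \<le> 1)) \<and>
        \<epsilon> \<longlonglongrightarrow> 0 \<and>
        (\<lambda>j. \<integral>\<^sup>+ x. ennreal (norm (u j x - indicat_real {y. 0 < y \<bullet> \<nu>} x *\<^sub>R z))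
              \<partial>lebesgue_on Q) \<longlonglongrightarrow> 0}"

definition convolution ::
  "(real^'n \<Rightarrow> 'b::euclidean_space) \<Rightarrow> (real^'n \<Rightarrow> real) \<Rightarrow> real^'n \<Rightarrow> 'b" where
  "convolution h \<phi> x = (LINT y|lborel. \<phi> y *\<^sub>R h (x - y))"

definition admissible ::
  "(real^'n \<Rightarrow> real) \<Rightarrow> (real^'n \<Rightarrow> real^'n) \<Rightarrow> real^'m \<Rightarrow> real^'n \<Rightarrow> real \<Rightarrow>
   ((real^'n \<Rightarrow> real^'m) \<times> (real^'n \<Rightarrow> real)) set" where
  "admissible \<phi> R z \<nu> T =
     {(u, v). W12_vec (cube R T) u \<and> W12 (cube R T) v \<and>
        (AE x in lebesgue_on (cube R T). 0 \<le> v x \<and> v x \<le> 1) \<and>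
        has_trace R T v (convolution (indicat_real {y. 2 \<le> \<bar>y \<bullet> \<nu>\<bar>}) \<phi>) \<and>
        (\<forall>i. has_trace R T (\<lambda>x. u x $ i)
           (\<lambda>x. convolution (\<lambda>y. indicat_real {y. 0 < y \<bullet> \<nu>} y *\<^sub>R z) \<phi> x $ i))}"

end

theory Submission
  imports Defs "HOL-Real_Asymp.Real_Asymp"
begin

text \<open>Both inequalities compare \<open>g\<close> with the normalised energy of one pair on one large cube; note that
  \<open>x \<mapsto> x/\<epsilon>\<close> turns \<open>\<F>\<^sub>\<epsilon>\<close> on \<open>Q\<^sub>1\<close> into \<open>\<epsilon>\<^sup>n\<^sup>-\<^sup>1 \<F>\<^sub>1\<close> on \<open>Q\<^bsub>1/\<epsilon>\<^esub>\<close>.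

  An admissible pair on \<open>Q\<^sub>T\<close> tiles most of the slab \<open>|x \<bullet> \<nu>| < T/2\<close> of a much larger cube \<open>Q\<^sub>S\<close>. The tiles fit
  together, and fit to the boundary values on the rest of \<open>Q\<^sub>S\<close>, because traces agree; the rest
  costs only the energy of the profile near its middle hyperplane, which is of lower order than \<open>S\<^sup>n\<^sup>-\<^sup>1\<close>.
  Rescaled to \<open>Q\<^sub>1\<close> these pairs converge to the jump, which bounds \<open>g\<close> from above, and unscaled they
  show that the cell infima nearly decrease along \<open>S\<close>.

  Conversely, boundary values are imposed on an almost optimal sequence for \<open>g\<close>. The jump part is
  interpolated after truncating \<open>u\<close> at a level, and on one of many annuli, both chosen by
  pigeonhole so that the bulk energy there is small. The term with \<open>(u - z\<chi>) \<otimes> \<nabla>\<theta>\<close> is controlled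
  by the \<open>L\<^sup>1\<close> distance to the jump alone, as the truncated function is bounded, and \<open>f(v)\<close> is made
  bounded by first multiplying \<open>v\<close> by \<open>1 - \<sigma>\<close>.\<close>

section \<open>Similarities and Lebesgue measure\<close>

text \<open>Every correction must be small against T^(n-1), while the L1 distance to the jump is
  only at most \<eta> T^n. Cutoffs on cubes of size T have gradients of order 1/T, so the mixed bulk
  term is of order (1/\<sigma>^2) T^-2 \<eta> T^n, whereas lowering v costs \<sigma>^2 T^n in the
  potential. The choice \<sigma> = s / sqrt T makes both of order T^(n-1), with small factors from s
  and then from \<eta>.

  The profile itself has no bulk energy: the mollified jump varies only where the distance to the
  hyperplane is below one, and there the damage profile is zero. To keep this separation during the
  modification, v is first lowered below the damage profile, then u is moved to the jump, and only
  then v is moved to its boundary value, in nested regions.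

  Weak gradients are carried as explicit pairs because \<open>weak_grad\<close> is a choice. Traces
  enter through two facts only: a function minus a smooth datum that is its trace extends by zero,
  and adding to the datum a function supported compactly in the cube keeps the trace.\<close>

text \<open>Up to a factor, a translation-invariant measure \<open>\<mu>\<close> is Lebesgue measure: by Tonelli
  \<open>\<lambda>(B) \<mu>(A) = \<lambda>(A) \<mu>(B)\<close>. For \<open>\<mu>\<close> the image of \<open>\<lambda>\<close> under an isometry, \<open>B\<close> is taken to be a ball.\<close>

lemma distr_lborel_orthogonal:
  fixes R :: "'a::euclidean_space \<Rightarrow> 'a"
  assumes R: "orthogonal_transformation R"
  shows "distr lborel borel R = lborel"
proof -
  have lin: "linear R" using R by (rule orthogonal_transformation_linear)
  have Rm[measurable]: "R \<in> borel_measurable borel"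
    using lin by (intro borel_measurable_continuous_onI linear_continuous_on linear_linear[THEN iffD2])
  have bij: "bij R" using R by (rule orthogonal_transformation_bij)
  let ?M = "distr lborel borel R"
  interpret M: sigma_finite_measure ?M
  proof
    let ?A = "range (\<lambda>n::nat. ball (0::'a) (real n))"
    have "emeasure ?M (ball 0 (real n)) \<noteq> \<infinity>" for n :: nat
    proof -
      have "R -` ball 0 (real n) = ball 0 (real n)"
        using R by (auto simp: orthogonal_transformation_norm)
      then have "emeasure ?M (ball 0 (real n)) = emeasure lborel (ball (0::'a) (real n))"
        by (simp add: emeasure_distr)
      then show ?thesis using emeasure_bounded_finite[of "ball (0::'a) (real n)"] by simp
    qed
    moreover have "\<Union>?A = space ?M"
      by (auto simp: reals_Archimedean2)
    ultimately show "\<exists>A. countable A \<and> A \<subseteq> sets ?M \<and> \<Union>A = space ?M \<and> (\<forall>a\<in>A. emeasure ?M a \<noteq> \<infinity>)"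
      by (intro exI[of _ ?A]) auto
  qed
  interpret P: pair_sigma_finite lborel ?M ..
  have trans: "(\<integral>\<^sup>+ y. f (x + y) \<partial>?M) = (\<integral>\<^sup>+ y. f y \<partial>?M)" if [measurable]: "f \<in> borel_measurable borel" for f x
  proof -
    obtain w where w: "x = R w" using bij by (metis bij_pointE)
    have "(\<integral>\<^sup>+ y. f (x + y) \<partial>?M) = (\<integral>\<^sup>+ y. f (R (w + y)) \<partial>lborel)"
      by (simp add: nn_integral_distr w linear_add[OF lin])
    also have "\<dots> = (\<integral>\<^sup>+ y. f (R y) \<partial>distr lborel borel (\<lambda>y. w + y))"
      by (simp add: nn_integral_distr)
    also have "\<dots> = (\<integral>\<^sup>+ y. f y \<partial>?M)"
      by (simp add: lborel_distr_plus nn_integral_distr)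
    finally show ?thesis .
  qed
  let ?B = "ball (0::'a) 1"
  have [measurable]: "?B \<in> sets borel" by simp
  have sets_eq: "sets (lborel \<Otimes>\<^sub>M ?M) = sets (borel \<Otimes>\<^sub>M borel)"
    by (intro sets_pair_measure_cong) simp_all
  have MB: "emeasure ?M ?B = emeasure lborel ?B"
  proof -
    have "R -` ?B = ?B" using R by (auto simp: orthogonal_transformation_norm)
    then show ?thesis by (simp add: emeasure_distr)
  qed
  have eq: "emeasure ?M A = emeasure lborel A" if [measurable]: "A \<in> sets borel" for A
  proof -
    have "emeasure lborel ?B * emeasure ?M A = (\<integral>\<^sup>+ x. (\<integral>\<^sup>+ y. indicator ?B x * indicator A (x + y) \<partial>?M) \<partial>lborel)"
      by (subst nn_integral_cmult, measurable, subst trans, measurable, subst nn_integral_multc) auto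
    also have "\<dots> = (\<integral>\<^sup>+ y. (\<integral>\<^sup>+ x. indicator ?B x * indicator A (x + y) \<partial>lborel) \<partial>?M)"
      by (intro P.Fubini'[symmetric]) (subst measurable_cong_sets[OF sets_eq refl], measurable)
    also have "\<dots> = (\<integral>\<^sup>+ y. (\<integral>\<^sup>+ x. indicator ?B (x - y) * indicator A x \<partial>lborel) \<partial>?M)"
    proof (rule nn_integral_cong)
      fix y
      have "(\<integral>\<^sup>+ x. indicator ?B (x - y) * indicator A x \<partial>lborel)
        = (\<integral>\<^sup>+ x. indicator ?B (x - y) * indicator A x \<partial>distr lborel borel (\<lambda>x. y + x))"
        by (simp add: lborel_distr_plus)
      also have "\<dots> = (\<integral>\<^sup>+ x. indicator ?B x * indicator A (x + y) \<partial>lborel)"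
        by (subst nn_integral_distr) (auto simp: add.commute)
      finally show "(\<integral>\<^sup>+ x. indicator ?B x * indicator A (x + y) \<partial>lborel)
          = (\<integral>\<^sup>+ x. indicator ?B (x - y) * (indicator A x :: ennreal) \<partial>lborel)" by simp
    qed
    also have "\<dots> = (\<integral>\<^sup>+ x. (\<integral>\<^sup>+ y. indicator ?B (x - y) * indicator A x \<partial>?M) \<partial>lborel)"
      by (intro P.Fubini') (subst measurable_cong_sets[OF sets_eq refl], measurable)
    also have "\<dots> = (\<integral>\<^sup>+ x. emeasure ?M ?B * indicator A x \<partial>lborel)"
    proof (intro nn_integral_cong)
      fix x
      have "(\<integral>\<^sup>+ y. indicator ?B (x - y) * indicator A x \<partial>?M) = (\<integral>\<^sup>+ y. indicator ?B (x - y) \<partial>?M) * indicator A x"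
        by (subst nn_integral_multc) auto
      also have "(\<integral>\<^sup>+ y. indicator ?B (x - y) \<partial>?M) = (\<integral>\<^sup>+ y. indicator ?B (- x + y) \<partial>?M)"
        by (intro nn_integral_cong) (auto simp: indicator_def norm_minus_commute)
      also have "\<dots> = emeasure ?M ?B"
        by (subst trans) auto
      finally show "(\<integral>\<^sup>+ y. indicator ?B (x - y) * indicator A x \<partial>?M) = emeasure ?M ?B * indicator A x" .
    qed
    also have "\<dots> = emeasure lborel ?B * emeasure lborel A"
      by (simp only: MB) (simp add: nn_integral_cmult)
    finally have *: "emeasure lborel ?B * emeasure ?M A = emeasure lborel ?B * emeasure lborel A" .
    have "emeasure lborel ?B \<noteq> 0" using content_ball_pos[of 1 "0::'a"] by (auto simp: measure_def)
    moreover have "emeasure lborel ?B \<noteq> \<infinity>" using emeasure_bounded_finite[of ?B] by simp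
    ultimately show ?thesis using * by (simp add: ennreal_mult_cancel_left)
  qed
  show ?thesis
    by (rule measure_eqI) (auto simp: eq)
qed

lemma similarity_lborel:
  fixes R :: "'a::euclidean_space \<Rightarrow> 'a"
  assumes R: "orthogonal_transformation R" and c: "c > 0"
  shows "lborel = density (distr lborel borel (\<lambda>x. t + c *\<^sub>R R x)) (\<lambda>_. ennreal (c ^ DIM('a)))"
proof -
  have [measurable]: "R \<in> borel_measurable borel"
    using R by (intro borel_measurable_continuous_onI linear_continuous_on linear_linear[THEN iffD2]
        orthogonal_transformation_linear)
  have "distr lborel borel (\<lambda>x. t + c *\<^sub>R R x) = distr (distr lborel borel R) borel (\<lambda>x. t + c *\<^sub>R x)"
    by (simp add: distr_distr o_def)
  also have "\<dots> = distr lborel borel (\<lambda>x. t + c *\<^sub>R x)"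
    by (simp only: distr_lborel_orthogonal[OF R])
  finally show ?thesis
    using lborel_affine[of c t] c by simp
qed

text \<open>By the Borel identity a Borel set is null exactly if its preimage is. This lets the
  image measure be exchanged with the completion.\<close>

lemma similarity_lebesgue:
  fixes R :: "'a::euclidean_space \<Rightarrow> 'a" and t :: 'a
  assumes R: "orthogonal_transformation R" and c: "c > 0"
  defines "T \<equiv> \<lambda>x. t + c *\<^sub>R R x"
  shows "T \<in> lebesgue \<rightarrow>\<^sub>M lebesgue"
    and "lebesgue = density (distr lebesgue lebesgue T) (\<lambda>_. ennreal (c ^ DIM('a)))"
proof -
  have [measurable]: "R \<in> borel_measurable borel"
    using R by (intro borel_measurable_continuous_onI linear_continuous_on linear_linear[THEN iffD2]
        orthogonal_transformation_linear)
  have T_borel[measurable]: "T \<in> borel \<rightarrow>\<^sub>M borel"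
    by (auto simp: T_def)
  have lb: "lborel = density (distr lborel borel T) (\<lambda>_. ennreal (c ^ DIM('a)))"
    unfolding T_def by (rule similarity_lborel[OF R c])
  { fix A :: "'a set" assume A: "A \<in> sets borel"
    then have "emeasure lborel A = 0 \<longleftrightarrow> emeasure (density (distr lborel borel T) (\<lambda>_. ennreal (c ^ DIM('a)))) A = 0"
      by (simp only: lb[symmetric])
    also have "\<dots> \<longleftrightarrow> emeasure (distr lebesgue lborel T) A = 0"
      using A c by (simp add: distr_completion emeasure_density nn_integral_cmult cong: distr_cong)
    finally have "emeasure lborel A = 0 \<longleftrightarrow> emeasure (distr lebesgue lborel T) A = 0" . }
  then have eq: "null_sets lborel = null_sets (distr lebesgue lborel T)"
    by (auto simp: null_sets_def)
  show "T \<in> lebesgue \<rightarrow>\<^sub>M lebesgue"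
    by (rule completion.measurable_completion2) (auto simp: eq measurable_completion)
  have "lebesgue = completion (density (distr lborel borel T) (\<lambda>_. ennreal (c ^ DIM('a))))"
    by (simp only: lb[symmetric])
  also have "\<dots> = density (completion (distr lebesgue lborel T)) (\<lambda>_. ennreal (c ^ DIM('a)))"
    using c by (auto intro!: always_eventually completion_density_eq simp: distr_completion cong: distr_cong)
  also have "\<dots> = density (distr lebesgue lebesgue T) (\<lambda>_. ennreal (c ^ DIM('a)))"
    by (subst completion.completion_distr_eq) (auto simp: eq measurable_completion)
  finally show "lebesgue = density (distr lebesgue lebesgue T) (\<lambda>_. ennreal (c ^ DIM('a)))" .
qed

lemma nn_integral_similarity:
  fixes R :: "'a::euclidean_space \<Rightarrow> 'a"
  assumes R: "orthogonal_transformation R" and c: "c > 0" and [measurable]: "f \<in> borel_measurable lebesgue"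
  shows "(\<integral>\<^sup>+ x. f x \<partial>lebesgue) = ennreal (c ^ DIM('a)) * (\<integral>\<^sup>+ x. f (t + c *\<^sub>R R x) \<partial>lebesgue)"
proof -
  note [measurable] = similarity_lebesgue(1)[OF R c]
  show ?thesis
    apply (subst similarity_lebesgue(2)[OF R c, of t])
    apply (subst nn_integral_density)
      apply measurable
    apply (subst nn_integral_cmult)
     apply measurable
    apply (subst nn_integral_distr)
      apply measurable
    done
qed

lemma integrable_similarity:
  fixes R :: "'a::euclidean_space \<Rightarrow> 'a" and f :: "'a \<Rightarrow> 'b::{banach, second_countable_topology}"
  assumes R: "orthogonal_transformation R" and c: "c > 0" and f: "integrable lebesgue f"
  shows "integrable lebesgue (\<lambda>x. f (t + c *\<^sub>R R x))"
proof -
  note [measurable] = similarity_lebesgue(1)[OF R c]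
  have [measurable]: "f \<in> borel_measurable lebesgue" using f by simp
  have "(\<integral>\<^sup>+ x. ennreal (norm (f x)) \<partial>lebesgue)
      = ennreal (c ^ DIM('a)) * (\<integral>\<^sup>+ x. ennreal (norm (f (t + c *\<^sub>R R x))) \<partial>lebesgue)"
    by (rule nn_integral_similarity[OF R c]) simp
  moreover have "(\<integral>\<^sup>+ x. ennreal (norm (f x)) \<partial>lebesgue) < \<infinity>"
    using f by (simp add: integrable_iff_bounded)
  ultimately have "(\<integral>\<^sup>+ x. ennreal (norm (f (t + c *\<^sub>R R x))) \<partial>lebesgue) < \<infinity>"
    using c by (auto simp: ennreal_mult_less_top)
  then show ?thesis
    by (intro integrableI_bounded) auto
qed

lemma integral_similarity:
  fixes R :: "'a::euclidean_space \<Rightarrow> 'a" and f :: "'a \<Rightarrow> real"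
  assumes R: "orthogonal_transformation R" and c: "c > 0" and [measurable]: "f \<in> borel_measurable lebesgue"
  shows "(\<integral> x. f x \<partial>lebesgue) = c ^ DIM('a) * (\<integral> x. f (t + c *\<^sub>R R x) \<partial>lebesgue)"
proof -
  note [measurable] = similarity_lebesgue(1)[OF R c]
  show ?thesis
    apply (subst similarity_lebesgue(2)[OF R c, of t])
    apply (subst integral_density)
       apply measurable
     using c apply simp
    apply (subst integral_distr)
      apply measurable
    done
qed

section \<open>Smooth functions and test functions\<close>

lemma grad_nth: "(f has_derivative D) (at x) \<Longrightarrow> grad f x $ j = D (axis j 1)"
  by (simp add: grad_def frechet_derivative_at[symmetric])

lemma has_derivative_grad:
  fixes f :: "real^'n \<Rightarrow> real"
  assumes "f differentiable at x"
  shows "(f has_derivative (\<lambda>h. grad f x \<bullet> h)) (at x)"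
proof -
  obtain D where D: "(f has_derivative D) (at x)" using assms by (auto simp: differentiable_def)
  have lin: "linear D" using D by (rule has_derivative_linear)
  have "D h = grad f x \<bullet> h" for h
  proof -
    have "D h = D (\<Sum>i\<in>UNIV. h $ i *s axis i 1)" by (simp add: basis_expansion)
    also have "\<dots> = (\<Sum>i\<in>UNIV. h $ i * D (axis i 1))"
      by (simp add: linear_sum[OF lin] scalar_mult_eq_scaleR linear_scale[OF lin])
    also have "\<dots> = grad f x \<bullet> h"
      by (simp add: inner_vec_def grad_nth[OF D] mult.commute)
    finally show ?thesis .
  qed
  then show ?thesis using D by (metis (no_types, lifting) ext)
qed

lemma grad_eqI:
  assumes "(f has_derivative (\<lambda>h. g \<bullet> h)) (at x)"
  shows "grad f x = g"
  by (simp add: vec_eq_iff grad_nth[OF assms] inner_axis)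

lemma C_diff_continuous: "C_diff k f \<Longrightarrow> continuous_on UNIV f"
  by (cases k) (auto intro: differentiable_imp_continuous_on)

lemma C_diff_SucD: "C_diff (Suc k) f \<Longrightarrow> C_diff k f"
proof (induction k arbitrary: f)
  case 0
  then show ?case by (auto intro: differentiable_imp_continuous_on)
next
  case (Suc k)
  then show ?case by (metis C_diff.simps(2))
qed

lemma C_diff_differentiable: "C_diff (Suc k) f \<Longrightarrow> f differentiable at x"
  by (simp add: differentiable_on_def)

lemma C_diff_const: "C_diff k (\<lambda>x::real^'n. c)"
proof (induction k arbitrary: c)
  case (Suc k)
  have "grad (\<lambda>x. c) x = 0" for x :: "real^'n" by (rule grad_eqI) simp
  then show ?case using Suc[of 0] by simp
qed simp

lemma grad_add:
  assumes "f differentiable at x" "g differentiable at x"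
  shows "grad (\<lambda>x. f x + g x) x = grad f x + grad g x"
  by (rule grad_eqI)
    (auto intro!: derivative_eq_intros has_derivative_grad[OF assms(1)] has_derivative_grad[OF assms(2)]
      simp: inner_add_left)

lemma grad_mult:
  assumes "f differentiable at x" "g differentiable at x"
  shows "grad (\<lambda>x. f x * g x) x = f x *\<^sub>R grad g x + g x *\<^sub>R grad f x"
  by (rule grad_eqI)
    (auto intro!: derivative_eq_intros has_derivative_grad[OF assms(1)] has_derivative_grad[OF assms(2)]
      simp: inner_add_left)

lemma C_diff_add: "C_diff k f \<Longrightarrow> C_diff k g \<Longrightarrow> C_diff k (\<lambda>x. f x + g x)"
proof (induction k arbitrary: f g)
  case 0
  then show ?case by (auto intro: continuous_intros)
next
  case (Suc k)
  then have "f differentiable at x" "g differentiable at x" for x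
    by (auto intro: C_diff_differentiable)
  with Suc show ?case by (simp add: grad_add differentiable_on_def)
qed

lemma C_diff_mult: "C_diff k f \<Longrightarrow> C_diff k g \<Longrightarrow> C_diff k (\<lambda>x. f x * g x)"
proof (induction k arbitrary: f g)
  case 0
  then show ?case by (auto intro: continuous_intros)
next
  case (Suc k)
  then have d: "f differentiable at x" "g differentiable at x" for x
    by (auto intro: C_diff_differentiable)
  moreover have "C_diff k f" "C_diff k g" using Suc.prems by (auto intro: C_diff_SucD simp del: C_diff.simps)
  ultimately show ?case using Suc by (simp add: grad_mult C_diff_add differentiable_on_def)
qed

lemma grad_affine:
  fixes f :: "real^'n \<Rightarrow> real"
  assumes "f differentiable at (a *\<^sub>R x + b)"
  shows "grad (\<lambda>x. f (a *\<^sub>R x + b)) x = a *\<^sub>R grad f (a *\<^sub>R x + b)"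
proof (rule grad_eqI)
  have "((\<lambda>x. f (a *\<^sub>R x + b)) has_derivative (\<lambda>h. grad f (a *\<^sub>R x + b) \<bullet> (a *\<^sub>R h))) (at x)"
    by (rule has_derivative_compose[where g=f and f="\<lambda>x. a *\<^sub>R x + b", OF _ has_derivative_grad[OF assms]])
      (auto intro!: derivative_eq_intros)
  moreover have "(\<lambda>h. grad f (a *\<^sub>R x + b) \<bullet> (a *\<^sub>R h)) = (\<bullet>) (a *\<^sub>R grad f (a *\<^sub>R x + b))"
    by (simp add: fun_eq_iff)
  ultimately show "((\<lambda>x. f (a *\<^sub>R x + b)) has_derivative (\<bullet>) (a *\<^sub>R grad f (a *\<^sub>R x + b))) (at x)"
    by simp
qed

lemma C_diff_affine: "C_diff k f \<Longrightarrow> C_diff k (\<lambda>x. f (a *\<^sub>R x + b))"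
proof (induction k arbitrary: f)
  case 0
  then show ?case by (auto intro!: continuous_intros continuous_on_compose2[of UNIV f])
next
  case (Suc k)
  then have d: "f differentiable at x" for x
    by (auto intro: C_diff_differentiable)
  have "(\<lambda>x. f (a *\<^sub>R x + b)) differentiable at x" for x
    by (rule differentiable_compose[OF d]) (auto intro!: derivative_intros)
  moreover have "C_diff k (\<lambda>x. a * grad f (a *\<^sub>R x + b) $ j)" for j
    using Suc by (intro C_diff_mult C_diff_const Suc.IH) auto
  ultimately show ?case using d by (simp add: grad_affine differentiable_on_def)
qed

lemma smooth_const: "smooth (\<lambda>x. c)"
  by (simp add: smooth_def C_diff_const)

lemma smooth_add: "smooth f \<Longrightarrow> smooth g \<Longrightarrow> smooth (\<lambda>x. f x + g x)"
  by (simp add: smooth_def C_diff_add)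

lemma smooth_mult: "smooth f \<Longrightarrow> smooth g \<Longrightarrow> smooth (\<lambda>x. f x * g x)"
  by (simp add: smooth_def C_diff_mult)

lemma smooth_diff: "smooth f \<Longrightarrow> smooth g \<Longrightarrow> smooth (\<lambda>x. f x - g x)"
  using smooth_add[of f "\<lambda>x. (-1) * g x"] smooth_mult[OF smooth_const[of "-1"], of g] by simp

lemma smooth_affine: "smooth f \<Longrightarrow> smooth (\<lambda>x. f (a *\<^sub>R x + b))"
  by (simp add: smooth_def C_diff_affine)

lemma smooth_differentiable: "smooth f \<Longrightarrow> f differentiable at x"
  using C_diff_differentiable smooth_def by blast

lemma smooth_continuous: "smooth f \<Longrightarrow> continuous_on UNIV f"
  using C_diff_continuous smooth_def by blast

lemma smooth_grad: "smooth f \<Longrightarrow> smooth (\<lambda>x. grad f x $ j)"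
  unfolding smooth_def by (metis C_diff.simps(2))

lemma C_diff_grad_continuous:
  assumes "C_diff (Suc k) f"
  shows "continuous_on UNIV (grad f)"
proof -
  have "continuous_on UNIV (\<lambda>x. grad f x $ j)" for j using C_diff_continuous assms by (metis C_diff.simps(2))
  then have "continuous_on UNIV (\<lambda>x. \<chi> j. grad f x $ j)" by (intro continuous_on_vec_lambda)
  then show ?thesis by simp
qed

lemma smooth_grad_continuous: "smooth f \<Longrightarrow> continuous_on UNIV (grad f)"
  using C_diff_grad_continuous smooth_def by blast

lemma grad_diff:
  assumes "f differentiable at x" "g differentiable at x"
  shows "grad (\<lambda>x. f x - g x) x = grad f x - grad g x"
  by (rule grad_eqI)
    (auto intro!: derivative_eq_intros has_derivative_grad[OF assms(1)] has_derivative_grad[OF assms(2)]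
      simp: inner_diff_left)

lemma grad_cmult:
  assumes "f differentiable at x"
  shows "grad (\<lambda>x. c * f x) x = c *\<^sub>R grad f x"
  by (rule grad_eqI) (auto intro!: derivative_eq_intros has_derivative_grad[OF assms])

lemma grad_0_open:
  fixes f :: "real^'n \<Rightarrow> real"
  assumes "open S" "x \<in> S" "\<And>y. y \<in> S \<Longrightarrow> f y = c"
  shows "grad f x = 0"
proof (rule grad_eqI)
  have "((\<lambda>y. c) has_derivative (\<lambda>h. 0 \<bullet> h)) (at x)" by simp
  then show "(f has_derivative (\<bullet>) 0) (at x)"
    by (rule has_derivative_transform_within_open[OF _ assms(1,2)]) (use assms in auto)
qed

lemma test_fun_smooth: "test_fun A \<phi> \<Longrightarrow> smooth \<phi>"
  by (simp add: test_fun_def)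

lemma test_fun_mono: "test_fun A \<phi> \<Longrightarrow> A \<subseteq> B \<Longrightarrow> test_fun B \<phi>"
  by (auto simp: test_fun_def)

lemma test_fun_zero: "test_fun A \<phi> \<Longrightarrow> x \<notin> A \<Longrightarrow> \<phi> x = 0"
  using closure_subset[of "{x. \<phi> x \<noteq> 0}"] by (auto simp: test_fun_def)

lemma test_funI:
  assumes "smooth \<phi>" "compact K" "K \<subseteq> A" "\<And>x. x \<notin> K \<Longrightarrow> \<phi> x = 0"
  shows "test_fun A \<phi>"
proof -
  have "{x. \<phi> x \<noteq> 0} \<subseteq> K" using assms by auto
  then have "closure {x. \<phi> x \<noteq> 0} \<subseteq> K"
    using assms compact_imp_closed closure_minimal by blast
  moreover from this have "compact (closure {x. \<phi> x \<noteq> 0})"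
    using assms by (meson bounded_subset closed_closure compact_eq_bounded_closed)
  ultimately show ?thesis using assms by (auto simp: test_fun_def)
qed

lemma test_fun_support:
  assumes "test_fun A \<phi>"
  obtains K where "compact K" "K \<subseteq> A" "\<And>x. x \<notin> K \<Longrightarrow> \<phi> x = 0" "\<And>x. x \<notin> K \<Longrightarrow> grad \<phi> x = 0"
proof -
  define K where "K = closure {x. \<phi> x \<noteq> 0}"
  have z: "\<phi> x = 0" if "x \<notin> K" for x
    using that closure_subset[of "{x. \<phi> x \<noteq> 0}"] unfolding K_def by blast
  have "closed K" by (simp add: K_def)
  have "grad \<phi> x = 0" if "x \<notin> K" for x
    by (rule grad_0_open[of "- K" _ _ 0]) (use that z \<open>closed K\<close> in auto)
  moreover have "compact K" "K \<subseteq> A" using assms by (simp_all add: test_fun_def K_def)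
  ultimately show ?thesis using that[of K] z by blast
qed

lemma test_fun_grad: "test_fun A \<phi> \<Longrightarrow> test_fun A (\<lambda>x. grad \<phi> x $ j)"
  by (rule test_fun_support, assumption) (rule test_funI, auto intro: smooth_grad test_fun_smooth)

lemma test_fun_mult: "test_fun A \<phi> \<Longrightarrow> smooth f \<Longrightarrow> test_fun A (\<lambda>x. f x * \<phi> x)"
  by (rule test_fun_support, assumption) (rule test_funI, auto intro: smooth_mult test_fun_smooth)

lemma test_fun_affine:
  assumes "test_fun A \<phi>" "a \<noteq> 0"
  shows "test_fun {x. a *\<^sub>R x + b \<in> A} (\<lambda>x. \<phi> (a *\<^sub>R x + b))"
proof -
  obtain K where K: "compact K" "K \<subseteq> A" "\<And>x. x \<notin> K \<Longrightarrow> \<phi> x = 0" using assms test_fun_support by metis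
  let ?g = "\<lambda>y. (1 / a) *\<^sub>R (y - b)"
  have "compact (?g ` K)" using K by (intro compact_continuous_image continuous_intros)
  moreover have "x \<in> ?g ` K" if "a *\<^sub>R x + b \<in> K" for x
    using that assms by (intro image_eqI[of _ _ "a *\<^sub>R x + b"]) auto
  moreover have "?g ` K \<subseteq> {x. a *\<^sub>R x + b \<in> A}" using K assms by auto
  ultimately show ?thesis using K(3) test_fun_smooth[OF assms(1)]
    by (intro test_funI[of _ "?g ` K"] smooth_affine) blast+
qed

text \<open>Only \<open>C\<^sup>1\<close> regularity is asked for, so that the results on mollification also serve for the
  integration by parts in the chain rule.\<close>

definition C1_comp :: "real \<Rightarrow> (real^'n \<Rightarrow> real) \<Rightarrow> bool" where
  "C1_comp r \<phi> \<longleftrightarrow> C_diff 1 \<phi> \<and> (\<forall>x. norm x > r \<longrightarrow> \<phi> x = 0)"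

lemma C1_compD:
  assumes "C1_comp r \<phi>"
  shows "\<phi> differentiable at x" "continuous_on UNIV \<phi>" "continuous_on UNIV (grad \<phi>)"
    "norm x > r \<Longrightarrow> \<phi> x = 0" "norm x > r \<Longrightarrow> grad \<phi> x = 0"
proof -
  have "C_diff (Suc 0) \<phi>" using assms by (simp add: C1_comp_def)
  then show "\<phi> differentiable at x" "continuous_on UNIV \<phi>" "continuous_on UNIV (grad \<phi>)"
    using C_diff_differentiable C_diff_continuous C_diff_grad_continuous by blast+
  show "norm x > r \<Longrightarrow> \<phi> x = 0" for x using assms by (simp add: C1_comp_def)
  then show "norm x > r \<Longrightarrow> grad \<phi> x = 0"
    by (intro grad_0_open[of "- cball 0 r" _ _ 0]) auto
qed

lemma test_fun_C1_comp:
  assumes "test_fun A \<phi>"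
  obtains r where "r > 0" "C1_comp r \<phi>"
proof -
  obtain K where K: "compact K" "\<And>x. x \<notin> K \<Longrightarrow> \<phi> x = 0" using assms test_fun_support by metis
  obtain r where "r > 0" "\<forall>x\<in>K. norm x \<le> r" using K bounded_pos compact_imp_bounded by blast
  moreover from this K have "\<phi> x = 0" if "norm x > r" for x using that by force
  moreover have "C_diff 1 \<phi>" using test_fun_smooth[OF assms] unfolding smooth_def by blast
  ultimately show ?thesis using that[of r] unfolding C1_comp_def by blast
qed

lemma test_fun_ball_C1_comp:
  assumes "test_fun (ball 0 r) \<phi>"
  shows "C1_comp r \<phi>"
proof -
  have "C_diff 1 \<phi>" using test_fun_smooth[OF assms] unfolding smooth_def by blast
  then show ?thesis using test_fun_zero[OF assms] unfolding C1_comp_def by simp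
qed

lemma bounded_comp_support:
  fixes f :: "real^'n \<Rightarrow> 'b::real_normed_vector"
  assumes "continuous_on UNIV f" "\<And>x. norm x > r \<Longrightarrow> f x = 0"
  obtains B where "B > 0" "\<And>x. norm (f x) \<le> B"
proof -
  have "compact (f ` cball 0 r)" using assms by (intro compact_continuous_image) (auto intro: continuous_on_subset)
  then obtain B where "B > 0" "\<forall>y\<in>f ` cball 0 r. norm y \<le> B"
    using bounded_pos compact_imp_bounded by blast
  then have "norm (f x) \<le> B" for x
    using assms(2)[of x] by (cases "norm x > r") auto
  then show ?thesis using that \<open>B > 0\<close> by blast
qed

lemma uniformly_continuous_comp_support:
  fixes f :: "real^'n \<Rightarrow> 'b::real_normed_vector"
  assumes "continuous_on UNIV f" "\<And>x. norm x > r \<Longrightarrow> f x = 0"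
  shows "uniformly_continuous_on UNIV f"
proof (unfold uniformly_continuous_on_def, intro allI impI)
  fix e :: real assume e: "e > 0"
  have "uniformly_continuous_on (cball 0 (r + 1)) f"
    using assms by (intro compact_uniformly_continuous) (auto intro: continuous_on_subset)
  then obtain d where d: "d > 0" "\<And>x y. x \<in> cball 0 (r+1) \<Longrightarrow> y \<in> cball 0 (r+1) \<Longrightarrow> dist y x < d \<Longrightarrow> dist (f y) (f x) < e"
    using e unfolding uniformly_continuous_on_def by metis
  show "\<exists>d>0. \<forall>x\<in>UNIV. \<forall>x'\<in>UNIV. dist x' x < d \<longrightarrow> dist (f x') (f x) < e"
  proof (intro exI[of _ "min d 1"] conjI ballI impI)
    fix x y :: "real^'n" assume xy: "dist y x < min d 1"
    show "dist (f y) (f x) < e"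
    proof (cases "norm x \<le> r + 1 \<and> norm y \<le> r + 1")
      case True
      then show ?thesis using d xy by auto
    next
      case False
      moreover have "norm y \<le> norm x + dist y x" "norm x \<le> norm y + dist y x"
        by (simp_all add: dist_norm norm_triangle_sub, metis norm_minus_commute norm_triangle_sub)
      ultimately have "norm x > r" "norm y > r" using xy by auto
      then show ?thesis using assms e by simp
    qed
  qed (use d in auto)
qed

text \<open>The mean value inequality for \<phi> minus its linearisation at \<open>x\<close>, with
  the uniform continuity of the gradient. Uniformity in \<open>x\<close> is what later permits
  differentiation under the integral.\<close>

lemma C1_comp_uniform_derivative:
  assumes "C1_comp r \<phi>" "e > 0"
  obtains d where "d > 0" "\<And>x h. norm h < d \<Longrightarrow> \<bar>\<phi> (x + h) - \<phi> x - grad \<phi> x \<bullet> h\<bar> \<le> e * norm h"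
proof -
  note C = C1_compD[OF assms(1)]
  have "uniformly_continuous_on UNIV (grad \<phi>)" using C uniformly_continuous_comp_support by blast
  then obtain d where d: "d > 0" "\<And>x y. dist y x < d \<Longrightarrow> dist (grad \<phi> y) (grad \<phi> x) < e"
    using assms(2) unfolding uniformly_continuous_on_def by auto
  have "\<bar>\<phi> (x + h) - \<phi> x - grad \<phi> x \<bullet> h\<bar> \<le> e * norm h" if "norm h < d" for x h
  proof -
    let ?g = "\<lambda>y. \<phi> y - grad \<phi> x \<bullet> y"
    have "norm (?g (x + h) - ?g x) \<le> e * norm (x + h - x)"
    proof (rule differentiable_bound[of "ball x d" ?g "\<lambda>y k. grad \<phi> y \<bullet> k - grad \<phi> x \<bullet> k" e])
      fix y assume y: "y \<in> ball x d"
      show "(?g has_derivative (\<lambda>k. grad \<phi> y \<bullet> k - grad \<phi> x \<bullet> k)) (at y within ball x d)"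
        by (auto intro!: derivative_eq_intros has_derivative_at_withinI[OF has_derivative_grad] C)
      show "onorm (\<lambda>k. grad \<phi> y \<bullet> k - grad \<phi> x \<bullet> k) \<le> e"
      proof (rule onorm_bound)
        fix k
        have "norm (grad \<phi> y \<bullet> k - grad \<phi> x \<bullet> k) \<le> norm (grad \<phi> y - grad \<phi> x) * norm k"
          by (metis inner_diff_left Cauchy_Schwarz_ineq2 real_norm_def)
        also have "\<dots> \<le> e * norm k"
          using d(2)[of y x] y by (intro mult_right_mono) (auto simp: dist_norm norm_minus_commute)
        finally show "norm (grad \<phi> y \<bullet> k - grad \<phi> x \<bullet> k) \<le> e * norm k" .
      qed (use assms in simp)
    qed (use that d in \<open>auto simp: dist_norm\<close>)
    then show ?thesis by (simp add: inner_add_right algebra_simps)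
  qed
  then show ?thesis using that d by blast
qed

section \<open>Mollification\<close>

lemma continuous_measurable_lebesgue:
  fixes f :: "'a::euclidean_space \<Rightarrow> 'b::topological_space"
  shows "continuous_on UNIV f \<Longrightarrow> f \<in> borel_measurable lebesgue"
  by (intro measurable_completion) (auto intro: borel_measurable_continuous_onI)

lemma emeasure_cball_finite: "emeasure lborel (cball x r) < top"
  using emeasure_bounded_finite[OF bounded_cball, of x r] by simp

lemma cball_lebesgue[measurable]: "cball x r \<in> sets lebesgue"
  by simp

lemma integral_reflect:
  fixes f :: "'a::euclidean_space \<Rightarrow> real"
  assumes "f \<in> borel_measurable lebesgue"
  shows "(\<integral> x. f x \<partial>lebesgue) = (\<integral> y. f (x - y) \<partial>lebesgue)"
  using integral_similarity[of uminus 1 f x] assms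
  by (simp add: orthogonal_transformation_neg)

definition loc_integrable :: "(real^'n \<Rightarrow> real) \<Rightarrow> bool" where
  "loc_integrable f \<longleftrightarrow> f \<in> borel_measurable lebesgue \<and>
     (\<forall>r. integrable lebesgue (\<lambda>x. indicator (cball 0 r) x * f x))"

text \<open>Taken over Lebesgue measure, so that \<open>f\<close> may be merely Lebesgue measurable.
  The \<open>convolution\<close> of the statement uses \<open>lborel\<close> and the reflected
  argument; \<open>convolution_eq_moll\<close> reconciles the two.\<close>

definition moll :: "(real^'n \<Rightarrow> real) \<Rightarrow> (real^'n \<Rightarrow> real) \<Rightarrow> real^'n \<Rightarrow> real" where
  "moll f \<phi> x = (LINT y|lebesgue. f y * \<phi> (x - y))"

lemma loc_integrable_bounded:
  assumes [measurable]: "f \<in> borel_measurable lebesgue" and "\<And>x. \<bar>f x\<bar> \<le> B"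
  shows "loc_integrable f"
  unfolding loc_integrable_def
proof (intro conjI allI)
  fix r
  have "integrable lebesgue (\<lambda>x::real^'n. indicator (cball 0 r) x * B)"
    by (intro integrable_mult_left integrable_real_indicator) (auto simp: emeasure_cball_finite)
  then show "integrable lebesgue (\<lambda>x. indicator (cball 0 r) x * f x)"
  proof (rule Bochner_Integration.integrable_bound)
    have "\<bar>f x\<bar> \<le> \<bar>B\<bar>" for x using assms(2)[of x] by linarith
    then show "AE x in lebesgue. norm (indicator (cball 0 r) x * f x) \<le> norm (indicator (cball 0 r) x * B)"
      by (auto simp: abs_mult indicator_def)
  qed simp
qed simp

lemma integrable_mult_comp_support:
  assumes f: "loc_integrable f" and "continuous_on UNIV \<psi>" "\<And>x. norm x > r \<Longrightarrow> \<psi> x = 0"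
  shows "integrable lebesgue (\<lambda>y. f y * \<psi> y)"
proof -
  obtain B where B: "B > 0" "\<And>x. norm (\<psi> x) \<le> B" using bounded_comp_support assms by metis
  have "integrable lebesgue (\<lambda>y. B * (indicator (cball 0 r) y * f y))"
    using f by (intro integrable_mult_right) (simp add: loc_integrable_def)
  moreover have "norm (f y * \<psi> y) \<le> norm (B * (indicator (cball 0 r) y * f y))" for y
  proof (cases "norm y > r")
    case False
    have "norm (f y * \<psi> y) \<le> \<bar>f y\<bar> * B"
      using B(2)[of y] by (simp add: abs_mult mult_left_mono)
    then show ?thesis using False B(1) by (simp add: abs_mult mult.commute)
  qed (use assms(3) in auto)
  moreover have "(\<lambda>y. f y * \<psi> y) \<in> borel_measurable lebesgue"
    using f continuous_measurable_lebesgue[OF assms(2)] unfolding loc_integrable_def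
    by (intro borel_measurable_times) auto
  ultimately show ?thesis
    by - (rule Bochner_Integration.integrable_bound[OF _ _ AE_I2])
qed

lemma moll_integrable:
  assumes f: "loc_integrable f" and "continuous_on UNIV \<phi>" "\<And>x. norm x > r \<Longrightarrow> \<phi> x = 0"
  shows "integrable lebesgue (\<lambda>y. f y * \<phi> (x - y))"
proof (rule integrable_mult_comp_support[OF f])
  show "continuous_on UNIV (\<lambda>y. \<phi> (x - y))"
    by (intro continuous_on_compose2[OF assms(2)] continuous_intros) auto
  show "\<phi> (x - y) = 0" if "norm y > norm x + r" for y
    using that norm_triangle_ineq2[of y x] by (intro assms(3)) (simp add: norm_minus_commute)
qed

lemma moll_has_derivative:
  assumes f: "loc_integrable f" and \<phi>: "C1_comp r \<phi>"
  shows "(moll f \<phi> has_derivative (\<lambda>h. (\<chi> j. moll f (\<lambda>y. grad \<phi> y $ j) x) \<bullet> h)) (at x)"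
proof -
  note C = C1_compD[OF \<phi>]
  have cj: "continuous_on UNIV (\<lambda>y. grad \<phi> y $ j)" for j using C by (intro continuous_intros)
  have lin: "(\<chi> j. moll f (\<lambda>y. grad \<phi> y $ j) x) \<bullet> h = (LINT w|lebesgue. f w * (grad \<phi> (x - w) \<bullet> h))"
    and int: "integrable lebesgue (\<lambda>w. f w * (grad \<phi> (x - w) \<bullet> h))" for h
  proof -
    have ij: "integrable lebesgue (\<lambda>w. f w * (grad \<phi> (x - w) $ j) * h $ j)" for j
      using C(5) by (intro integrable_mult_left moll_integrable[OF f cj, of r]) auto
    have eq: "f w * (grad \<phi> (x - w) \<bullet> h) = (\<Sum>j\<in>UNIV. f w * (grad \<phi> (x - w) $ j) * h $ j)" for w
      by (simp add: inner_vec_def sum_distrib_left mult.assoc)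
    show "integrable lebesgue (\<lambda>w. f w * (grad \<phi> (x - w) \<bullet> h))" unfolding eq using ij by simp
    show "(\<chi> j. moll f (\<lambda>y. grad \<phi> y $ j) x) \<bullet> h = (LINT w|lebesgue. f w * (grad \<phi> (x - w) \<bullet> h))"
      unfolding eq using ij by (simp add: inner_vec_def moll_def)
  qed
  have im: "integrable lebesgue (\<lambda>w. f w * \<phi> (y - w))" for y
    using C(4) by (intro moll_integrable[OF f C(2), of r]) auto
  show ?thesis
    unfolding has_derivative_at_alt
  proof (intro conjI allI impI)
    show "bounded_linear ((\<bullet>) (\<chi> j. moll f (\<lambda>y. grad \<phi> y $ j) x))" by (rule bounded_linear_inner_right)
    fix e :: real assume e: "e > 0"
    \<comment> \<open>For \<open>y\<close> within distance one of \<open>x\<close> all kernels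
      vanish at \<open>w\<close> outside this ball, so the remainder sees \<open>f\<close> only
      where it is integrable. The divisor \<open>I + 1\<close> below stays positive even if
      \<open>I\<close> is zero.\<close>
    let ?g = "\<lambda>w. indicator (cball 0 (norm x + 1 + r)) w * f w"
    have gi: "integrable lebesgue ?g" using f by (simp add: loc_integrable_def)
    define I where "I = (LINT w|lebesgue. \<bar>?g w\<bar>)"
    have I0: "I \<ge> 0" unfolding I_def by (intro integral_nonneg_AE) auto
    obtain d where d: "d > 0" "\<And>x h. norm h < d \<Longrightarrow> \<bar>\<phi> (x + h) - \<phi> x - grad \<phi> x \<bullet> h\<bar> \<le> e / (I + 1) * norm h"
      using C1_comp_uniform_derivative[OF \<phi>, of "e / (I+1)"] e I0 by (metis divide_pos_pos add_nonneg_pos zero_less_one)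
    show "\<exists>d>0. \<forall>y. norm (y - x) < d \<longrightarrow>
        norm (moll f \<phi> y - moll f \<phi> x - (\<chi> j. moll f (\<lambda>y. grad \<phi> y $ j) x) \<bullet> (y - x)) \<le> e * norm (y - x)"
    proof (intro exI[of _ "min d 1"] conjI allI impI)
      fix y assume y: "norm (y - x) < min d 1"
      let ?k = "\<lambda>w. f w * \<phi> (y - w) - f w * \<phi> (x - w) - f w * (grad \<phi> (x - w) \<bullet> (y - x))"
      have eq: "moll f \<phi> y - moll f \<phi> x - (\<chi> j. moll f (\<lambda>y. grad \<phi> y $ j) x) \<bullet> (y - x) = (LINT w|lebesgue. ?k w)"
        unfolding lin unfolding moll_def using im int by simp
      have "norm (LINT w|lebesgue. ?k w) \<le> (LINT w|lebesgue. norm (?k w))" by (rule integral_norm_bound)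
      also have "\<dots> \<le> (LINT w|lebesgue. \<bar>?g w\<bar> * (e / (I + 1) * norm (y - x)))"
      proof (rule integral_mono)
        show "integrable lebesgue (\<lambda>w. norm (?k w))" using im int by (intro integrable_norm Bochner_Integration.integrable_diff) auto
        show "integrable lebesgue (\<lambda>w. \<bar>?g w\<bar> * (e / (I + 1) * norm (y - x)))" using gi by (intro integrable_mult_left integrable_abs) auto
        fix w
        show "norm (?k w) \<le> \<bar>?g w\<bar> * (e / (I + 1) * norm (y - x))"
        proof (cases "norm w > norm x + 1 + r")
          case True
          then have "norm (x - w) > r" using norm_triangle_ineq2[of w x] by (simp add: norm_minus_commute)
          moreover have "norm (y - w) > r"
            using True y norm_triangle_ineq2[of w y] norm_triangle_ineq2[of y x] by (simp add: norm_minus_commute)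
          ultimately show ?thesis using C(4,5) True by simp
        next
          case False
          have "norm (?k w) = \<bar>f w\<bar> * \<bar>\<phi> ((x - w) + (y - x)) - \<phi> (x - w) - grad \<phi> (x - w) \<bullet> (y - x)\<bar>"
            by (simp add: abs_mult[symmetric] algebra_simps)
          also have "\<dots> \<le> \<bar>f w\<bar> * (e / (I + 1) * norm (y - x))"
            using y by (intro mult_left_mono d) auto
          finally show ?thesis using False by (simp add: indicator_def)
        qed
      qed
      also have "\<dots> = I * (e / (I + 1) * norm (y - x))" by (simp add: I_def)
      also have "\<dots> \<le> e * norm (y - x)"
        using e I0 by (simp add: field_simps mult_left_mono)
      finally show "norm (moll f \<phi> y - moll f \<phi> x - (\<chi> j. moll f (\<lambda>y. grad \<phi> y $ j) x) \<bullet> (y - x)) \<le> e * norm (y - x)"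
        unfolding eq .
    qed (use d in auto)
  qed
qed

lemma moll_differentiable:
  assumes "loc_integrable f" "C1_comp r \<phi>"
  shows "moll f \<phi> differentiable at x"
  using moll_has_derivative[OF assms] by (auto simp: differentiable_def)

lemma grad_moll:
  assumes "loc_integrable f" "C1_comp r \<phi>"
  shows "grad (moll f \<phi>) x $ j = moll f (\<lambda>y. grad \<phi> y $ j) x"
  using grad_eqI[OF moll_has_derivative[OF assms]] by simp

text \<open>Derivatives fall on the kernel, and partial derivatives of test functions are test
  functions, so the induction on the order of differentiability closes.\<close>

lemma smooth_moll:
  assumes f: "loc_integrable f" and "test_fun A \<phi>"
  shows "smooth (moll f \<phi>)"
proof -
  have "C_diff k (moll f \<phi>)" for k using assms(2)
  proof (induction k arbitrary: \<phi>)
    case 0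
    obtain r where "C1_comp r \<phi>" using 0 test_fun_C1_comp by blast
    then show ?case using moll_differentiable[OF f]
      by (auto intro!: differentiable_imp_continuous_on simp: differentiable_on_def)
  next
    case (Suc k)
    obtain r where r: "C1_comp r \<phi>" using Suc.prems test_fun_C1_comp by blast
    have "grad (moll f \<phi>) x $ j = moll f (\<lambda>y. grad \<phi> y $ j) x" for x j using grad_moll[OF f r] .
    then show ?case using moll_differentiable[OF f r] Suc.IH[OF test_fun_grad[OF Suc.prems]]
      by (simp add: differentiable_on_def)
  qed
  then show ?thesis by (simp add: smooth_def)
qed

text \<open>Differentiate the mollification of a constant.\<close>

lemma integral_grad_0:
  assumes "C1_comp r \<phi>"
  shows "(LINT x|lebesgue. grad \<phi> x $ j) = 0"
proof -
  note C = C1_compD[OF assms]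
  have li: "loc_integrable (\<lambda>x::real^'n. 1)" by (rule loc_integrable_bounded[of _ 1]) auto
  have [measurable]: "\<phi> \<in> borel_measurable lebesgue" "(\<lambda>y. grad \<phi> y $ j) \<in> borel_measurable lebesgue"
    using C by (auto intro!: continuous_measurable_lebesgue continuous_intros)
  have "moll (\<lambda>x. 1) \<phi> x = (LINT x|lebesgue. \<phi> x)" for x
    using integral_reflect[of \<phi> x] by (simp add: moll_def)
  then have "grad (moll (\<lambda>x. 1) \<phi>) 0 = 0"
    by (intro grad_0_open[of UNIV]) auto
  then have "moll (\<lambda>x. 1) (\<lambda>y. grad \<phi> y $ j) 0 = 0"
    using grad_moll[OF li assms, of 0 j] by simp
  then show ?thesis using integral_reflect[of "\<lambda>y. grad \<phi> y $ j" 0] by (simp add: moll_def)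
qed

lemma C1_comp_mult:
  assumes "C_diff 1 f" "C1_comp r \<phi>"
  shows "C1_comp r (\<lambda>x. f x * \<phi> x)"
  using assms unfolding C1_comp_def by (auto simp del: One_nat_def intro: C_diff_mult)

text \<open>The product of \<open>f\<close> and \<phi> has bounded support, hence its partial
  derivative integrates to zero.\<close>

lemma integral_by_parts:
  assumes f: "C_diff 1 f" and \<phi>: "C1_comp r \<phi>"
  shows "(LINT x|lebesgue. f x * grad \<phi> x $ j) = - (LINT x|lebesgue. grad f x $ j * \<phi> x)"
proof -
  note C = C1_compD[OF \<phi>]
  have fC: "f differentiable at x" "continuous_on UNIV f" "continuous_on UNIV (grad f)" for x
    using f C_diff_differentiable[of 0 f] C_diff_continuous[OF f] C_diff_grad_continuous[of 0 f] by (auto simp del: C_diff.simps)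
  have li: "loc_integrable (\<lambda>x::real^'n. 1)" by (rule loc_integrable_bounded[of _ 1]) auto
  have 1: "integrable lebesgue (\<lambda>x. f x * grad \<phi> x $ j)"
    using integrable_mult_comp_support[OF li, of "\<lambda>x. f x * grad \<phi> x $ j" r] C fC
    by (force intro!: continuous_intros)
  have 2: "integrable lebesgue (\<lambda>x. grad f x $ j * \<phi> x)"
    using integrable_mult_comp_support[OF li, of "\<lambda>x. grad f x $ j * \<phi> x" r] C fC
    by (force intro!: continuous_intros)
  have "grad (\<lambda>x. f x * \<phi> x) x $ j = f x * grad \<phi> x $ j + grad f x $ j * \<phi> x" for x
    by (simp add: grad_mult[OF fC(1) C(1)])
  then show ?thesis
    using integral_grad_0[OF C1_comp_mult[OF f \<phi>], of j] 1 2 by simp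
qed

section \<open>Convergence of mollifications in L2\<close>

definition scale_moll :: "real \<Rightarrow> (real^'n \<Rightarrow> real) \<Rightarrow> real^'n \<Rightarrow> real" where
  "scale_moll d \<phi> x = (1 / d ^ CARD('n)) * \<phi> ((1 / d) *\<^sub>R x)"

lemma test_fun_scale_moll:
  fixes \<phi> :: "real^'n \<Rightarrow> real"
  assumes "test_fun (ball 0 1) \<phi>" "d > 0"
  shows "test_fun (ball 0 d) (scale_moll d \<phi>)"
proof -
  have "test_fun {x. (1/d) *\<^sub>R x + 0 \<in> ball 0 1} (\<lambda>x. \<phi> ((1/d) *\<^sub>R x + 0))"
    by (rule test_fun_affine) (use assms in auto)
  moreover have "{x. (1/d) *\<^sub>R x + 0 \<in> ball 0 1} = (ball 0 d :: (real^'n) set)"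
    using assms by (auto simp: field_simps)
  ultimately show ?thesis
    unfolding scale_moll_def using test_fun_mult[OF _ smooth_const[of "1 / d ^ CARD('n)"], of "ball 0 d" "\<lambda>x. \<phi> ((1/d) *\<^sub>R x)"] by simp
qed

lemma moll_scale_moll:
  fixes f \<phi> :: "real^'n \<Rightarrow> real"
  assumes [measurable]: "f \<in> borel_measurable lebesgue" "\<phi> \<in> borel_measurable borel" and d: "d > 0"
  shows "moll f (scale_moll d \<phi>) x = (LINT t|lebesgue. \<phi> t * f (x - d *\<^sub>R t))"
proof -
  have "(\<lambda>y. scale_moll d \<phi> (x - y)) \<in> borel_measurable lebesgue"
    unfolding scale_moll_def by (intro measurable_completion) measurable
  then have "moll f (scale_moll d \<phi>) x = d ^ CARD('n) * (LINT t|lebesgue. f (x - d *\<^sub>R t) * scale_moll d \<phi> (d *\<^sub>R t))"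
    unfolding moll_def by (subst integral_similarity[of uminus d _ x])
      (use d in \<open>auto simp: orthogonal_transformation_neg\<close>)
  also have "\<dots> = (LINT t|lebesgue. d ^ CARD('n) * (f (x - d *\<^sub>R t) * scale_moll d \<phi> (d *\<^sub>R t)))"
    by simp
  also have "\<dots> = (LINT t|lebesgue. \<phi> t * f (x - d *\<^sub>R t))"
    using d by (intro Bochner_Integration.integral_cong) (auto simp: scale_moll_def)
  finally show ?thesis .
qed

text \<open>Clamping at a level \<open>M\<close> first reduces to a bounded function. Measurability
  then supplies continuous functions converging almost everywhere; clamping these too and
  multiplying by a radial tent function makes dominated convergence applicable.\<close>

lemma L2_approx_continuous:
  fixes f :: "real^'n \<Rightarrow> real"
  assumes [measurable]: "f \<in> borel_measurable lebesgue" and fin: "(\<integral>\<^sup>+ x. ennreal ((f x)\<^sup>2) \<partial>lebesgue) < \<infinity>"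
    and supp: "\<And>x. norm x > r \<Longrightarrow> f x = 0" and e: "e > 0"
  obtains g where "continuous_on UNIV g" "\<And>x. norm x > r + 1 \<Longrightarrow> g x = 0"
    "(\<integral>\<^sup>+ x. ennreal ((f x - g x)\<^sup>2) \<partial>lebesgue) \<le> ennreal e"
proof -
  define cl :: "real \<Rightarrow> real \<Rightarrow> real" where "cl M y = max (- M) (min M y)" for M y
  have cl_cont: "continuous_on UNIV (cl M)" for M unfolding cl_def by (intro continuous_intros)
  then have [measurable]: "cl M \<in> borel_measurable borel" for M by (rule borel_measurable_continuous_onI)
  have "(\<lambda>M::nat. \<integral>\<^sup>+ x. ennreal ((f x - cl M (f x))\<^sup>2) \<partial>lebesgue) \<longlonglongrightarrow> (\<integral>\<^sup>+ x. 0 \<partial>(lebesgue :: (real^'n) measure))"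
  proof (rule nn_integral_dominated_convergence[where w="\<lambda>x. ennreal ((f x)\<^sup>2)"])
    show "AE x in lebesgue. ennreal ((f x - cl (real M) (f x))\<^sup>2) \<le> ennreal ((f x)\<^sup>2)" for M
      by (intro AE_I2 ennreal_leI) (auto simp: cl_def abs_le_square_iff[symmetric] max_def min_def)
    show "AE x in lebesgue. (\<lambda>M. ennreal ((f x - cl (real M) (f x))\<^sup>2)) \<longlonglongrightarrow> 0"
    proof (rule AE_I2)
      fix x
      obtain N :: nat where N: "\<bar>f x\<bar> \<le> N" using real_arch_simple by blast
      have "eventually (\<lambda>M. ennreal ((f x - cl (real M) (f x))\<^sup>2) = 0) sequentially"
        using eventually_ge_at_top[of N] by eventually_elim (use N in \<open>auto simp: cl_def\<close>)
      then show "(\<lambda>M. ennreal ((f x - cl (real M) (f x))\<^sup>2)) \<longlonglongrightarrow> 0"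
        by (rule tendsto_eventually)
    qed
  qed (use fin in auto)
  then have "eventually (\<lambda>M::nat. (\<integral>\<^sup>+ x. ennreal ((f x - cl M (f x))\<^sup>2) \<partial>lebesgue) < ennreal (e / 4)) sequentially"
    using e by (intro order_tendstoD) auto
  then obtain M :: nat where M: "(\<integral>\<^sup>+ x. ennreal ((f x - cl M (f x))\<^sup>2) \<partial>lebesgue) < ennreal (e / 4)"
    using eventually_happens trivial_limit_sequentially by blast
  have "f measurable_on UNIV" by (rule lebesgue_measurable_imp_measurable_on) auto
  then obtain N g where N: "negligible N" and g: "\<And>n. continuous_on UNIV (g n)"
      and lim: "\<And>x. x \<notin> N \<Longrightarrow> (\<lambda>n. g n x) \<longlonglongrightarrow> f x"
    unfolding measurable_on_def by auto
  define h where "h n x = cl M (g n x) * max 0 (min 1 (r + 1 - norm x))" for n :: nat and x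
  have hc: "continuous_on UNIV (h n)" for n
    unfolding h_def by (intro continuous_intros continuous_on_compose2[OF cl_cont g]) auto
  then have [measurable]: "h n \<in> borel_measurable lebesgue" for n by (rule continuous_measurable_lebesgue)
  have hs: "h n x = 0" if "norm x > r + 1" for n x using that by (simp add: h_def)
  have "(\<lambda>n. \<integral>\<^sup>+ x. ennreal ((cl M (f x) - h n x)\<^sup>2) \<partial>lebesgue) \<longlonglongrightarrow> (\<integral>\<^sup>+ x. 0 \<partial>(lebesgue :: (real^'n) measure))"
  proof (rule nn_integral_dominated_convergence[where w="\<lambda>x. ennreal ((2 * real M)\<^sup>2) * indicator (cball 0 (r + 1)) x"])
    show "AE x in lebesgue. ennreal ((cl M (f x) - h n x)\<^sup>2) \<le> ennreal ((2 * real M)\<^sup>2) * indicator (cball 0 (r + 1)) x" for n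
    proof (rule AE_I2)
      fix x :: "real^'n"
      show "ennreal ((cl M (f x) - h n x)\<^sup>2) \<le> ennreal ((2 * real M)\<^sup>2) * indicator (cball 0 (r + 1)) x"
      proof (cases "norm x > r + 1")
        case True
        then show ?thesis using supp[of x] hs[of x n] by (simp add: cl_def)
      next
        case False
        have a: "\<bar>cl M y\<bar> \<le> M" for y by (auto simp: cl_def)
        have "\<bar>h n x\<bar> \<le> real M * 1" unfolding h_def abs_mult by (intro mult_mono a) auto
        then have "\<bar>cl M (f x) - h n x\<bar> \<le> \<bar>2 * real M\<bar>" using a[of "f x"] by linarith
        then have "(cl M (f x) - h n x)\<^sup>2 \<le> (2 * real M)\<^sup>2" by (rule abs_le_square_iff[THEN iffD1])
        then show ?thesis using False by (simp add: ennreal_leI)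
      qed
    qed
    show "AE x in lebesgue. (\<lambda>n. ennreal ((cl M (f x) - h n x)\<^sup>2)) \<longlonglongrightarrow> 0"
    proof (rule AE_I')
      show "N \<in> null_sets lebesgue" using N by (simp add: negligible_iff_null_sets)
      show "{x \<in> space lebesgue. \<not> (\<lambda>n. ennreal ((cl M (f x) - h n x)\<^sup>2)) \<longlonglongrightarrow> 0} \<subseteq> N"
      proof (clarify, rule ccontr)
        fix x assume nl: "\<not> (\<lambda>n. ennreal ((cl M (f x) - h n x)\<^sup>2)) \<longlonglongrightarrow> 0" and "x \<notin> N"
        have "isCont (cl M) (f x)" using cl_cont continuous_on_eq_continuous_at open_UNIV by blast
        then have "(\<lambda>n. cl M (g n x)) \<longlonglongrightarrow> cl M (f x)" using lim[OF \<open>x \<notin> N\<close>] isCont_tendsto_compose by blast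
        then have "(\<lambda>n. h n x) \<longlonglongrightarrow> cl M (f x) * max 0 (min 1 (r + 1 - norm x))"
          unfolding h_def by (intro tendsto_intros)
        also have "cl M (f x) * max 0 (min 1 (r + 1 - norm x)) = cl M (f x)"
          using supp[of x] by (cases "norm x > r") (auto simp: cl_def)
        finally have "(\<lambda>n. (cl M (f x) - h n x)\<^sup>2) \<longlonglongrightarrow> (cl M (f x) - cl M (f x))\<^sup>2" by (intro tendsto_intros)
        then have "(\<lambda>n. ennreal ((cl M (f x) - h n x)\<^sup>2)) \<longlonglongrightarrow> ennreal 0" by (intro tendsto_ennrealI) simp
        then show False using nl by simp
      qed
    qed
    show "(\<integral>\<^sup>+ x. ennreal ((2 * real M)\<^sup>2) * indicator (cball 0 (r + 1)) x \<partial>(lebesgue :: (real^'n) measure)) < \<infinity>"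
      by (simp add: nn_integral_cmult_indicator ennreal_mult_less_top emeasure_cball_finite)
  qed auto
  then have "eventually (\<lambda>n. (\<integral>\<^sup>+ x. ennreal ((cl M (f x) - h n x)\<^sup>2) \<partial>lebesgue) < ennreal (e / 4)) sequentially"
    using e by (intro order_tendstoD) auto
  then obtain n where n: "(\<integral>\<^sup>+ x. ennreal ((cl M (f x) - h n x)\<^sup>2) \<partial>lebesgue) < ennreal (e / 4)"
    using eventually_happens trivial_limit_sequentially by blast
  have "(\<integral>\<^sup>+ x. ennreal ((f x - h n x)\<^sup>2) \<partial>lebesgue)
     \<le> (\<integral>\<^sup>+ x. 2 * ennreal ((f x - cl M (f x))\<^sup>2) + 2 * ennreal ((cl M (f x) - h n x)\<^sup>2) \<partial>lebesgue)"
  proof (intro nn_integral_mono)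
    fix x
    have "(f x - h n x)\<^sup>2 \<le> 2 * (f x - cl M (f x))\<^sup>2 + 2 * (cl M (f x) - h n x)\<^sup>2"
      using sum_squares_ge_zero[of "(f x - cl M (f x)) - (cl M (f x) - h n x)" 0] by (simp add: power2_eq_square algebra_simps)
    then show "ennreal ((f x - h n x)\<^sup>2) \<le> 2 * ennreal ((f x - cl M (f x))\<^sup>2) + 2 * ennreal ((cl M (f x) - h n x)\<^sup>2)"
      by (simp add: ennreal_mult'[symmetric] ennreal_plus[symmetric] ennreal_leI flip: ennreal_numeral del: ennreal_plus)
  qed
  also have "\<dots> = 2 * (\<integral>\<^sup>+ x. ennreal ((f x - cl M (f x))\<^sup>2) \<partial>lebesgue) + 2 * (\<integral>\<^sup>+ x. ennreal ((cl M (f x) - h n x)\<^sup>2) \<partial>lebesgue)"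
    by (simp add: nn_integral_add nn_integral_cmult)
  also have "\<dots> \<le> 2 * ennreal (e / 4) + 2 * ennreal (e / 4)"
    using M n by (intro add_mono mult_left_mono) auto
  also have "\<dots> = ennreal e"
    using e by (simp add: ennreal_mult'[symmetric] ennreal_plus[symmetric] flip: ennreal_numeral del: ennreal_plus)
  finally show ?thesis using that hc hs by blast
qed

lemma nn_integral_translate:
  fixes f :: "'a::euclidean_space \<Rightarrow> ennreal"
  assumes "f \<in> borel_measurable lebesgue"
  shows "(\<integral>\<^sup>+ x. f (x + t) \<partial>lebesgue) = (\<integral>\<^sup>+ x. f x \<partial>lebesgue)"
  using nn_integral_similarity[of "\<lambda>x. x" 1 f t] assms by (simp add: add.commute)

lemma L2_translation_continuous:
  fixes f :: "real^'n \<Rightarrow> real"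
  assumes [measurable]: "f \<in> borel_measurable lebesgue" and fin: "(\<integral>\<^sup>+ x. ennreal ((f x)\<^sup>2) \<partial>lebesgue) < \<infinity>"
    and supp: "\<And>x. norm x > r \<Longrightarrow> f x = 0" and e: "e > 0"
  obtains d where "d > 0" "\<And>y. norm y < d \<Longrightarrow> (\<integral>\<^sup>+ x. ennreal ((f (x - y) - f x)\<^sup>2) \<partial>lebesgue) \<le> ennreal e"
proof -
  \<comment> \<open>The square of a three-term sum costs a factor 3, and each term gets a third of
    \<open>e\<close>. The two approximation errors are equal by translation invariance;
    \<open>w\<close> below is chosen so that the middle term on a ball of volume \<open>V\<close>
    stays below \<open>e / 3\<close>.\<close>
  have e9: "e / 9 > 0" using e by simp
  obtain g where gc: "continuous_on UNIV g" and gs: "\<And>x. norm x > r + 1 \<Longrightarrow> g x = 0"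
    and ge: "(\<integral>\<^sup>+ x. ennreal ((f x - g x)\<^sup>2) \<partial>lebesgue) \<le> ennreal (e / 9)"
    using L2_approx_continuous[OF assms(1) fin supp e9] by blast
  have [measurable]: "g \<in> borel_measurable lebesgue" using gc by (rule continuous_measurable_lebesgue)
  define V where "V = measure lborel (cball (0::real^'n) (r + 2))"
  have V0: "V \<ge> 0" by (simp add: V_def)
  define w where "w = sqrt (e / (9 * (V + 1)))"
  have w: "w > 0" using e V0 by (simp add: w_def add_nonneg_pos)
  have "uniformly_continuous_on UNIV g" using gc gs uniformly_continuous_comp_support by blast
  then obtain d where d: "d > 0" "\<And>x y. dist y x < d \<Longrightarrow> dist (g y) (g x) < w"
    using w unfolding uniformly_continuous_on_def by auto
  have "(\<integral>\<^sup>+ x. ennreal ((f (x - y) - f x)\<^sup>2) \<partial>lebesgue) \<le> ennreal e" if y: "norm y < min d 1" for y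
  proof -
    note [measurable] = similarity_lebesgue(1)[of "\<lambda>x. x" 1 "- y", simplified]
    have [measurable]: "(\<lambda>x. f (x - y)) \<in> borel_measurable lebesgue" "(\<lambda>x. g (x - y)) \<in> borel_measurable lebesgue"
      using measurable_compose[OF similarity_lebesgue(1)[of "\<lambda>x. x" 1 "- y"]] assms(1)
        \<open>g \<in> borel_measurable lebesgue\<close> by fastforce+
    have "(\<integral>\<^sup>+ x. ennreal ((f (x - y) - f x)\<^sup>2) \<partial>lebesgue)
       \<le> (\<integral>\<^sup>+ x. 3 * ennreal ((f (x - y) - g (x - y))\<^sup>2) + 3 * ennreal (w\<^sup>2) * indicator (cball 0 (r + 2)) x
            + 3 * ennreal ((f x - g x)\<^sup>2) \<partial>lebesgue)"
    proof (intro nn_integral_mono)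
      fix x
      have "(g (x - y) - g x)\<^sup>2 \<le> w\<^sup>2 * indicator (cball 0 (r + 2)) x"
      proof (cases "norm x > r + 2")
        case True
        then have "norm (x - y) > r + 1" using y norm_triangle_ineq2[of x y] by simp
        then show ?thesis using gs True by simp
      next
        case False
        have "\<bar>g (x - y) - g x\<bar> \<le> \<bar>w\<bar>" using d(2)[of "x - y" x] y w by (simp add: dist_real_def dist_norm)
        then show ?thesis using False by (simp add: abs_le_square_iff[symmetric])
      qed
      moreover have "(f (x - y) - f x)\<^sup>2 \<le> 3 * (f (x - y) - g (x - y))\<^sup>2 + 3 * (g (x - y) - g x)\<^sup>2 + 3 * (f x - g x)\<^sup>2"
      proof -
        have "(a + b + c)\<^sup>2 \<le> 3 * a\<^sup>2 + 3 * b\<^sup>2 + 3 * c\<^sup>2" for a b c :: real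
          using zero_le_power2[of "a - b"] zero_le_power2[of "b - c"] zero_le_power2[of "a - c"]
          by (simp add: power2_eq_square algebra_simps)
        from this[of "f (x - y) - g (x - y)" "g (x - y) - g x" "g x - f x"]
        show ?thesis by (simp add: power2_commute)
      qed
      ultimately have "ennreal ((f (x - y) - f x)\<^sup>2) \<le> ennreal (3 * (f (x - y) - g (x - y))\<^sup>2 + 3 * (w\<^sup>2 * indicator (cball 0 (r + 2)) x) + 3 * (f x - g x)\<^sup>2)"
        by (intro ennreal_leI) linarith
      then show "ennreal ((f (x - y) - f x)\<^sup>2) \<le> 3 * ennreal ((f (x - y) - g (x - y))\<^sup>2) + 3 * ennreal (w\<^sup>2) * indicator (cball 0 (r + 2)) x + 3 * ennreal ((f x - g x)\<^sup>2)"
        by (cases "norm x \<le> r + 2") (simp_all add: ennreal_mult')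
    qed
    also have "\<dots> = 3 * (\<integral>\<^sup>+ x. ennreal ((f (x - y) - g (x - y))\<^sup>2) \<partial>lebesgue) + 3 * ennreal (w\<^sup>2) * ennreal V + 3 * (\<integral>\<^sup>+ x. ennreal ((f x - g x)\<^sup>2) \<partial>lebesgue)"
      using emeasure_cball_finite[of "0::real^'n" "r + 2"]
      by (simp add: nn_integral_add nn_integral_cmult nn_integral_cmult_indicator V_def emeasure_eq_ennreal_measure less_top)
    also have "(\<integral>\<^sup>+ x. ennreal ((f (x - y) - g (x - y))\<^sup>2) \<partial>lebesgue) = (\<integral>\<^sup>+ x. ennreal ((f x - g x)\<^sup>2) \<partial>lebesgue)"
      using nn_integral_translate[of "\<lambda>x. ennreal ((f x - g x)\<^sup>2)" "- y"] by simp
    also have "3 * (\<integral>\<^sup>+ x. ennreal ((f x - g x)\<^sup>2) \<partial>lebesgue) + 3 * ennreal (w\<^sup>2) * ennreal V + 3 * (\<integral>\<^sup>+ x. ennreal ((f x - g x)\<^sup>2) \<partial>lebesgue)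
       \<le> 3 * ennreal (e / 9) + 3 * ennreal (w\<^sup>2) * ennreal V + 3 * ennreal (e / 9)"
      by (intro add_mono mult_left_mono ge) auto
    also have "\<dots> = ennreal (e / 3 + 3 * w\<^sup>2 * V + e / 3)"
      using e V0 by (simp add: ennreal_mult'[symmetric] ennreal_plus[symmetric] flip: ennreal_numeral del: ennreal_plus)
    also have "\<dots> \<le> ennreal e"
    proof (intro ennreal_leI)
      have "3 * w\<^sup>2 * V = (e / 3) * (V / (V + 1))" using e V0 by (simp add: w_def field_simps)
      also have "\<dots> \<le> (e / 3) * 1" using e V0 by (intro mult_left_mono) auto
      finally show "e / 3 + 3 * w\<^sup>2 * V + e / 3 \<le> e" by simp
    qed
    finally show ?thesis .
  qed
  then show ?thesis using that[of "min d 1"] d by simp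
qed

lemma loc_integrable_L2:
  fixes f :: "real^'n \<Rightarrow> real"
  assumes [measurable]: "f \<in> borel_measurable lebesgue" and fin: "(\<integral>\<^sup>+ x. ennreal ((f x)\<^sup>2) \<partial>lebesgue) < \<infinity>"
  shows "loc_integrable f"
  unfolding loc_integrable_def
proof (intro conjI allI)
  fix r
  have i2: "integrable lebesgue (\<lambda>x. (f x)\<^sup>2)"
    using fin by (intro integrableI_bounded) auto
  have "integrable lebesgue (\<lambda>x::real^'n. indicator (cball 0 r) x :: real)"
    by (intro integrable_real_indicator) (auto simp: emeasure_cball_finite)
  then show "integrable lebesgue (\<lambda>x. indicator (cball 0 r) x * f x)"
  proof (rule Bochner_Integration.integrable_bound[OF Bochner_Integration.integrable_add[OF i2]])
    have "\<bar>y\<bar> \<le> y\<^sup>2 + 1" for y :: real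
      using zero_le_power2[of "\<bar>y\<bar> - 1/2"] by (simp add: power2_eq_square algebra_simps)
    then show "AE x in lebesgue. norm (indicator (cball 0 r) x * f x) \<le> norm ((f x)\<^sup>2 + indicator (cball 0 r) x)"
      by (auto simp: indicator_def)
  qed simp
qed simp

locale mollifier =
  fixes \<phi> :: "real^'n \<Rightarrow> real"
  assumes test: "test_fun (ball 0 1) \<phi>"
    and nonneg: "\<And>x. \<phi> x \<ge> 0"
    and integral_1: "(LINT x:ball 0 1|lborel. \<phi> x) = 1"
begin

lemma continuous: "continuous_on UNIV \<phi>"
  using test by (simp add: smooth_continuous test_fun_smooth)

lemma borel[measurable]: "\<phi> \<in> borel_measurable borel"
  using continuous by (rule borel_measurable_continuous_onI)

lemma zero: "norm x \<ge> 1 \<Longrightarrow> \<phi> x = 0"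
  using test_fun_zero[OF test] by simp

lemma integral_lborel: "(LINT x|lborel. \<phi> x) = 1"
proof -
  have "(\<lambda>x. indicator (ball 0 1) x *\<^sub>R \<phi> x) = \<phi>"
    using zero by (auto simp: indicator_def fun_eq_iff)
  then show ?thesis using integral_1 by (simp add: set_lebesgue_integral_def)
qed

lemma integral_lebesgue: "(LINT x|lebesgue. \<phi> x) = 1"
  using integral_lborel by (simp add: integral_completion)

lemma integrable_lborel: "integrable lborel \<phi>"
  using integral_lborel not_integrable_integral_eq by fastforce

lemma nn_integral_lborel: "(\<integral>\<^sup>+ x. ennreal (\<phi> x) \<partial>lborel) = 1"
  using nn_integral_eq_integral[OF integrable_lborel] nonneg integral_lborel by simp

lemma C1: "C1_comp 1 \<phi>"
  using test by (rule test_fun_ball_C1_comp)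

text \<open>The mollification error is an average of translation errors, and Tonelli's theorem
  exchanges average and norm. Borel measurability of \<open>f\<close> gives joint measurability in
  \<open>x\<close> and \<open>t\<close>; \<open>moll_L2\<close> passes to Lebesgue measurable
  functions.\<close>

lemma moll_L2_borel:
  assumes f[measurable]: "f \<in> borel_measurable borel" and fin: "(\<integral>\<^sup>+ x. ennreal ((f x)\<^sup>2) \<partial>lebesgue) < \<infinity>"
    and e: "\<And>y. norm y < d \<Longrightarrow> (\<integral>\<^sup>+ x. ennreal ((f (x - y) - f x)\<^sup>2) \<partial>lebesgue) \<le> e"
    and \<delta>: "0 < \<delta>" "\<delta> < d"
  shows "(\<integral>\<^sup>+ x. ennreal ((moll f (scale_moll \<delta> \<phi>) x - f x)\<^sup>2) \<partial>lebesgue) \<le> e"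
proof -
  have fl: "f \<in> borel_measurable lebesgue" by (intro measurable_completion) simp
  have li: "loc_integrable f" by (rule loc_integrable_L2[OF fl fin])
  let ?h = "\<lambda>x t. f (x - \<delta> *\<^sub>R t) - f x"
  have pt: "ennreal ((moll f (scale_moll \<delta> \<phi>) x - f x)\<^sup>2) \<le> (\<integral>\<^sup>+ t. ennreal (\<phi> t) * ennreal ((?h x t)\<^sup>2) \<partial>lborel)" for x
  proof -
    have "integrable lebesgue (\<lambda>y. f y * scale_moll \<delta> \<phi> (x - y))"
      using moll_integrable[OF li, of "scale_moll \<delta> \<phi>" \<delta>] C1_compD[OF test_fun_ball_C1_comp[OF test_fun_scale_moll[OF test \<delta>(1)]]]
      by blast
    then have "integrable lebesgue (\<lambda>t. f (x + \<delta> *\<^sub>R (- t)) * scale_moll \<delta> \<phi> (x - (x + \<delta> *\<^sub>R (- t))))"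
      by (intro integrable_similarity[of uminus \<delta> "\<lambda>y. f y * scale_moll \<delta> \<phi> (x - y)" x] \<delta>)
        (simp_all add: orthogonal_transformation_neg)
    then have "integrable lebesgue (\<lambda>t. \<delta> ^ CARD('n) * (f (x + \<delta> *\<^sub>R (- t)) * scale_moll \<delta> \<phi> (x - (x + \<delta> *\<^sub>R (- t)))))"
      by (rule integrable_mult_right)
    moreover have "(\<lambda>t. \<delta> ^ CARD('n) * (f (x + \<delta> *\<^sub>R (- t)) * scale_moll \<delta> \<phi> (x - (x + \<delta> *\<^sub>R (- t)))))
       = (\<lambda>t. \<phi> t * f (x - \<delta> *\<^sub>R t))"
      using \<delta> by (auto simp: scale_moll_def)
    ultimately have "integrable lebesgue (\<lambda>t. \<phi> t * f (x - \<delta> *\<^sub>R t))" by (simp only:)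
    then have i: "integrable lborel (\<lambda>t. \<phi> t * f (x - \<delta> *\<^sub>R t))"
      by (subst (asm) integrable_completion) auto
    have "moll f (scale_moll \<delta> \<phi>) x - f x = (LINT t|lborel. \<phi> t * f (x - \<delta> *\<^sub>R t)) - (LINT t|lborel. \<phi> t * f x)"
      by (simp add: moll_scale_moll[OF fl borel \<delta>(1)] integral_completion integral_lborel)
    also have "\<dots> = (LINT t|lborel. \<phi> t * ?h x t)"
      using i integrable_lborel by (simp add: right_diff_distrib)
    finally have eq: "moll f (scale_moll \<delta> \<phi>) x - f x = (LINT t|lborel. \<phi> t * ?h x t)" .
    have "ennreal (norm (LINT t|lborel. \<phi> t * ?h x t)) \<le> (\<integral>\<^sup>+ t. ennreal (norm (\<phi> t * ?h x t)) \<partial>lborel)"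
    proof (cases "integrable lborel (\<lambda>t. \<phi> t * ?h x t)")
      case True
      then show ?thesis by (rule integral_norm_bound_ennreal)
    qed (simp add: not_integrable_integral_eq)
    \<comment> \<open>Distributing the kernel as two square roots turns the Cauchy-Schwarz
      inequality into Jensen's inequality for the probability measure with density \<phi>.\<close>
    also have "\<dots> = (\<integral>\<^sup>+ t. ennreal (sqrt (\<phi> t)) * ennreal (sqrt (\<phi> t) * \<bar>?h x t\<bar>) \<partial>lborel)"
      using nonneg by (intro nn_integral_cong) (simp add: ennreal_mult'[symmetric] abs_mult mult.assoc[symmetric])
    finally have "(ennreal (norm (LINT t|lborel. \<phi> t * ?h x t)))\<^sup>2 \<le> (\<integral>\<^sup>+ t. ennreal (sqrt (\<phi> t)) * ennreal (sqrt (\<phi> t) * \<bar>?h x t\<bar>) \<partial>lborel)\<^sup>2"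
      by (intro power_mono) auto
    also have "\<dots> \<le> (\<integral>\<^sup>+ t. (ennreal (sqrt (\<phi> t)))\<^sup>2 \<partial>lborel) * (\<integral>\<^sup>+ t. (ennreal (sqrt (\<phi> t) * \<bar>?h x t\<bar>))\<^sup>2 \<partial>lborel)"
      by (rule Cauchy_Schwarz_nn_integral) auto
    also have "(\<integral>\<^sup>+ t. (ennreal (sqrt (\<phi> t)))\<^sup>2 \<partial>lborel) = 1"
      using nonneg nn_integral_lborel by (simp add: ennreal_power)
    also have "(\<integral>\<^sup>+ t. (ennreal (sqrt (\<phi> t) * \<bar>?h x t\<bar>))\<^sup>2 \<partial>lborel) = (\<integral>\<^sup>+ t. ennreal (\<phi> t) * ennreal ((?h x t)\<^sup>2) \<partial>lborel)"
      using nonneg by (intro nn_integral_cong) (simp add: ennreal_power power_mult_distrib ennreal_mult')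
    finally show ?thesis by (simp add: eq ennreal_power)
  qed
  have "(\<integral>\<^sup>+ x. ennreal ((moll f (scale_moll \<delta> \<phi>) x - f x)\<^sup>2) \<partial>lebesgue)
      \<le> (\<integral>\<^sup>+ x. (\<integral>\<^sup>+ t. ennreal (\<phi> t) * ennreal ((?h x t)\<^sup>2) \<partial>lborel) \<partial>lebesgue)"
    by (intro nn_integral_mono pt)
  also have "\<dots> = (\<integral>\<^sup>+ x. (\<integral>\<^sup>+ t. ennreal (\<phi> t) * ennreal ((?h x t)\<^sup>2) \<partial>lborel) \<partial>lborel)"
    by (rule nn_integral_completion)
  also have "\<dots> = (\<integral>\<^sup>+ t. (\<integral>\<^sup>+ x. ennreal (\<phi> t) * ennreal ((?h x t)\<^sup>2) \<partial>lborel) \<partial>lborel)"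
    by (intro lborel_pair.Fubini'[symmetric]) measurable
  also have "\<dots> \<le> (\<integral>\<^sup>+ t. ennreal (\<phi> t) * e \<partial>lborel)"
  proof (intro nn_integral_mono)
    fix t
    have "(\<integral>\<^sup>+ x. ennreal (\<phi> t) * ennreal ((?h x t)\<^sup>2) \<partial>lborel) = ennreal (\<phi> t) * (\<integral>\<^sup>+ x. ennreal ((?h x t)\<^sup>2) \<partial>lborel)"
      by (rule nn_integral_cmult) measurable
    also have "\<dots> \<le> ennreal (\<phi> t) * e"
    proof (cases "norm t \<ge> 1")
      case False
      then have "\<delta> * norm t \<le> \<delta> * 1" using \<delta> by (intro mult_left_mono) auto
      moreover have "norm (\<delta> *\<^sub>R t) = \<delta> * norm t" using \<delta> by simp
      ultimately have "norm (\<delta> *\<^sub>R t) < d" using \<delta> by linarith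
      then show ?thesis using e[of "\<delta> *\<^sub>R t"] by (intro mult_left_mono) (auto simp: nn_integral_completion)
    qed (simp add: zero)
    finally show "(\<integral>\<^sup>+ x. ennreal (\<phi> t) * ennreal ((?h x t)\<^sup>2) \<partial>lborel) \<le> ennreal (\<phi> t) * e" .
  qed
  also have "\<dots> = e" by (simp add: nn_integral_multc nn_integral_lborel)
  finally show ?thesis .
qed

lemma moll_L2:
  assumes f: "f \<in> borel_measurable lebesgue" and fin: "(\<integral>\<^sup>+ x. ennreal ((f x)\<^sup>2) \<partial>lebesgue) < \<infinity>"
    and supp: "\<And>x. norm x > r \<Longrightarrow> f x = 0" and e: "e > 0"
  obtains d where "d > 0"
    "\<And>\<delta>. 0 < \<delta> \<Longrightarrow> \<delta> < d \<Longrightarrow> (\<integral>\<^sup>+ x. ennreal ((moll f (scale_moll \<delta> \<phi>) x - f x)\<^sup>2) \<partial>lebesgue) \<le> ennreal e"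
proof -
  \<comment> \<open>A Borel version agrees with \<open>f\<close> only almost everywhere, so it is
    cut off once more to restore the bounded support at every point.\<close>
  obtain f' where f'[measurable]: "f' \<in> borel_measurable borel" and AE0: "AE x in lborel. f x = f' x"
    using completion_ex_borel_measurable_real[OF f] by auto
  have AE: "AE x in lebesgue. f x = f' x" using AE0 by (rule AE_completion)
  have f'l: "f' \<in> borel_measurable lebesgue" by (intro measurable_completion) simp
  define f'' where "f'' x = indicator (cball 0 r) x * f' x" for x
  have f''[measurable]: "f'' \<in> borel_measurable borel" unfolding f''_def
    by (intro borel_measurable_times borel_measurable_indicator f') simp
  have AE'': "AE x in lebesgue. f x = f'' x"
    using AE by eventually_elim (use supp in \<open>auto simp: f''_def indicator_def not_le\<close>)
  have "(\<integral>\<^sup>+ x. ennreal ((f'' x)\<^sup>2) \<partial>lebesgue) = (\<integral>\<^sup>+ x. ennreal ((f x)\<^sup>2) \<partial>lebesgue)"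
    using AE'' by (intro nn_integral_cong_AE) auto
  with fin have fin'': "(\<integral>\<^sup>+ x. ennreal ((f'' x)\<^sup>2) \<partial>lebesgue) < \<infinity>" by simp
  have f''l: "f'' \<in> borel_measurable lebesgue" by (intro measurable_completion) simp
  obtain d where d: "d > 0" "\<And>y. norm y < d \<Longrightarrow> (\<integral>\<^sup>+ x. ennreal ((f'' (x - y) - f'' x)\<^sup>2) \<partial>lebesgue) \<le> ennreal e"
    using L2_translation_continuous[OF f''l fin'' _ e, of r] by (auto simp: f''_def)
  have "(\<integral>\<^sup>+ x. ennreal ((moll f (scale_moll \<delta> \<phi>) x - f x)\<^sup>2) \<partial>lebesgue) \<le> ennreal e"
    if \<delta>: "0 < \<delta>" "\<delta> < d" for \<delta>
  proof -
    have "moll f (scale_moll \<delta> \<phi>) x = moll f'' (scale_moll \<delta> \<phi>) x" for x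
    proof -
      have [measurable]: "(\<lambda>y. scale_moll \<delta> \<phi> (x - y)) \<in> borel_measurable lebesgue"
        unfolding scale_moll_def by (intro measurable_completion) measurable
      show ?thesis unfolding moll_def using AE'' f f''l
        by (intro integral_cong_AE borel_measurable_times) auto
    qed
    then have "(\<integral>\<^sup>+ x. ennreal ((moll f (scale_moll \<delta> \<phi>) x - f x)\<^sup>2) \<partial>lebesgue)
      = (\<integral>\<^sup>+ x. ennreal ((moll f'' (scale_moll \<delta> \<phi>) x - f'' x)\<^sup>2) \<partial>lebesgue)"
      using AE'' by (intro nn_integral_cong_AE) auto
    also have "\<dots> \<le> ennreal e" by (rule moll_L2_borel[OF f'' fin'' d(2) \<delta>])
    finally show ?thesis .
  qed
  then show ?thesis using that d by blast
qed

lemma moll_L2_tendsto: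
  assumes f: "f \<in> borel_measurable lebesgue" and fin: "(\<integral>\<^sup>+ x. ennreal ((f x)\<^sup>2) \<partial>lebesgue) < \<infinity>"
    and supp: "\<And>x. norm x > r \<Longrightarrow> f x = 0" and d: "\<And>k. d k > 0" "d \<longlonglongrightarrow> 0"
  shows "(\<lambda>k. \<integral>\<^sup>+ x. ennreal ((moll f (scale_moll (d k) \<phi>) x - f x)\<^sup>2) \<partial>lebesgue) \<longlonglongrightarrow> 0"
proof (rule order_tendstoI)
  fix a :: ennreal assume "0 < a"
  then obtain b where b: "0 < b" "b < a" using dense by blast
  then obtain e where e: "e > 0" "ennreal e < a"
    by (cases b) auto
  obtain d' where d': "d' > 0"
    "\<And>\<delta>. 0 < \<delta> \<Longrightarrow> \<delta> < d' \<Longrightarrow> (\<integral>\<^sup>+ x. ennreal ((moll f (scale_moll \<delta> \<phi>) x - f x)\<^sup>2) \<partial>lebesgue) \<le> ennreal e"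
    using moll_L2[OF f fin supp e(1)] by blast
  have "eventually (\<lambda>k. d k < d') sequentially" using d d' by (intro order_tendstoD) auto
  then show "eventually (\<lambda>k. (\<integral>\<^sup>+ x. ennreal ((moll f (scale_moll (d k) \<phi>) x - f x)\<^sup>2) \<partial>lebesgue) < a) sequentially"
    by eventually_elim (use d' d e in \<open>blast intro: le_less_trans\<close>)
qed simp

end

section \<open>Square integrability and weak gradients\<close>

lemma open_lebesgue: "open A \<Longrightarrow> A \<in> sets lebesgue"
  by (intro sets_completionI_sets) auto

lemma sq_integrable_iff:
  fixes f :: "real^'n \<Rightarrow> 'b::euclidean_space"
  assumes "A \<in> sets lebesgue"
  shows "sq_integrable A f \<longleftrightarrow> sq_integrable UNIV (\<lambda>x. indicator A x *\<^sub>R f x)"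
proof -
  have "(\<lambda>x. indicator A x *\<^sub>R (norm (f x))\<^sup>2) = (\<lambda>x. (norm (indicator A x *\<^sub>R f x))\<^sup>2)"
    by (auto simp: indicator_def)
  then show ?thesis using assms unfolding sq_integrable_def
    by (simp add: borel_measurable_restrict_space_iff integrable_restrict_space lebesgue_on_UNIV_eq)
qed

lemma sq_integrable_UNIV:
  "sq_integrable UNIV f \<longleftrightarrow> f \<in> borel_measurable lebesgue \<and> (\<integral>\<^sup>+ x. ennreal ((norm (f x))\<^sup>2) \<partial>lebesgue) < \<infinity>"
  unfolding sq_integrable_def lebesgue_on_UNIV_eq by (auto simp: integrable_iff_bounded)

lemma sq_integrable_measurable: "sq_integrable A f \<Longrightarrow> f \<in> borel_measurable (lebesgue_on A)"
  by (simp add: sq_integrable_def)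

lemma sq_integrable_bound:
  assumes "f \<in> borel_measurable (lebesgue_on A)" "integrable (lebesgue_on A) g"
    and "\<And>x. x \<in> A \<Longrightarrow> (norm (f x))\<^sup>2 \<le> g x"
  shows "sq_integrable A f"
  unfolding sq_integrable_def
proof
  show "integrable (lebesgue_on A) (\<lambda>x. (norm (f x))\<^sup>2)"
    using assms(1) by (intro Bochner_Integration.integrable_bound[OF assms(2)] AE_I2) (auto intro: order_trans[OF assms(3)])
qed (rule assms)

lemma sq_integrable_add:
  assumes "sq_integrable A f" "sq_integrable A g"
  shows "sq_integrable A (\<lambda>x. f x + g x)"
proof (rule sq_integrable_bound)
  show "integrable (lebesgue_on A) (\<lambda>x. 2 * (norm (f x))\<^sup>2 + 2 * (norm (g x))\<^sup>2)"
    using assms by (simp add: sq_integrable_def)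
  show "(norm (f x + g x))\<^sup>2 \<le> 2 * (norm (f x))\<^sup>2 + 2 * (norm (g x))\<^sup>2" for x
  proof -
    have "(norm (f x + g x))\<^sup>2 \<le> (norm (f x) + norm (g x))\<^sup>2" by (intro power_mono norm_triangle_ineq) auto
    also have "\<dots> \<le> 2 * (norm (f x))\<^sup>2 + 2 * (norm (g x))\<^sup>2"
      using zero_le_power2[of "norm (f x) - norm (g x)"] by (simp add: power2_eq_square algebra_simps)
    finally show ?thesis .
  qed
qed (use assms in \<open>auto simp: sq_integrable_def\<close>)

lemma sq_integrable_scaleR_bounded:
  fixes f :: "real^'n \<Rightarrow> 'b::euclidean_space"
  assumes f: "sq_integrable A f" and g: "g \<in> borel_measurable (lebesgue_on A)"
    and B: "\<And>x. x \<in> A \<Longrightarrow> \<bar>g x\<bar> \<le> B"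
  shows "sq_integrable A (\<lambda>x. g x *\<^sub>R f x)"
proof (rule sq_integrable_bound)
  show "integrable (lebesgue_on A) (\<lambda>x. B\<^sup>2 * (norm (f x))\<^sup>2)" using f by (simp add: sq_integrable_def)
  show "(norm (g x *\<^sub>R f x))\<^sup>2 \<le> B\<^sup>2 * (norm (f x))\<^sup>2" if "x \<in> A" for x
    using power_mono[OF B[OF that], of 2] by (auto simp: power_mult_distrib intro!: mult_right_mono)
qed (use f g in \<open>auto simp: sq_integrable_def\<close>)

lemma sq_integrable_cmult:
  fixes f :: "real^'n \<Rightarrow> 'b::euclidean_space"
  shows "sq_integrable A f \<Longrightarrow> sq_integrable A (\<lambda>x. (c::real) *\<^sub>R f x)"
  by (rule sq_integrable_scaleR_bounded[of A f _ "\<bar>c\<bar>"]) auto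

lemma sq_integrable_bounded_domain:
  fixes f :: "real^'n \<Rightarrow> 'b::euclidean_space"
  assumes f: "f \<in> borel_measurable (lebesgue_on A)" and A: "A \<in> lmeasurable"
    and B: "\<And>x. x \<in> A \<Longrightarrow> norm (f x) \<le> B"
  shows "sq_integrable A f"
proof (rule sq_integrable_bound[OF f])
  show "integrable (lebesgue_on A) (\<lambda>x. B\<^sup>2)" using A
    by (intro finite_measure.integrable_const finite_measure_lebesgue_on)
  show "(norm (f x))\<^sup>2 \<le> B\<^sup>2" if "x \<in> A" for x using B[OF that] by (intro power_mono) auto
qed

lemma sq_integrable_nth:
  fixes G :: "real^'n \<Rightarrow> real^'m"
  shows "sq_integrable A G \<Longrightarrow> sq_integrable A (\<lambda>x. G x $ j)"
  by (rule sq_integrable_bound[where g="\<lambda>x. (norm (G x))\<^sup>2"])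
    (auto simp: sq_integrable_def component_le_norm_cart abs_le_square_iff[symmetric]
      intro!: measurable_compose[OF _ borel_measurable_continuous_onI[of "\<lambda>v. v $ j"]] continuous_intros)

lemma sq_integrable_mono:
  fixes f :: "real^'n \<Rightarrow> 'b::euclidean_space"
  assumes f: "sq_integrable A f" and AB: "A \<in> sets lebesgue" "B \<in> sets lebesgue" "B \<subseteq> A"
  shows "sq_integrable B f"
proof -
  have "sq_integrable UNIV (\<lambda>x. indicator A x *\<^sub>R f x)" using f sq_integrable_iff AB by blast
  then have "sq_integrable UNIV (\<lambda>x. indicator B x *\<^sub>R indicator A x *\<^sub>R f x)"
    by (rule sq_integrable_scaleR_bounded[where B=1])
      (use AB in \<open>auto simp: lebesgue_on_UNIV_eq split: split_indicator\<close>)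
  also have "(\<lambda>x. indicator B x *\<^sub>R indicator A x *\<^sub>R f x) = (\<lambda>x. indicator B x *\<^sub>R f x)"
    using AB by (auto simp: indicator_def fun_eq_iff)
  finally show ?thesis using sq_integrable_iff AB by blast
qed

lemma integrable_mult_test:
  fixes f :: "real^'n \<Rightarrow> real"
  assumes f: "sq_integrable A f" and A: "A \<in> sets lebesgue" and \<psi>: "test_fun A \<psi>"
  shows "integrable lebesgue (\<lambda>x. f x * \<psi> x)"
proof -
  have "loc_integrable (\<lambda>x. indicator A x *\<^sub>R f x)"
    using f A by (intro loc_integrable_L2) (auto simp: sq_integrable_iff[of A f] sq_integrable_UNIV)
  moreover obtain r where r: "C1_comp r \<psi>" using \<psi> test_fun_C1_comp by blast
  ultimately have "integrable lebesgue (\<lambda>x. (indicator A x *\<^sub>R f x) * \<psi> x)"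
    using C1_compD[OF r] by (intro integrable_mult_comp_support[of _ \<psi> r]) auto
  also have "(\<lambda>x. (indicator A x *\<^sub>R f x) * \<psi> x) = (\<lambda>x. f x * \<psi> x)"
    using test_fun_zero[OF \<psi>] by (auto simp: indicator_def fun_eq_iff)
  finally show ?thesis .
qed

lemma integral_mult_test:
  assumes A: "A \<in> sets lebesgue" and \<psi>: "test_fun A \<psi>"
  shows "(LINT x|lebesgue_on A. f x * \<psi> x) = (LINT x|lebesgue. f x * \<psi> x)"
proof -
  have "(\<lambda>x. indicator A x *\<^sub>R (f x * \<psi> x)) = (\<lambda>x. f x * \<psi> x)"
    using test_fun_zero[OF \<psi>] by (auto simp: indicator_def fun_eq_iff)
  then show ?thesis using A by (simp add: integral_restrict_space)
qed

text \<open>Test functions vanish off \<open>A\<close>, so the restricted integrals may be taken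
  over the whole space and the integration by parts identity no longer mentions the measure on
  \<open>A\<close>.\<close>

lemma is_weak_grad_iff:
  assumes A: "A \<in> sets lebesgue"
  shows "is_weak_grad A v G \<longleftrightarrow> sq_integrable A G \<and>
     (\<forall>\<phi> j. test_fun A \<phi> \<longrightarrow>
        (LINT x|lebesgue. v x * grad \<phi> x $ j) = - (LINT x|lebesgue. G x $ j * \<phi> x))"
proof -
  have "(LINT x|lebesgue_on A. v x * grad \<phi> x $ j) = (LINT x|lebesgue. v x * grad \<phi> x $ j)"
    "(LINT x|lebesgue_on A. G x $ j * \<phi> x) = (LINT x|lebesgue. G x $ j * \<phi> x)"
    if "test_fun A \<phi>" for \<phi> j
    by (rule integral_mult_test[OF A test_fun_grad[OF that]], rule integral_mult_test[OF A that])
  then show ?thesis unfolding is_weak_grad_def by simp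
qed

text \<open>\<open>H1 A v G\<close>: \<open>v\<close> lies in \<open>W\<^sup>1\<^sup>,\<^sup>2(A)\<close> and \<open>G\<close> is a version of its gradient.\<close>

definition H1 :: "(real^'n) set \<Rightarrow> (real^'n \<Rightarrow> real) \<Rightarrow> (real^'n \<Rightarrow> real^'n) \<Rightarrow> bool" where
  "H1 A v G \<longleftrightarrow> sq_integrable A v \<and> is_weak_grad A v G"

lemma H1_iff:
  assumes "A \<in> sets lebesgue"
  shows "H1 A v G \<longleftrightarrow> sq_integrable A v \<and> sq_integrable A G \<and>
     (\<forall>\<phi> j. test_fun A \<phi> \<longrightarrow>
        (LINT x|lebesgue. v x * grad \<phi> x $ j) = - (LINT x|lebesgue. G x $ j * \<phi> x))"
  by (simp add: H1_def is_weak_grad_iff[OF assms])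

lemma W12_iff_H1: "W12 A v \<longleftrightarrow> (\<exists>G. H1 A v G)"
  by (auto simp: W12_def H1_def)

lemma W12_H1_weak_grad: "W12 A v \<Longrightarrow> H1 A v (weak_grad A v)"
  unfolding W12_def H1_def weak_grad_def by (metis someI)

lemma H1_sq_integrable: "H1 A v G \<Longrightarrow> sq_integrable A v" "H1 A v G \<Longrightarrow> sq_integrable A G"
  by (auto simp: H1_def is_weak_grad_def)

lemma H1_mono:
  assumes "H1 A v G" "A \<in> sets lebesgue" "B \<in> sets lebesgue" "B \<subseteq> A"
  shows "H1 B v G"
proof -
  have "sq_integrable A v" "sq_integrable A G" using H1_sq_integrable assms(1) by auto
  then have "sq_integrable B v" "sq_integrable B G" using sq_integrable_mono assms by blast+
  then show ?thesis using assms H1_iff[of A v G] H1_iff[of B v G] test_fun_mono[OF _ assms(4)] by simp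
qed

lemma H1_add:
  assumes "H1 A v G" "H1 A w H" "A \<in> sets lebesgue"
  shows "H1 A (\<lambda>x. v x + w x) (\<lambda>x. G x + H x)"
  unfolding H1_iff[OF assms(3)]
proof (intro conjI allI impI)
  note sq = H1_sq_integrable[OF assms(1)] H1_sq_integrable[OF assms(2)]
  show "sq_integrable A (\<lambda>x. v x + w x)" "sq_integrable A (\<lambda>x. G x + H x)"
    using sq sq_integrable_add by blast+
  fix \<psi> j
  assume \<psi>: "test_fun A \<psi>"
  note i1 = sq(1,3)[THEN integrable_mult_test[OF _ assms(3) test_fun_grad[OF \<psi>, of j]]]
  note i2 = sq(2,4)[THEN sq_integrable_nth, THEN integrable_mult_test[OF _ assms(3) \<psi>], of j]
  show "(LINT x|lebesgue. (v x + w x) * grad \<psi> x $ j) = - (LINT x|lebesgue. (G x + H x) $ j * \<psi> x)"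
    using assms(1,2) \<psi> i1 i2 unfolding H1_iff[OF assms(3)] by (simp add: distrib_right)
qed

lemma H1_cmult:
  assumes "H1 A v G" "A \<in> sets lebesgue"
  shows "H1 A (\<lambda>x. c * v x) (\<lambda>x. c *\<^sub>R G x)"
  using assms(1) sq_integrable_cmult[of A v c] sq_integrable_cmult[of A G c] unfolding H1_iff[OF assms(2)]
  by (simp add: mult.assoc)

lemma H1_diff:
  assumes "H1 A v G" "H1 A w H" "A \<in> sets lebesgue"
  shows "H1 A (\<lambda>x. v x - w x) (\<lambda>x. G x - H x)"
  using H1_add[OF assms(1) H1_cmult[OF assms(2,3), of "-1"] assms(3)] by simp

lemma H1_zero: "A \<in> sets lebesgue \<Longrightarrow> H1 A (\<lambda>x. 0) (\<lambda>x. 0)"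
  by (simp add: H1_iff sq_integrable_def)

lemma H1_sum:
  assumes "finite I" "\<And>i. i \<in> I \<Longrightarrow> H1 A (v i) (G i)" "A \<in> sets lebesgue"
  shows "H1 A (\<lambda>x. \<Sum>i\<in>I. v i x) (\<lambda>x. \<Sum>i\<in>I. G i x)"
  using assms(1,2) by (induction I) (auto intro!: H1_zero H1_add assms(3))

lemma bounded_open_lmeasurable: "bounded A \<Longrightarrow> open A \<Longrightarrow> A \<in> lmeasurable"
  by (simp add: bounded_set_imp_lmeasurable open_lebesgue)

lemma continuous_bounded_on_bounded:
  fixes f :: "real^'n \<Rightarrow> 'b::real_normed_vector"
  assumes "continuous_on UNIV f" "bounded A"
  obtains B where "B > 0" "\<And>x. x \<in> A \<Longrightarrow> norm (f x) \<le> B"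
proof -
  have "compact (closure A)" using assms(2) by simp
  then have "compact (f ` closure A)" using assms(1) continuous_on_subset by (intro compact_continuous_image) blast+
  then obtain B where "B > 0" "\<forall>y\<in>f ` closure A. norm y \<le> B" using bounded_pos compact_imp_bounded by blast
  then show ?thesis using that closure_subset by blast
qed

lemma continuous_measurable_on:
  fixes f :: "real^'n \<Rightarrow> 'b::topological_space"
  shows "continuous_on UNIV f \<Longrightarrow> f \<in> borel_measurable (lebesgue_on A)"
  by (intro measurable_restrict_space1 continuous_measurable_lebesgue)

lemma sq_integrable_continuous:
  fixes f :: "real^'n \<Rightarrow> 'b::euclidean_space"
  assumes "continuous_on UNIV f" "bounded A" "open A"
  shows "sq_integrable A f"
proof -
  obtain B where "B > 0" "\<And>x. x \<in> A \<Longrightarrow> norm (f x) \<le> B" using continuous_bounded_on_bounded assms by blast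
  then show ?thesis
    using sq_integrable_bounded_domain continuous_measurable_on bounded_open_lmeasurable assms by metis
qed

lemma H1_smooth:
  assumes "smooth w" "bounded A" "open A"
  shows "H1 A w (grad w)"
  unfolding H1_iff[OF open_lebesgue[OF assms(3)]]
proof (intro conjI allI impI)
  show "sq_integrable A w" "sq_integrable A (grad w)"
    using assms by (auto intro!: sq_integrable_continuous smooth_continuous smooth_grad_continuous)
  fix \<psi> j
  assume "test_fun A \<psi>"
  then obtain r where "C1_comp r \<psi>" using test_fun_C1_comp by blast
  moreover have "C_diff 1 w" using assms(1) unfolding smooth_def by blast
  ultimately show "(LINT x|lebesgue. w x * grad \<psi> x $ j) = - (LINT x|lebesgue. grad w x $ j * \<psi> x)"
    using integral_by_parts by blast
qed

text \<open>Only the products of \<open>w\<close> and its derivative with \<psi> are asked to be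
  test functions of \<open>A\<close>. This covers both uses: \<psi> a test function of
  \<open>A\<close> and \<open>w\<close> any smooth function, or the other way round when a product
  is extended to the whole space.\<close>

lemma weak_product_rule:
  assumes H: "H1 A v G" and A: "A \<in> sets lebesgue" and w: "smooth w"
    and t: "test_fun A (\<lambda>x. w x * \<psi> x)" "test_fun A (\<lambda>x. grad w x $ j * \<psi> x)" and \<psi>: "smooth \<psi>"
  shows "(LINT x|lebesgue. w x * v x * grad \<psi> x $ j) = - (LINT x|lebesgue. (w x *\<^sub>R G x + v x *\<^sub>R grad w x) $ j * \<psi> x)"
proof -
  note sq = H1_sq_integrable[OF H]
  have g: "grad (\<lambda>x. w x * \<psi> x) x $ j = w x * grad \<psi> x $ j + grad w x $ j * \<psi> x" for x
    by (simp add: grad_mult[OF smooth_differentiable[OF w] smooth_differentiable[OF \<psi>]])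
  have i1: "integrable lebesgue (\<lambda>x. v x * grad (\<lambda>x. w x * \<psi> x) x $ j)"
    by (rule integrable_mult_test[OF sq(1) A test_fun_grad[OF t(1)]])
  have i2: "integrable lebesgue (\<lambda>x. v x * (grad w x $ j * \<psi> x))"
    by (rule integrable_mult_test[OF sq(1) A t(2)])
  have i3: "integrable lebesgue (\<lambda>x. G x $ j * (w x * \<psi> x))"
    by (rule integrable_mult_test[OF sq_integrable_nth[OF sq(2)] A t(1)])
  have "(LINT x|lebesgue. w x * v x * grad \<psi> x $ j)
      = (LINT x|lebesgue. v x * grad (\<lambda>x. w x * \<psi> x) x $ j - v x * (grad w x $ j * \<psi> x))"
    by (intro Bochner_Integration.integral_cong refl) (simp only: g, simp add: algebra_simps)
  also have "\<dots> = (LINT x|lebesgue. v x * grad (\<lambda>x. w x * \<psi> x) x $ j) - (LINT x|lebesgue. v x * (grad w x $ j * \<psi> x))"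
    using i1 i2 by simp
  also have "(LINT x|lebesgue. v x * grad (\<lambda>x. w x * \<psi> x) x $ j) = - (LINT x|lebesgue. G x $ j * (w x * \<psi> x))"
    using H t(1) unfolding H1_iff[OF A] by blast
  also have "- (LINT x|lebesgue. G x $ j * (w x * \<psi> x)) - (LINT x|lebesgue. v x * (grad w x $ j * \<psi> x))
      = - (LINT x|lebesgue. G x $ j * (w x * \<psi> x) + v x * (grad w x $ j * \<psi> x))"
    using i2 i3 by simp
  also have "\<dots> = - (LINT x|lebesgue. (w x *\<^sub>R G x + v x *\<^sub>R grad w x) $ j * \<psi> x)"
    by (intro arg_cong[where f=uminus] Bochner_Integration.integral_cong) (auto simp: algebra_simps)
  finally show ?thesis .
qed

lemma H1_mult_smooth:
  assumes H: "H1 A v G" and A: "bounded A" "open A" and w: "smooth w"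
  shows "H1 A (\<lambda>x. w x * v x) (\<lambda>x. w x *\<^sub>R G x + v x *\<^sub>R grad w x)"
proof -
  have Al: "A \<in> sets lebesgue" using A by (simp add: open_lebesgue)
  note sq = H1_sq_integrable[OF H]
  have wc: "continuous_on UNIV w" "continuous_on UNIV (grad w)" using w smooth_continuous smooth_grad_continuous by auto
  obtain B where B: "\<And>x. x \<in> A \<Longrightarrow> norm (w x) \<le> B" using continuous_bounded_on_bounded[OF wc(1) A(1)] by blast
  obtain B' where B': "\<And>x. x \<in> A \<Longrightarrow> norm (grad w x) \<le> B'" using continuous_bounded_on_bounded[OF wc(2) A(1)] by blast
  have "sq_integrable A (\<lambda>x. w x *\<^sub>R v x)" "sq_integrable A (\<lambda>x. w x *\<^sub>R G x)"
    by (rule sq_integrable_scaleR_bounded[OF _ continuous_measurable_on[OF wc(1)], where B=B]; use sq B in auto)+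
  moreover have "sq_integrable A (\<lambda>x. v x *\<^sub>R grad w x)"
  proof (rule sq_integrable_bound)
    show "(\<lambda>x. v x *\<^sub>R grad w x) \<in> borel_measurable (lebesgue_on A)"
      using sq wc by (intro borel_measurable_scaleR sq_integrable_measurable continuous_measurable_on)
    show "integrable (lebesgue_on A) (\<lambda>x. B'\<^sup>2 * (norm (v x))\<^sup>2)" using sq by (simp add: sq_integrable_def)
    show "(norm (v x *\<^sub>R grad w x))\<^sup>2 \<le> B'\<^sup>2 * (norm (v x))\<^sup>2" if "x \<in> A" for x
      using power_mono[OF B'[OF that], of 2] by (auto simp: power_mult_distrib mult.commute[of "B'\<^sup>2"] intro!: mult_left_mono)
  qed
  moreover have "(LINT x|lebesgue. w x * v x * grad \<psi> x $ j) = - (LINT x|lebesgue. (w x *\<^sub>R G x + v x *\<^sub>R grad w x) $ j * \<psi> x)"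
    if "test_fun A \<psi>" for \<psi> j
    by (rule weak_product_rule[OF H Al w test_fun_mult[OF that w] test_fun_mult[OF that smooth_grad[OF w]] test_fun_smooth[OF that]])
  ultimately show ?thesis unfolding H1_iff[OF Al] by (simp add: sq_integrable_add)
qed

text \<open>Multiplication by a test function of \<open>A\<close> extends to the whole space; no values of \<open>v\<close>, \<open>G\<close>
  outside \<open>A\<close> enter, as \<open>\<theta>\<close> and its gradient vanish there.\<close>

lemma H1_mult_test:
  assumes H: "H1 A v G" and A: "A \<in> sets lebesgue" and \<theta>: "test_fun A \<theta>"
  shows "H1 UNIV (\<lambda>x. \<theta> x * v x) (\<lambda>x. \<theta> x *\<^sub>R G x + v x *\<^sub>R grad \<theta> x)"
proof -
  note sq = H1_sq_integrable[OF H]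
  have sm: "smooth \<theta>" using \<theta> by (rule test_fun_smooth)
  have wc: "continuous_on UNIV \<theta>" "continuous_on UNIV (grad \<theta>)" using sm smooth_continuous smooth_grad_continuous by auto
  obtain r where r: "C1_comp r \<theta>" using \<theta> test_fun_C1_comp by blast
  obtain B where B: "\<And>x. norm (\<theta> x) \<le> B" using bounded_comp_support[OF wc(1) C1_compD(4)[OF r]] by blast
  obtain B' where B': "\<And>x. norm (grad \<theta> x) \<le> B'" using bounded_comp_support[OF wc(2) C1_compD(5)[OF r]] by blast
  obtain K where K: "K \<subseteq> A" "\<And>x. x \<notin> K \<Longrightarrow> \<theta> x = 0" "\<And>x. x \<notin> K \<Longrightarrow> grad \<theta> x = 0"
    using \<theta> test_fun_support by metis
  have z: "\<theta> x = 0" "grad \<theta> x = 0" if "x \<notin> A" for x using K that by auto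
  have "sq_integrable A (\<lambda>x. \<theta> x *\<^sub>R v x)" "sq_integrable A (\<lambda>x. \<theta> x *\<^sub>R G x)"
    by (rule sq_integrable_scaleR_bounded[OF _ continuous_measurable_on[OF wc(1)], where B=B]; use sq B in auto)+
  moreover have "sq_integrable A (\<lambda>x. v x *\<^sub>R grad \<theta> x)"
  proof (rule sq_integrable_bound)
    show "(\<lambda>x. v x *\<^sub>R grad \<theta> x) \<in> borel_measurable (lebesgue_on A)"
      using sq wc by (intro borel_measurable_scaleR sq_integrable_measurable continuous_measurable_on)
    show "integrable (lebesgue_on A) (\<lambda>x. B'\<^sup>2 * (norm (v x))\<^sup>2)" using sq by (simp add: sq_integrable_def)
    show "(norm (v x *\<^sub>R grad \<theta> x))\<^sup>2 \<le> B'\<^sup>2 * (norm (v x))\<^sup>2" if "x \<in> A" for x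
      using power_mono[OF B'[of x], of 2] by (auto simp: power_mult_distrib mult.commute[of "B'\<^sup>2"] intro!: mult_left_mono)
  qed
  ultimately have "sq_integrable A (\<lambda>x. \<theta> x * v x)" "sq_integrable A (\<lambda>x. \<theta> x *\<^sub>R G x + v x *\<^sub>R grad \<theta> x)"
    by (simp_all add: sq_integrable_add)
  then have "sq_integrable UNIV (\<lambda>x. indicator A x *\<^sub>R (\<theta> x * v x))"
    "sq_integrable UNIV (\<lambda>x. indicator A x *\<^sub>R (\<theta> x *\<^sub>R G x + v x *\<^sub>R grad \<theta> x))"
    by (simp_all only: sq_integrable_iff[OF A, symmetric])
  moreover have "(\<lambda>x. indicator A x *\<^sub>R (\<theta> x * v x)) = (\<lambda>x. \<theta> x * v x)"
     "(\<lambda>x. indicator A x *\<^sub>R (\<theta> x *\<^sub>R G x + v x *\<^sub>R grad \<theta> x)) = (\<lambda>x. \<theta> x *\<^sub>R G x + v x *\<^sub>R grad \<theta> x)"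
    using z by (rule_tac [!] ext, case_tac [!] "x \<in> A") simp_all
  ultimately have "sq_integrable UNIV (\<lambda>x. \<theta> x * v x)" "sq_integrable UNIV (\<lambda>x. \<theta> x *\<^sub>R G x + v x *\<^sub>R grad \<theta> x)"
    by (simp_all only:)
  moreover have "(LINT x|lebesgue. \<theta> x * v x * grad \<psi> x $ j) = - (LINT x|lebesgue. (\<theta> x *\<^sub>R G x + v x *\<^sub>R grad \<theta> x) $ j * \<psi> x)"
    if "test_fun UNIV \<psi>" for \<psi> j
  proof (rule weak_product_rule[OF H A sm _ _ test_fun_smooth[OF that]])
    show "test_fun A (\<lambda>x. \<theta> x * \<psi> x)" "test_fun A (\<lambda>x. grad \<theta> x $ j * \<psi> x)"
      using test_fun_mult[OF \<theta> test_fun_smooth[OF that]] test_fun_mult[OF test_fun_grad[OF \<theta>] test_fun_smooth[OF that]]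
      by (simp_all add: mult.commute)
  qed
  ultimately show ?thesis by (subst H1_iff) auto
qed

lemma sq_integrable_affine:
  fixes f :: "real^'n \<Rightarrow> 'b::euclidean_space"
  assumes f: "sq_integrable A f" and A: "A \<in> sets lebesgue" and c: "c > 0"
  shows "sq_integrable {x. c *\<^sub>R x + t \<in> A} (\<lambda>x. f (c *\<^sub>R x + t))"
proof -
  have m: "(\<lambda>x. t + c *\<^sub>R x) \<in> lebesgue \<rightarrow>\<^sub>M lebesgue"
    using similarity_lebesgue(1)[of "\<lambda>x::real^'n. x" c t] c by simp
  have B: "{x. c *\<^sub>R x + t \<in> A} \<in> sets lebesgue"
    using measurable_sets[OF m A] by (simp add: vimage_def add.commute)
  have U: "sq_integrable UNIV (\<lambda>x. indicator A x *\<^sub>R f x)" using f sq_integrable_iff[OF A] by blast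
  then have "(\<lambda>x. indicator A (t + c *\<^sub>R x) *\<^sub>R f (t + c *\<^sub>R x)) \<in> borel_measurable lebesgue"
    using measurable_compose[OF m] by (auto simp: sq_integrable_UNIV)
  moreover have "integrable lebesgue (\<lambda>x. (norm (indicator A (t + c *\<^sub>R x) *\<^sub>R f (t + c *\<^sub>R x)))\<^sup>2)"
    using U integrable_similarity[of "\<lambda>x::real^'n. x" c "\<lambda>x. (norm (indicator A x *\<^sub>R f x))\<^sup>2" t] c
    by (simp add: sq_integrable_def lebesgue_on_UNIV_eq)
  ultimately have "sq_integrable UNIV (\<lambda>x. indicator A (t + c *\<^sub>R x) *\<^sub>R f (t + c *\<^sub>R x))"
    by (simp add: sq_integrable_def lebesgue_on_UNIV_eq)
  then show ?thesis
    unfolding sq_integrable_iff[OF B] by (simp add: indicator_def add.commute)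
qed

lemma H1_affine:
  fixes v :: "real^'n \<Rightarrow> real"
  assumes H: "H1 A v G" and A: "A \<in> sets lebesgue" and c: "c > 0"
  shows "H1 {x. c *\<^sub>R x + t \<in> A} (\<lambda>x. v (c *\<^sub>R x + t)) (\<lambda>x. c *\<^sub>R G (c *\<^sub>R x + t))"
proof -
  note sq = H1_sq_integrable[OF H]
  let ?B = "{x. c *\<^sub>R x + t \<in> A}"
  have m: "(\<lambda>x. t + c *\<^sub>R x) \<in> lebesgue \<rightarrow>\<^sub>M lebesgue"
    using similarity_lebesgue(1)[of "\<lambda>x::real^'n. x" c t] c by simp
  have B: "?B \<in> sets lebesgue"
    using measurable_sets[OF m A] by (simp add: vimage_def add.commute)
  have "sq_integrable ?B (\<lambda>x. v (c *\<^sub>R x + t))" "sq_integrable ?B (\<lambda>x. c *\<^sub>R G (c *\<^sub>R x + t))"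
    by (intro sq_integrable_cmult sq_integrable_affine sq A c)+
  moreover have "(LINT x|lebesgue. v (c *\<^sub>R x + t) * grad \<psi> x $ j) = - (LINT x|lebesgue. (c *\<^sub>R G (c *\<^sub>R x + t)) $ j * \<psi> x)"
    if \<psi>: "test_fun ?B \<psi>" for \<psi> j
  proof -
    \<comment> \<open>The test function is carried back to \<open>A\<close> by the inverse map, so
      that the identity for \<open>v\<close> can be applied and then transformed as a whole.\<close>
    define \<eta> where "\<eta> = (\<lambda>y. \<psi> ((1 / c) *\<^sub>R y + - (1 / c) *\<^sub>R t))"
    have "test_fun {y. (1 / c) *\<^sub>R y + - (1 / c) *\<^sub>R t \<in> ?B} \<eta>"
      unfolding \<eta>_def using \<psi> c by (intro test_fun_affine) auto
    moreover have "{y. (1 / c) *\<^sub>R y + - (1 / c) *\<^sub>R t \<in> ?B} = A"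
      using c by (auto simp: algebra_simps)
    ultimately have t\<eta>: "test_fun A \<eta>" by simp
    have \<eta>1: "\<eta> (t + c *\<^sub>R x) = \<psi> x" for x using c by (simp add: \<eta>_def algebra_simps)
    have \<eta>2: "grad \<eta> (t + c *\<^sub>R x) = (1 / c) *\<^sub>R grad \<psi> x" for x
    proof -
      have "grad \<eta> (t + c *\<^sub>R x) = (1 / c) *\<^sub>R grad \<psi> ((1 / c) *\<^sub>R (t + c *\<^sub>R x) + - (1 / c) *\<^sub>R t)"
        unfolding \<eta>_def by (rule grad_affine) (rule smooth_differentiable[OF test_fun_smooth[OF \<psi>]])
      then show ?thesis using c by (simp add: algebra_simps)
    qed
    have i1: "integrable lebesgue (\<lambda>y. v y * grad \<eta> y $ j)"
      by (rule integrable_mult_test[OF sq(1) A test_fun_grad[OF t\<eta>]])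
    have i2: "integrable lebesgue (\<lambda>y. G y $ j * \<eta> y)"
      by (rule integrable_mult_test[OF sq_integrable_nth[OF sq(2)] A t\<eta>])
    have e1: "(LINT y|lebesgue. v y * grad \<eta> y $ j) = c ^ CARD('n) * (LINT x|lebesgue. v (t + c *\<^sub>R x) * ((1 / c) * grad \<psi> x $ j))"
      using integral_similarity[of "\<lambda>x. x" c "\<lambda>y. v y * grad \<eta> y $ j" t] i1 c by (simp add: \<eta>2)
    have e2: "(LINT y|lebesgue. G y $ j * \<eta> y) = c ^ CARD('n) * (LINT x|lebesgue. G (t + c *\<^sub>R x) $ j * \<psi> x)"
      using integral_similarity[of "\<lambda>x. x" c "\<lambda>y. G y $ j * \<eta> y" t] i2 c by (simp add: \<eta>1)
    have "(LINT y|lebesgue. v y * grad \<eta> y $ j) = - (LINT y|lebesgue. G y $ j * \<eta> y)"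
      using H t\<eta> unfolding H1_iff[OF A] by blast
    then have "(LINT x|lebesgue. v (t + c *\<^sub>R x) * grad \<psi> x $ j) = - c * (LINT x|lebesgue. G (t + c *\<^sub>R x) $ j * \<psi> x)"
    proof -
      assume "(LINT y|lebesgue. v y * grad \<eta> y $ j) = - (LINT y|lebesgue. G y $ j * \<eta> y)"
      then have "c ^ CARD('n) * (LINT x|lebesgue. v (t + c *\<^sub>R x) * grad \<psi> x $ j)
        = c ^ CARD('n) * (- c * (LINT x|lebesgue. G (t + c *\<^sub>R x) $ j * \<psi> x))"
        unfolding e1 e2 using c by (simp add: field_simps)
      then show ?thesis using c by (subst (asm) mult_left_cancel) auto
    qed
    then show ?thesis by (simp add: add.commute mult.assoc)
  qed
  ultimately show ?thesis unfolding H1_iff[OF B] by blast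
qed

section \<open>Uniqueness of weak gradients and cutoff functions\<close>

context mollifier
begin

lemma scale_moll_test_at:
  assumes "d > 0"
  shows "test_fun (ball x d) (\<lambda>y. scale_moll d \<phi> (x - y))"
proof -
  have "test_fun {y. (-1) *\<^sub>R y + x \<in> ball 0 d} (\<lambda>y. scale_moll d \<phi> ((-1) *\<^sub>R y + x))"
    by (intro test_fun_affine test_fun_scale_moll[OF test assms]) auto
  moreover have "{y. (-1) *\<^sub>R y + x \<in> ball 0 d} = ball x d"
    by (auto simp: dist_norm norm_minus_commute)
  moreover have "(\<lambda>y. scale_moll d \<phi> ((-1) *\<^sub>R y + x)) = (\<lambda>y. scale_moll d \<phi> (x - y))" by simp
  ultimately show ?thesis by simp
qed

lemma scale_moll_zero: "d > 0 \<Longrightarrow> norm x \<ge> d \<Longrightarrow> scale_moll d \<phi> x = 0"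
  using zero[of "(1/d) *\<^sub>R x"] by (simp add: scale_moll_def)

lemma moll_1: "d > 0 \<Longrightarrow> moll (\<lambda>x. 1) (scale_moll d \<phi>) x = 1"
  by (simp add: moll_scale_moll borel integral_lebesgue)

lemma scale_moll_nonneg: "d > 0 \<Longrightarrow> scale_moll d \<phi> x \<ge> 0"
  by (simp add: scale_moll_def nonneg)

lemma smooth_moll_scale: "loc_integrable f \<Longrightarrow> d > 0 \<Longrightarrow> smooth (moll f (scale_moll d \<phi>))"
  using smooth_moll test_fun_scale_moll[OF test] by blast

lemma moll_local:
  assumes "d > 0" "\<And>y. dist x y < d \<Longrightarrow> f y = g y"
  shows "moll f (scale_moll d \<phi>) x = moll g (scale_moll d \<phi>) x"
  unfolding moll_def
proof (intro Bochner_Integration.integral_cong refl)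
  fix y
  show "f y * scale_moll d \<phi> (x - y) = g y * scale_moll d \<phi> (x - y)"
    using assms scale_moll_zero[of d "x - y"] by (cases "dist x y < d") (auto simp: dist_norm)
qed

text \<open>At a point further than the kernel radius from the complement of \<open>A\<close>, a
  mollification of \<open>h\<close> is an integral against a test function and so vanishes. The
  mollifications converge in L2, and Fatou's lemma makes the lower limit of the squared errors zero
  almost everywhere; there it equals the square of \<open>h\<close>.\<close>

lemma fundamental_lemma:
  fixes h :: "real^'n \<Rightarrow> real"
  assumes A: "A \<in> sets lebesgue" "open A" and h: "sq_integrable A h"
    and 0: "\<And>\<psi>. test_fun A \<psi> \<Longrightarrow> (LINT x|lebesgue. h x * \<psi> x) = 0"
  shows "AE x in lebesgue_on A. h x = 0"
proof -
  have *: "AE x in lebesgue. cball x (1 / Suc n) \<subseteq> A \<and> norm x \<le> n \<longrightarrow> h x = 0" for n :: nat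
  proof -
    \<comment> \<open>The cutoff gives a function of bounded support in L2 of the whole space that
      agrees with \<open>h\<close> near every \<open>x\<close> considered, because the kernels have
      radius below one.\<close>
    define S where "S = A \<inter> cball 0 (real n + 2)"
    have S: "S \<in> sets lebesgue" unfolding S_def using A by (intro sets.Int cball_lebesgue) auto
    define f where "f = (\<lambda>x. indicator S x *\<^sub>R h x)"
    have "sq_integrable S h" by (rule sq_integrable_mono[OF h A(1) S]) (simp add: S_def)
    then have "sq_integrable UNIV f" using sq_integrable_iff[OF S, of h] by (simp add: f_def)
    then have f: "f \<in> borel_measurable lebesgue" and fin: "(\<integral>\<^sup>+ x. ennreal ((f x)\<^sup>2) \<partial>lebesgue) < \<infinity>"
      by (simp_all add: sq_integrable_UNIV)
    have li: "loc_integrable f" using f fin by (rule loc_integrable_L2)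
    have supp: "f x = 0" if "norm x > real n + 2" for x using that by (simp add: f_def S_def)
    define d where "d k = 1 / real (Suc (Suc (n + k)))" for k
    have d: "d k > 0" "d k < 1 / Suc n" for k by (auto simp: d_def field_simps)
    have d0: "d \<longlonglongrightarrow> 0"
      unfolding d_def by (rule LIMSEQ_offset[where k=0]) real_asymp
    define u where "u k x = ennreal ((moll f (scale_moll (d k) \<phi>) x - f x)\<^sup>2)" for k x
    have [measurable]: "u k \<in> borel_measurable lebesgue" for k
      using f continuous_measurable_lebesgue[OF smooth_continuous[OF smooth_moll_scale[OF li d(1)[of k]]]]
      unfolding u_def by measurable
    have "(\<integral>\<^sup>+ x. liminf (\<lambda>k. u k x) \<partial>lebesgue) \<le> liminf (\<lambda>k. \<integral>\<^sup>+ x. u k x \<partial>lebesgue)"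
      by (rule nn_integral_liminf) measurable
    also have "\<dots> = 0"
      using lim_imp_Liminf[OF _ moll_L2_tendsto[OF f fin supp d(1) d0]] by (simp add: u_def)
    finally have "AE x in lebesgue. liminf (\<lambda>k. u k x) = 0"
      by (subst (asm) le_zero_eq, subst (asm) nn_integral_0_iff_AE) auto
    then show ?thesis
    proof eventually_elim
      case (elim x)
      show ?case
      proof (intro impI, elim conjE)
        assume x: "cball x (1 / Suc n) \<subseteq> A" "norm x \<le> n"
        have "moll f (scale_moll (d k) \<phi>) x = 0" for k
        proof -
          have sub: "ball x (d k) \<subseteq> A" using x(1) d(2)[of k] by (force simp: subset_iff)
          have "moll f (scale_moll (d k) \<phi>) x = moll h (scale_moll (d k) \<phi>) x"
          proof (rule moll_local[OF d(1)])
            fix y assume y: "dist x y < d k"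
            have "d k < 1" by (simp add: d_def)
            then have "norm y \<le> n + 2" using y x(2) norm_triangle_ineq2[of y x] by (simp add: dist_norm norm_minus_commute)
            moreover have "y \<in> A" using sub y by auto
            ultimately show "f y = h y" by (simp add: f_def S_def)
          qed
          also have "\<dots> = 0"
            unfolding moll_def by (intro 0 test_fun_mono[OF scale_moll_test_at[OF d(1)] sub])
          finally show ?thesis .
        qed
        then have "liminf (\<lambda>k. u k x) = ennreal ((f x)\<^sup>2)" by (simp add: u_def Liminf_const)
        then have "f x = 0" using elim by (simp add: ennreal_eq_0_iff)
        moreover have "x \<in> A" using x(1) by (auto simp: subset_iff)
        ultimately show "h x = 0" using x(2) by (auto simp: f_def S_def)
      qed
    qed
  qed
  have "AE x in lebesgue. \<forall>n::nat. cball x (1 / Suc n) \<subseteq> A \<and> norm x \<le> n \<longrightarrow> h x = 0"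
    using * by (subst AE_all_countable) blast
  then have "AE x in lebesgue. x \<in> A \<longrightarrow> h x = 0"
  proof eventually_elim
    case (elim x)
    show ?case
    proof
      assume "x \<in> A"
      then obtain e where e: "e > 0" "cball x e \<subseteq> A" using A(2) open_contains_cball by blast
      obtain N :: nat where N: "1 / e < N" "norm x < N" by (meson reals_Archimedean2 max_less_iff_conj)
      have "1 / real (Suc N) \<le> e" using N e by (simp add: field_simps)
      then have "cball x (1 / real (Suc N)) \<subseteq> A" using e by (meson order_trans subset_cball)
      then show "h x = 0" using elim N by (meson less_imp_le)
    qed
  qed
  then show ?thesis using A by (subst AE_restrict_space_iff) auto
qed

lemma H1_unique:
  fixes v :: "real^'n \<Rightarrow> real"
  assumes "open A" "H1 A v G" "H1 A v G'"
  shows "AE x in lebesgue_on A. G x = G' x"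
proof -
  have A: "A \<in> sets lebesgue" using assms(1) by (rule open_lebesgue)
  note H = H1_diff[OF assms(2,3) A]
  have "AE x in lebesgue_on A. (G x - G' x) $ j = 0" for j
  proof (rule fundamental_lemma[OF A assms(1) sq_integrable_nth[OF H1_sq_integrable(2)[OF H]]])
    fix \<psi> :: "real^'n \<Rightarrow> real" assume "test_fun A \<psi>"
    then show "(LINT x|lebesgue. (G x - G' x) $ j * \<psi> x) = 0"
      using H unfolding H1_iff[OF A] by simp
  qed
  then have "AE x in lebesgue_on A. \<forall>j. (G x - G' x) $ j = 0"
    by (subst AE_all_countable) blast
  then show ?thesis by eventually_elim (simp add: vec_eq_iff)
qed

lemma weak_grad_AE:
  fixes v :: "real^'n \<Rightarrow> real"
  assumes "open A" "H1 A v G"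
  shows "AE x in lebesgue_on A. weak_grad A v x = G x"
  using H1_unique[OF assms(1) W12_H1_weak_grad assms(2)] assms(2) W12_iff_H1 by blast

text \<open>If the closed \<open>e\<close>-neighbourhood of \<open>K\<close> lies in
  \<open>A\<close>, the indicator of the \<open>e/2\<close>-neighbourhood is mollified at scale
  \<open>e/4\<close>: the result is one on the \<open>e/4\<close>-neighbourhood \<open>N\<close> and
  zero off the \<open>e\<close>-neighbourhood. Being constant on an open set around
  \<open>K\<close>, it also has zero gradient there.\<close>

lemma ex_cutoff:
  fixes K :: "(real^'n) set"
  assumes "compact K" "open A" "K \<subseteq> A"
  obtains \<theta> N where "test_fun A \<theta>" "\<And>x. 0 \<le> \<theta> x" "\<And>x. \<theta> x \<le> 1" "open N" "K \<subseteq> N" "\<And>x. x \<in> N \<Longrightarrow> \<theta> x = 1"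
proof -
  obtain e where e: "e > 0" "(\<Union>x\<in>K. cball x e) \<subseteq> A"
    using compact_subset_open_imp_cball_epsilon_subset[OF assms] by blast
  define E where "E = (\<Union>x\<in>K. cball x (e/2))"
  define N where "N = (\<Union>x\<in>K. ball x (e/4))"
  define \<theta> where "\<theta> = moll (indicator E) (scale_moll (e/4) \<phi>)"
  have cE: "compact E" unfolding E_def by (rule compact_minkowski_sum_cball[OF assms(1)])
  have cA: "compact (\<Union>x\<in>K. cball x e)" by (rule compact_minkowski_sum_cball[OF assms(1)])
  have [measurable]: "E \<in> sets lebesgue" using cE by (simp add: borel_compact)
  have li: "loc_integrable (indicator E)" by (rule loc_integrable_bounded[of _ 1]) (auto split: split_indicator)
  have e4: "e / 4 > 0" using e by simp
  have sm: "smooth \<theta>" unfolding \<theta>_def by (rule smooth_moll_scale[OF li e4])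
  have C: "continuous_on UNIV (scale_moll (e/4) \<phi>)" "\<And>x. norm x > e/4 \<Longrightarrow> scale_moll (e/4) \<phi> x = 0"
    using C1_compD[OF test_fun_ball_C1_comp[OF test_fun_scale_moll[OF test e4]]] by blast+
  have 1: "\<theta> x = 1" if x: "x \<in> N" for x
  proof -
    obtain k where k: "k \<in> K" "dist k x < e/4" using x by (auto simp: N_def)
    have "\<theta> x = moll (\<lambda>x. 1) (scale_moll (e/4) \<phi>) x"
      unfolding \<theta>_def
    proof (rule moll_local[OF e4])
      fix y assume "dist x y < e/4"
      then have "dist k y \<le> e/2" using k dist_triangle[of k y x] by linarith
      then show "indicator E y = (1::real)" using k by (auto simp: E_def indicator_def)
    qed
    then show ?thesis using moll_1[OF e4] by simp
  qed
  have 0: "\<theta> x = 0" if "x \<notin> (\<Union>x\<in>K. cball x e)" for x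
  proof -
    have "\<theta> x = moll (\<lambda>x. 0) (scale_moll (e/4) \<phi>) x"
      unfolding \<theta>_def
    proof (rule moll_local[OF e4])
      fix y assume y: "dist x y < e/4"
      have "y \<notin> E"
      proof
        assume "y \<in> E"
        then obtain k where "k \<in> K" "dist k y \<le> e/2" by (auto simp: E_def)
        then have "dist k x \<le> e" using y dist_triangle[of k x y] e by (simp add: dist_commute)
        then show False using that \<open>k \<in> K\<close> by auto
      qed
      then show "indicator E y = (0::real)" by simp
    qed
    then show ?thesis by (simp add: moll_def)
  qed
  have nn: "0 \<le> \<theta> x" for x
    unfolding \<theta>_def moll_def by (intro integral_nonneg_AE AE_I2 mult_nonneg_nonneg scale_moll_nonneg e4) auto
  have le: "\<theta> x \<le> 1" for x
  proof -
    have "\<theta> x \<le> moll (\<lambda>x. 1) (scale_moll (e/4) \<phi>) x"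
      unfolding \<theta>_def moll_def
      by (intro integral_mono moll_integrable[OF li C(1), where r="e/4"] moll_integrable[OF loc_integrable_bounded[of _ 1] C(1), where r="e/4"] C(2)
          mult_right_mono scale_moll_nonneg e4) (auto split: split_indicator)
    then show ?thesis using moll_1[OF e4] by simp
  qed
  have "test_fun A \<theta>" by (rule test_funI[OF sm cA e(2) 0])
  moreover have "open N" "K \<subseteq> N" using e by (auto simp: N_def)
  ultimately show ?thesis using that nn le 1 by blast
qed

end

text \<open>Replaces Hoelder's inequality in limits: \<open>x y \<le> a x\<^sup>2 + y\<^sup>2 / a\<close> with \<open>a\<close> small.\<close>

lemma ennreal_tendsto_0_by_Young:
  fixes u s :: "nat \<Rightarrow> ennreal"
  assumes "\<And>a k. a > 0 \<Longrightarrow> u k \<le> ennreal a * M + ennreal (1 / a) * s k" and M: "M < \<infinity>" and s: "s \<longlonglongrightarrow> 0"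
  shows "u \<longlonglongrightarrow> 0"
proof (rule order_tendstoI)
  fix e :: ennreal assume "0 < e"
  then obtain e0 where "0 < e0" "e0 < e" using dense by blast
  then obtain e' where e': "e' > 0" "ennreal e' < e" by (cases e0) auto
  obtain m where m: "M = ennreal m" "m \<ge> 0" using M by (cases M) auto
  define a where "a = e' / (2 * (m + 1))"
  have a: "a > 0" using e' m by (simp add: a_def)
  have am: "a * m \<le> e' / 2" using e' m by (simp add: a_def field_simps)
  have "eventually (\<lambda>k. s k < ennreal (a * e' / 2)) sequentially"
    using s a e' by (intro order_tendstoD) auto
  then show "eventually (\<lambda>k. u k < e) sequentially"
  proof eventually_elim
    case (elim k)
    have "u k \<le> ennreal a * M + ennreal (1 / a) * s k" by (rule assms(1)[OF a])
    also have "\<dots> \<le> ennreal a * M + ennreal (1 / a) * ennreal (a * e' / 2)"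
      using elim by (intro add_mono mult_left_mono) auto
    also have "\<dots> = ennreal (a * m + e' / 2)"
      using a e' m by (simp add: ennreal_mult'[symmetric] ennreal_plus[symmetric] del: ennreal_plus)
    also have "\<dots> \<le> ennreal e'" using am by (intro ennreal_leI) simp
    finally show ?case using e' by simp
  qed
qed simp

lemma Young_ennreal:
  assumes "a > 0"
  shows "ennreal \<bar>x * y\<bar> \<le> ennreal a * ennreal (x\<^sup>2) + ennreal (1 / a) * ennreal (y\<^sup>2)"
proof -
  have "0 \<le> (a * \<bar>x\<bar> - \<bar>y\<bar>)\<^sup>2" by simp
  then have "2 * a * (\<bar>x\<bar> * \<bar>y\<bar>) \<le> a\<^sup>2 * x\<^sup>2 + y\<^sup>2"
    by (simp add: power2_eq_square algebra_simps abs_mult_self_eq)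
  moreover have "0 \<le> a * (\<bar>x\<bar> * \<bar>y\<bar>)" using assms by simp
  ultimately have "a * (\<bar>x\<bar> * \<bar>y\<bar>) \<le> a\<^sup>2 * x\<^sup>2 + y\<^sup>2" by linarith
  then have "\<bar>x * y\<bar> \<le> a * x\<^sup>2 + 1 / a * y\<^sup>2"
    using assms by (simp add: abs_mult field_simps power2_eq_square)
  then show ?thesis using assms by (simp add: ennreal_mult'[symmetric] ennreal_plus[symmetric] ennreal_leI del: ennreal_plus)
qed

lemma nn_integral_mult_tendsto_0:
  fixes f d :: "_ \<Rightarrow> real" and g :: "nat \<Rightarrow> _ \<Rightarrow> real"
  assumes [measurable]: "f \<in> borel_measurable M" "\<And>k. g k \<in> borel_measurable M"
    and f: "(\<integral>\<^sup>+ x. ennreal ((f x)\<^sup>2) \<partial>M) < \<infinity>"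
    and g: "(\<lambda>k. \<integral>\<^sup>+ x. ennreal ((g k x)\<^sup>2) \<partial>M) \<longlonglongrightarrow> 0"
  shows "(\<lambda>k. \<integral>\<^sup>+ x. ennreal \<bar>f x * g k x\<bar> \<partial>M) \<longlonglongrightarrow> 0"
proof (rule ennreal_tendsto_0_by_Young[OF _ f g])
  fix a :: real and k assume a: "a > 0"
  have "(\<integral>\<^sup>+ x. ennreal \<bar>f x * g k x\<bar> \<partial>M) \<le> (\<integral>\<^sup>+ x. ennreal a * ennreal ((f x)\<^sup>2) + ennreal (1 / a) * ennreal ((g k x)\<^sup>2) \<partial>M)"
    by (intro nn_integral_mono Young_ennreal a)
  also have "\<dots> = ennreal a * (\<integral>\<^sup>+ x. ennreal ((f x)\<^sup>2) \<partial>M) + ennreal (1 / a) * (\<integral>\<^sup>+ x. ennreal ((g k x)\<^sup>2) \<partial>M)"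
    by (simp add: nn_integral_add nn_integral_cmult)
  finally show "(\<integral>\<^sup>+ x. ennreal \<bar>f x * g k x\<bar> \<partial>M) \<le> ennreal a * (\<integral>\<^sup>+ x. ennreal ((f x)\<^sup>2) \<partial>M) + ennreal (1 / a) * (\<integral>\<^sup>+ x. ennreal ((g k x)\<^sup>2) \<partial>M)" .
qed

lemma tendsto_subseq_0: "u \<longlonglongrightarrow> (0::ennreal) \<Longrightarrow> strict_mono r \<Longrightarrow> (\<lambda>k. u (r k)) \<longlonglongrightarrow> 0"
  using LIMSEQ_subseq_LIMSEQ[of u 0 r] by (simp add: o_def)

lemma borel_measurable_vec:
  fixes u :: "'a \<Rightarrow> ('b::euclidean_space)^'m"
  assumes "\<And>i. (\<lambda>x. u x $ i) \<in> borel_measurable M"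
  shows "u \<in> borel_measurable M"
proof (subst borel_measurable_euclidean_space, intro ballI)
  fix b :: "'b^'m" assume "b \<in> Basis"
  then obtain i k where "b = axis i k" by (auto simp: Basis_vec_def)
  then show "(\<lambda>x. u x \<bullet> b) \<in> borel_measurable M" using assms[of i] by (simp add: inner_axis)
qed

lemma sq_integrable_sum:
  assumes "finite I" "\<And>i. i \<in> I \<Longrightarrow> sq_integrable A (f i)"
  shows "sq_integrable A (\<lambda>x. \<Sum>i\<in>I. f i x)"
  using assms
proof (induction I)
  case empty
  then show ?case by (simp add: sq_integrable_def)
qed (auto intro: sq_integrable_add)

lemma C_diff_1I:
  fixes f :: "real^'n \<Rightarrow> real"
  assumes "\<And>x. (f has_derivative (\<lambda>h. g x \<bullet> h)) (at x)" "\<And>j. continuous_on UNIV (\<lambda>x. g x $ j)"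
  shows "C_diff 1 f"
  using assms grad_eqI[OF assms(1)] by (auto simp: differentiable_on_def differentiable_def)

section \<open>Approximation by smooth functions and the chain rule\<close>

context mollifier
begin

text \<open>The kernel centred at \<open>x\<close> is itself a test function, so the derivative on
  the kernel moves to \<open>u\<close> by definition of the weak gradient: the gradient of the
  mollification is the mollification of \<open>G\<close>. Both limits are then L2 convergence of
  mollifications.\<close>

lemma H1_moll:
  assumes H: "H1 UNIV u G" and supp: "\<And>x. norm x > r \<Longrightarrow> u x = 0" "\<And>x. norm x > r \<Longrightarrow> G x = 0"
    and d: "\<And>k. d k > 0" and d0: "d \<longlonglongrightarrow> 0"
  defines "w \<equiv> \<lambda>k. moll u (scale_moll (d k) \<phi>)"
  shows "smooth (w k)"
    "(\<lambda>k. \<integral>\<^sup>+ x. ennreal ((w k x - u x)\<^sup>2) \<partial>lebesgue) \<longlonglongrightarrow> 0"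
    "(\<lambda>k. \<integral>\<^sup>+ x. ennreal ((grad (w k) x $ j - G x $ j)\<^sup>2) \<partial>lebesgue) \<longlonglongrightarrow> 0"
proof -
  note sq = H1_sq_integrable(1)[OF H] sq_integrable_nth[OF H1_sq_integrable(2)[OF H]]
  have m: "u \<in> borel_measurable lebesgue" "(\<integral>\<^sup>+ x. ennreal ((u x)\<^sup>2) \<partial>lebesgue) < \<infinity>"
    "(\<lambda>x. G x $ j) \<in> borel_measurable lebesgue" "(\<integral>\<^sup>+ x. ennreal ((G x $ j)\<^sup>2) \<partial>lebesgue) < \<infinity>" for j
    using sq by (simp_all add: sq_integrable_UNIV)
  have li: "loc_integrable u" by (rule loc_integrable_L2[OF m(1,2)])
  show "smooth (w k)" for k unfolding w_def by (rule smooth_moll_scale[OF li d])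
  have gr: "grad (w k) x $ j = moll (\<lambda>y. G y $ j) (scale_moll (d k) \<phi>) x" for j k x
  proof -
    note t = scale_moll_test_at[OF d[of k], of x]
    have C: "C1_comp (d k) (scale_moll (d k) \<phi>)" by (rule test_fun_ball_C1_comp[OF test_fun_scale_moll[OF test d]])
    have g: "grad (\<lambda>y. scale_moll (d k) \<phi> (x - y)) y = - grad (scale_moll (d k) \<phi>) (x - y)" for y
      using grad_affine[of "scale_moll (d k) \<phi>" "-1" y x] C1_compD(1)[OF C] by simp
    have "grad (w k) x $ j = (LINT y|lebesgue. u y * grad (scale_moll (d k) \<phi>) (x - y) $ j)"
      unfolding w_def using grad_moll[OF li C] by (simp add: moll_def)
    also have "\<dots> = - (LINT y|lebesgue. u y * grad (\<lambda>y. scale_moll (d k) \<phi> (x - y)) y $ j)"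
      unfolding g by simp
    also have "\<dots> = (LINT y|lebesgue. G y $ j * scale_moll (d k) \<phi> (x - y))"
      using H test_fun_mono[OF t, of UNIV] by (subst (asm) H1_iff) auto
    finally show ?thesis by (simp add: moll_def)
  qed
  show "(\<lambda>k. \<integral>\<^sup>+ x. ennreal ((grad (w k) x $ j - G x $ j)\<^sup>2) \<partial>lebesgue) \<longlonglongrightarrow> 0" for j
    unfolding gr by (rule moll_L2_tendsto[OF m(3,4) _ d d0, of r]) (simp add: supp)
  show "(\<lambda>k. \<integral>\<^sup>+ x. ennreal ((w k x - u x)\<^sup>2) \<partial>lebesgue) \<longlonglongrightarrow> 0"
    unfolding w_def by (rule moll_L2_tendsto[OF m(1,2) _ d d0, of r]) (simp add: supp)
qed

text \<open>A single subsequence must serve all components. It is extracted from the sum of the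
  squared errors, which tends to zero in L1.\<close>

lemma H1_approximation:
  fixes u :: "'m::finite \<Rightarrow> real^'n \<Rightarrow> real"
  assumes H: "\<And>i. H1 UNIV (u i) (G i)" and supp: "\<And>i x. norm x > r \<Longrightarrow> u i x = 0" "\<And>i x. norm x > r \<Longrightarrow> G i x = 0"
  obtains w where "\<And>i k. smooth (w i k)"
    "\<And>i j. (\<lambda>k. \<integral>\<^sup>+ x. ennreal ((grad (w i k) x $ j - G i x $ j)\<^sup>2) \<partial>lebesgue) \<longlonglongrightarrow> 0"
    "AE x in lebesgue. \<forall>i. (\<lambda>k. w i k x) \<longlonglongrightarrow> u i x"
proof -
  define d where "d k = 1 / real (Suc k)" for k
  have d: "d k > 0" for k by (simp add: d_def)
  have d0: "d \<longlonglongrightarrow> 0" unfolding d_def by real_asymp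
  define w where "w i k = moll (u i) (scale_moll (d k) \<phi>)" for i k
  have m: "u i \<in> borel_measurable lebesgue" for i
    using H1_sq_integrable(1)[OF H] by (simp add: sq_integrable_UNIV)
  have sm: "smooth (w i k)"
    and L2: "(\<lambda>k. \<integral>\<^sup>+ x. ennreal ((w i k x - u i x)\<^sup>2) \<partial>lebesgue) \<longlonglongrightarrow> 0"
    and L2g: "(\<lambda>k. \<integral>\<^sup>+ x. ennreal ((grad (w i k) x $ j - G i x $ j)\<^sup>2) \<partial>lebesgue) \<longlonglongrightarrow> 0" for i j k
    unfolding w_def by (rule H1_moll[OF H supp d d0]; assumption)+
  have wm[measurable]: "w i k \<in> borel_measurable lebesgue" for i k
    by (intro continuous_measurable_lebesgue smooth_continuous sm)
  note m[measurable]
  define S where "S k x = (\<Sum>i\<in>UNIV. (w i k x - u i x)\<^sup>2)" for k x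
  have Snn: "S k x \<ge> 0" for k x by (simp add: S_def sum_nonneg)
  have Sm[measurable]: "S k \<in> borel_measurable lebesgue" for k unfolding S_def by measurable
  have SL: "(\<lambda>k. \<integral>\<^sup>+ x. ennreal (S k x) \<partial>lebesgue) \<longlonglongrightarrow> 0"
  proof -
    have "(\<integral>\<^sup>+ x. ennreal (S k x) \<partial>lebesgue) = (\<Sum>i\<in>UNIV. \<integral>\<^sup>+ x. ennreal ((w i k x - u i x)\<^sup>2) \<partial>lebesgue)" for k
      unfolding S_def by (subst nn_integral_sum[symmetric]) (auto simp: sum_ennreal)
    then show ?thesis using tendsto_sum[of UNIV, OF L2] by simp
  qed
  \<comment> \<open>Only from some index on is the error known to be integrable, hence the shift by
    \<open>k0\<close> before a subsequence is taken.\<close>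
  have "eventually (\<lambda>k. (\<integral>\<^sup>+ x. ennreal (S k x) \<partial>lebesgue) < 1) sequentially"
    using SL by (rule order_tendstoD) simp
  then obtain k0 where k0: "\<And>k. k \<ge> k0 \<Longrightarrow> (\<integral>\<^sup>+ x. ennreal (S k x) \<partial>lebesgue) < 1"
    unfolding eventually_sequentially by blast
  have int: "integrable lebesgue (S (k + k0))" for k
    using k0[of "k + k0"] Snn by (intro integrableI_bounded) (auto simp: less_top[symmetric] intro: order.strict_trans)
  have "(\<lambda>k. LINT x|lebesgue. norm (S (k + k0) x)) \<longlonglongrightarrow> 0"
  proof -
    have "(LINT x|lebesgue. norm (S (k + k0) x)) = enn2real (\<integral>\<^sup>+ x. ennreal (S (k + k0) x) \<partial>lebesgue)" for k
      using Snn by (subst integral_eq_nn_integral) auto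
    moreover have "(\<lambda>k. enn2real (\<integral>\<^sup>+ x. ennreal (S (k + k0) x) \<partial>lebesgue)) \<longlonglongrightarrow> enn2real 0"
      using LIMSEQ_ignore_initial_segment[OF SL, of k0] by (intro tendsto_enn2real) auto
    ultimately show ?thesis by simp
  qed
  then obtain q where q: "strict_mono q" "AE x in lebesgue. (\<lambda>k. S (q k + k0) x) \<longlonglongrightarrow> 0"
    using tendsto_L1_AE_subseq[of lebesgue "\<lambda>k. S (k + k0)"] int by blast
  let ?w = "\<lambda>i k. w i (q k + k0)"
  have sub: "(\<lambda>k. v (q k + k0)) \<longlonglongrightarrow> 0" if "v \<longlonglongrightarrow> 0" for v :: "nat \<Rightarrow> ennreal"
    using tendsto_subseq_0[OF LIMSEQ_ignore_initial_segment[OF that] q(1)] .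
  show ?thesis
  proof (rule that[of ?w])
    show "smooth (?w i k)" for i k by (rule sm)
    show "(\<lambda>k. \<integral>\<^sup>+ x. ennreal ((grad (?w i k) x $ j - G i x $ j)\<^sup>2) \<partial>lebesgue) \<longlonglongrightarrow> 0" for i j
      by (rule sub[OF L2g])
    show "AE x in lebesgue. \<forall>i. (\<lambda>k. ?w i k x) \<longlonglongrightarrow> u i x"
      using q(2)
    proof eventually_elim
      case (elim x)
      show ?case
      proof
        fix i
        have "(?w i k x - u i x)\<^sup>2 \<le> S (q k + k0) x" for k
          unfolding S_def by (rule member_le_sum) auto
        then have "(\<lambda>k. (?w i k x - u i x)\<^sup>2) \<longlonglongrightarrow> 0"
          using elim by (intro tendsto_sandwich[OF _ _ tendsto_const elim]) auto
        from tendsto_real_sqrt[OF this] have "(\<lambda>k. \<bar>?w i k x - u i x\<bar>) \<longlonglongrightarrow> 0"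
          by simp
        then show "(\<lambda>k. ?w i k x) \<longlonglongrightarrow> u i x"
          by (simp add: tendsto_rabs_zero_iff LIM_zero_iff)
      qed
    qed
  qed
qed

text \<open>A cutoff equal to one near the support of the test function reduces to compactly
  supported \<open>Uv\<close>, approximated by smooth \<open>W k\<close>, for which the identity is
  classical. Almost everywhere convergence passes to the limit in the bounded continuous factors, L2
  convergence in the gradients. Boundedness of \<psi> makes the composition square integrable on the
  bounded set \<open>A\<close>.\<close>

lemma H1_chain:
  fixes u :: "real^'n \<Rightarrow> real^'m" and G :: "real^'n \<Rightarrow> real^'n^'m" and \<psi> :: "real^'m \<Rightarrow> real"
  assumes A: "open A" "bounded A" and H: "\<And>i. H1 A (\<lambda>x. u x $ i) (\<lambda>x. G x $ i)"
    and d\<psi>: "\<And>y. (\<psi> has_derivative (\<lambda>h. d\<psi> y \<bullet> h)) (at y)" and dc: "continuous_on UNIV d\<psi>"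
    and B: "\<And>y. \<bar>\<psi> y\<bar> \<le> B" and L: "\<And>y. norm (d\<psi> y) \<le> L"
  shows "H1 A (\<lambda>x. \<psi> (u x)) (\<lambda>x. \<Sum>i\<in>UNIV. (d\<psi> (u x) $ i) *\<^sub>R (G x $ i))"
proof -
  have Al: "A \<in> sets lebesgue" using A by (simp add: open_lebesgue)
  have Alm: "A \<in> lmeasurable" using A by (simp add: bounded_open_lmeasurable)
  note sq = H1_sq_integrable[OF H]
  have \<psi>c: "continuous_on UNIV \<psi>" by (intro continuous_at_imp_continuous_on ballI has_derivative_continuous[OF d\<psi>])
  have dci: "continuous_on UNIV (\<lambda>y. d\<psi> y $ i)" for i using dc by (intro continuous_intros)
  have Li: "\<bar>d\<psi> y $ i\<bar> \<le> L" for y i using L[of y] component_le_norm_cart[of "d\<psi> y" i] by linarith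
  have um: "u \<in> borel_measurable (lebesgue_on A)"
    using sq by (intro borel_measurable_vec sq_integrable_measurable)
  have "sq_integrable A (\<lambda>x. \<psi> (u x))"
    using measurable_compose[OF um borel_measurable_continuous_onI[OF \<psi>c]] B
    by (intro sq_integrable_bounded_domain[OF _ Alm]) auto
  moreover have "sq_integrable A (\<lambda>x. \<Sum>i\<in>UNIV. (d\<psi> (u x) $ i) *\<^sub>R (G x $ i))"
    using measurable_compose[OF um borel_measurable_continuous_onI[OF dci]] Li sq
    by (intro sq_integrable_sum sq_integrable_scaleR_bounded[where B=L]) auto
  moreover have "(LINT x|lebesgue. \<psi> (u x) * grad \<eta> x $ j)
      = - (LINT x|lebesgue. (\<Sum>i\<in>UNIV. (d\<psi> (u x) $ i) *\<^sub>R (G x $ i)) $ j * \<eta> x)" if \<eta>: "test_fun A \<eta>" for \<eta> j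
  proof -
    obtain K where K: "compact K" "K \<subseteq> A" "\<And>x. x \<notin> K \<Longrightarrow> \<eta> x = 0" "\<And>x. x \<notin> K \<Longrightarrow> grad \<eta> x = 0"
      using test_fun_support[OF \<eta>] by metis
    obtain \<theta> N where \<theta>: "test_fun A \<theta>" "open N" "K \<subseteq> N" "\<And>x. x \<in> N \<Longrightarrow> \<theta> x = 1"
      using ex_cutoff[OF K(1) A(1) K(2)] by metis
    have \<theta>g: "grad \<theta> x = 0" if "x \<in> N" for x by (rule grad_0_open[OF \<theta>(2) that \<theta>(4)])
    obtain r where r: "C1_comp r \<theta>" using test_fun_C1_comp[OF \<theta>(1)] by blast
    define U where "U i x = \<theta> x * u x $ i" for i x
    define V where "V i x = \<theta> x *\<^sub>R G x $ i + u x $ i *\<^sub>R grad \<theta> x" for i x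
    have HU: "H1 UNIV (U i) (V i)" for i unfolding U_def V_def by (rule H1_mult_test[OF H Al \<theta>(1)])
    obtain w where w: "\<And>i k. smooth (w i k)"
      "\<And>i j. (\<lambda>k. \<integral>\<^sup>+ x. ennreal ((grad (w i k) x $ j - V i x $ j)\<^sup>2) \<partial>lebesgue) \<longlonglongrightarrow> 0"
      "AE x in lebesgue. \<forall>i. (\<lambda>k. w i k x) \<longlonglongrightarrow> U i x"
      by (rule H1_approximation[of U V r, OF HU]) (use C1_compD(4,5)[OF r] in \<open>auto simp: U_def V_def\<close>)
    define W where "W k x = (\<chi> i. w i k x)" for k x
    define Uv where "Uv x = (\<chi> i. U i x)" for x
    have Wc: "continuous_on UNIV (W k)" for k
      unfolding W_def by (intro continuous_on_vec_lambda smooth_continuous w)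
    have WA: "AE x in lebesgue. (\<lambda>k. W k x) \<longlonglongrightarrow> Uv x"
      using w(3) by eventually_elim (simp add: W_def Uv_def vec_tendstoI)
    have UvK: "Uv x = u x" if "x \<in> K" for x
      using \<theta>(4)[of x] \<theta>(3) that by (auto simp: Uv_def U_def vec_eq_iff)
    have VK: "V i x = G x $ i" if "x \<in> K" for x i
      using \<theta>(4)[of x] \<theta>g[of x] \<theta>(3) that by (auto simp: V_def)
    note sqU = H1_sq_integrable[OF HU]
    have Um: "U i \<in> borel_measurable lebesgue" "(\<lambda>x. V i x $ j) \<in> borel_measurable lebesgue" for i j
      using sqU(1)[of i] sq_integrable_nth[OF sqU(2)[of i], of j] by (simp_all add: sq_integrable_UNIV)
    have Uvm: "Uv \<in> borel_measurable lebesgue"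
      by (rule borel_measurable_vec) (simp add: Uv_def Um)
    have \<eta>c: "continuous_on UNIV \<eta>" "continuous_on UNIV (\<lambda>x. grad \<eta> x $ j)"
      using \<eta> test_fun_smooth smooth_continuous smooth_grad by blast+
    have \<eta>m[measurable]: "\<eta> \<in> borel_measurable lebesgue" "(\<lambda>x. grad \<eta> x $ j) \<in> borel_measurable lebesgue"
      using \<eta>c by (auto intro: continuous_measurable_lebesgue)
    have \<psi>W[measurable]: "(\<lambda>x. \<psi> (W k x)) \<in> borel_measurable lebesgue" "(\<lambda>x. d\<psi> (W k x) $ i) \<in> borel_measurable lebesgue" for k i
      by (intro continuous_measurable_lebesgue continuous_on_compose2[OF \<psi>c Wc] continuous_on_compose2[OF dci Wc]; simp)+
    have \<psi>U[measurable]: "(\<lambda>x. \<psi> (Uv x)) \<in> borel_measurable lebesgue" "(\<lambda>x. d\<psi> (Uv x) $ i) \<in> borel_measurable lebesgue" for i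
      by (intro measurable_compose[OF Uvm borel_measurable_continuous_onI] \<psi>c dci)+
    have gm[measurable]: "(\<lambda>x. grad (w i k) x $ j) \<in> borel_measurable lebesgue" for i k
      by (intro continuous_measurable_lebesgue smooth_continuous smooth_grad w)
    note [measurable] = Um
    have sqUN: "sq_integrable UNIV (\<lambda>x. 1 * \<eta> x)" "sq_integrable UNIV (\<lambda>x. V i x $ j)" for i
    proof -
      have "integrable lebesgue (\<lambda>x. \<eta> x * \<eta> x)"
        by (rule integrable_mult_test[OF sq_integrable_continuous Al \<eta>]) (use \<eta>c A in auto)
      then show "sq_integrable UNIV (\<lambda>x. 1 * \<eta> x)"
        by (simp add: sq_integrable_def lebesgue_on_UNIV_eq power2_eq_square)
      show "sq_integrable UNIV (\<lambda>x. V i x $ j)" by (rule sq_integrable_nth[OF sqU(2)])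
    qed
    have \<eta>t: "test_fun UNIV \<eta>" using \<eta> test_fun_mono by blast
    have gt: "test_fun UNIV (\<lambda>x. grad \<eta> x $ j)" by (rule test_fun_grad[OF \<eta>t])
    have V\<eta>: "integrable lebesgue (\<lambda>x. V i x $ j * \<eta> x)" for i
      by (rule integrable_mult_test[OF sqUN(2) _ \<eta>t]) simp
    have gi: "integrable lebesgue (\<lambda>x. 1 * grad \<eta> x $ j)"
      by (rule integrable_mult_test[OF _ Al test_fun_grad[OF \<eta>]]) (intro sq_integrable_continuous continuous_intros A)
    have lim1: "(\<lambda>k. LINT x|lebesgue. \<psi> (W k x) * grad \<eta> x $ j) \<longlonglongrightarrow> (LINT x|lebesgue. \<psi> (Uv x) * grad \<eta> x $ j)"
    proof (rule integral_dominated_convergence[where w="\<lambda>x. B * \<bar>grad \<eta> x $ j\<bar>"])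
      show "integrable lebesgue (\<lambda>x. B * \<bar>grad \<eta> x $ j\<bar>)" using gi by (intro integrable_mult_right integrable_abs) simp
      show "AE x in lebesgue. (\<lambda>k. \<psi> (W k x) * grad \<eta> x $ j) \<longlonglongrightarrow> \<psi> (Uv x) * grad \<eta> x $ j"
        using WA by eventually_elim (intro tendsto_intros continuous_on_tendsto_compose[OF \<psi>c], auto)
      show "AE x in lebesgue. norm (\<psi> (W k x) * grad \<eta> x $ j) \<le> B * \<bar>grad \<eta> x $ j\<bar>" for k
        using B by (auto simp: abs_mult intro!: mult_right_mono)
    qed measurable
    have lim2: "(\<lambda>k. LINT x|lebesgue. d\<psi> (W k x) $ i * grad (w i k) x $ j * \<eta> x) \<longlonglongrightarrow> (LINT x|lebesgue. d\<psi> (Uv x) $ i * V i x $ j * \<eta> x)"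
      and int2: "integrable lebesgue (\<lambda>x. d\<psi> (W k x) $ i * grad (w i k) x $ j * \<eta> x)"
      and int3: "integrable lebesgue (\<lambda>x. d\<psi> (Uv x) $ i * V i x $ j * \<eta> x)" for i k
    proof -
      have I1: "integrable lebesgue (\<lambda>x. grad (w i k) x $ j * \<eta> x)" for k
        by (rule integrable_mult_test[OF sq_integrable_continuous Al \<eta>]) (use A smooth_continuous[OF smooth_grad[OF w(1)]] in auto)
      have *: "integrable lebesgue (\<lambda>x. b x * c x * \<eta> x)" if "integrable lebesgue (\<lambda>x. c x * \<eta> x)"
        and [measurable]: "b \<in> borel_measurable lebesgue" "c \<in> borel_measurable lebesgue" and "\<And>x. \<bar>b x\<bar> \<le> L" for b c
        by (rule Bochner_Integration.integrable_bound[OF integrable_mult_right[OF that(1), of L]])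
          (use that(4) in \<open>auto simp: abs_mult mult.assoc intro!: mult_mono AE_I2 order_trans[OF that(4)]\<close>)
      show i2: "integrable lebesgue (\<lambda>x. d\<psi> (W k x) $ i * grad (w i k) x $ j * \<eta> x)" for k
        by (rule *[OF I1]) (auto intro: Li)
      show i3: "integrable lebesgue (\<lambda>x. d\<psi> (Uv x) $ i * V i x $ j * \<eta> x)"
        by (rule *[OF V\<eta>]) (auto intro: Li)
      have i4: "integrable lebesgue (\<lambda>x. d\<psi> (W k x) $ i * V i x $ j * \<eta> x)" for k
        by (rule *[OF V\<eta>]) (auto intro: Li)
      have l1: "(\<lambda>k. LINT x|lebesgue. d\<psi> (W k x) $ i * V i x $ j * \<eta> x) \<longlonglongrightarrow> (LINT x|lebesgue. d\<psi> (Uv x) $ i * V i x $ j * \<eta> x)"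
      proof (rule integral_dominated_convergence[where w="\<lambda>x. L * \<bar>V i x $ j * \<eta> x\<bar>"])
        show "integrable lebesgue (\<lambda>x. L * \<bar>V i x $ j * \<eta> x\<bar>)" using V\<eta> by (intro integrable_mult_right integrable_abs)
        show "AE x in lebesgue. (\<lambda>k. d\<psi> (W k x) $ i * V i x $ j * \<eta> x) \<longlonglongrightarrow> d\<psi> (Uv x) $ i * V i x $ j * \<eta> x"
          using WA by eventually_elim (intro tendsto_intros continuous_on_tendsto_compose[OF dci], auto)
        show "AE x in lebesgue. norm (d\<psi> (W k x) $ i * V i x $ j * \<eta> x) \<le> L * \<bar>V i x $ j * \<eta> x\<bar>" for k
          using Li by (auto simp: abs_mult mult.assoc intro!: mult_right_mono)
      qed measurable
      \<comment> \<open>The coefficients converge only almost everywhere, so here they are estimated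
        by \<open>L\<close>; what tends to zero is the gradient error paired with a fixed L2
        function.\<close>
      have l2: "(\<lambda>k. LINT x|lebesgue. d\<psi> (W k x) $ i * (grad (w i k) x $ j - V i x $ j) * \<eta> x) \<longlonglongrightarrow> (LINT x|lebesgue. 0 * \<eta> x)"
      proof (rule tendsto_L1_int)
        show "integrable lebesgue (\<lambda>x. d\<psi> (W k x) $ i * (grad (w i k) x $ j - V i x $ j) * \<eta> x)" for k
          using Bochner_Integration.integrable_diff[OF i2 i4] by (simp add: algebra_simps)
        have "(\<lambda>k. \<integral>\<^sup>+ x. ennreal \<bar>(L * \<eta> x) * (grad (w i k) x $ j - V i x $ j)\<bar> \<partial>lebesgue) \<longlonglongrightarrow> 0"
        proof (rule nn_integral_mult_tendsto_0[OF _ _ _ w(2)])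
          have "sq_integrable UNIV (\<lambda>x. L *\<^sub>R \<eta> x)" using sqUN(1) by (intro sq_integrable_cmult) simp
          then show "(\<integral>\<^sup>+ x. ennreal ((L * \<eta> x)\<^sup>2) \<partial>lebesgue) < \<infinity>" by (simp add: sq_integrable_UNIV)
        qed measurable
        then show "(\<lambda>k. \<integral>\<^sup>+ x. norm (d\<psi> (W k x) $ i * (grad (w i k) x $ j - V i x $ j) * \<eta> x - 0 * \<eta> x) \<partial>lebesgue) \<longlonglongrightarrow> 0"
        proof (rule tendsto_sandwich[OF _ _ tendsto_const, rotated 2])
          show "eventually (\<lambda>k. (\<integral>\<^sup>+ x. norm (d\<psi> (W k x) $ i * (grad (w i k) x $ j - V i x $ j) * \<eta> x - 0 * \<eta> x) \<partial>lebesgue)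
            \<le> (\<integral>\<^sup>+ x. ennreal \<bar>(L * \<eta> x) * (grad (w i k) x $ j - V i x $ j)\<bar> \<partial>lebesgue)) sequentially"
          proof (intro always_eventually allI nn_integral_mono ennreal_leI)
            fix k x
            have "\<bar>d\<psi> (W k x) $ i\<bar> * \<bar>(grad (w i k) x $ j - V i x $ j) * \<eta> x\<bar> \<le> \<bar>L\<bar> * \<bar>(grad (w i k) x $ j - V i x $ j) * \<eta> x\<bar>"
              using Li[of "W k x" i] by (intro mult_right_mono) auto
            then show "norm (d\<psi> (W k x) $ i * (grad (w i k) x $ j - V i x $ j) * \<eta> x - 0 * \<eta> x) \<le> \<bar>(L * \<eta> x) * (grad (w i k) x $ j - V i x $ j)\<bar>"
              by (simp add: abs_mult mult_ac)
          qed
        qed simp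
      qed simp
      have "(LINT x|lebesgue. d\<psi> (W k x) $ i * grad (w i k) x $ j * \<eta> x)
         = (LINT x|lebesgue. d\<psi> (W k x) $ i * V i x $ j * \<eta> x) + (LINT x|lebesgue. d\<psi> (W k x) $ i * (grad (w i k) x $ j - V i x $ j) * \<eta> x)" for k
        using i2 i4 by (subst Bochner_Integration.integral_add[symmetric])
          (auto simp: algebra_simps intro: Bochner_Integration.integrable_diff)
      then show "(\<lambda>k. LINT x|lebesgue. d\<psi> (W k x) $ i * grad (w i k) x $ j * \<eta> x) \<longlonglongrightarrow> (LINT x|lebesgue. d\<psi> (Uv x) $ i * V i x $ j * \<eta> x)"
        using tendsto_add[OF l1 l2] by simp
    qed
    have dW: "((\<lambda>x. \<psi> (W k x)) has_derivative (\<lambda>h. (\<Sum>i\<in>UNIV. (d\<psi> (W k x) $ i) *\<^sub>R grad (w i k) x) \<bullet> h)) (at x)" for k x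
    proof -
      have "(W k has_derivative (\<lambda>h. \<chi> i. grad (w i k) x \<bullet> h)) (at x)"
      proof -
        have "((\<lambda>x. W k x $ i) has_derivative (\<lambda>h. (\<chi> i. grad (w i k) x \<bullet> h) $ i)) (at x)" for i
          using has_derivative_grad[OF smooth_differentiable[OF w(1)]] by (simp add: W_def)
        then show ?thesis
          by (subst has_derivative_componentwise_within) (auto simp: Basis_vec_def inner_axis)
      qed
      from has_derivative_compose[OF this d\<psi>]
      show ?thesis by (simp add: inner_vec_def[of "d\<psi> _"] inner_sum_left)
    qed
    have "C_diff 1 (\<lambda>x. \<psi> (W k x))" for k
      by (rule C_diff_1I[OF dW], unfold sum_component vector_scaleR_component,
          intro continuous_intros continuous_on_compose2[OF dci Wc] smooth_continuous[OF smooth_grad[OF w(1)]]) simp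
    note Cd = this
    obtain r' where r': "C1_comp r' \<eta>" using test_fun_C1_comp[OF \<eta>] by blast
    have "(LINT x|lebesgue. \<psi> (W k x) * grad \<eta> x $ j) = - (LINT x|lebesgue. (\<Sum>i\<in>UNIV. (d\<psi> (W k x) $ i) *\<^sub>R grad (w i k) x) $ j * \<eta> x)" for k
      using integral_by_parts[OF Cd r', of k j] by (simp only: grad_eqI[OF dW])
    also have "\<dots> k = - (\<Sum>i\<in>UNIV. LINT x|lebesgue. d\<psi> (W k x) $ i * grad (w i k) x $ j * \<eta> x)" for k
      using int2 by (simp add: sum_distrib_right)
    finally have eq: "(LINT x|lebesgue. \<psi> (W k x) * grad \<eta> x $ j) = - (\<Sum>i\<in>UNIV. LINT x|lebesgue. d\<psi> (W k x) $ i * grad (w i k) x $ j * \<eta> x)" for k .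
    have "(\<lambda>k. LINT x|lebesgue. \<psi> (W k x) * grad \<eta> x $ j) \<longlonglongrightarrow> - (\<Sum>i\<in>UNIV. LINT x|lebesgue. d\<psi> (Uv x) $ i * V i x $ j * \<eta> x)"
      unfolding eq by (intro tendsto_intros lim2)
    then have "(LINT x|lebesgue. \<psi> (Uv x) * grad \<eta> x $ j) = - (\<Sum>i\<in>UNIV. LINT x|lebesgue. d\<psi> (Uv x) $ i * V i x $ j * \<eta> x)"
      by (rule LIMSEQ_unique[OF lim1])
    also have "\<dots> = - (LINT x|lebesgue. (\<Sum>i\<in>UNIV. (d\<psi> (Uv x) $ i) *\<^sub>R V i x) $ j * \<eta> x)"
      using int3 by (simp add: sum_distrib_right)
    finally have "(LINT x|lebesgue. \<psi> (Uv x) * grad \<eta> x $ j) = - (LINT x|lebesgue. (\<Sum>i\<in>UNIV. (d\<psi> (Uv x) $ i) *\<^sub>R V i x) $ j * \<eta> x)" .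
    moreover have "(\<lambda>x. \<psi> (Uv x) * grad \<eta> x $ j) = (\<lambda>x. \<psi> (u x) * grad \<eta> x $ j)"
    proof
      fix x show "\<psi> (Uv x) * grad \<eta> x $ j = \<psi> (u x) * grad \<eta> x $ j"
        using UvK[of x] K(4)[of x] by (cases "x \<in> K") simp_all
    qed
    moreover have "(\<lambda>x. (\<Sum>i\<in>UNIV. (d\<psi> (Uv x) $ i) *\<^sub>R V i x) $ j * \<eta> x) = (\<lambda>x. (\<Sum>i\<in>UNIV. (d\<psi> (u x) $ i) *\<^sub>R (G x $ i)) $ j * \<eta> x)"
    proof
      fix x show "(\<Sum>i\<in>UNIV. (d\<psi> (Uv x) $ i) *\<^sub>R V i x) $ j * \<eta> x = (\<Sum>i\<in>UNIV. (d\<psi> (u x) $ i) *\<^sub>R (G x $ i)) $ j * \<eta> x"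
        using UvK[of x] VK[of x] K(3)[of x] by (cases "x \<in> K") simp_all
    qed
    ultimately show ?thesis by (simp only:)
  qed
  ultimately show ?thesis unfolding H1_iff[OF Al] by blast
qed

end

section \<open>Cubes and traces\<close>

lemma unit_cube_eq_box: "(unit_cube :: (real^'n) set) = box (\<chi> j. -1/2) (\<chi> j. 1/2)"
proof -
  have "\<bar>x\<bar> < 1/2 \<longleftrightarrow> -1/2 < x \<and> x < 1/2" for x :: real by auto
  then show ?thesis unfolding unit_cube_def set_eq_iff mem_Collect_eq mem_box_cart vec_lambda_beta by simp
qed

lemma mem_unit_cube: "(y :: real^'n) \<in> unit_cube \<longleftrightarrow> (\<forall>j. -1/2 < y $ j \<and> y $ j < 1/2)"
  by (simp add: unit_cube_eq_box mem_box_cart)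

lemma open_unit_cube: "open (unit_cube :: (real^'n) set)"
  by (simp add: unit_cube_eq_box open_box)

lemma bounded_unit_cube: "bounded (unit_cube :: (real^'n) set)"
  by (simp add: unit_cube_eq_box bounded_box)

lemma unit_cube_lebesgue: "(unit_cube :: (real^'n) set) \<in> sets lebesgue"
  by (simp add: open_lebesgue open_unit_cube)

lemma emeasure_unit_cube: "emeasure lebesgue (unit_cube :: (real^'n) set) = 1"
proof -
  have "emeasure lborel (unit_cube :: (real^'n) set) = ennreal (\<Prod>b\<in>Basis. ((\<chi> j. 1/2) - (\<chi> j. -1/2) :: real^'n) \<bullet> b)"
    unfolding unit_cube_eq_box by (rule emeasure_lborel_box) (auto simp: Basis_vec_def inner_axis)
  also have "(\<Prod>b\<in>Basis. ((\<chi> j. 1/2) - (\<chi> j. -1/2) :: real^'n) \<bullet> b) = (\<Prod>b\<in>(Basis :: (real^'n) set). 1)"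
    by (intro prod.cong) (auto simp: Basis_vec_def inner_axis)
  finally show ?thesis by (simp add: borel_open open_unit_cube)
qed

lemma orthogonal_frame_inner:
  assumes "orthogonal_transformation R"
  shows "R y \<bullet> R (axis j 1) = y $ j"
  using assms by (simp add: orthogonal_transformation_def inner_axis)

lemma mem_cube:
  assumes R: "orthogonal_transformation R" and r: "r > 0"
  shows "x \<in> cube R r \<longleftrightarrow> (\<forall>j. \<bar>x \<bullet> R (axis j 1)\<bar> < r / 2)"
proof
  assume "x \<in> cube R r"
  then obtain y where y: "y \<in> unit_cube" "x = r *\<^sub>R R y" by (auto simp: cube_def)
  have "\<bar>x \<bullet> R (axis j 1)\<bar> < r / 2" for j
  proof -
    have "\<bar>y $ j\<bar> < 1 / 2" using y by (simp add: unit_cube_def)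
    then have "r * \<bar>y $ j\<bar> < r * (1 / 2)" using r by (intro mult_strict_left_mono)
    then show ?thesis using y r by (simp add: orthogonal_frame_inner[OF R] abs_mult)
  qed
  then show "\<forall>j. \<bar>x \<bullet> R (axis j 1)\<bar> < r / 2" ..
next
  assume a: "\<forall>j. \<bar>x \<bullet> R (axis j 1)\<bar> < r / 2"
  obtain y where y: "x = R y" using orthogonal_transformation_surj[OF R] by (metis surjD)
  have "x = r *\<^sub>R R ((1 / r) *\<^sub>R y)"
    using r y by (simp add: orthogonal_transformation_scaleR[OF R])
  moreover have "(1 / r) *\<^sub>R y \<in> unit_cube"
    using a r by (auto simp: unit_cube_def y orthogonal_frame_inner[OF R] abs_mult field_simps)
  ultimately show "x \<in> cube R r" unfolding cube_def by blast
qed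

lemma open_cube:
  assumes R: "orthogonal_transformation R" and r: "r > 0"
  shows "open (cube R r)"
proof -
  have "cube R r = (\<Inter>j. {x. \<bar>x \<bullet> R (axis j 1)\<bar> < r / 2})" using mem_cube[OF assms] by auto
  moreover have "open {x. \<bar>x \<bullet> R (axis j 1)\<bar> < r / 2}" for j
    by (intro open_Collect_less continuous_intros)
  ultimately show ?thesis by auto
qed

lemma bounded_cube:
  assumes R: "orthogonal_transformation R"
  shows "bounded (cube R r)"
proof -
  obtain B where B: "\<And>y :: real^'a. y \<in> unit_cube \<Longrightarrow> norm y \<le> B" using bounded_unit_cube bounded_iff by metis
  have "norm x \<le> \<bar>r\<bar> * B" if "x \<in> cube R r" for x
    using that B by (auto simp: cube_def orthogonal_transformation_norm[OF R] intro!: mult_left_mono)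
  then show ?thesis by (auto simp: bounded_iff)
qed

lemma cube_lebesgue: "orthogonal_transformation R \<Longrightarrow> r > 0 \<Longrightarrow> cube R r \<in> sets lebesgue"
  by (simp add: open_lebesgue open_cube)

lemma indicator_cube_scaleR:
  assumes R: "orthogonal_transformation R" and r: "r > 0"
  shows "indicator (cube R r) (r *\<^sub>R R y) = indicator unit_cube y"
  using r by (simp add: indicator_def mem_cube[OF R r] orthogonal_frame_inner[OF R] unit_cube_def abs_mult field_simps)

text \<open>The substitution stretches the \<open>i\<close>-th coordinate by \<open>t\<close> and
  shifts it by \<open>c\<close>, leaving the others alone. With small \<open>t\<close> it relates a
  thin box at a face to the whole unit cube.\<close>

lemma integral_affine_coordinate:
  fixes f :: "real^'n \<Rightarrow> real"
  assumes [measurable]: "f \<in> borel_measurable lebesgue" and t: "t > 0"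
  shows "(LINT x|lebesgue. f x) = t * (LINT x|lebesgue. f (x + ((t - 1) * x $ i + c) *\<^sub>R axis i 1))"
proof -
  let ?a = "axis i 1 :: real^'n"
  define k where "k j = (if j = ?a then t else 1)" for j
  define T where "T x = c *\<^sub>R ?a + (\<Sum>j\<in>Basis. (k j * (x \<bullet> j)) *\<^sub>R j)" for x
  have T: "T x = x + ((t - 1) * x $ i + c) *\<^sub>R ?a" for x
  proof (rule euclidean_eqI)
    fix b :: "real^'n" assume b: "b \<in> Basis"
    then obtain m where m: "b = axis m 1" by (auto simp: Basis_vec_def)
    have "T x \<bullet> b = c * (?a \<bullet> b) + k b * (x \<bullet> b)" using b by (simp add: T_def inner_add_left)
    then show "T x \<bullet> b = (x + ((t - 1) * x $ i + c) *\<^sub>R ?a) \<bullet> b"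
      by (auto simp: m inner_add_left inner_axis_axis inner_axis k_def axis_eq_axis algebra_simps)
        (simp_all add: axis_def)
  qed
  have k0: "\<forall>j\<in>Basis. k j \<noteq> 0" using t by (auto simp: k_def)
  have pr: "(\<Prod>j\<in>Basis. \<bar>k j\<bar>) = t"
  proof -
    have "(\<Prod>j\<in>Basis. \<bar>k j\<bar>) = (\<Prod>j\<in>Basis. if j = ?a then t else 1)" using t by (intro prod.cong) (auto simp: k_def)
    also have "\<dots> = t" by (subst prod.delta) (auto simp: Basis_vec_def)
    finally show ?thesis .
  qed
  note L = lebesgue_affine_euclidean[of k "c *\<^sub>R ?a", OF bspec[OF k0], folded T_def]
  have [measurable]: "T \<in> lebesgue \<rightarrow>\<^sub>M lebesgue"
    using lebesgue_affine_measurable[of k "c *\<^sub>R ?a", OF bspec[OF k0]] unfolding T_def by simp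
  have "(LINT x|lebesgue. f x) = (LINT x|density (distr lebesgue lebesgue T) (\<lambda>_. ennreal t). f x)"
    using L pr by simp
  also have "\<dots> = t * (LINT x|lebesgue. f (T x))"
    using t by (subst integral_density) (auto simp: integral_distr)
  finally show ?thesis by (simp add: T)
qed

section \<open>Divergence theorem on a cube and traces\<close>

definition face_proj :: "'n::finite \<Rightarrow> real \<Rightarrow> real^'n \<Rightarrow> real^'n" where
  "face_proj i c y = (\<chi> j. if j = i then c else y $ j)"

lemma continuous_face_proj: "continuous_on UNIV (face_proj i c)"
  unfolding face_proj_def
proof (rule continuous_on_vec_lambda)
  fix j show "continuous_on UNIV (\<lambda>y. if j = i then c else y $ j)"
    by (cases "j = i") (auto intro: continuous_intros)
qed

text \<open>Both sides are the derivative at \<open>t = 0\<close> of the integral of \<open>g\<close> over the unit cube shifted by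
  \<open>t\<close> in the \<open>i\<close>-th direction: for the right-hand side, the difference of the integrals over the
  shifted and the original cube is that over two thin boxes next to the faces.\<close>

lemma unit_cube_divergence:
  fixes g :: "real^'n \<Rightarrow> real"
  assumes g: "C1_comp r g"
  shows "(LINT y|lebesgue. indicator unit_cube y * grad g y $ i)
    = (LINT y|lebesgue. indicator unit_cube y * (g (face_proj i (1/2) y) - g (face_proj i (-1/2) y)))"
proof -
  note C = C1_compD[OF g]
  let ?e = "axis i 1 :: real^'n"
  let ?ind = "\<lambda>y. indicator (unit_cube :: (real^'n) set) y :: real"
  have [measurable]: "(unit_cube :: (real^'n) set) \<in> sets lebesgue" by (rule unit_cube_lebesgue)
  have gm[measurable]: "g \<in> borel_measurable lebesgue" using C by (intro continuous_measurable_lebesgue)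
  obtain B where B: "\<And>x. \<bar>g x\<bar> \<le> B" using bounded_comp_support[of g r] C(2,4) by (metis real_norm_def)
  have iu: "integrable lebesgue ?ind"     by (intro integrable_real_indicator unit_cube_lebesgue) (simp add: emeasure_unit_cube del: emeasure_completion)
  have bi: "integrable lebesgue (\<lambda>y. ?ind y * f y)" if [measurable]: "f \<in> borel_measurable lebesgue" and "\<And>y. \<bar>f y\<bar> \<le> D" for f D
    by (rule Bochner_Integration.integrable_bound[OF integrable_mult_right[OF iu, of D]])
      (use order_trans[OF that(2) abs_ge_self] in \<open>auto simp: indicator_def\<close>)
  define t where "t k = 1 / real (k + 2)" for k
  have t: "0 < t k" "t k < 1" for k by (auto simp: t_def)
  have t0: "t \<longlonglongrightarrow> 0" unfolding t_def by real_asymp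
  define D where "D k = (LINT y|lebesgue. ?ind y * ((g (y + t k *\<^sub>R ?e) - g y) / t k))" for k
  have shift: "(\<lambda>y. g (y + t k *\<^sub>R ?e)) \<in> borel_measurable lebesgue" for k
    by (intro continuous_measurable_lebesgue continuous_on_compose2[OF C(2)] continuous_intros) auto
  have gj: "(\<lambda>y. grad g y $ i) \<in> borel_measurable lebesgue"
    using C by (intro continuous_measurable_lebesgue continuous_intros)
  obtain B' where B': "\<And>x. norm (grad g x) \<le> B'" using bounded_comp_support[of "grad g" r] C(3,5) by metis
  have gjb: "\<bar>grad g y $ i\<bar> \<le> B'" for y using component_le_norm_cart[of "grad g y" i] B'[of y] by linarith
  have lim1: "D \<longlonglongrightarrow> (LINT y|lebesgue. ?ind y * grad g y $ i)"
  proof (rule LIMSEQ_I)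
    fix e :: real assume e: "e > 0"
    obtain d where d: "d > 0" "\<And>x h. norm h < d \<Longrightarrow> \<bar>g (x + h) - g x - grad g x \<bullet> h\<bar> \<le> (e/2) * norm h"
      using C1_comp_uniform_derivative[OF g, of "e/2"] e by auto
    have "eventually (\<lambda>k. t k < d) sequentially" using t0 d(1) by (intro order_tendstoD) auto
    then obtain N where N: "\<And>k. k \<ge> N \<Longrightarrow> t k < d" by (auto simp: eventually_sequentially)
    have "norm (D k - (LINT y|lebesgue. ?ind y * grad g y $ i)) < e" if "k \<ge> N" for k
    proof -
      have i1: "integrable lebesgue (\<lambda>y. ?ind y * ((g (y + t k *\<^sub>R ?e) - g y) / t k))"
      proof (rule bi)
        show "\<bar>(g (y + t k *\<^sub>R ?e) - g y) / t k\<bar> \<le> 2 * B / t k" for y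
          using B[of y] B[of "y + t k *\<^sub>R ?e"] t[of k] by (auto simp: abs_divide intro!: divide_right_mono)
      qed (use shift gm in \<open>intro borel_measurable_divide borel_measurable_diff\<close>, auto)
      have i2: "integrable lebesgue (\<lambda>y. ?ind y * grad g y $ i)" by (rule bi[OF gj gjb])
      have "D k - (LINT y|lebesgue. ?ind y * grad g y $ i) = (LINT y|lebesgue. ?ind y * ((g (y + t k *\<^sub>R ?e) - g y) / t k) - ?ind y * grad g y $ i)"
        unfolding D_def using i1 i2 by simp
      then have "norm (D k - (LINT y|lebesgue. ?ind y * grad g y $ i)) \<le> (LINT y|lebesgue. norm (?ind y * ((g (y + t k *\<^sub>R ?e) - g y) / t k) - ?ind y * grad g y $ i))"
        by (simp only: integral_norm_bound)
      also have "\<dots> \<le> (LINT y|lebesgue. ?ind y * (e / 2))"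
      proof (rule integral_mono)
        fix y
        have "\<bar>g (y + t k *\<^sub>R ?e) - g y - t k * grad g y $ i\<bar> \<le> (e/2) * t k"
          using d(2)[of "t k *\<^sub>R ?e" y] N[OF that] t[of k] by (simp add: inner_axis)
        then have "\<bar>(g (y + t k *\<^sub>R ?e) - g y - t k * grad g y $ i) / t k\<bar> \<le> e / 2"
          using t[of k] by (simp add: abs_divide divide_le_eq)
        then show "norm (?ind y * ((g (y + t k *\<^sub>R ?e) - g y) / t k) - ?ind y * grad g y $ i) \<le> ?ind y * (e / 2)"
          using t[of k] by (simp add: indicator_def diff_divide_distrib)
      qed (use i1 i2 iu in auto)
      also have "\<dots> = e / 2" using emeasure_unit_cube[where 'n='n] unit_cube_lebesgue[where 'n='n] by (simp add: measure_def)
      finally show ?thesis using e by simp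
    qed
    then show "\<exists>no. \<forall>k\<ge>no. norm (D k - (LINT y|lebesgue. ?ind y * grad g y $ i)) < e" by blast
  qed
  \<comment> \<open>\<open>P c k\<close> maps the unit cube onto the box in which the
    \<open>i\<close>-th coordinate runs from \<open>c\<close> to \<open>c + t k\<close>. As
    \<open>t k\<close> tends to zero it collapses to the projection onto the hyperplane at height
    \<open>c\<close>.\<close>
  define P where "P c k y = y + ((t k - 1) * y $ i + (c + t k / 2)) *\<^sub>R ?e" for c k and y :: "real^'n"
  have Pc: "continuous_on UNIV (P c k)" for c k unfolding P_def by (intro continuous_intros)
  have gP: "(\<lambda>y. g (P c k y)) \<in> borel_measurable lebesgue" for c k
    by (intro continuous_measurable_lebesgue continuous_on_compose2[OF C(2) Pc]) auto
  have D2: "D k = (LINT y|lebesgue. ?ind y * g (P (1/2) k y)) - (LINT y|lebesgue. ?ind y * g (P (-1/2) k y))" for k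
  proof -
    let ?t = "t k"
    define S where "S c = {y :: real^'n. (\<forall>j. j \<noteq> i \<longrightarrow> -1/2 < y $ j \<and> y $ j < 1 / 2) \<and> c < y $ i \<and> y $ i < c + ?t}" for c
    have Sb: "S c = box (\<chi> j. if j = i then c else -1/2) (\<chi> j. if j = i then c + ?t else 1/2)" for c
    proof (rule set_eqI)
      fix y :: "real^'n"
      define H where "H j \<longleftrightarrow> (if j = i then c else -1/2) < y $ j \<and> y $ j < (if j = i then c + ?t else 1/2)" for j
      have "y \<in> box (\<chi> j. if j = i then c else -1/2) (\<chi> j. if j = i then c + ?t else 1/2) \<longleftrightarrow> (\<forall>j. H j)"
        by (simp add: mem_box_cart H_def)
      also have "\<dots> \<longleftrightarrow> (\<forall>j. j \<noteq> i \<longrightarrow> H j) \<and> H i" by metis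
      also have "\<dots> \<longleftrightarrow> y \<in> S c" by (simp add: S_def H_def)
      finally show "y \<in> S c \<longleftrightarrow> y \<in> box (\<chi> j. if j = i then c else -1/2) (\<chi> j. if j = i then c + ?t else 1/2)" by simp
    qed
    have [measurable]: "S c \<in> sets lebesgue" for c unfolding Sb by (simp add: open_lebesgue)
    have indS: "indicator (S c) (P c k y) = ?ind y" for c y
    proof -
      have "P c k y $ j = (if j = i then ?t * (y $ i + 1/2) + c else y $ j)" for j
        by (simp add: P_def axis_def algebra_simps)
      moreover have "c < ?t * (y $ i + 1/2) + c \<longleftrightarrow> -1/2 < y $ i" using t[of k] by (simp add: zero_less_mult_iff) linarith
      moreover have "?t * (y $ i + 1/2) + c < c + ?t \<longleftrightarrow> y $ i < 1/2" using t[of k]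
        by (metis add.commute add_less_cancel_left mult_less_cancel_left_pos mult.right_neutral field_sum_of_halves less_add_same_cancel2)
      ultimately have "P c k y \<in> S c \<longleftrightarrow> y \<in> unit_cube"
        unfolding S_def mem_unit_cube mem_Collect_eq by (metis (full_types))
      then show ?thesis by (simp add: indicator_def)
    qed
    have IS: "(LINT y|lebesgue. indicator (S c) y * g y) = ?t * (LINT y|lebesgue. ?ind y * g (P c k y))" for c
      using integral_affine_coordinate[of "\<lambda>y. indicator (S c) y * g y" ?t i "c + ?t / 2"] t[of k]
      by (simp add: indS[of c, unfolded P_def] P_def)
    have iS: "integrable lebesgue (\<lambda>y. indicator (S c) y * g y)" for c
    proof -
      have "integrable lebesgue (\<lambda>y. indicator (S c) y * B)"
        unfolding Sb by (intro integrable_mult_left integrable_real_indicator) (use emeasure_lborel_box_finite in \<open>auto simp: open_lebesgue\<close>)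
      then show ?thesis
        by (rule Bochner_Integration.integrable_bound) (use order_trans[OF B abs_ge_self] in \<open>auto simp: indicator_def\<close>)
    qed
    have i0: "integrable lebesgue (\<lambda>y. ?ind y * g y)" by (rule bi[OF gm B])
    have i1: "integrable lebesgue (\<lambda>y. ?ind y * g (y + ?t *\<^sub>R ?e))" by (rule bi[OF shift B])
    have it: "integrable lebesgue (\<lambda>y. ?ind (y - ?t *\<^sub>R ?e) * g y)"
      using integrable_similarity[of "\<lambda>x. x" 1, OF _ _ i1, of "- ?t *\<^sub>R ?e"] by (simp add: add.commute)
    have "(LINT y|lebesgue. ?ind y * g (y + ?t *\<^sub>R ?e)) = (LINT y|lebesgue. ?ind (y - ?t *\<^sub>R ?e) * g y)"
      using integral_similarity[of "\<lambda>x. x" 1 "\<lambda>y. ?ind y * g (y + ?t *\<^sub>R ?e)" "- ?t *\<^sub>R ?e"] i1 by (simp add: add.commute)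
    then have "(LINT y|lebesgue. ?ind y * g (y + ?t *\<^sub>R ?e)) - (LINT y|lebesgue. ?ind y * g y)
      = (LINT y|lebesgue. ?ind (y - ?t *\<^sub>R ?e) * g y - ?ind y * g y)"
      using i0 it by simp
    also have "\<dots> = (LINT y|lebesgue. indicator (S (1/2)) y * g y - indicator (S (-1/2)) y * g y)"
    proof (rule integral_cong_AE)
      \<comment> \<open>All boxes are open, so the identity between their indicators fails on these
        two hyperplanes and holds off them.\<close>
      have "negligible ({y. y $ i = 1/2} \<union> {y :: real^'n. y $ i = -1/2 + ?t})"
        using negligible_hyperplane[of ?e "1/2"] negligible_hyperplane[of ?e "-1/2 + ?t"]
        by (intro negligible_Un) (simp_all add: inner_axis' axis_eq_0_iff)
      then have "AE y in lebesgue. y \<notin> {y. y $ i = 1/2} \<union> {y :: real^'n. y $ i = -1/2 + ?t}"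
        by (intro AE_not_in) (simp add: negligible_iff_null_sets)
      then show "AE y in lebesgue. ?ind (y - ?t *\<^sub>R ?e) * g y - ?ind y * g y = indicator (S (1/2)) y * g y - indicator (S (-1/2)) y * g y"
      proof eventually_elim
        case (elim y)
        define Q where "Q \<longleftrightarrow> (\<forall>j. j \<noteq> i \<longrightarrow> -1/2 < y $ j \<and> y $ j < 1 / 2)"
        have 1: "y \<in> unit_cube \<longleftrightarrow> Q \<and> -1/2 < y $ i \<and> y $ i < 1/2" unfolding mem_unit_cube Q_def by metis
        have 2: "y - ?t *\<^sub>R ?e \<in> unit_cube \<longleftrightarrow> Q \<and> -1/2 < y $ i - ?t \<and> y $ i - ?t < 1/2"
        proof -
          have "(y - ?t *\<^sub>R ?e) $ j = (if j = i then y $ i - ?t else y $ j)" for j by (simp add: axis_def)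
          then show ?thesis unfolding mem_unit_cube Q_def by metis
        qed
        have 3: "y \<in> S c \<longleftrightarrow> Q \<and> c < y $ i \<and> y $ i < c + ?t" for c by (auto simp: S_def Q_def)
        have "y $ i \<noteq> 1/2" "y $ i \<noteq> -1/2 + ?t" using elim by auto
        then have "?ind (y - ?t *\<^sub>R ?e) - ?ind y = indicator (S (1/2)) y - indicator (S (-1/2)) y"
          unfolding indicator_def 1 2 3 using t[of k] by (cases Q) (auto simp: abs_less_iff)
        then show ?case by (simp add: left_diff_distrib[symmetric])
      qed
    qed (use i0 it iS in auto)
    also have "\<dots> = ?t * ((LINT y|lebesgue. ?ind y * g (P (1/2) k y)) - (LINT y|lebesgue. ?ind y * g (P (-1/2) k y)))"
      using iS by (simp add: IS right_diff_distrib)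
    finally have *: "(LINT y|lebesgue. ?ind y * g (y + ?t *\<^sub>R ?e)) - (LINT y|lebesgue. ?ind y * g y)
      = ?t * ((LINT y|lebesgue. ?ind y * g (P (1/2) k y)) - (LINT y|lebesgue. ?ind y * g (P (-1/2) k y)))" .
    have "D k = (LINT y|lebesgue. (?ind y * g (y + ?t *\<^sub>R ?e) - ?ind y * g y) / ?t)"
      unfolding D_def by (intro Bochner_Integration.integral_cong) (auto simp: algebra_simps diff_divide_distrib)
    also have "\<dots> = ((LINT y|lebesgue. ?ind y * g (y + ?t *\<^sub>R ?e)) - (LINT y|lebesgue. ?ind y * g y)) / ?t"
      using i0 i1 by simp
    finally show ?thesis using * t[of k] by simp
  qed
  have gf: "(\<lambda>y. g (face_proj i c y)) \<in> borel_measurable lebesgue" for c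
    by (intro continuous_measurable_lebesgue continuous_on_compose2[OF C(2) continuous_face_proj]) auto
  have lim2: "(\<lambda>k. LINT y|lebesgue. ?ind y * g (P c k y)) \<longlonglongrightarrow> (LINT y|lebesgue. ?ind y * g (face_proj i c y))" for c
  proof (rule integral_dominated_convergence[where w="\<lambda>y. ?ind y * B"])
    show "AE y in lebesgue. (\<lambda>k. ?ind y * g (P c k y)) \<longlonglongrightarrow> ?ind y * g (face_proj i c y)"
    proof (intro AE_I2 tendsto_intros continuous_on_tendsto_compose[OF C(2)])
      fix y
      have "(\<lambda>k. P c k y) \<longlonglongrightarrow> y + ((0 - 1) * y $ i + (c + 0 / 2)) *\<^sub>R ?e"
        unfolding P_def by (intro tendsto_intros t0) auto
      also have "y + ((0 - 1) * y $ i + (c + 0 / 2)) *\<^sub>R ?e = face_proj i c y"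
        by (simp add: face_proj_def vec_eq_iff axis_def)
      finally show "(\<lambda>k. P c k y) \<longlonglongrightarrow> face_proj i c y" .
    qed auto
    show "AE y in lebesgue. norm (?ind y * g (P c k y)) \<le> ?ind y * B" for k
      using B by (auto simp: indicator_def)
  qed (use gP gf iu in \<open>auto intro!: borel_measurable_times\<close>)
  have "D \<longlonglongrightarrow> (LINT y|lebesgue. ?ind y * g (face_proj i (1/2) y)) - (LINT y|lebesgue. ?ind y * g (face_proj i (-1/2) y))"
    unfolding D2 by (intro tendsto_diff lim2)
  then have "(LINT y|lebesgue. ?ind y * grad g y $ i) = (LINT y|lebesgue. ?ind y * g (face_proj i (1/2) y)) - (LINT y|lebesgue. ?ind y * g (face_proj i (-1/2) y))"
    by (rule LIMSEQ_unique[OF lim1])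
  also have "\<dots> = (LINT y|lebesgue. ?ind y * (g (face_proj i (1/2) y) - g (face_proj i (-1/2) y)))"
    using bi[OF gf B] by (simp add: right_diff_distrib)
  finally show ?thesis .
qed

lemma cube_boundary_integral_eq:
  "cube_boundary_integral R r h = (\<Sum>i\<in>UNIV. ennreal (r ^ (CARD('n) - 1)) *
     ((\<integral>\<^sup>+ y. h (r *\<^sub>R R (face_proj i (-1/2) y)) \<partial>lebesgue_on unit_cube) +
      (\<integral>\<^sup>+ y. h (r *\<^sub>R R (face_proj i (1/2) y)) \<partial>lebesgue_on unit_cube)))"
  for R :: "real^'n \<Rightarrow> real^'n"
  unfolding cube_boundary_integral_def face_proj_def by (simp add: distrib_left)

text \<open>After rotation to the unit cube, each frame component of the gradient integrates to a
  difference of face integrals. The direction of differentiation is a combination of the face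
  normals with coefficients of modulus at most one, so the L1 norm on the boundary dominates. The
  inequality suffices, because it is applied to functions whose boundary values tend to
  zero.\<close>

lemma cube_divergence_bound:
  fixes f :: "real^'n \<Rightarrow> real"
  assumes R: "orthogonal_transformation R" and r: "r > 0" and f: "C1_comp \<rho> f"
  shows "ennreal \<bar>LINT x|lebesgue. indicator (cube R r) x * grad f x $ j\<bar>
    \<le> cube_boundary_integral R r (\<lambda>x. ennreal \<bar>f x\<bar>)"
proof -
  note C = C1_compD[OF f]
  have lin: "linear R" using R by (rule orthogonal_transformation_linear)
  have Rc: "continuous_on UNIV R" using lin by (intro linear_continuous_on linear_linear[THEN iffD2])
  have rRc: "continuous_on UNIV (\<lambda>y. r *\<^sub>R R y)" by (intro continuous_intros Rc)
  define g where "g y = f (r *\<^sub>R R y)" for y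
  define b where "b i = R (axis i 1)" for i
  have dR: "((\<lambda>y. r *\<^sub>R R y) has_derivative (\<lambda>h. r *\<^sub>R R h)) (at y)" for y
    by (intro has_derivative_scaleR_right linear_imp_has_derivative lin)
  have dg: "(g has_derivative (\<lambda>h. grad f (r *\<^sub>R R y) \<bullet> (r *\<^sub>R R h))) (at y)" for y
    unfolding g_def by (rule has_derivative_compose[OF dR has_derivative_grad[OF C(1)]])
  have gg: "grad g y $ i = r * (grad f (r *\<^sub>R R y) \<bullet> b i)" for y i
    using grad_nth[OF dg] by (simp add: b_def)
  have cfb: "continuous_on UNIV (\<lambda>y. grad f (r *\<^sub>R R y) \<bullet> b i)" for i
    by (intro continuous_intros continuous_on_compose2[OF C(3) rRc]) auto
  have gC: "C1_comp (\<rho> / r) g"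
    unfolding C1_comp_def
  proof
    have "(\<lambda>h. grad f (r *\<^sub>R R y) \<bullet> (r *\<^sub>R R h)) = (\<lambda>h. grad g y \<bullet> h)" for y
      using has_derivative_unique[OF dg has_derivative_grad] dg by (auto simp: differentiable_def)
    then show "C_diff 1 g" using dg by (intro C_diff_1I[of g "grad g"]) (auto simp: gg intro!: continuous_intros cfb)
    show "\<forall>x. norm x > \<rho> / r \<longrightarrow> g x = 0"
      using C(4) r by (auto simp: g_def orthogonal_transformation_norm[OF R] field_simps)
  qed
  note gC' = C1_compD[OF gC]
  \<comment> \<open>The entries of \<open>w\<close> are the coordinates of the \<open>j\<close>-th
    unit vector in the frame of face normals.\<close>
  obtain w where w: "axis j 1 = R w" using orthogonal_transformation_surj[OF R] by (metis surjD)
  have "norm (R w) = 1" unfolding w[symmetric] by (simp add: norm_eq_1 inner_axis_axis)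
  then have nw: "norm w = 1" using orthogonal_transformation_norm[OF R, of w] by simp
  have wi: "\<bar>w $ i\<bar> \<le> 1" for i using component_le_norm_cart[of w i] nw by simp
  have aj: "axis j 1 = (\<Sum>i\<in>UNIV. w $ i *\<^sub>R b i)"
  proof -
    have "R w = R (\<Sum>i\<in>UNIV. w $ i *s axis i 1)" by (simp add: basis_expansion)
    then show ?thesis unfolding w b_def by (simp add: linear_sum[OF lin] scalar_mult_eq_scaleR linear_scale[OF lin])
  qed
  have fj: "grad f x $ j = (\<Sum>i\<in>UNIV. w $ i * (grad f x \<bullet> b i))" for x
  proof -
    have "grad f x $ j = grad f x \<bullet> axis j 1" by (simp add: inner_axis)
    then show ?thesis by (simp only: aj) (simp add: inner_sum_right)
  qed
  have [measurable]: "cube R r \<in> sets lebesgue" by (rule cube_lebesgue[OF R r])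
  have gjm: "(\<lambda>x. grad f x $ j) \<in> borel_measurable lebesgue"
    using C(3) by (intro continuous_measurable_lebesgue continuous_intros)
  define J where "J i = (LINT y|lebesgue. indicator unit_cube y * grad g y $ i)" for i
  have ii: "integrable lebesgue (\<lambda>y. indicator unit_cube y * grad g y $ i)" for i
  proof -
    have "sq_integrable unit_cube (\<lambda>y. grad g y $ i)"
      using gC' by (intro sq_integrable_continuous continuous_intros bounded_unit_cube open_unit_cube)
    have li: "loc_integrable (indicator unit_cube :: real^'n \<Rightarrow> real)"
      by (rule loc_integrable_bounded[of _ 1]) (auto intro!: borel_measurable_indicator unit_cube_lebesgue split: split_indicator)
    show ?thesis
      by (rule integrable_mult_comp_support[OF li, of _ "\<rho> / r"]) (use gC' in \<open>auto intro!: continuous_intros\<close>)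
  qed
  have "(LINT x|lebesgue. indicator (cube R r) x * grad f x $ j)
    = r ^ CARD('n) * (LINT y|lebesgue. indicator (cube R r) (0 + r *\<^sub>R R y) * grad f (0 + r *\<^sub>R R y) $ j)"
    using gjm by (subst integral_similarity[OF R r, where t=0]) (auto intro!: borel_measurable_times)
  also have "\<dots> = r ^ CARD('n) * (LINT y|lebesgue. indicator unit_cube y * grad f (r *\<^sub>R R y) $ j)"
    by (simp add: indicator_cube_scaleR[OF R r])
  also have "(LINT y|lebesgue. indicator unit_cube y * grad f (r *\<^sub>R R y) $ j)
      = (LINT y|lebesgue. (\<Sum>i\<in>UNIV. (w $ i / r) * (indicator unit_cube y * grad g y $ i)))"
    unfolding fj gg using r by (intro Bochner_Integration.integral_cong refl) (simp add: sum_distrib_left mult_ac)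
  also have "\<dots> = (\<Sum>i\<in>UNIV. (w $ i / r) * J i)" using ii by (simp add: J_def)
  finally have eq: "(LINT x|lebesgue. indicator (cube R r) x * grad f x $ j) = r ^ CARD('n) * (\<Sum>i\<in>UNIV. (w $ i / r) * J i)" .
  have "CARD('n) = Suc (CARD('n) - 1)" by simp
  then have rn: "r ^ CARD('n) = r ^ (CARD('n) - 1) * r" by (metis power_Suc2)
  have Ji: "ennreal \<bar>J i\<bar> \<le> (\<integral>\<^sup>+ y. ennreal \<bar>f (r *\<^sub>R R (face_proj i (-1/2) y))\<bar> \<partial>lebesgue_on unit_cube) +
      (\<integral>\<^sup>+ y. ennreal \<bar>f (r *\<^sub>R R (face_proj i (1/2) y))\<bar> \<partial>lebesgue_on unit_cube)" for i
  proof -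
    have gf[measurable]: "(\<lambda>y. g (face_proj i c y)) \<in> borel_measurable lebesgue" for c
      by (intro continuous_measurable_lebesgue continuous_on_compose2[OF gC'(2) continuous_face_proj]) auto
    have [measurable]: "(unit_cube :: (real^'n) set) \<in> sets lebesgue" by (rule unit_cube_lebesgue)
    have "J i = (LINT y|lebesgue_on unit_cube. g (face_proj i (1/2) y) - g (face_proj i (-1/2) y))"
      unfolding J_def unit_cube_divergence[OF gC] by (simp add: integral_restrict_space)
    moreover have "ennreal (norm (LINT y|lebesgue_on unit_cube. g (face_proj i (1/2) y) - g (face_proj i (-1/2) y)))
        \<le> (\<integral>\<^sup>+ y. ennreal (norm (g (face_proj i (1/2) y) - g (face_proj i (-1/2) y))) \<partial>lebesgue_on unit_cube)" 
    proof (cases "integrable (lebesgue_on unit_cube) (\<lambda>y. g (face_proj i (1/2) y) - g (face_proj i (-1/2) y))")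
      case True
      then show ?thesis by (rule integral_norm_bound_ennreal)
    qed (simp add: not_integrable_integral_eq)
    ultimately have "ennreal \<bar>J i\<bar> \<le> (\<integral>\<^sup>+ y. ennreal (norm (g (face_proj i (1/2) y) - g (face_proj i (-1/2) y))) \<partial>lebesgue_on unit_cube)"
      by simp
    also have "\<dots> \<le> (\<integral>\<^sup>+ y. ennreal \<bar>g (face_proj i (-1/2) y)\<bar> + ennreal \<bar>g (face_proj i (1/2) y)\<bar> \<partial>lebesgue_on unit_cube)"
      by (intro nn_integral_mono) (simp add: ennreal_plus[symmetric] ennreal_leI del: ennreal_plus)
    also have "\<dots> = (\<integral>\<^sup>+ y. ennreal \<bar>g (face_proj i (-1/2) y)\<bar> \<partial>lebesgue_on unit_cube) + (\<integral>\<^sup>+ y. ennreal \<bar>g (face_proj i (1/2) y)\<bar> \<partial>lebesgue_on unit_cube)"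
      by (intro nn_integral_add) (auto intro!: measurable_restrict_space1)
    finally show ?thesis by (simp add: g_def)
  qed
  have "\<bar>LINT x|lebesgue. indicator (cube R r) x * grad f x $ j\<bar> \<le> (\<Sum>i\<in>UNIV. r ^ (CARD('n) - 1) * \<bar>J i\<bar>)"
  proof -
    have "\<bar>LINT x|lebesgue. indicator (cube R r) x * grad f x $ j\<bar> = \<bar>\<Sum>i\<in>UNIV. r ^ (CARD('n) - 1) * (w $ i * J i)\<bar>"
      unfolding eq rn using r by (simp add: sum_distrib_left mult.assoc)
    also have "\<dots> \<le> (\<Sum>i\<in>UNIV. \<bar>r ^ (CARD('n) - 1) * (w $ i * J i)\<bar>)" by (rule sum_abs)
    also have "\<dots> \<le> (\<Sum>i\<in>UNIV. r ^ (CARD('n) - 1) * \<bar>J i\<bar>)"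
      using r wi by (intro sum_mono) (auto simp: abs_mult intro!: mult_left_mono mult_left_le_one_le)
    finally show ?thesis .
  qed
  then have "ennreal \<bar>LINT x|lebesgue. indicator (cube R r) x * grad f x $ j\<bar> \<le> (\<Sum>i\<in>UNIV. ennreal (r ^ (CARD('n) - 1)) * ennreal \<bar>J i\<bar>)"
    using r by (subst (asm) ennreal_le_iff[symmetric]) (auto simp: sum_nonneg sum_ennreal[symmetric] ennreal_mult' simp del: sum_ennreal)
  also have "\<dots> \<le> cube_boundary_integral R r (\<lambda>x. ennreal \<bar>f x\<bar>)"
    unfolding cube_boundary_integral_eq by (intro sum_mono mult_left_mono Ji) auto
  finally show ?thesis .
qed

lemma cube_boundary_integral_mono:
  assumes "\<And>x. h x \<le> k x"
  shows "cube_boundary_integral R r h \<le> cube_boundary_integral R r k"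
  unfolding cube_boundary_integral_def by (intro sum_mono mult_left_mono nn_integral_mono assms) auto

lemma cube_boundary_integral_Young:
  fixes R :: "real^'n \<Rightarrow> real^'n" and d :: "real^'n \<Rightarrow> real"
  assumes R: "linear R" and d: "continuous_on UNIV d"
  shows "cube_boundary_integral R r (\<lambda>x. c + e * ennreal (d x))
    = cube_boundary_integral R r (\<lambda>x. c) + e * cube_boundary_integral R r (\<lambda>x. ennreal (d x))"
proof -
  have [measurable]: "(\<lambda>y. d (r *\<^sub>R R (face_proj i s y))) \<in> borel_measurable (lebesgue_on unit_cube)" for i s
  proof (intro continuous_measurable_on continuous_on_compose2[OF d])
    have "continuous_on UNIV R" using R by (intro linear_continuous_on linear_linear[THEN iffD2])
    then show "continuous_on UNIV (\<lambda>y. r *\<^sub>R R (face_proj i s y))"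
      by (intro continuous_intros continuous_on_compose2[OF _ continuous_face_proj]) auto
  qed auto
  have "(\<integral>\<^sup>+ y. c + e * ennreal (d (r *\<^sub>R R (face_proj i s y))) \<partial>lebesgue_on unit_cube)
    = (\<integral>\<^sup>+ y. c \<partial>(lebesgue_on unit_cube :: (real^'n) measure)) + e * (\<integral>\<^sup>+ y. ennreal (d (r *\<^sub>R R (face_proj i s y))) \<partial>lebesgue_on unit_cube)" for i s
    by (subst nn_integral_add) (auto simp: nn_integral_cmult)
  then show ?thesis
    unfolding cube_boundary_integral_eq
    by (simp add: sum_distrib_left sum.distrib distrib_left mult_ac add_ac del: sum_constant nn_integral_const)
qed

lemma cube_boundary_integral_const:
  fixes R :: "real^'n \<Rightarrow> real^'n"
  shows "cube_boundary_integral R r (\<lambda>x. c) = c * cube_boundary_integral R r (\<lambda>x. 1)"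
proof -
  have "emeasure (lebesgue_on unit_cube) (unit_cube :: (real^'n) set) = 1"
    using emeasure_unit_cube[where 'n='n] by (subst emeasure_restrict_space) (auto intro: unit_cube_lebesgue simp del: emeasure_completion)
  then show ?thesis unfolding cube_boundary_integral_eq by (simp add: sum_distrib_left mult_ac distrib_left mult_2[symmetric])
qed

lemma cube_boundary_integral_1_finite:
  fixes R :: "real^'n \<Rightarrow> real^'n"
  shows "cube_boundary_integral R r (\<lambda>x. 1) < \<infinity>"
proof -
  have "emeasure (lebesgue_on unit_cube) (unit_cube :: (real^'n) set) = 1"
    using emeasure_unit_cube[where 'n='n] by (subst emeasure_restrict_space) (auto intro: unit_cube_lebesgue simp del: emeasure_completion)
  then show ?thesis unfolding cube_boundary_integral_eq by (simp add: ennreal_mult_less_top ennreal_of_nat_eq_real_of_nat)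
qed

context mollifier
begin

text \<open>The approximants \<open>w k\<close> that witness the trace are multiplied, after
  subtracting \<open>U\<close>, by a test function of the whole space. The divergence bound shows
  that the boundary contribution disappears, so integration by parts over the cube has no boundary
  term. This makes it possible to put modified cells side by side.\<close>

lemma trace_zero_extension:
  fixes R :: "real^'n \<Rightarrow> real^'n"
  assumes R: "orthogonal_transformation R" and r: "r > 0" and H: "H1 (cube R r) v G"
    and tr: "has_trace R r v U" and U: "smooth U"
  shows "H1 UNIV (\<lambda>x. indicator (cube R r) x * (v x - U x)) (\<lambda>x. indicator (cube R r) x *\<^sub>R (G x - grad U x))"
proof -
  let ?Q = "cube R r"
  have oQ: "open ?Q" and bQ: "bounded ?Q" and Q[measurable]: "?Q \<in> sets lebesgue"
    using R r by (auto intro: open_cube bounded_cube cube_lebesgue)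
  have lin: "linear R" using R by (rule orthogonal_transformation_linear)
  have HU: "H1 ?Q U (grad U)" by (rule H1_smooth[OF U bQ oQ])
  note H' = H1_diff[OF H HU Q]
  note sq = H1_sq_integrable[OF H']
  have "sq_integrable UNIV (\<lambda>x. indicator ?Q x *\<^sub>R (v x - U x))" "sq_integrable UNIV (\<lambda>x. indicator ?Q x *\<^sub>R (G x - grad U x))"
    using sq by (simp_all only: sq_integrable_iff[OF Q, symmetric])
  moreover have "(LINT x|lebesgue. indicator ?Q x * (v x - U x) * grad \<psi> x $ j)
      = - (LINT x|lebesgue. (indicator ?Q x *\<^sub>R (G x - grad U x)) $ j * \<psi> x)" if \<psi>: "test_fun UNIV \<psi>" for \<psi> j
  proof -
    obtain w where w: "\<And>k. smooth (w k)"
      and w1: "(\<lambda>k. \<integral>\<^sup>+ x. ennreal ((w k x - v x)\<^sup>2) \<partial>lebesgue_on ?Q) \<longlonglongrightarrow> 0"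
      and w2: "(\<lambda>k. \<integral>\<^sup>+ x. ennreal ((norm (grad (w k) x - weak_grad ?Q v x))\<^sup>2) \<partial>lebesgue_on ?Q) \<longlonglongrightarrow> 0"
      and w3: "(\<lambda>k. cube_boundary_integral R r (\<lambda>x. ennreal ((w k x - U x)\<^sup>2))) \<longlonglongrightarrow> 0"
      using tr unfolding has_trace_def by blast
    have wAE: "AE x in lebesgue_on ?Q. weak_grad ?Q v x = G x" by (rule weak_grad_AE[OF oQ H])
    obtain \<rho> where \<rho>: "C1_comp \<rho> \<psi>" using \<psi> test_fun_C1_comp by blast
    note C = C1_compD[OF \<rho>]
    obtain B where B: "B > 0" "\<And>x. norm (\<psi> x) \<le> B" using bounded_comp_support[of \<psi> \<rho>] C(2,4) by metis
    have sm\<psi>: "smooth \<psi>" using \<psi> by (rule test_fun_smooth)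
    define f where "f k x = (w k x - U x) * \<psi> x" for k x
    have smd: "smooth (\<lambda>x. w k x - U x)" for k by (intro smooth_diff w U)
    have fC: "C1_comp \<rho> (f k)" for k
      using C1_comp_mult[OF _ \<rho>, of "\<lambda>x. w k x - U x"] smd unfolding f_def smooth_def by blast
    have gf: "grad (f k) x $ j = (w k x - U x) * grad \<psi> x $ j + (grad (w k) x - grad U x) $ j * \<psi> x" for k x
      unfolding f_def using grad_mult[OF smooth_differentiable[OF smd] smooth_differentiable[OF sm\<psi>]]
      by (simp add: grad_diff[OF smooth_differentiable[OF w] smooth_differentiable[OF U]])
    \<comment> \<open>\<open>b k\<close> is a flux through the boundary. It tends to zero because
      the boundary data do, and it tends to \<open>L\<close> by L2 convergence inside the cube;
      \<open>L = 0\<close> is the required identity.\<close>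
    define b where "b k = (LINT x|lebesgue_on ?Q. grad (f k) x $ j)" for k
    define L where "L = (LINT x|lebesgue_on ?Q. (v x - U x) * grad \<psi> x $ j + (G x - grad U x) $ j * \<psi> x)"
    have bk: "b k = (LINT x|lebesgue. indicator ?Q x * grad (f k) x $ j)" for k
      unfolding b_def by (simp add: integral_restrict_space)
    have "(\<lambda>k. ennreal \<bar>b k\<bar>) \<longlonglongrightarrow> 0"
    proof (rule ennreal_tendsto_0_by_Young[OF _ _ w3])
      show "ennreal (B\<^sup>2) * cube_boundary_integral R r (\<lambda>x. 1) < \<infinity>"
        using cube_boundary_integral_1_finite[of R r] by (auto simp: ennreal_mult_less_top)
      fix a :: real and k assume a: "a > 0"
      have "ennreal \<bar>b k\<bar> \<le> cube_boundary_integral R r (\<lambda>x. ennreal \<bar>f k x\<bar>)"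
        unfolding bk by (rule cube_divergence_bound[OF R r fC])
      also have "\<dots> \<le> cube_boundary_integral R r (\<lambda>x. ennreal (a * B\<^sup>2) + ennreal (1 / a) * ennreal ((w k x - U x)\<^sup>2))"
      proof (rule cube_boundary_integral_mono)
        fix x
        have "ennreal \<bar>f k x\<bar> \<le> ennreal a * ennreal ((\<psi> x)\<^sup>2) + ennreal (1 / a) * ennreal ((w k x - U x)\<^sup>2)"
          using Young_ennreal[OF a, of "\<psi> x" "w k x - U x"] by (simp add: f_def mult.commute)
        also have "ennreal a * ennreal ((\<psi> x)\<^sup>2) \<le> ennreal (a * B\<^sup>2)"
          using a B(2)[of x] by (simp add: ennreal_mult'[symmetric] ennreal_leI abs_le_square_iff[symmetric] mult_left_mono)
        finally show "ennreal \<bar>f k x\<bar> \<le> ennreal (a * B\<^sup>2) + ennreal (1 / a) * ennreal ((w k x - U x)\<^sup>2)"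
          by (simp add: add_right_mono)
      qed
      also have "\<dots> = ennreal a * (ennreal (B\<^sup>2) * cube_boundary_integral R r (\<lambda>x. 1)) + ennreal (1 / a) * cube_boundary_integral R r (\<lambda>x. ennreal ((w k x - U x)\<^sup>2))"
      proof -
        have "continuous_on UNIV (\<lambda>x. (w k x - U x)\<^sup>2)" by (intro continuous_intros smooth_continuous w U)
        then show ?thesis
          unfolding cube_boundary_integral_Young[OF lin \<open>continuous_on UNIV (\<lambda>x. (w k x - U x)\<^sup>2)\<close>]
            cube_boundary_integral_const[of R r "ennreal (a * B\<^sup>2)"]
          using a by (simp add: ennreal_mult' mult.assoc)
      qed
      finally show "ennreal \<bar>b k\<bar> \<le> ennreal a * (ennreal (B\<^sup>2) * cube_boundary_integral R r (\<lambda>x. 1)) + ennreal (1 / a) * cube_boundary_integral R r (\<lambda>x. ennreal ((w k x - U x)\<^sup>2))" .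
    qed
    then have "(\<lambda>k. enn2real (ennreal \<bar>b k\<bar>)) \<longlonglongrightarrow> 0" by (intro tendsto_enn2real) simp_all
    then have b0: "b \<longlonglongrightarrow> 0" by (simp add: tendsto_rabs_zero_iff)
    have \<psi>c: "continuous_on UNIV \<psi>" "continuous_on UNIV (\<lambda>x. grad \<psi> x $ j)"
      using sm\<psi> by (auto intro: smooth_continuous smooth_grad)
    have Qm: "sq_integrable ?Q (\<lambda>x. grad \<psi> x $ j)" "sq_integrable ?Q \<psi>"
      using \<psi>c bQ oQ by (auto intro: sq_integrable_continuous)
    have vm: "v \<in> borel_measurable (lebesgue_on ?Q)" "(\<lambda>x. G x $ j) \<in> borel_measurable (lebesgue_on ?Q)"
      using H1_sq_integrable[OF H] sq_integrable_nth by (auto intro: sq_integrable_measurable)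
    have Um: "U \<in> borel_measurable (lebesgue_on ?Q)" "(\<lambda>x. grad U x $ j) \<in> borel_measurable (lebesgue_on ?Q)"
      using U by (auto intro!: continuous_measurable_on smooth_continuous smooth_grad)
    have wm: "w k \<in> borel_measurable (lebesgue_on ?Q)" "(\<lambda>x. grad (w k) x $ j) \<in> borel_measurable (lebesgue_on ?Q)" for k
      using w by (auto intro!: continuous_measurable_on smooth_continuous smooth_grad)
    have pm: "(\<lambda>x. grad \<psi> x $ j) \<in> borel_measurable (lebesgue_on ?Q)" "\<psi> \<in> borel_measurable (lebesgue_on ?Q)"
      using Qm by (auto intro: sq_integrable_measurable)
    note [measurable] = vm Um wm pm
    have n1: "(\<lambda>k. \<integral>\<^sup>+ x. ennreal \<bar>grad \<psi> x $ j * (w k x - v x)\<bar> \<partial>lebesgue_on ?Q) \<longlonglongrightarrow> 0"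
      using Qm(1) by (intro nn_integral_mult_tendsto_0[OF _ _ _ w1]) (auto simp: sq_integrable_def integrable_iff_bounded)
    have n2: "(\<lambda>k. \<integral>\<^sup>+ x. ennreal \<bar>\<psi> x * (grad (w k) x $ j - G x $ j)\<bar> \<partial>lebesgue_on ?Q) \<longlonglongrightarrow> 0"
    proof (rule nn_integral_mult_tendsto_0)
      show "(\<lambda>k. \<integral>\<^sup>+ x. ennreal ((grad (w k) x $ j - G x $ j)\<^sup>2) \<partial>lebesgue_on ?Q) \<longlonglongrightarrow> 0"
      proof (rule tendsto_sandwich[OF _ _ tendsto_const w2])
        show "eventually (\<lambda>k. (\<integral>\<^sup>+ x. ennreal ((grad (w k) x $ j - G x $ j)\<^sup>2) \<partial>lebesgue_on ?Q)
          \<le> (\<integral>\<^sup>+ x. ennreal ((norm (grad (w k) x - weak_grad ?Q v x))\<^sup>2) \<partial>lebesgue_on ?Q)) sequentially"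
        proof (rule always_eventually, rule allI, rule nn_integral_mono_AE)
          fix k
          show "AE x in lebesgue_on ?Q. ennreal ((grad (w k) x $ j - G x $ j)\<^sup>2) \<le> ennreal ((norm (grad (w k) x - weak_grad ?Q v x))\<^sup>2)"
            using wAE
          proof eventually_elim
            case (elim x)
            show ?case using component_le_norm_cart[of "grad (w k) x - G x" j]
              by (simp add: elim ennreal_leI abs_le_square_iff[symmetric])
          qed
        qed
      qed simp
      show "(\<integral>\<^sup>+ x. ennreal ((\<psi> x)\<^sup>2) \<partial>lebesgue_on ?Q) < \<infinity>" using Qm(2) by (auto simp: sq_integrable_def integrable_iff_bounded)
    qed measurable
    have int_mult: "integrable (lebesgue_on ?Q) (\<lambda>x. p x * q x)" if "sq_integrable ?Q p" "sq_integrable ?Q q" for p q :: "real^'n \<Rightarrow> real"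
    proof (rule Bochner_Integration.integrable_bound)
      show "integrable (lebesgue_on ?Q) (\<lambda>x. (norm (p x))\<^sup>2 + (norm (q x))\<^sup>2)" using that by (simp add: sq_integrable_def)
      show "(\<lambda>x. p x * q x) \<in> borel_measurable (lebesgue_on ?Q)" using that by (auto simp: sq_integrable_def)
      have "\<bar>a * c\<bar> \<le> a\<^sup>2 + c\<^sup>2" for a c :: real
      proof -
        have "2 * \<bar>a * c\<bar> \<le> a\<^sup>2 + c\<^sup>2" using sum_squares_bound[of "\<bar>a\<bar>" "\<bar>c\<bar>"] by (simp add: abs_mult)
        then show ?thesis using abs_ge_zero[of "a * c"] by linarith
      qed
      then show "AE x in lebesgue_on ?Q. norm (p x * q x) \<le> norm ((norm (p x))\<^sup>2 + (norm (q x))\<^sup>2)" by simp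
    qed
    have L_int: "integrable (lebesgue_on ?Q) (\<lambda>x. (v x - U x) * grad \<psi> x $ j)" "integrable (lebesgue_on ?Q) (\<lambda>x. (G x - grad U x) $ j * \<psi> x)"
      by (intro int_mult sq Qm sq_integrable_nth)+
    have "b \<longlonglongrightarrow> L"
      unfolding b_def L_def
    proof (rule tendsto_L1_int)
      show "integrable (lebesgue_on ?Q) (\<lambda>x. (v x - U x) * grad \<psi> x $ j + (G x - grad U x) $ j * \<psi> x)"
        using L_int by (rule Bochner_Integration.integrable_add)
      show "integrable (lebesgue_on ?Q) (\<lambda>x. grad (f k) x $ j)" for k
        unfolding gf using w U bQ oQ
        by (intro Bochner_Integration.integrable_add int_mult Qm sq_integrable_continuous continuous_intros smooth_continuous smooth_grad_continuous) auto
      have lim: "(\<lambda>k. (\<integral>\<^sup>+ x. ennreal \<bar>grad \<psi> x $ j * (w k x - v x)\<bar> \<partial>lebesgue_on ?Q) + (\<integral>\<^sup>+ x. ennreal \<bar>\<psi> x * (grad (w k) x $ j - G x $ j)\<bar> \<partial>lebesgue_on ?Q)) \<longlonglongrightarrow> 0 + 0"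
        by (intro tendsto_add n1 n2)
      show "(\<lambda>k. \<integral>\<^sup>+ x. norm (grad (f k) x $ j - ((v x - U x) * grad \<psi> x $ j + (G x - grad U x) $ j * \<psi> x)) \<partial>lebesgue_on ?Q) \<longlonglongrightarrow> 0"
      proof (rule tendsto_sandwich[OF _ _ tendsto_const])
        show "eventually (\<lambda>k. (\<integral>\<^sup>+ x. norm (grad (f k) x $ j - ((v x - U x) * grad \<psi> x $ j + (G x - grad U x) $ j * \<psi> x)) \<partial>lebesgue_on ?Q)
           \<le> (\<integral>\<^sup>+ x. ennreal \<bar>grad \<psi> x $ j * (w k x - v x)\<bar> \<partial>lebesgue_on ?Q) + (\<integral>\<^sup>+ x. ennreal \<bar>\<psi> x * (grad (w k) x $ j - G x $ j)\<bar> \<partial>lebesgue_on ?Q)) sequentially"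
        proof (intro always_eventually allI)
          fix k
          have "(\<integral>\<^sup>+ x. norm (grad (f k) x $ j - ((v x - U x) * grad \<psi> x $ j + (G x - grad U x) $ j * \<psi> x)) \<partial>lebesgue_on ?Q)
            \<le> (\<integral>\<^sup>+ x. ennreal \<bar>grad \<psi> x $ j * (w k x - v x)\<bar> + ennreal \<bar>\<psi> x * (grad (w k) x $ j - G x $ j)\<bar> \<partial>lebesgue_on ?Q)"
          proof (intro nn_integral_mono)
            fix x
            have "grad (f k) x $ j - ((v x - U x) * grad \<psi> x $ j + (G x - grad U x) $ j * \<psi> x)
              = grad \<psi> x $ j * (w k x - v x) + \<psi> x * (grad (w k) x $ j - G x $ j)"
              unfolding gf by (simp add: algebra_simps)
            then have "norm (grad (f k) x $ j - ((v x - U x) * grad \<psi> x $ j + (G x - grad U x) $ j * \<psi> x))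
              \<le> \<bar>grad \<psi> x $ j * (w k x - v x)\<bar> + \<bar>\<psi> x * (grad (w k) x $ j - G x $ j)\<bar>"
              by (metis abs_triangle_ineq real_norm_def)
            then show "ennreal (norm (grad (f k) x $ j - ((v x - U x) * grad \<psi> x $ j + (G x - grad U x) $ j * \<psi> x)))
              \<le> ennreal \<bar>grad \<psi> x $ j * (w k x - v x)\<bar> + ennreal \<bar>\<psi> x * (grad (w k) x $ j - G x $ j)\<bar>"
              by (simp add: ennreal_plus[symmetric] ennreal_leI del: ennreal_plus)
          qed
          also have "\<dots> = (\<integral>\<^sup>+ x. ennreal \<bar>grad \<psi> x $ j * (w k x - v x)\<bar> \<partial>lebesgue_on ?Q) + (\<integral>\<^sup>+ x. ennreal \<bar>\<psi> x * (grad (w k) x $ j - G x $ j)\<bar> \<partial>lebesgue_on ?Q)"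
            by (intro nn_integral_add) measurable
          finally show "(\<integral>\<^sup>+ x. norm (grad (f k) x $ j - ((v x - U x) * grad \<psi> x $ j + (G x - grad U x) $ j * \<psi> x)) \<partial>lebesgue_on ?Q)
           \<le> (\<integral>\<^sup>+ x. ennreal \<bar>grad \<psi> x $ j * (w k x - v x)\<bar> \<partial>lebesgue_on ?Q) + (\<integral>\<^sup>+ x. ennreal \<bar>\<psi> x * (grad (w k) x $ j - G x $ j)\<bar> \<partial>lebesgue_on ?Q)" .
        qed
      qed (use lim in simp_all)
    qed
    then have "L = 0" using b0 LIMSEQ_unique by blast
    then have "(LINT x|lebesgue_on ?Q. (v x - U x) * grad \<psi> x $ j) = - (LINT x|lebesgue_on ?Q. (G x - grad U x) $ j * \<psi> x)"
      unfolding L_def using L_int by simp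
    then show ?thesis by (simp add: integral_restrict_space mult.assoc)
  qed
  ultimately show ?thesis by (subst H1_iff) auto
qed

text \<open>Mollifying \<open>w\<close> at scales below the distance from \<open>K\<close> to the
  complement of the cube keeps the support inside the cube. The smooth approximants then equal
  \<open>U\<close> exactly on the boundary, and the boundary error is zero rather than
  small.\<close>

lemma has_trace_compact_perturbation:
  fixes R :: "real^'n \<Rightarrow> real^'n"
  assumes R: "orthogonal_transformation R" and r: "r > 0" and U: "smooth U"
    and H: "H1 UNIV w G" and K: "compact K" "K \<subseteq> cube R r"
    and z: "\<And>x. x \<notin> K \<Longrightarrow> w x = 0" "\<And>x. x \<notin> K \<Longrightarrow> G x = 0"
  shows "has_trace R r (\<lambda>x. U x + w x) U"
proof -
  let ?Q = "cube R r"
  have oQ: "open ?Q" and bQ: "bounded ?Q" and Q[measurable]: "?Q \<in> sets lebesgue"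
    using R r by (auto intro: open_cube bounded_cube cube_lebesgue)
  obtain e where e: "e > 0" "(\<Union>x\<in>K. cball x e) \<subseteq> ?Q"
    using compact_subset_open_imp_cball_epsilon_subset[OF K(1) oQ K(2)] by blast
  obtain \<rho> where \<rho>: "\<forall>x\<in>K. norm x \<le> \<rho>" using compact_imp_bounded[OF K(1)] bounded_iff by blast
  have supp: "w x = 0" "G x = 0" if "norm x > \<rho>" for x using z[of x] \<rho> that by force+
  define d where "d k = e / real (k + 2)" for k
  have d: "d k > 0" "d k < e" for k using e by (auto simp: d_def field_simps intro: add_pos_nonneg)
  have d0: "d \<longlonglongrightarrow> 0" unfolding d_def by real_asymp
  define m where "m k = moll w (scale_moll (d k) \<phi>)" for k
  note M = H1_moll[OF H supp d(1) d0, folded m_def]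
  have HQ: "H1 ?Q (\<lambda>x. U x + w x) (\<lambda>x. grad U x + G x)"
    by (intro H1_add H1_smooth U bQ oQ Q H1_mono[OF H]) auto
  have wAE: "AE x in lebesgue_on ?Q. weak_grad ?Q (\<lambda>x. U x + w x) x = grad U x + G x"
    by (rule weak_grad_AE[OF oQ HQ])
  note sq = H1_sq_integrable(1)[OF H] sq_integrable_nth[OF H1_sq_integrable(2)[OF H]]
  have [measurable]: "w \<in> borel_measurable lebesgue" "(\<lambda>x. G x $ j) \<in> borel_measurable lebesgue"
     "(\<lambda>x. grad (m k) x $ j) \<in> borel_measurable lebesgue" for j k
    using sq M(1) by (auto simp: sq_integrable_UNIV intro!: continuous_measurable_lebesgue smooth_continuous smooth_grad)
  have sub: "(\<integral>\<^sup>+ x. h x \<partial>lebesgue_on ?Q) \<le> (\<integral>\<^sup>+ x. h x \<partial>lebesgue)" for h :: "real^'n \<Rightarrow> ennreal"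
    by (subst nn_integral_restrict_space) (auto intro!: nn_integral_mono split: split_indicator)
  show ?thesis
    unfolding has_trace_def
  proof (intro exI[of _ "\<lambda>k x. U x + m k x"] conjI allI)
    show "smooth (\<lambda>x. U x + m k x)" for k by (intro smooth_add U M)
    show "(\<lambda>k. \<integral>\<^sup>+ x. ennreal ((U x + m k x - (U x + w x))\<^sup>2) \<partial>lebesgue_on ?Q) \<longlonglongrightarrow> 0"
      by (rule tendsto_sandwich[OF _ _ tendsto_const M(2)]) (use sub in auto)
    have lim: "(\<lambda>k. \<Sum>j\<in>UNIV. \<integral>\<^sup>+ x. ennreal ((grad (m k) x $ j - G x $ j)\<^sup>2) \<partial>lebesgue) \<longlonglongrightarrow> (\<Sum>j\<in>(UNIV :: 'n set). 0)"
      by (intro tendsto_sum M)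
    show "(\<lambda>k. \<integral>\<^sup>+ x. ennreal ((norm (grad (\<lambda>x. U x + m k x) x - weak_grad ?Q (\<lambda>x. U x + w x) x))\<^sup>2) \<partial>lebesgue_on ?Q) \<longlonglongrightarrow> 0"
    proof (rule tendsto_sandwich[OF _ _ tendsto_const])
      show "eventually (\<lambda>k. (\<integral>\<^sup>+ x. ennreal ((norm (grad (\<lambda>x. U x + m k x) x - weak_grad ?Q (\<lambda>x. U x + w x) x))\<^sup>2) \<partial>lebesgue_on ?Q)
         \<le> (\<Sum>j\<in>UNIV. \<integral>\<^sup>+ x. ennreal ((grad (m k) x $ j - G x $ j)\<^sup>2) \<partial>lebesgue)) sequentially"
      proof (intro always_eventually allI)
        fix k
        have n2: "(norm y)\<^sup>2 = (\<Sum>j\<in>UNIV. (y $ j)\<^sup>2)" for y :: "real^'n"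
          by (simp only: power2_norm_eq_inner) (simp add: inner_vec_def power2_eq_square)
        have "(\<integral>\<^sup>+ x. ennreal ((norm (grad (\<lambda>x. U x + m k x) x - weak_grad ?Q (\<lambda>x. U x + w x) x))\<^sup>2) \<partial>lebesgue_on ?Q)
          = (\<integral>\<^sup>+ x. ennreal ((norm (grad (m k) x - G x))\<^sup>2) \<partial>lebesgue_on ?Q)"
        proof (rule nn_integral_cong_AE)
          show "AE x in lebesgue_on ?Q. ennreal ((norm (grad (\<lambda>x. U x + m k x) x - weak_grad ?Q (\<lambda>x. U x + w x) x))\<^sup>2)
            = ennreal ((norm (grad (m k) x - G x))\<^sup>2)"
            using wAE
          proof eventually_elim
            case (elim x)
            show ?case by (simp add: elim grad_add[OF smooth_differentiable[OF U] smooth_differentiable[OF M(1)]])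
          qed
        qed
        also have "\<dots> \<le> (\<integral>\<^sup>+ x. ennreal ((norm (grad (m k) x - G x))\<^sup>2) \<partial>lebesgue)" by (rule sub)
        also have "\<dots> = (\<integral>\<^sup>+ x. (\<Sum>j\<in>UNIV. ennreal ((grad (m k) x $ j - G x $ j)\<^sup>2)) \<partial>lebesgue)"
          by (simp add: n2)
        also have "\<dots> = (\<Sum>j\<in>UNIV. \<integral>\<^sup>+ x. ennreal ((grad (m k) x $ j - G x $ j)\<^sup>2) \<partial>lebesgue)"
          by (rule nn_integral_sum) measurable
        finally show "(\<integral>\<^sup>+ x. ennreal ((norm (grad (\<lambda>x. U x + m k x) x - weak_grad ?Q (\<lambda>x. U x + w x) x))\<^sup>2) \<partial>lebesgue_on ?Q)
         \<le> (\<Sum>j\<in>UNIV. \<integral>\<^sup>+ x. ennreal ((grad (m k) x $ j - G x $ j)\<^sup>2) \<partial>lebesgue)" .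
      qed
      show "(\<lambda>k. \<Sum>j\<in>UNIV. \<integral>\<^sup>+ x. ennreal ((grad (m k) x $ j - G x $ j)\<^sup>2) \<partial>lebesgue) \<longlonglongrightarrow> 0"
        using lim by simp
    qed simp
    have m0: "m k x = 0" if "x \<notin> ?Q" for k x
    proof -
      have "m k x = moll (\<lambda>x. 0) (scale_moll (d k) \<phi>) x"
        unfolding m_def
      proof (rule moll_local[OF d(1)])
        fix y assume y: "dist x y < d k"
        have "y \<notin> K"
        proof
          assume "y \<in> K"
          moreover have "x \<in> cball y e" using y d(2)[of k] by (simp add: dist_commute)
          ultimately show False using e(2) that by blast
        qed
        then show "w y = 0" by (rule z)
      qed
      then show ?thesis by (simp add: moll_def)
    qed
    \<comment> \<open>The parametrised faces lie outside the open cube, where every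
      \<open>m k\<close> vanishes.\<close>
    have bd: "r *\<^sub>R R (\<chi> j. if j = i then s / 2 else y $ j) \<notin> ?Q" if "s \<in> {-1, 1::real}" for i s y
    proof -
      have "\<bar>(r *\<^sub>R R (\<chi> j. if j = i then s / 2 else y $ j)) \<bullet> R (axis i 1)\<bar> = r / 2"
        using that r by (auto simp: orthogonal_frame_inner[OF R])
      then show ?thesis unfolding mem_cube[OF R r] by (metis less_irrefl)
    qed
    have "cube_boundary_integral R r (\<lambda>x. ennreal ((U x + m k x - U x)\<^sup>2)) = 0" for k
      unfolding cube_boundary_integral_def by (intro sum.neutral ballI) (simp only: m0[OF bd], simp)
    then show "(\<lambda>k. cube_boundary_integral R r (\<lambda>x. ennreal ((U x + m k x - U x)\<^sup>2))) \<longlonglongrightarrow> 0" by simp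
  qed
qed

end

section \<open>The recession function and the energy density\<close>

locale recession_function =
  fixes \<Psi> :: "real^'n^'m \<Rightarrow> real" and c :: real
  assumes cont: "continuous_on UNIV \<Psi>" and c1: "c \<ge> 1"
    and lower: "\<And>\<xi>. max ((norm \<xi>)\<^sup>2 / c - c) 0 \<le> \<Psi> \<xi>"
    and upper: "\<And>\<xi>. \<Psi> \<xi> \<le> c * ((norm \<xi>)\<^sup>2 + 1)"
    and unif: "uniform_limit (sphere 0 1) (\<lambda>t \<xi>. \<Psi> (t *\<^sub>R \<xi>) / t\<^sup>2) (recession \<Psi>) at_top"
begin

lemma recession_scale_tendsto:
  assumes "norm \<xi> = 1" "a > 0"
  shows "((\<lambda>t. \<Psi> (t *\<^sub>R (a *\<^sub>R \<xi>)) / t\<^sup>2) \<longlongrightarrow> a\<^sup>2 * recession \<Psi> \<xi>) at_top"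
proof -
  have "((\<lambda>t. \<Psi> (t *\<^sub>R \<xi>) / t\<^sup>2) \<longlongrightarrow> recession \<Psi> \<xi>) at_top"
    by (rule tendsto_uniform_limitI[OF unif]) (use assms in simp)
  moreover have "filterlim (\<lambda>t. t * a) at_top at_top"
    using assms(2) by (intro filterlim_at_top_mult_tendsto_pos[OF tendsto_const]) (auto simp: filterlim_ident)
  ultimately have "((\<lambda>t. \<Psi> ((t * a) *\<^sub>R \<xi>) / (t * a)\<^sup>2) \<longlongrightarrow> recession \<Psi> \<xi>) at_top"
    by (rule filterlim_compose)
  then have "((\<lambda>t. a\<^sup>2 * (\<Psi> ((t * a) *\<^sub>R \<xi>) / (t * a)\<^sup>2)) \<longlongrightarrow> a\<^sup>2 * recession \<Psi> \<xi>) at_top"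
    by (intro tendsto_intros)
  then show ?thesis using assms(2) by (simp add: power_mult_distrib)
qed

text \<open>\<open>Lim\<close> has a meaning only where a limit exists. On the sphere existence is
  assumed; elsewhere it follows by scaling the argument, and at zero because a constant is divided
  by the square of \<open>t\<close>.\<close>

lemma recession_tendsto: "((\<lambda>t. \<Psi> (t *\<^sub>R \<xi>) / t\<^sup>2) \<longlongrightarrow> recession \<Psi> \<xi>) at_top"
proof -
  have "\<exists>L. ((\<lambda>t. \<Psi> (t *\<^sub>R \<xi>) / t\<^sup>2) \<longlongrightarrow> L) at_top"
  proof (cases "\<xi> = 0")
    case True
    have "((\<lambda>t::real. \<Psi> 0 / t\<^sup>2) \<longlongrightarrow> 0) at_top" by real_asymp
    then show ?thesis using True by auto
  next
    case False
    then show ?thesis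
      using recession_scale_tendsto[of "(1 / norm \<xi>) *\<^sub>R \<xi>" "norm \<xi>"] by auto
  qed
  then obtain L where L: "((\<lambda>t. \<Psi> (t *\<^sub>R \<xi>) / t\<^sup>2) \<longlongrightarrow> L) at_top" ..
  then have "recession \<Psi> \<xi> = L" unfolding recession_def by (intro tendsto_Lim) auto
  then show ?thesis using L by simp
qed

lemma recession_scale:
  assumes "a > 0"
  shows "recession \<Psi> (a *\<^sub>R \<xi>) = a\<^sup>2 * recession \<Psi> \<xi>"
proof (rule tendsto_unique[OF _ recession_tendsto])
  have "filterlim (\<lambda>t. t * a) at_top at_top"
    using assms by (intro filterlim_at_top_mult_tendsto_pos[OF tendsto_const]) (auto simp: filterlim_ident)
  from filterlim_compose[OF recession_tendsto this]
  have "((\<lambda>t. a\<^sup>2 * (\<Psi> ((t * a) *\<^sub>R \<xi>) / (t * a)\<^sup>2)) \<longlongrightarrow> a\<^sup>2 * recession \<Psi> \<xi>) at_top"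
    by (intro tendsto_intros)
  then show "((\<lambda>t. \<Psi> (t *\<^sub>R (a *\<^sub>R \<xi>)) / t\<^sup>2) \<longlongrightarrow> a\<^sup>2 * recession \<Psi> \<xi>) at_top"
    using assms by (simp add: power_mult_distrib)
qed simp

lemma recession_lower: "(norm \<xi>)\<^sup>2 / c \<le> recession \<Psi> \<xi>"
proof (rule tendsto_le[OF _ recession_tendsto])
  show "((\<lambda>t. (norm \<xi>)\<^sup>2 / c - c / t\<^sup>2) \<longlongrightarrow> (norm \<xi>)\<^sup>2 / c) at_top" by real_asymp
  show "eventually (\<lambda>t. (norm \<xi>)\<^sup>2 / c - c / t\<^sup>2 \<le> \<Psi> (t *\<^sub>R \<xi>) / t\<^sup>2) at_top"
    using eventually_gt_at_top[of 0]
  proof eventually_elim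
    case (elim t)
    have "(norm \<xi>)\<^sup>2 / c - c / t\<^sup>2 = ((norm (t *\<^sub>R \<xi>))\<^sup>2 / c - c) / t\<^sup>2"
      using elim by (simp add: power_mult_distrib diff_divide_distrib)
    also have "\<dots> \<le> \<Psi> (t *\<^sub>R \<xi>) / t\<^sup>2" using lower[of "t *\<^sub>R \<xi>"] by (intro divide_right_mono) auto
    finally show ?case .
  qed
qed simp

lemma recession_upper: "recession \<Psi> \<xi> \<le> c * (norm \<xi>)\<^sup>2"
proof (rule tendsto_le[OF _ _ recession_tendsto])
  show "((\<lambda>t. c * (norm \<xi>)\<^sup>2 + c / t\<^sup>2) \<longlongrightarrow> c * (norm \<xi>)\<^sup>2) at_top" by real_asymp
  show "eventually (\<lambda>t. \<Psi> (t *\<^sub>R \<xi>) / t\<^sup>2 \<le> c * (norm \<xi>)\<^sup>2 + c / t\<^sup>2) at_top"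
    using eventually_gt_at_top[of 0]
  proof eventually_elim
    case (elim t)
    have "\<Psi> (t *\<^sub>R \<xi>) / t\<^sup>2 \<le> (c * ((norm (t *\<^sub>R \<xi>))\<^sup>2 + 1)) / t\<^sup>2"
      using upper[of "t *\<^sub>R \<xi>"] by (intro divide_right_mono) auto
    also have "\<dots> = c * (norm \<xi>)\<^sup>2 + c / t\<^sup>2" using elim by (simp add: power_mult_distrib field_simps)
    finally show ?case .
  qed
qed simp

lemma recession_nonneg: "0 \<le> recession \<Psi> \<xi>"
proof -
  have "0 \<le> (norm \<xi>)\<^sup>2 / c" using c1 by simp
  then show ?thesis using recession_lower[of \<xi>] by linarith
qed

lemma recession_measurable[measurable]: "recession \<Psi> \<in> borel_measurable borel"
proof (rule borel_measurable_LIMSEQ_real)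
  show "(\<lambda>n. \<Psi> (real n *\<^sub>R \<xi>) / (real n)\<^sup>2) \<longlonglongrightarrow> recession \<Psi> \<xi>" for \<xi>
    by (rule filterlim_compose[OF recession_tendsto filterlim_real_sequentially])
  show "(\<lambda>\<xi>. \<Psi> (real n *\<^sub>R \<xi>) / (real n)\<^sup>2) \<in> borel_measurable borel" for n
    by (intro borel_measurable_divide borel_measurable_const borel_measurable_continuous_onI
        continuous_on_compose2[OF cont]) (auto intro!: continuous_intros)
qed

end

text \<open>First summand of the energy without its factor \<epsilon>. The case distinction keeps
  the convention that a vanishing gradient costs nothing even where the degradation is
  infinite.\<close>

definition bulk :: "real \<Rightarrow> (real^'n^'m \<Rightarrow> real) \<Rightarrow> real^'n^'m \<Rightarrow> real \<Rightarrow> ennreal" where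
  "bulk l \<Psi> J s = (if J = 0 then 0 else (degr_f l s)\<^sup>2 * ennreal (recession \<Psi> J))"

lemma degr_f_measurable[measurable]: "degr_f l \<in> borel_measurable borel"
  unfolding degr_f_def by measurable

lemma degr_f_0[simp]: "degr_f l 0 = 0"
  by (simp add: degr_f_def)

lemma degr_f_mono:
  assumes "l > 0" "s \<le> t"
  shows "degr_f l s \<le> degr_f l t"
proof (cases "t < 1")
  case True
  have "l * s / (1 - s) = l / (1 - s) - l" "l * t / (1 - t) = l / (1 - t) - l"
    using True assms by (auto simp: field_simps)
  moreover have "l / (1 - s) \<le> l / (1 - t)" using True assms by (intro divide_left_mono) auto
  ultimately show ?thesis using True assms by (auto simp: degr_f_def intro: ennreal_leI)
qed (simp add: degr_f_def)

context recession_function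
begin

lemma bulk_measurable[measurable]:
  assumes [measurable]: "J \<in> borel_measurable M" "v \<in> borel_measurable M"
  shows "(\<lambda>x. bulk l \<Psi> (J x) (v x)) \<in> borel_measurable M"
  unfolding bulk_def by measurable

end

lemma weak_jacobian_row: "weak_jacobian A u x $ i = weak_grad A (\<lambda>y. u y $ i) x"
  by (simp add: weak_jacobian_def)

context mollifier
begin

lemma weak_jacobian_AE:
  fixes u :: "real^'n \<Rightarrow> real^'m"
  assumes "open A" "\<And>i. H1 A (\<lambda>x. u x $ i) (\<lambda>x. J x $ i)"
  shows "AE x in lebesgue_on A. weak_jacobian A u x = J x"
proof -
  have "AE x in lebesgue_on A. \<forall>i. weak_grad A (\<lambda>y. u y $ i) x = J x $ i"
    using weak_grad_AE[OF assms] by (subst AE_all_countable) blast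
  then show ?thesis by eventually_elim (simp add: vec_eq_iff[of _ "J _"] weak_jacobian_row)
qed

text \<open>Frees the energy from the chosen representatives: two gradients of one function agree
  almost everywhere, so any explicit ones may be inserted.\<close>

lemma F_inf_eq:
  fixes u :: "real^'n \<Rightarrow> real^'m"
  assumes A: "open A" and u: "\<And>i. H1 A (\<lambda>x. u x $ i) (\<lambda>x. J x $ i)" and v: "H1 A v g"
  shows "F_inf l \<Psi> \<epsilon> u v A = (\<integral>\<^sup>+ x. ennreal \<epsilon> * bulk l \<Psi> (J x) (v x)
      + ennreal ((1 - v x)\<^sup>2 / (4 * \<epsilon>)) + ennreal (\<epsilon> * (norm (g x))\<^sup>2) \<partial>lebesgue_on A)"
  unfolding F_inf_def
proof (rule nn_integral_cong_AE)
  show "AE x in lebesgue_on A. (if weak_jacobian A u x = 0 then 0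
            else ennreal \<epsilon> * (degr_f l (v x))\<^sup>2 * ennreal (recession \<Psi> (weak_jacobian A u x)))
          + ennreal ((1 - v x)\<^sup>2 / (4 * \<epsilon>)) + ennreal (\<epsilon> * (norm (weak_grad A v x))\<^sup>2)
      = ennreal \<epsilon> * bulk l \<Psi> (J x) (v x)
      + ennreal ((1 - v x)\<^sup>2 / (4 * \<epsilon>)) + ennreal (\<epsilon> * (norm (g x))\<^sup>2)"
    using weak_jacobian_AE[OF A u] weak_grad_AE[OF A v]
    by eventually_elim (simp add: bulk_def mult.assoc)
qed

end

lemma W12_vec_H1:
  assumes "W12_vec A u"
  obtains J where "\<And>i. H1 A (\<lambda>x. u x $ i) (\<lambda>x. J x $ i)"
  using that[of "weak_jacobian A u"] assms by (simp add: W12_vec_def weak_jacobian_row W12_H1_weak_grad)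

lemma H1_rows_measurable:
  fixes J :: "real^'n \<Rightarrow> real^'n^'m"
  assumes "\<And>i. H1 A (\<lambda>x. u x $ i) (\<lambda>x. J x $ i)"
  shows "u \<in> borel_measurable (lebesgue_on A)" "J \<in> borel_measurable (lebesgue_on A)"
  by (intro borel_measurable_vec sq_integrable_measurable[OF H1_sq_integrable(1)[OF assms]]
      sq_integrable_measurable[OF H1_sq_integrable(2)[OF assms]])+

section \<open>Scaling of the energy\<close>

lemma nn_integral_scale_domain:
  fixes h :: "real^'n \<Rightarrow> ennreal"
  assumes h: "h \<in> borel_measurable (lebesgue_on A)" and A: "A \<in> sets lebesgue" and a: "a > 0"
  shows "(\<integral>\<^sup>+ x. h (a *\<^sub>R x) \<partial>lebesgue_on {x. a *\<^sub>R x \<in> A}) = ennreal (1 / a ^ CARD('n)) * (\<integral>\<^sup>+ x. h x \<partial>lebesgue_on A)"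
proof -
  have m: "(\<lambda>x. 0 + a *\<^sub>R x) \<in> lebesgue \<rightarrow>\<^sub>M lebesgue"
    using similarity_lebesgue(1)[of "\<lambda>x::real^'n. x" a 0] a by simp
  have B: "{x. a *\<^sub>R x \<in> A} \<in> sets lebesgue"
    using measurable_sets[OF m A] by (simp add: vimage_def)
  have hm: "(\<lambda>x. h x * indicator A x) \<in> borel_measurable lebesgue"
    using h A by (simp add: borel_measurable_restrict_space_iff_ennreal)
  have "ennreal (1 / a ^ CARD('n)) * (\<integral>\<^sup>+ x. h x \<partial>lebesgue_on A)
     = ennreal (1 / a ^ CARD('n)) * (ennreal (a ^ CARD('n)) * (\<integral>\<^sup>+ x. h (a *\<^sub>R x) * indicator A (a *\<^sub>R x) \<partial>lebesgue))"
    using nn_integral_similarity[of "\<lambda>x::real^'n. x" a "\<lambda>x. h x * indicator A x" 0] hm A a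
    by (simp add: nn_integral_restrict_space)
  also have "\<dots> = (\<integral>\<^sup>+ x. h (a *\<^sub>R x) * indicator A (a *\<^sub>R x) \<partial>lebesgue)"
    using a by (simp add: mult.assoc[symmetric] ennreal_mult'[symmetric])
  also have "\<dots> = (\<integral>\<^sup>+ x. h (a *\<^sub>R x) \<partial>lebesgue_on {x. a *\<^sub>R x \<in> A})"
    using B by (subst nn_integral_restrict_space) (auto intro!: nn_integral_cong simp: indicator_def)
  finally show ?thesis by simp
qed

lemma scaled_cube:
  assumes "orthogonal_transformation R" "a > 0" "r > 0"
  shows "{x. a *\<^sub>R x \<in> cube R r} = cube R (r / a)"
  using assms by (auto simp: mem_cube abs_mult field_simps)

lemma H1_scale:
  fixes v :: "real^'n \<Rightarrow> real"
  assumes "H1 A v g" "A \<in> sets lebesgue" "a > 0"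
  shows "H1 {x. a *\<^sub>R x \<in> A} (\<lambda>x. v (a *\<^sub>R x)) (\<lambda>x. a *\<^sub>R g (a *\<^sub>R x))"
  using H1_affine[OF assms, of 0] by simp

locale phase_field = mollifier \<phi> + recession_function \<Psi> c
  for \<phi> :: "real^'n \<Rightarrow> real" and \<Psi> :: "real^'n^'m \<Rightarrow> real" and c
begin

lemma bulk_scale: "a > 0 \<Longrightarrow> bulk l \<Psi> (a *\<^sub>R J) s = ennreal (a\<^sup>2) * bulk l \<Psi> J s"
  by (simp add: bulk_def recession_scale ennreal_mult recession_nonneg mult_ac)

text \<open>Each of the three terms gains exactly one factor \<open>a\<close>: the gradient terms as
  \<epsilon>/a times a^2, the potential from dividing by \<epsilon>/a. The volume contributes a^-n,
  which leaves a^-(n-1).\<close>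

lemma F_inf_scale:
  fixes u :: "real^'n \<Rightarrow> real^'m"
  assumes A: "open A" and u: "W12_vec A u" and v: "W12 A v" and a: "a > 0" and \<epsilon>: "\<epsilon> > 0"
  shows "F_inf l \<Psi> (\<epsilon> / a) (\<lambda>x. u (a *\<^sub>R x)) (\<lambda>x. v (a *\<^sub>R x)) {x. a *\<^sub>R x \<in> A}
     = ennreal (1 / a ^ (CARD('n) - 1)) * F_inf l \<Psi> \<epsilon> u v A"
    and "W12_vec {x. a *\<^sub>R x \<in> A} (\<lambda>x. u (a *\<^sub>R x))" and "W12 {x. a *\<^sub>R x \<in> A} (\<lambda>x. v (a *\<^sub>R x))"
proof -
  let ?B = "{x. a *\<^sub>R x \<in> A}"
  have Al: "A \<in> sets lebesgue" using A by (rule open_lebesgue)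
  have B: "open ?B"
    using continuous_open_vimage[of A "\<lambda>x. a *\<^sub>R x"] A by (simp add: vimage_def continuous_intros)
  obtain J where J: "\<And>i. H1 A (\<lambda>x. u x $ i) (\<lambda>x. J x $ i)" using W12_vec_H1[OF u] by blast
  obtain g where g: "H1 A v g" using v W12_iff_H1 by blast
  have J': "H1 ?B (\<lambda>x. u (a *\<^sub>R x) $ i) (\<lambda>x. (a *\<^sub>R J (a *\<^sub>R x)) $ i)" for i
    using H1_scale[OF J Al a] by simp
  have g': "H1 ?B (\<lambda>x. v (a *\<^sub>R x)) (\<lambda>x. a *\<^sub>R g (a *\<^sub>R x))" by (rule H1_scale[OF g Al a])
  show "W12_vec ?B (\<lambda>x. u (a *\<^sub>R x))" "W12 ?B (\<lambda>x. v (a *\<^sub>R x))"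
    using J' g' unfolding W12_vec_def W12_iff_H1 by blast+
  let ?h = "\<lambda>x. ennreal \<epsilon> * bulk l \<Psi> (J x) (v x) + ennreal ((1 - v x)\<^sup>2 / (4 * \<epsilon>)) + ennreal (\<epsilon> * (norm (g x))\<^sup>2)"
  note [measurable] = H1_rows_measurable[OF J] sq_integrable_measurable[OF H1_sq_integrable(1)[OF g]] sq_integrable_measurable[OF H1_sq_integrable(2)[OF g]]
  have hm: "?h \<in> borel_measurable (lebesgue_on A)" by measurable
  have "F_inf l \<Psi> (\<epsilon> / a) (\<lambda>x. u (a *\<^sub>R x)) (\<lambda>x. v (a *\<^sub>R x)) ?B
    = (\<integral>\<^sup>+ x. ennreal a * ?h (a *\<^sub>R x) \<partial>lebesgue_on ?B)"
    unfolding F_inf_eq[OF B J' g']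
  proof (intro nn_integral_cong)
    fix x :: "real^'n"
    let ?y = "a *\<^sub>R x"
    have "ennreal (\<epsilon> / a) * bulk l \<Psi> (a *\<^sub>R J ?y) (v ?y) = ennreal a * (ennreal \<epsilon> * bulk l \<Psi> (J ?y) (v ?y))"
    proof -
      have "ennreal (\<epsilon> / a) * ennreal (a\<^sup>2) = ennreal (\<epsilon> / a * a\<^sup>2)" using a \<epsilon> by (intro ennreal_mult[symmetric]) auto
      also have "\<epsilon> / a * a\<^sup>2 = a * \<epsilon>" using a by (simp add: power2_eq_square)
      also have "ennreal (a * \<epsilon>) = ennreal a * ennreal \<epsilon>" using a \<epsilon> by (simp add: ennreal_mult)
      finally show ?thesis unfolding bulk_scale[OF a] mult.assoc[symmetric] by simp
    qed
    moreover have "ennreal ((1 - v ?y)\<^sup>2 / (4 * (\<epsilon> / a))) = ennreal a * ennreal ((1 - v ?y)\<^sup>2 / (4 * \<epsilon>))"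
      using a \<epsilon> by (simp add: ennreal_mult'[symmetric] mult.commute)
    moreover have "ennreal (\<epsilon> / a * (norm (a *\<^sub>R g ?y))\<^sup>2) = ennreal a * ennreal (\<epsilon> * (norm (g ?y))\<^sup>2)"
      using a \<epsilon> by (simp add: ennreal_mult'[symmetric] power2_eq_square field_simps)
    ultimately show "ennreal (\<epsilon> / a) * bulk l \<Psi> (a *\<^sub>R J ?y) (v ?y) + ennreal ((1 - v ?y)\<^sup>2 / (4 * (\<epsilon> / a))) + ennreal (\<epsilon> / a * (norm (a *\<^sub>R g ?y))\<^sup>2)
      = ennreal a * ?h ?y"
      by (simp only: distrib_left)
  qed
  also have "\<dots> = ennreal (1 / a ^ CARD('n)) * (\<integral>\<^sup>+ x. ennreal a * ?h x \<partial>lebesgue_on A)"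
    using hm by (intro nn_integral_scale_domain[OF _ Al a]) measurable
  also have "\<dots> = ennreal (1 / a ^ CARD('n)) * (ennreal a * (\<integral>\<^sup>+ x. ?h x \<partial>lebesgue_on A))"
    using hm by (simp add: nn_integral_cmult)
  also have "\<dots> = ennreal (1 / a ^ (CARD('n) - 1)) * (\<integral>\<^sup>+ x. ?h x \<partial>lebesgue_on A)"
  proof -
    have "CARD('n) = Suc (CARD('n) - 1)" by simp
    then have "a ^ CARD('n) = a * a ^ (CARD('n) - 1)" by (metis power_Suc)
    then show ?thesis using a by (simp add: mult.assoc[symmetric] ennreal_mult'[symmetric])
  qed
  also have "\<dots> = ennreal (1 / a ^ (CARD('n) - 1)) * F_inf l \<Psi> \<epsilon> u v A"
    unfolding F_inf_eq[OF A J g] ..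
  finally show "F_inf l \<Psi> (\<epsilon> / a) (\<lambda>x. u (a *\<^sub>R x)) (\<lambda>x. v (a *\<^sub>R x)) ?B
     = ennreal (1 / a ^ (CARD('n) - 1)) * F_inf l \<Psi> \<epsilon> u v A" .
qed

end

section \<open>The boundary profile\<close>

text \<open>Meant for functions with values between 0 and 1: wherever the value 0 or 1 is attained
  the gradient vanishes, also at boundary points of the level set.\<close>

lemma grad_0_extremum:
  fixes f :: "real^'n \<Rightarrow> real"
  assumes d: "f differentiable at x" and ex: "(\<forall>y. f y \<le> f x) \<or> (\<forall>y. f x \<le> f y)"
  shows "grad f x = 0"
proof -
  have "(\<lambda>h. grad f x \<bullet> h) = (\<lambda>h. 0)"
    by (rule differential_zero_maxmin[of x UNIV f]) (use ex has_derivative_grad[OF d] in auto)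
  then have "grad f x \<bullet> grad f x = 0" by metis
  then show ?thesis by simp
qed

lemma moll_bounds:
  assumes f: "loc_integrable f" and "\<And>x. \<bar>f x\<bar> \<le> 1" and \<psi>: "C1_comp r \<psi>"
  shows "\<bar>moll f \<psi> x\<bar> \<le> (LINT y|lebesgue. \<bar>\<psi> y\<bar>)"
proof -
  note C = C1_compD[OF \<psi>]
  have m[measurable]: "\<psi> \<in> borel_measurable lebesgue" using C by (intro continuous_measurable_lebesgue)
  have li: "loc_integrable (\<lambda>x::real^'n. 1)" by (rule loc_integrable_bounded[of _ 1]) auto
  have i1: "integrable lebesgue (\<lambda>y. f y * \<psi> (x - y))" by (rule moll_integrable[OF f C(2), of r]) (rule C(4))
  have i2: "integrable lebesgue (\<lambda>y. 1 * \<psi> (x - y))" by (rule moll_integrable[OF li C(2), of r]) (rule C(4))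
  have "\<bar>moll f \<psi> x\<bar> \<le> (LINT y|lebesgue. \<bar>f y * \<psi> (x - y)\<bar>)"
    unfolding moll_def using integral_norm_bound[of lebesgue "\<lambda>y. f y * \<psi> (x - y)"] by simp
  also have "\<dots> \<le> (LINT y|lebesgue. \<bar>\<psi> (x - y)\<bar>)"
    using i1 i2 assms(2) by (intro integral_mono integrable_abs) (auto simp: abs_mult intro: mult_left_le_one_le)
  also have "\<dots> = (LINT y|lebesgue. \<bar>\<psi> y\<bar>)"
    using integral_reflect[of "\<lambda>y. \<bar>\<psi> y\<bar>" x] by simp
  finally show ?thesis .
qed

context mollifier
begin

lemma scale_moll_1: "scale_moll 1 \<phi> = \<phi>"
  by (simp add: scale_moll_def fun_eq_iff)

lemma convolution_eq_moll:
  fixes h :: "real^'n \<Rightarrow> real"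
  assumes [measurable]: "h \<in> borel_measurable borel"
  shows "convolution h \<phi> = moll h \<phi>"
proof
  fix x
  have "moll h \<phi> x = (LINT t|lebesgue. \<phi> t * h (x - 1 *\<^sub>R t))"
  proof -
    have "h \<in> borel_measurable lebesgue" by (intro measurable_completion) simp
    then show ?thesis using moll_scale_moll[of h \<phi> 1 x] by (simp add: scale_moll_1)
  qed
  also have "\<dots> = convolution h \<phi> x"
    by (simp add: convolution_def integral_completion)
  finally show "convolution h \<phi> x = moll h \<phi> x" by simp
qed

lemma moll_const_near:
  assumes "\<And>y. dist x y < 1 \<Longrightarrow> f y = a"
  shows "moll f \<phi> x = a"
proof -
  have "moll f \<phi> x = moll (\<lambda>y. a) \<phi> x"
    using moll_local[of 1 x f "\<lambda>y. a"] assms by (simp add: scale_moll_1)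
  also have "\<dots> = a * moll (\<lambda>y. 1) \<phi> x" by (simp add: moll_def)
  finally show ?thesis using moll_1[of 1 x] by (simp add: scale_moll_1)
qed

lemma moll_indicator_range:
  assumes S: "S \<in> sets borel"
  shows "0 \<le> moll (indicator S) \<phi> x" "moll (indicator S) \<phi> x \<le> 1"
proof -
  have [measurable]: "S \<in> sets lebesgue" using S by simp
  have li: "loc_integrable (indicator S)" by (rule loc_integrable_bounded[of _ 1]) (auto split: split_indicator)
  show "0 \<le> moll (indicator S) \<phi> x"
    unfolding moll_def by (intro integral_nonneg_AE AE_I2 mult_nonneg_nonneg nonneg) auto
  have "\<bar>moll (indicator S) \<phi> x\<bar> \<le> (LINT y|lebesgue. \<bar>\<phi> y\<bar>)"
    by (rule moll_bounds[OF li _ C1]) (auto split: split_indicator)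
  then show "moll (indicator S) \<phi> x \<le> 1" using integral_lebesgue nonneg by simp
qed

lemma moll_translate:
  assumes "f \<in> borel_measurable borel" "\<And>y. f (y + w) = f y"
  shows "moll f \<phi> (x + w) = moll f \<phi> x"
  unfolding convolution_eq_moll[OF assms(1), symmetric] convolution_def
  using assms(2) by (metis (no_types, lifting) add_diff_eq diff_add_eq)

end

locale boundary_profile = mollifier \<phi> for \<phi> :: "real^'n \<Rightarrow> real" +
  fixes \<nu> :: "real^'n"
  assumes \<nu>: "norm \<nu> = 1"
begin

definition jump_profile :: "real^'n \<Rightarrow> real" where
  "jump_profile = moll (indicator {y. 0 < y \<bullet> \<nu>}) \<phi>"

definition damage_profile :: "real^'n \<Rightarrow> real" where
  "damage_profile = moll (indicator {y. 2 \<le> \<bar>y \<bullet> \<nu>\<bar>}) \<phi>"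

lemma profile_sets[measurable]: "{y. 0 < y \<bullet> \<nu>} \<in> sets borel" "{y. 2 \<le> \<bar>y \<bullet> \<nu>\<bar>} \<in> sets borel"
proof -
  have "open {y. 0 < y \<bullet> \<nu>}" by (intro open_Collect_less continuous_intros)
  then show "{y. 0 < y \<bullet> \<nu>} \<in> sets borel" by simp
  have "closed {y. 2 \<le> \<bar>y \<bullet> \<nu>\<bar>}" by (intro closed_Collect_le continuous_intros)
  then show "{y. 2 \<le> \<bar>y \<bullet> \<nu>\<bar>} \<in> sets borel" by simp
qed

lemma loc_integrable_indicator: "S \<in> sets borel \<Longrightarrow> loc_integrable (indicator S :: real^'n \<Rightarrow> real)"
  by (rule loc_integrable_bounded[of _ 1]) (auto split: split_indicator intro!: borel_measurable_indicator)

lemma smooth_profile: "smooth jump_profile" "smooth damage_profile"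
  unfolding jump_profile_def damage_profile_def
  by (intro smooth_moll[OF loc_integrable_indicator test] profile_sets)+

lemma convolution_profile:
  "convolution (indicat_real {y. 2 \<le> \<bar>y \<bullet> \<nu>\<bar>}) \<phi> = damage_profile"
  "convolution (\<lambda>y. indicat_real {y. 0 < y \<bullet> \<nu>} y *\<^sub>R z) \<phi> x $ i = z $ i * jump_profile x"
  for z :: "real^'m"
proof -
  show "convolution (indicat_real {y. 2 \<le> \<bar>y \<bullet> \<nu>\<bar>}) \<phi> = damage_profile"
    unfolding damage_profile_def by (rule convolution_eq_moll) measurable
  have "convolution (\<lambda>y. indicat_real {y. 0 < y \<bullet> \<nu>} y *\<^sub>R z) \<phi> x
      = (LINT y|lborel. (\<phi> y * indicat_real {y. 0 < y \<bullet> \<nu>} (x - y)) *\<^sub>R z)"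
    by (simp add: convolution_def)
  also have "\<dots> = (LINT y|lborel. \<phi> y * indicat_real {y. 0 < y \<bullet> \<nu>} (x - y)) *\<^sub>R z"
  proof (rule integral_scaleR_left)
    show "integrable lborel (\<lambda>y. \<phi> y * indicat_real {y. 0 < y \<bullet> \<nu>} (x - y))"
      by (rule Bochner_Integration.integrable_bound[OF integrable_lborel]) (auto split: split_indicator)
  qed
  also have "(LINT y|lborel. \<phi> y * indicat_real {y. 0 < y \<bullet> \<nu>} (x - y)) = jump_profile x"
    unfolding jump_profile_def by (subst convolution_eq_moll[symmetric]) (auto simp: convolution_def)
  finally show "convolution (\<lambda>y. indicat_real {y. 0 < y \<bullet> \<nu>} y *\<^sub>R z) \<phi> x $ i = z $ i * jump_profile x"
    by simp
qed

lemma dist_inner_\<nu>: "\<bar>x \<bullet> \<nu> - y \<bullet> \<nu>\<bar> \<le> dist x y"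
  using Cauchy_Schwarz_ineq2[of "x - y" \<nu>] \<nu> by (simp add: dist_norm inner_diff_left)

lemma jump_profile_range: "0 \<le> jump_profile x" "jump_profile x \<le> 1"
  unfolding jump_profile_def by (intro moll_indicator_range profile_sets)+

lemma damage_profile_range: "0 \<le> damage_profile x" "damage_profile x \<le> 1"
  unfolding damage_profile_def by (intro moll_indicator_range profile_sets)+

lemma jump_profile_eq:
  assumes "1 \<le> \<bar>x \<bullet> \<nu>\<bar>"
  shows "jump_profile x = indicator {y. 0 < y \<bullet> \<nu>} x"
  unfolding jump_profile_def
proof (rule moll_const_near)
  fix y assume "dist x y < 1"
  then have "0 < y \<bullet> \<nu> \<longleftrightarrow> 0 < x \<bullet> \<nu>" using dist_inner_\<nu>[of x y] assms by (auto simp: abs_if split: if_splits)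
  then show "indicator {y. 0 < y \<bullet> \<nu>} y = (indicator {y. 0 < y \<bullet> \<nu>} x :: real)" by (simp add: indicator_def)
qed

lemma damage_profile_1: "3 \<le> \<bar>x \<bullet> \<nu>\<bar> \<Longrightarrow> damage_profile x = 1"
  unfolding damage_profile_def
proof (rule moll_const_near)
  fix y assume "3 \<le> \<bar>x \<bullet> \<nu>\<bar>" "dist x y < 1"
  then have "2 \<le> \<bar>y \<bullet> \<nu>\<bar>" using dist_inner_\<nu>[of x y] by linarith
  then show "indicator {y. 2 \<le> \<bar>y \<bullet> \<nu>\<bar>} y = (1 :: real)" by simp
qed

lemma damage_profile_0: "\<bar>x \<bullet> \<nu>\<bar> \<le> 1 \<Longrightarrow> damage_profile x = 0"
  unfolding damage_profile_def
proof (rule moll_const_near)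
  fix y assume "\<bar>x \<bullet> \<nu>\<bar> \<le> 1" "dist x y < 1"
  then have "\<not> 2 \<le> \<bar>y \<bullet> \<nu>\<bar>" using dist_inner_\<nu>[of x y] by linarith
  then show "indicator {y. 2 \<le> \<bar>y \<bullet> \<nu>\<bar>} y = (0 :: real)" by simp
qed

lemma grad_jump_profile_0: "1 \<le> \<bar>x \<bullet> \<nu>\<bar> \<Longrightarrow> grad jump_profile x = 0"
  using jump_profile_eq[of x] jump_profile_range
  by (intro grad_0_extremum smooth_differentiable smooth_profile) (auto simp: indicator_def split: if_splits)

lemma grad_damage_profile_0: "3 \<le> \<bar>x \<bullet> \<nu>\<bar> \<Longrightarrow> grad damage_profile x = 0"
  using damage_profile_1[of x] damage_profile_range
  by (intro grad_0_extremum smooth_differentiable smooth_profile) auto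

text \<open>The derivative falls on the kernel, so the L1 norms of the partial derivatives of \<phi>
  bound the gradient on the whole space.\<close>

lemma grad_damage_profile_bounded:
  obtains B where "B > 0" "\<And>x. norm (grad damage_profile x) \<le> B"
proof -
  define b where "b j = (LINT y|lebesgue. \<bar>grad \<phi> y $ j\<bar>)" for j
  have "\<bar>grad damage_profile x $ j\<bar> \<le> b j" for x j
  proof -
    obtain r where r: "C1_comp r (\<lambda>x. grad \<phi> x $ j)" using test_fun_C1_comp[OF test_fun_grad[OF test]] by blast
    show ?thesis
      unfolding damage_profile_def b_def
      using grad_moll[OF loc_integrable_indicator[OF profile_sets(2)] C1]
        moll_bounds[OF loc_integrable_indicator[OF profile_sets(2)] _ r, of x]
      by (simp split: split_indicator)
  qed
  then have "norm (grad damage_profile x) \<le> (\<Sum>j\<in>UNIV. b j)" for x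
    by (intro order_trans[OF norm_le_l1_cart] sum_mono)
  moreover have "(\<Sum>j\<in>UNIV. b j) \<le> \<bar>\<Sum>j\<in>UNIV. b j\<bar> + 1" by linarith
  ultimately have "norm (grad damage_profile x) \<le> \<bar>\<Sum>j\<in>UNIV. b j\<bar> + 1" for x
    by (rule order_trans)
  then show ?thesis by (rule that[rotated]) linarith
qed

text \<open>Invariance along the hyperplane: all tiles, shifted in directions orthogonal to \<nu>,
  see the same boundary values.\<close>

lemma profile_translate:
  assumes "w \<bullet> \<nu> = 0"
  shows "jump_profile (x + w) = jump_profile x" "damage_profile (x + w) = damage_profile x"
    "grad jump_profile (x + w) = grad jump_profile x" "grad damage_profile (x + w) = grad damage_profile x"
proof -
  have j: "jump_profile (x + w) = jump_profile x" and d: "damage_profile (x + w) = damage_profile x" for x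
    unfolding jump_profile_def damage_profile_def
    by (rule moll_translate; use assms in \<open>simp add: inner_add_left indicator_def\<close>)+
  show "jump_profile (x + w) = jump_profile x" "damage_profile (x + w) = damage_profile x" by (rule j, rule d)
  show "grad jump_profile (x + w) = grad jump_profile x"
    using grad_affine[of jump_profile 1 x w] smooth_differentiable[OF smooth_profile(1)] j by simp
  show "grad damage_profile (x + w) = grad damage_profile x"
    using grad_affine[of damage_profile 1 x w] smooth_differentiable[OF smooth_profile(2)] d by simp
qed

end

lemma prod_Basis_if:
  fixes k :: "'n::finite"
  shows "(\<Prod>b\<in>(Basis :: (real^'n) set). if b = axis k 1 then a else s) = a * s ^ (CARD('n) - 1)"
proof -
  have "(\<Prod>b\<in>(Basis :: (real^'n) set). if b = axis k 1 then a else s)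
    = a * (\<Prod>b\<in>(Basis :: (real^'n) set) - {axis k 1}. s)"
    by (subst prod.remove[of _ "axis k 1"]) (auto simp: Basis_vec_def intro!: arg_cong2[where f="(*)"] prod.cong)
  also have "\<dots> = a * s ^ (CARD('n) - 1)"
    by (simp add: card_Diff_singleton axis_in_Basis_iff)
  finally show ?thesis .
qed

lemma emeasure_slab:
  fixes R :: "real^'n \<Rightarrow> real^'n"
  assumes R: "orthogonal_transformation R" and r: "r > 0" and h: "0 < h" "h \<le> r / 2"
  shows "{x \<in> cube R r. \<bar>x \<bullet> R (axis k 1)\<bar> < h} \<in> sets lebesgue"
    and "emeasure lebesgue {x \<in> cube R r. \<bar>x \<bullet> R (axis k 1)\<bar> < h} = ennreal (2 * h * r ^ (CARD('n) - 1))"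
proof -
  let ?S = "{x \<in> cube R r. \<bar>x \<bullet> R (axis k 1)\<bar> < h}"
  have "open {x. \<bar>x \<bullet> R (axis k 1)\<bar> < h}" by (intro open_Collect_less continuous_intros)
  then have "open (cube R r \<inter> {x. \<bar>x \<bullet> R (axis k 1)\<bar> < h})" using open_cube[OF R r] by blast
  moreover have "cube R r \<inter> {x. \<bar>x \<bullet> R (axis k 1)\<bar> < h} = ?S" by auto
  ultimately show S: "?S \<in> sets lebesgue" using open_lebesgue by metis
  define B where "B = box (\<chi> j. if j = k then - h else - r / 2) (\<chi> j. if j = k then h else r / 2)"
  have RB: "R y \<in> ?S \<longleftrightarrow> y \<in> B" for y
  proof -
    have "R y \<in> ?S \<longleftrightarrow> (\<forall>j. \<bar>y $ j\<bar> < r / 2) \<and> \<bar>y $ k\<bar> < h"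
      by (simp add: mem_cube[OF R r] orthogonal_frame_inner[OF R])
    also have "\<dots> \<longleftrightarrow> (\<forall>j. \<bar>y $ j\<bar> < (if j = k then h else r / 2))"
    proof
      assume *: "\<forall>j. \<bar>y $ j\<bar> < (if j = k then h else r / 2)"
      have "(if j = k then h else r / 2) \<le> r / 2" for j using h by simp
      then have "\<forall>j. \<bar>y $ j\<bar> < r / 2" using * by (blast intro: order_less_le_trans)
      then show "(\<forall>j. \<bar>y $ j\<bar> < r / 2) \<and> \<bar>y $ k\<bar> < h" using spec[OF *, of k] by simp
    qed simp
    also have "\<dots> \<longleftrightarrow> y \<in> B"
    proof -
      have "\<bar>y $ j\<bar> < (if j = k then h else r / 2) \<longleftrightarrow> (if j = k then - h else - r / 2) < y $ j \<and> y $ j < (if j = k then h else r / 2)" for j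
        by auto
      then show ?thesis unfolding B_def mem_box_cart vec_lambda_beta by simp
    qed
    finally show ?thesis .
  qed
  have "emeasure lebesgue ?S = (\<integral>\<^sup>+ x. indicator ?S x \<partial>lebesgue)"
    using S by (simp del: emeasure_completion)
  also have "\<dots> = ennreal (1 ^ DIM(real^'n)) * (\<integral>\<^sup>+ x. indicator ?S (0 + 1 *\<^sub>R R x) \<partial>lebesgue)"
    by (rule nn_integral_similarity[OF R]) (use S in auto)
  also have "\<dots> = (\<integral>\<^sup>+ x. indicator B x \<partial>lebesgue)"
    using RB by (simp add: indicator_def)
  also have "\<dots> = emeasure lborel B"
    by (simp add: B_def nn_integral_completion)
  also have "\<dots> = ennreal (\<Prod>b\<in>Basis. ((\<chi> j. if j = k then h else r / 2) - (\<chi> j. if j = k then - h else - r / 2)) \<bullet> b)"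
    unfolding B_def using h r by (intro emeasure_lborel_box) (auto simp: Basis_vec_def inner_axis)
  also have "(\<Prod>b\<in>Basis. ((\<chi> j. if j = k then h else r / 2) - (\<chi> j. if j = k then - h else - r / 2)) \<bullet> b)
     = (\<Prod>b\<in>(Basis :: (real^'n) set). if b = axis k 1 then 2 * h else r)"
    by (intro prod.cong) (auto simp: Basis_vec_def inner_axis axis_eq_axis)
  also have "\<dots> = 2 * h * r ^ (CARD('n) - 1)" by (rule prod_Basis_if)
  finally show "emeasure lebesgue ?S = ennreal (2 * h * r ^ (CARD('n) - 1))" .
qed

section \<open>Tiling\<close>

lemma AE_translate:
  fixes P :: "real^'n \<Rightarrow> bool"
  assumes "AE x in lebesgue. P x"
  shows "AE x in lebesgue. P (x + t)"
proof -
  obtain N where N: "negligible N" "\<And>x. \<not> P x \<Longrightarrow> x \<in> N"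
    using assms unfolding eventually_ae_filter negligible_iff_null_sets by auto
  have "negligible ((+) (- t) ` N)" using N(1) by (rule negligible_translation)
  then have "AE x in lebesgue. x \<notin> (+) (- t) ` N" by (intro AE_not_in) (simp add: negligible_iff_null_sets)
  then show ?thesis
  proof eventually_elim
    case (elim x)
    show ?case
    proof (rule ccontr)
      assume "\<not> P (x + t)"
      then have "x + t \<in> N" by (rule N(2))
      then have "x \<in> (+) (- t) ` N" by (intro image_eqI[of _ _ "x + t"]) auto
      then show False using elim by blast
    qed
  qed
qed

lemma closure_cube_subset:
  assumes R: "orthogonal_transformation R" and "0 < r" "r < s"
  shows "compact (closure (cube R r))" "closure (cube R r) \<subseteq> cube R s"
proof -
  show "compact (closure (cube R r))" using bounded_cube[OF R] by simp
  have "closed (\<Inter>j. {x. \<bar>x \<bullet> R (axis j 1)\<bar> \<le> r / 2})"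
    by (intro closed_INT ballI closed_Collect_le continuous_intros)
  moreover have "cube R r \<subseteq> (\<Inter>j. {x. \<bar>x \<bullet> R (axis j 1)\<bar> \<le> r / 2})"
    using mem_cube[OF R assms(2)] by (auto intro: less_imp_le)
  ultimately have "closure (cube R r) \<subseteq> (\<Inter>j. {x. \<bar>x \<bullet> R (axis j 1)\<bar> \<le> r / 2})" by (rule closure_minimal[rotated])
  also have "\<dots> \<subseteq> cube R s"
  proof
    fix x assume x: "x \<in> (\<Inter>j. {x. \<bar>x \<bullet> R (axis j 1)\<bar> \<le> r / 2})"
    have "\<bar>x \<bullet> R (axis j 1)\<bar> < s / 2" for j
    proof -
      have "\<bar>x \<bullet> R (axis j 1)\<bar> \<le> r / 2" using x by blast
      then show ?thesis using assms by linarith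
    qed
    then show "x \<in> cube R s" using mem_cube[OF R, of s] assms by simp
  qed
  finally show "closure (cube R r) \<subseteq> cube R s" .
qed

text \<open>Integrand of the energy for \<epsilon> = 1, with the gradients as arguments.\<close>

definition energy_density :: "real \<Rightarrow> (real^'n^'m \<Rightarrow> real) \<Rightarrow> real^'n^'m \<Rightarrow> real \<Rightarrow> real^'n \<Rightarrow> ennreal" where
  "energy_density l \<Psi> J s g = bulk l \<Psi> J s + ennreal ((1 - s)\<^sup>2 / 4) + ennreal ((norm g)\<^sup>2)"

lemma H1_translate_UNIV:
  fixes v :: "real^'n \<Rightarrow> real"
  assumes "H1 UNIV v G"
  shows "H1 UNIV (\<lambda>x. v (x - t)) (\<lambda>x. G (x - t))"
  using H1_affine[OF assms, of 1 "- t"] by simp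

locale cell_problem = phase_field \<phi> \<Psi> c + boundary_profile \<phi> \<nu>
  for \<phi> :: "real^'n \<Rightarrow> real" and \<Psi> :: "real^'n^'m \<Rightarrow> real" and c and \<nu> :: "real^'n" +
  fixes R :: "real^'n \<Rightarrow> real^'n" and k :: 'n and l :: real and z :: "real^'m"
  assumes R: "orthogonal_transformation R" and Rk: "R (axis k 1) = \<nu>" and l: "l > 0"
begin

abbreviation Q :: "real \<Rightarrow> (real^'n) set" where "Q T \<equiv> cube R T"

definition jump :: "real^'n \<Rightarrow> real^'m" where "jump x = indicat_real {y. 0 < y \<bullet> \<nu>} x *\<^sub>R z"
definition smooth_jump :: "real^'n \<Rightarrow> real^'m" where "smooth_jump x = jump_profile x *\<^sub>R z"
definition jump_jacobian :: "real^'n \<Rightarrow> real^'n^'m" where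
  "jump_jacobian x = (\<chi> i. z $ i *\<^sub>R grad jump_profile x)"

lemma jump_measurable [measurable]: "jump \<in> borel_measurable (lebesgue_on A)"
  unfolding jump_def by (intro measurable_restrict_space1 measurable_completion) measurable

lemma smooth_smooth_jump: "smooth (\<lambda>x. smooth_jump x $ i)"
  using smooth_mult[OF smooth_profile(1) smooth_const[of "z $ i"]] by (simp add: smooth_jump_def)

lemma grad_smooth_jump: "grad (\<lambda>x. smooth_jump x $ i) x = jump_jacobian x $ i"
  using grad_cmult[OF smooth_differentiable[OF smooth_profile(1)], of "z $ i"]
  by (simp add: smooth_jump_def jump_jacobian_def mult.commute)

lemma admissible_iff:
  "(u, v) \<in> admissible \<phi> R z \<nu> T \<longleftrightarrow> W12_vec (Q T) u \<and> W12 (Q T) v \<and>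
     (AE x in lebesgue_on (Q T). 0 \<le> v x \<and> v x \<le> 1) \<and> has_trace R T v damage_profile \<and>
     (\<forall>i. has_trace R T (\<lambda>x. u x $ i) (\<lambda>x. smooth_jump x $ i))"
  unfolding admissible_def by (simp add: convolution_profile smooth_jump_def mult.commute)

lemma open_Q: "T > 0 \<Longrightarrow> open (Q T)" and bounded_Q: "bounded (Q T)" and Q_lebesgue: "T > 0 \<Longrightarrow> Q T \<in> sets lebesgue"
  using R by (auto intro: open_cube bounded_cube cube_lebesgue)

lemma F_inf_1:
  assumes "T > 0" and "\<And>i. H1 (Q T) (\<lambda>x. u x $ i) (\<lambda>x. J x $ i)" and "H1 (Q T) v g"
  shows "F_inf l \<Psi> 1 u v (Q T) = (\<integral>\<^sup>+ x. energy_density l \<Psi> (J x) (v x) (g x) \<partial>lebesgue_on (Q T))"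
  using F_inf_eq[OF open_Q[OF assms(1)] assms(2,3), of l \<Psi> 1] by (simp add: energy_density_def)

lemma bulk_profile: "bulk l \<Psi> (jump_jacobian x) (damage_profile x) = 0"
proof (cases "\<bar>x \<bullet> \<nu>\<bar> \<le> 1")
  case True
  then show ?thesis by (simp add: bulk_def damage_profile_0)
next
  case False
  then have "jump_jacobian x = 0" by (simp add: jump_jacobian_def grad_jump_profile_0 vec_eq_iff)
  then show ?thesis by (simp add: bulk_def)
qed

lemma profile_energy:
  obtains C where "C > 0" "\<And>x. energy_density l \<Psi> (jump_jacobian x) (damage_profile x) (grad damage_profile x)
    \<le> ennreal C * indicator {y. \<bar>y \<bullet> \<nu>\<bar> < 3} x"
proof -
  obtain B where B: "B > 0" "\<And>x. norm (grad damage_profile x) \<le> B" using grad_damage_profile_bounded by blast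
  have "energy_density l \<Psi> (jump_jacobian x) (damage_profile x) (grad damage_profile x)
    \<le> ennreal (1 / 4 + B\<^sup>2) * indicator {y. \<bar>y \<bullet> \<nu>\<bar> < 3} x" for x
  proof (cases "\<bar>x \<bullet> \<nu>\<bar> < 3")
    case True
    have "(1 - damage_profile x)\<^sup>2 \<le> 1\<^sup>2" using damage_profile_range[of x] by (intro power_mono) auto
    moreover have "(norm (grad damage_profile x))\<^sup>2 \<le> B\<^sup>2" by (intro power_mono B) auto
    ultimately show ?thesis using True
      by (simp add: energy_density_def bulk_profile ennreal_plus[symmetric] ennreal_leI del: ennreal_plus)
  next
    case False
    then show ?thesis
      using bulk_profile[of x] by (simp add: energy_density_def damage_profile_1 grad_damage_profile_0)
  qed
  then show ?thesis using that[of "1 / 4 + B\<^sup>2"] B(1) by (simp add: add_pos_nonneg)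
qed

lemma jump_eq: "1 \<le> \<bar>x \<bullet> \<nu>\<bar> \<Longrightarrow> smooth_jump x = jump x"
  by (simp add: smooth_jump_def jump_def jump_profile_eq)

lemma norm_smooth_jump_diff: "norm (smooth_jump x - jump x) \<le> norm z * indicator {y. \<bar>y \<bullet> \<nu>\<bar> < 1} x"
proof (cases "\<bar>x \<bullet> \<nu>\<bar> < 1")
  case True
  have "\<bar>jump_profile x - indicat_real {y. 0 < y \<bullet> \<nu>} x\<bar> \<le> 1" using jump_profile_range[of x] by (auto simp: indicator_def)
  then have "norm ((jump_profile x - indicat_real {y. 0 < y \<bullet> \<nu>} x) *\<^sub>R z) \<le> 1 * norm z"
    unfolding norm_scaleR by (intro mult_right_mono) auto
  then show ?thesis using True by (simp add: smooth_jump_def jump_def scaleR_diff_left)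
qed (simp add: jump_eq)

lemma slab_lebesgue:
  assumes "T > 0" "0 < h" "h \<le> T / 2"
  shows "{x \<in> Q T. \<bar>x \<bullet> \<nu>\<bar> < h} \<in> sets lebesgue"
    "emeasure lebesgue {x \<in> Q T. \<bar>x \<bullet> \<nu>\<bar> < h} = ennreal (2 * h * T ^ (CARD('n) - 1))"
  using emeasure_slab[OF R assms, of k] by (simp_all add: Rk)

text \<open>The centres form a grid in the hyperplane that is symmetric about the origin: along each
  axis other than \<open>k\<close>, the \<open>N\<close> tiles of side \<open>T\<close> fill, up to
  their faces, the centred interval of length \<open>N * T\<close>.\<close>

definition shift :: "real \<Rightarrow> nat \<Rightarrow> ('n \<Rightarrow> nat) \<Rightarrow> real^'n" where
  "shift T N i = R (\<chi> j. if j = k then 0 else T * (real (i j) - (real N - 1) / 2))"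

definition tiles :: "nat \<Rightarrow> ('n \<Rightarrow> nat) set" where
  "tiles N = PiE (UNIV - {k}) (\<lambda>_. {..<N})"

text \<open>Written as the profile plus shifted zero extensions of \<open>w - P\<close>, so that
  regularity follows from \<open>trace_zero_extension\<close> by summation and no gluing along faces
  occurs. The same operator acts on functions and on their gradients.\<close>

definition tile :: "real \<Rightarrow> nat \<Rightarrow> (real^'n \<Rightarrow> 'b::real_vector) \<Rightarrow> (real^'n \<Rightarrow> 'b) \<Rightarrow> real^'n \<Rightarrow> 'b" where
  "tile T N P w x = P x + (\<Sum>i\<in>tiles N. indicat_real (Q T) (x - shift T N i) *\<^sub>R (w (x - shift T N i) - P (x - shift T N i)))"

lemma finite_tiles: "finite (tiles N)" and card_tiles: "card (tiles N) = N ^ (CARD('n) - 1)"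
  unfolding tiles_def by (auto intro: finite_PiE simp: card_PiE card_Diff_singleton)

lemma shift_inner: "shift T N i \<bullet> R (axis j 1) = (if j = k then 0 else T * (real (i j) - (real N - 1) / 2))"
  unfolding shift_def by (simp add: orthogonal_frame_inner[OF R])

lemma shift_\<nu>: "shift T N i \<bullet> \<nu> = 0"
  using shift_inner[of T N i k] by (simp add: Rk)

lemma tile_disjoint:
  assumes T: "T > 0" and i: "i \<in> tiles N" "x - shift T N i \<in> Q T" and i': "i' \<in> tiles N" "x - shift T N i' \<in> Q T"
  shows "i = i'"
proof (rule PiE_ext[OF i(1)[unfolded tiles_def] i'(1)[unfolded tiles_def]])
  fix j assume "j \<in> UNIV - {k}"
  then have j: "j \<noteq> k" by simp
  have "\<bar>x \<bullet> R (axis j 1) - T * (real (i j) - (real N - 1) / 2)\<bar> < T / 2"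
    "\<bar>x \<bullet> R (axis j 1) - T * (real (i' j) - (real N - 1) / 2)\<bar> < T / 2"
    using spec[OF i(2)[unfolded mem_cube[OF R T]], of j] spec[OF i'(2)[unfolded mem_cube[OF R T]], of j] j
    by (simp_all add: inner_diff_left shift_inner)
  then have "\<bar>T * (real (i j) - (real N - 1) / 2) - T * (real (i' j) - (real N - 1) / 2)\<bar> < T" by linarith
  also have "T * (real (i j) - (real N - 1) / 2) - T * (real (i' j) - (real N - 1) / 2) = T * (real (i j) - real (i' j))"
    by (simp add: algebra_simps)
  finally have "\<bar>real (i j) - real (i' j)\<bar> < 1" using T by (simp add: abs_mult)
  then show "i j = i' j" by linarith
qed

lemma tile_subset:
  assumes T: "T > 0" and N: "N \<ge> 1" and i: "i \<in> tiles N" "x - shift T N i \<in> Q T"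
  shows "x \<in> Q (N * T)"
proof -
  have "\<bar>x \<bullet> R (axis j 1)\<bar> < N * T / 2" for j
  proof (cases "j = k")
    case True
    have "\<bar>x \<bullet> R (axis k 1)\<bar> < T / 2"       using spec[OF i(2)[unfolded mem_cube[OF R T]], of k] by (simp add: inner_diff_left shift_inner)
    also have "1 * T \<le> N * T" using N T by (intro mult_right_mono) auto
    then have "T / 2 \<le> N * T / 2" by simp
    finally show ?thesis using True by simp
  next
    case False
    have a: "\<bar>x \<bullet> R (axis j 1) - T * (real (i j) - (real N - 1) / 2)\<bar> < T / 2"
      using spec[OF i(2)[unfolded mem_cube[OF R T]], of j] False by (simp add: inner_diff_left shift_inner)
    have "i j < N" using i(1) False by (auto simp: tiles_def PiE_iff)
    then have "real (i j) \<le> real N - 1" by linarith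
    then have "\<bar>real (i j) - (real N - 1) / 2\<bar> \<le> (real N - 1) / 2"      by (intro abs_leI) (simp_all add: field_simps)
    then have "T * \<bar>real (i j) - (real N - 1) / 2\<bar> \<le> T * ((real N - 1) / 2)" using T by (intro mult_left_mono) auto
    then have "\<bar>T * (real (i j) - (real N - 1) / 2)\<bar> \<le> T * ((real N - 1) / 2)" using T by (simp add: abs_mult)
    moreover have "T / 2 + T * ((real N - 1) / 2) = N * T / 2" by (simp add: field_simps)
    ultimately show ?thesis using a by linarith
  qed
  then show ?thesis using mem_cube[OF R, of "N * T"] T N by simp
qed

lemma tile_in:
  assumes T: "T > 0" and P: "\<And>x w. w \<bullet> \<nu> = 0 \<Longrightarrow> P (x + w) = P x" and i: "i \<in> tiles N" "x - shift T N i \<in> Q T"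
  shows "tile T N P w x = w (x - shift T N i)"
proof -
  have "(\<Sum>i'\<in>tiles N - {i}. indicat_real (Q T) (x - shift T N i') *\<^sub>R (w (x - shift T N i') - P (x - shift T N i'))) = 0"
  proof (intro sum.neutral ballI)
    fix i' assume "i' \<in> tiles N - {i}"
    then have "x - shift T N i' \<notin> Q T" using tile_disjoint[OF T i, of i'] by blast
    then show "indicat_real (Q T) (x - shift T N i') *\<^sub>R (w (x - shift T N i') - P (x - shift T N i')) = 0" by simp
  qed
  then have "tile T N P w x = P x + (w (x - shift T N i) - P (x - shift T N i))"
    unfolding tile_def sum.remove[OF finite_tiles i(1)] using i(2) by simp
  also have "\<dots> = w (x - shift T N i)"
    using P[of "- shift T N i" x] by (simp add: shift_\<nu>)
  finally show ?thesis .
qed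

lemma tile_out: "(\<And>i. i \<in> tiles N \<Longrightarrow> x - shift T N i \<notin> Q T) \<Longrightarrow> tile T N P w x = P x"
  unfolding tile_def by simp

lemma tile_nth: "tile T N P w x $ i = tile T N (\<lambda>x. P x $ i) (\<lambda>x. w x $ i) x"
  unfolding tile_def by (simp add: sum_component)

text \<open>The strict inequality between \<open>N * T\<close> and \<open>S\<close> puts the closed
  union of the tiles inside the open cube \<open>Q S\<close>. The sum of the corrections is then a
  compact perturbation of the profile and keeps its trace.\<close>

lemma tile_H1_trace:
  assumes T: "T > 0" and N: "N \<ge> 1" "N * T < S" and P: "smooth P"
    and w: "H1 (Q T) w G" "has_trace R T w P"
  shows "H1 (Q S) (tile T N P w) (tile T N (grad P) G)" "has_trace R S (tile T N P w) P"
proof -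
  have NT: "N * T > 0" using T N by simp
  then have S: "S > 0" using N by linarith
  let ?w = "\<lambda>x. indicator (Q T) x * (w x - P x)" and ?G = "\<lambda>x. indicator (Q T) x *\<^sub>R (G x - grad P x)"
  let ?W = "\<lambda>x. \<Sum>i\<in>tiles N. ?w (x - shift T N i)" and ?H = "\<lambda>x. \<Sum>i\<in>tiles N. ?G (x - shift T N i)"
  have "H1 UNIV ?w ?G" by (rule trace_zero_extension[OF R T w P])
  then have H: "H1 UNIV ?W ?H" by (intro H1_sum H1_translate_UNIV finite_tiles) auto
  let ?K = "closure (Q (N * T))"
  have K: "compact ?K" "?K \<subseteq> Q S" using closure_cube_subset[OF R NT N(2)] by auto
  have z: "x - shift T N i \<notin> Q T" if "x \<notin> ?K" "i \<in> tiles N" for x i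
    using tile_subset[OF T N(1) that(2)] that(1) closure_subset[of "Q (N * T)"] by blast
  have zero: "?W x = 0" "?H x = 0" if "x \<notin> ?K" for x using z[OF that] by simp_all
  have "has_trace R S (\<lambda>x. P x + ?W x) P" by (rule has_trace_compact_perturbation[OF R S P H K zero])
  moreover have "(\<lambda>x. P x + ?W x) = tile T N P w" by (simp add: fun_eq_iff tile_def)
  ultimately show "has_trace R S (tile T N P w) P" by simp
  have "H1 (Q S) (\<lambda>x. P x + ?W x) (\<lambda>x. grad P x + ?H x)"
    by (intro H1_add H1_smooth P open_Q bounded_Q H1_mono[OF H] Q_lebesgue S) auto
  moreover have "(\<lambda>x. grad P x + ?H x) = tile T N (grad P) G" by (simp add: fun_eq_iff tile_def)
  ultimately show "H1 (Q S) (tile T N P w) (tile T N (grad P) G)"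
    using \<open>(\<lambda>x. P x + ?W x) = tile T N P w\<close> by simp
qed

text \<open>Off the tiles the integrand lives in the slab of half-width \<open>h\<close>. Because
  \<open>2 * h \<le> T\<close>, that slab crosses each tile fully, and its uncovered part has the
  stated volume by disjointness of the tiles. The form with general \<open>F\<close> and
  \<open>f\<close> serves both for the energy and for the L1 distance to the jump.\<close>

lemma tile_integral:
  assumes T: "T > 0" and N: "N \<ge> 1" "N * T < S" and h: "0 < h" "2 * h \<le> T"
    and f[measurable]: "f \<in> borel_measurable (lebesgue_on (Q T))"
    and inside: "\<And>x i. i \<in> tiles N \<Longrightarrow> x - shift T N i \<in> Q T \<Longrightarrow> F x \<le> f (x - shift T N i)"
    and outside: "\<And>x. (\<And>i. i \<in> tiles N \<Longrightarrow> x - shift T N i \<notin> Q T) \<Longrightarrow> F x \<le> C * indicator {y. \<bar>y \<bullet> \<nu>\<bar> < h} x"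
  shows "(\<integral>\<^sup>+ x. F x \<partial>lebesgue_on (Q S)) \<le> of_nat (N ^ (CARD('n) - 1)) * (\<integral>\<^sup>+ x. f x \<partial>lebesgue_on (Q T))
     + C * ennreal (2 * h * (S ^ (CARD('n) - 1) - (N * T) ^ (CARD('n) - 1)))"
proof -
  let ?n = "CARD('n) - 1"
  have NT: "N * T > 0" using T N by simp
  then have S: "S > 0" using N by linarith
  have hT: "h \<le> T / 2" using h by simp
  have hS: "h \<le> S / 2"
  proof -
    have "1 * T \<le> N * T" using N T by (intro mult_right_mono) auto
    then have "T < S" using N by linarith
    then show ?thesis using h by linarith
  qed
  have QT: "Q T \<in> sets lebesgue" "Q S \<in> sets lebesgue" using T S by (auto intro: Q_lebesgue)
  define f0 where "f0 x = f x * indicator (Q T) x" for x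
  have f0[measurable]: "f0 \<in> borel_measurable lebesgue"
    unfolding f0_def using f QT by (simp add: borel_measurable_restrict_space_iff_ennreal)
  have tr[measurable]: "(\<lambda>x. x - t) \<in> lebesgue \<rightarrow>\<^sub>M lebesgue" for t :: "real^'n"
    using similarity_lebesgue(1)[of "\<lambda>x::real^'n. x" 1 "- t"] by simp
  define Sl where "Sl r = {x \<in> Q r. \<bar>x \<bullet> \<nu>\<bar> < h}" for r
  have SlT: "Sl T \<in> sets lebesgue" "emeasure lebesgue (Sl T) = ennreal (2 * h * T ^ ?n)"
    and SlS: "Sl S \<in> sets lebesgue" "emeasure lebesgue (Sl S) = ennreal (2 * h * S ^ ?n)"
    unfolding Sl_def by (rule slab_lebesgue[OF T h(1) hT] slab_lebesgue[OF S h(1) hS])+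
  define A where "A i = {x. x - shift T N i \<in> Sl T}" for i
  have A: "A i \<in> sets lebesgue" for i
    using measurable_sets[OF tr SlT(1), of "shift T N i"] by (simp add: A_def vimage_def)
  have mA: "emeasure lebesgue (A i) = ennreal (2 * h * T ^ ?n)" for i
  proof -
    have "emeasure lebesgue (A i) = (\<integral>\<^sup>+ x. indicator (A i) x \<partial>lebesgue)" using A by (simp del: emeasure_completion)
    also have "\<dots> = (\<integral>\<^sup>+ x. indicator (Sl T) (x + (- shift T N i)) \<partial>lebesgue)"
      by (simp add: A_def indicator_def)
    also have "\<dots> = emeasure lebesgue (Sl T)"
      using SlT by (subst nn_integral_translate) (auto simp del: emeasure_completion)
    finally show ?thesis using SlT by simp
  qed
  have disj: "disjoint_family_on A (tiles N)"
    using tile_disjoint[OF T] unfolding disjoint_family_on_def A_def Sl_def by blast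
  have Asub: "(\<Union>i\<in>tiles N. A i) \<subseteq> Sl S"
  proof
    fix x assume "x \<in> (\<Union>i\<in>tiles N. A i)"
    then obtain i where i: "i \<in> tiles N" "x - shift T N i \<in> Q T" "\<bar>(x - shift T N i) \<bullet> \<nu>\<bar> < h"
      by (auto simp: A_def Sl_def)
    have "Q (N * T) \<subseteq> Q S" using closure_cube_subset(2)[OF R NT N(2)] closure_subset by blast
    then show "x \<in> Sl S" using tile_subset[OF T N(1) i(1,2)] i(3) by (auto simp: Sl_def inner_diff_left shift_\<nu>)
  qed
  have mU: "emeasure lebesgue (\<Union>i\<in>tiles N. A i) = ennreal (2 * h * (N * T) ^ ?n)"
  proof -
    have "emeasure lebesgue (\<Union>i\<in>tiles N. A i) = (\<Sum>i\<in>tiles N. emeasure lebesgue (A i))"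
      using A disj finite_tiles by (intro sum_emeasure[symmetric]) auto
    also have "\<dots> = of_nat (N ^ ?n) * ennreal (2 * h * T ^ ?n)" by (simp only: mA sum_constant card_tiles)
    also have "\<dots> = ennreal (2 * h * (N * T) ^ ?n)"
      using h T by (simp add: ennreal_of_nat_eq_real_of_nat ennreal_mult[symmetric] power_mult_distrib mult_ac)
    finally show ?thesis .
  qed
  \<comment> \<open>The common faces of the tiles remain in \<open>D\<close>; being null sets they
    do not disturb the exact volume computed from the open tiles.\<close>
  define D where "D = Sl S - (\<Union>i\<in>tiles N. A i)"
  have Um: "(\<Union>i\<in>tiles N. A i) \<in> sets lebesgue" using A finite_tiles by auto
  have D[measurable]: "D \<in> sets lebesgue" unfolding D_def using SlS Um by blast
  have mD: "emeasure lebesgue D = ennreal (2 * h * (S ^ ?n - (N * T) ^ ?n))"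
  proof -
    have "emeasure lebesgue D = emeasure lebesgue (Sl S) - emeasure lebesgue (\<Union>i\<in>tiles N. A i)"
      unfolding D_def using SlS Um Asub mU by (intro emeasure_Diff) auto
    also have "\<dots> = ennreal (2 * h * S ^ ?n - 2 * h * (N * T) ^ ?n)"
      unfolding SlS(2) mU using h T by (subst ennreal_minus) auto
    finally show ?thesis by (simp add: right_diff_distrib)
  qed
  have "(\<integral>\<^sup>+ x. F x \<partial>lebesgue_on (Q S)) = (\<integral>\<^sup>+ x. F x * indicator (Q S) x \<partial>lebesgue)"
    using QT by (simp add: nn_integral_restrict_space)
  also have "\<dots> \<le> (\<integral>\<^sup>+ x. (\<Sum>i\<in>tiles N. f0 (x - shift T N i)) + C * indicator D x \<partial>lebesgue)"
  proof (intro nn_integral_mono)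
    fix x
    show "F x * indicator (Q S) x \<le> (\<Sum>i\<in>tiles N. f0 (x - shift T N i)) + C * indicator D x"
    proof (cases "\<exists>i\<in>tiles N. x - shift T N i \<in> Q T")
      case True
      then obtain i where i: "i \<in> tiles N" "x - shift T N i \<in> Q T" by blast
      have "F x * indicator (Q S) x \<le> F x" by (simp add: indicator_def)
      also have "\<dots> \<le> f0 (x - shift T N i)" using inside[OF i] i(2) by (simp add: f0_def)
      also have "\<dots> \<le> (\<Sum>i\<in>tiles N. f0 (x - shift T N i))"
        using i finite_tiles by (intro member_le_sum) auto
      also have "\<dots> \<le> (\<Sum>i\<in>tiles N. f0 (x - shift T N i)) + C * indicator D x" by simp
      finally show ?thesis .
    next
      case False
      have "F x * indicator (Q S) x \<le> C * indicator {y. \<bar>y \<bullet> \<nu>\<bar> < h} x * indicator (Q S) x"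
        using False by (intro mult_right_mono outside) auto
      also have "\<dots> = C * indicator D x"
        using False by (auto simp: D_def A_def Sl_def indicator_def)
      also have "\<dots> \<le> (\<Sum>i\<in>tiles N. f0 (x - shift T N i)) + C * indicator D x" by (simp add: add_increasing)
      finally show ?thesis .
    qed
  qed
  also have "\<dots> = (\<Sum>i\<in>tiles N. (\<integral>\<^sup>+ x. f0 (x - shift T N i) \<partial>lebesgue)) + C * emeasure lebesgue D"
    using finite_tiles D
    by (subst nn_integral_add, measurable, subst nn_integral_sum, measurable) (simp add: nn_integral_cmult_indicator del: emeasure_completion)
  also have "(\<lambda>i. (\<integral>\<^sup>+ x. f0 (x - shift T N i) \<partial>lebesgue)) = (\<lambda>i. (\<integral>\<^sup>+ x. f x \<partial>lebesgue_on (Q T)))"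
  proof
    fix i
    show "(\<integral>\<^sup>+ x. f0 (x - shift T N i) \<partial>lebesgue) = (\<integral>\<^sup>+ x. f x \<partial>lebesgue_on (Q T))"
      using nn_integral_translate[OF f0, of "- shift T N i"] QT by (simp add: f0_def nn_integral_restrict_space)
  qed
  also have "(\<Sum>i\<in>tiles N. (\<integral>\<^sup>+ x. f x \<partial>lebesgue_on (Q T))) = of_nat (N ^ ?n) * (\<integral>\<^sup>+ x. f x \<partial>lebesgue_on (Q T))"
    by (simp only: sum_constant card_tiles)
  finally show ?thesis unfolding mD .
qed

text \<open>\<open>T \<ge> 6\<close> makes the slab of half-width 3, which carries the profile
  energy, fit into a tile. The last estimate is there for the upper bound on \<open>g\<close>, where
  the rescaled tilings have to converge to the jump; the mollified jump differs from the jump only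
  in a slab of half-width 1.\<close>

lemma tiling:
  assumes T: "T \<ge> 6" and N: "N \<ge> 1" "N * T < S" and uv: "(u, v) \<in> admissible \<phi> R z \<nu> T"
    and C: "\<And>x. energy_density l \<Psi> (jump_jacobian x) (damage_profile x) (grad damage_profile x)
      \<le> ennreal C * indicator {y. \<bar>y \<bullet> \<nu>\<bar> < 3} x"
  obtains u' v' where "(u', v') \<in> admissible \<phi> R z \<nu> S"
    "F_inf l \<Psi> 1 u' v' (Q S) \<le> of_nat (N ^ (CARD('n) - 1)) * F_inf l \<Psi> 1 u v (Q T)
      + ennreal C * ennreal (6 * (S ^ (CARD('n) - 1) - (N * T) ^ (CARD('n) - 1)))"
    "(\<integral>\<^sup>+ x. ennreal (norm (u' x - jump x)) \<partial>lebesgue_on (Q S))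
      \<le> of_nat (N ^ (CARD('n) - 1)) * (\<integral>\<^sup>+ x. ennreal (norm (u x - jump x)) \<partial>lebesgue_on (Q T))
        + ennreal (norm z) * ennreal (2 * (S ^ (CARD('n) - 1) - (N * T) ^ (CARD('n) - 1)))"
proof -
  have T0: "T > 0" using T by simp
  have NT: "N * T > 0" using T0 N by simp
  then have S: "S > 0" using N by linarith
  have W: "W12_vec (Q T) u" "W12 (Q T) v" and AE: "AE x in lebesgue_on (Q T). 0 \<le> v x \<and> v x \<le> 1"
    and tr: "has_trace R T v damage_profile" "\<And>i. has_trace R T (\<lambda>x. u x $ i) (\<lambda>x. smooth_jump x $ i)"
    using uv unfolding admissible_iff by auto
  obtain J where J: "\<And>i. H1 (Q T) (\<lambda>x. u x $ i) (\<lambda>x. J x $ i)" using W12_vec_H1[OF W(1)] by blast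
  obtain g where g: "H1 (Q T) v g" using W(2) W12_iff_H1 by blast
  define u' where "u' = tile T N smooth_jump u"
  define v' where "v' = tile T N damage_profile v"
  define J' where "J' = tile T N jump_jacobian J"
  define g' where "g' = tile T N (grad damage_profile) g"
  note pt = profile_translate
  have P: "smooth_jump (x + w) = smooth_jump x" "jump_jacobian (x + w) = jump_jacobian x" "jump (x + w) = jump x" if "w \<bullet> \<nu> = 0" for x w
    using pt[OF that] that by (simp_all add: smooth_jump_def jump_jacobian_def jump_def indicator_def inner_add_left)
  have u'H: "H1 (Q S) (\<lambda>x. u' x $ i) (\<lambda>x. J' x $ i)" "has_trace R S (\<lambda>x. u' x $ i) (\<lambda>x. smooth_jump x $ i)" for i
    using tile_H1_trace[OF T0 N smooth_smooth_jump J tr(2), of i]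
    by (simp_all add: u'_def J'_def tile_nth grad_smooth_jump[abs_def])
  have v'H: "H1 (Q S) v' g'" "has_trace R S v' damage_profile"
    unfolding v'_def g'_def by (rule tile_H1_trace[OF T0 N smooth_profile(2) g tr(1)])+
  have in': "u' x = u (x - shift T N i)" "v' x = v (x - shift T N i)" "J' x = J (x - shift T N i)" "g' x = g (x - shift T N i)"
    if "i \<in> tiles N" "x - shift T N i \<in> Q T" for x i
    unfolding u'_def v'_def J'_def g'_def by (rule tile_in[OF T0 _ that]; use pt P in simp)+
  have out': "u' x = smooth_jump x" "v' x = damage_profile x" "J' x = jump_jacobian x" "g' x = grad damage_profile x"
    if "\<And>i. i \<in> tiles N \<Longrightarrow> x - shift T N i \<notin> Q T" for x
    unfolding u'_def v'_def J'_def g'_def by (simp_all add: tile_out[OF that])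
  have AE': "AE x in lebesgue. 0 \<le> v' x \<and> v' x \<le> 1"
  proof -
    have "AE x in lebesgue. x \<in> Q T \<longrightarrow> 0 \<le> v x \<and> v x \<le> 1"
      using AE Q_lebesgue[OF T0] by (subst (asm) AE_restrict_space_iff) auto
    \<comment> \<open>Each shift moves the exceptional null set; finitely many translates of it are
      still null.\<close>
    from AE_translate[OF this] have "AE x in lebesgue. \<forall>i\<in>tiles N. x + (- shift T N i) \<in> Q T \<longrightarrow> 0 \<le> v (x + (- shift T N i)) \<and> v (x + (- shift T N i)) \<le> 1"
      by (intro AE_finite_allI finite_tiles)
    then show ?thesis
    proof eventually_elim
      case (elim x)
      show ?case
      proof (cases "\<exists>i\<in>tiles N. x - shift T N i \<in> Q T")
        case True
        then show ?thesis using elim in'(2) by auto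
      next
        case False
        then show ?thesis using out'(2)[of x] damage_profile_range by auto
      qed
    qed
  qed
  have "(u', v') \<in> admissible \<phi> R z \<nu> S"
    unfolding admissible_iff W12_vec_def W12_iff_H1
    using u'H v'H AE' Q_lebesgue[OF S] by (auto simp: AE_restrict_space_iff)
  moreover have "F_inf l \<Psi> 1 u' v' (Q S) \<le> of_nat (N ^ (CARD('n) - 1)) * F_inf l \<Psi> 1 u v (Q T)
      + ennreal C * ennreal (2 * 3 * (S ^ (CARD('n) - 1) - (N * T) ^ (CARD('n) - 1)))"
    unfolding F_inf_1[OF S u'H(1) v'H(1)] F_inf_1[OF T0 J g]
  proof (rule tile_integral[OF T0 N])
    note [measurable] = H1_rows_measurable[OF J] sq_integrable_measurable[OF H1_sq_integrable(1)[OF g]] sq_integrable_measurable[OF H1_sq_integrable(2)[OF g]]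
    show "(\<lambda>x. energy_density l \<Psi> (J x) (v x) (g x)) \<in> borel_measurable (lebesgue_on (Q T))"
      unfolding energy_density_def by measurable
  qed (use in' out' C T in auto)
  moreover have "(\<integral>\<^sup>+ x. ennreal (norm (u' x - jump x)) \<partial>lebesgue_on (Q S))
      \<le> of_nat (N ^ (CARD('n) - 1)) * (\<integral>\<^sup>+ x. ennreal (norm (u x - jump x)) \<partial>lebesgue_on (Q T))
        + ennreal (norm z) * ennreal (2 * 1 * (S ^ (CARD('n) - 1) - (N * T) ^ (CARD('n) - 1)))"
  proof (rule tile_integral[OF T0 N])
    note [measurable] = H1_rows_measurable[OF J]
    show "(\<lambda>x. ennreal (norm (u x - jump x))) \<in> borel_measurable (lebesgue_on (Q T))" by measurable
    show "ennreal (norm (u' x - jump x)) \<le> ennreal (norm (u (x - shift T N i) - jump (x - shift T N i)))"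
      if "i \<in> tiles N" "x - shift T N i \<in> Q T" for x i
      using in'(1)[OF that] P(3)[of "- shift T N i" x] by (simp add: shift_\<nu>)
    show "ennreal (norm (u' x - jump x)) \<le> ennreal (norm z) * indicator {y. \<bar>y \<bullet> \<nu>\<bar> < 1} x"
      if "\<And>i. i \<in> tiles N \<Longrightarrow> x - shift T N i \<notin> Q T" for x
    proof -
      have "u' x = smooth_jump x" by (rule out'(1)) (rule that)
      then show ?thesis using ennreal_leI[OF norm_smooth_jump_diff[of x]]
        by (auto simp: indicator_def split: if_splits)
    qed
  qed (use T in auto)
  ultimately show ?thesis using that by simp
qed

end

section \<open>Truncation and cutoff\<close>

text \<open>A C1 building block for an explicit cutoff; the chain rule \<open>H1_chain\<close> asks
  for continuous first derivatives.\<close>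

definition pos2 :: "real \<Rightarrow> real" where "pos2 x = (max 0 x)\<^sup>2"

lemma pos2_deriv: "(pos2 has_real_derivative 2 * max 0 x) (at x)"
proof -
  consider "x > 0" | "x < 0" | "x = 0" by linarith
  then show ?thesis
  proof cases
    case 1
    have "((\<lambda>x. x\<^sup>2) has_real_derivative 2 * max 0 x) (at x)"
      using 1 by (auto intro!: derivative_eq_intros)
    then show ?thesis
      by (rule has_field_derivative_transform_within_open[of _ _ _ "{0<..}"]) (use 1 in \<open>auto simp: pos2_def\<close>)
  next
    case 2
    have "((\<lambda>x. 0) has_real_derivative 2 * max 0 x) (at x)"
      using 2 by (auto intro!: derivative_eq_intros)
    then show ?thesis
      by (rule has_field_derivative_transform_within_open[of _ _ _ "{..<0}"]) (use 2 in \<open>auto simp: pos2_def\<close>)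
  next
    case 3
    have "(pos2 has_derivative (\<lambda>h. 0)) (at 0)"
      unfolding has_derivative_at_alt
    proof (intro conjI allI impI bounded_linear_zero)
      fix e :: real assume e: "e > 0"
      have "norm (pos2 y - pos2 0 - 0) \<le> e * norm (y - 0)" if "norm (y - 0) < e" for y
      proof -
        have "pos2 y \<le> \<bar>y\<bar> * \<bar>y\<bar>" by (auto simp: pos2_def max_def power2_eq_square)
        also have "\<dots> \<le> e * \<bar>y\<bar>" using that by (intro mult_right_mono) auto
        finally show ?thesis by (simp add: pos2_def)
      qed
      then show "\<exists>d>0. \<forall>y. norm (y - 0) < d \<longrightarrow> norm (pos2 y - pos2 0 - 0) \<le> e * norm (y - 0)"
        using e by blast
    qed
    then show ?thesis using 3 by (simp add: has_field_derivative_def lambda_zero)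
  qed
qed

text \<open>Falls from one on t \<le> 1 to zero on t \<ge> 2. Composing two squared positive parts
  makes the transition C1 at both ends, with slope at most 4.\<close>

definition cut :: "real \<Rightarrow> real" where "cut t = pos2 (1 - pos2 (t - 1))"
definition cut' :: "real \<Rightarrow> real" where "cut' t = 2 * max 0 (1 - pos2 (t - 1)) * (- (2 * max 0 (t - 1)))"

lemma cut_deriv: "(cut has_real_derivative cut' t) (at t)"
proof -
  have "((\<lambda>t. pos2 (t - 1)) has_real_derivative 2 * max 0 (t - 1)) (at t)"
    by (rule DERIV_chain'[where f="\<lambda>t. t - 1" and g=pos2, OF _ pos2_deriv, THEN DERIV_cong])
      (auto intro!: derivative_eq_intros)
  then have "((\<lambda>t. 1 - pos2 (t - 1)) has_real_derivative - (2 * max 0 (t - 1))) (at t)"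
    by (auto intro!: derivative_eq_intros)
  from DERIV_chain'[OF this pos2_deriv] show ?thesis
    unfolding cut_def[abs_def] cut'_def by (simp add: mult.commute)
qed

lemma cut_range: "0 \<le> cut t" "cut t \<le> 1"
proof -
  show "0 \<le> cut t" by (simp add: cut_def pos2_def)
  have "(max 0 (1 - pos2 (t - 1)))\<^sup>2 \<le> 1\<^sup>2" by (intro power_mono) (auto simp: pos2_def)
  then show "cut t \<le> 1" by (simp add: cut_def pos2_def[of "1 - _"])
qed

lemma cut_1: "t \<le> 1 \<Longrightarrow> cut t = 1" "t \<le> 1 \<Longrightarrow> cut' t = 0"
  by (simp_all add: cut_def cut'_def pos2_def)

lemma cut_0:
  assumes "t \<ge> 2"
  shows "cut t = 0" "cut' t = 0"
proof -
  have "(max 0 (t - 1))\<^sup>2 \<ge> 1\<^sup>2" using assms by (intro power_mono) auto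
  then have "1 - pos2 (t - 1) \<le> 0" by (simp add: pos2_def)
  then show "cut t = 0" "cut' t = 0" by (simp_all add: cut_def cut'_def pos2_def[of "1 - _"])
qed

lemma cut'_bound: "\<bar>cut' t\<bar> \<le> 4"
proof (cases "t \<ge> 2")
  case False
  have "0 \<le> pos2 (t - 1)" by (simp add: pos2_def)
  then have "\<bar>max 0 (1 - pos2 (t - 1))\<bar> * \<bar>max 0 (t - 1)\<bar> \<le> 1 * 1" using False by (intro mult_mono) auto
  then show ?thesis by (simp add: cut'_def abs_mult)
qed (simp add: cut_0)

lemma continuous_cut: "continuous_on UNIV cut" "continuous_on UNIV cut'"
proof -
  show "continuous_on UNIV cut"
    by (intro continuous_at_imp_continuous_on ballI DERIV_isCont[OF cut_deriv])
  show "continuous_on UNIV cut'" unfolding cut'_def pos2_def by (intro continuous_intros)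
qed

text \<open>The identity up to norm \<open>M\<close>, and zero once the squared norm reaches
  \<open>2 * M\<^sup>2\<close>. The transition annulus has ratio sqrt 2, so the annuli of levels
  that double are disjoint.\<close>

definition trunc :: "real \<Rightarrow> real^'m \<Rightarrow> real^'m" where
  "trunc M y = cut ((y \<bullet> y) / M\<^sup>2) *\<^sub>R y"

definition trunc_grad :: "real \<Rightarrow> 'm::finite \<Rightarrow> real^'m \<Rightarrow> real^'m" where
  "trunc_grad M i y = cut ((y \<bullet> y) / M\<^sup>2) *\<^sub>R axis i 1 + (cut' ((y \<bullet> y) / M\<^sup>2) * (2 / M\<^sup>2) * y $ i) *\<^sub>R y"

definition trunc_jacobian :: "real \<Rightarrow> real^'m \<Rightarrow> real^'n^'m \<Rightarrow> real^'n^'m" where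
  "trunc_jacobian M y J = (\<chi> i. \<Sum>j\<in>UNIV. (trunc_grad M i y $ j) *\<^sub>R (J $ j))"

lemma trunc_has_derivative: "((\<lambda>y. trunc M y $ i) has_derivative (\<lambda>h. trunc_grad M i y \<bullet> h)) (at y)"
proof -
  have s: "((\<lambda>y. (y \<bullet> y) / M\<^sup>2) has_derivative (\<lambda>h. (2 * (y \<bullet> h)) / M\<^sup>2)) (at y)"
    unfolding divide_inverse
    by (rule has_derivative_eq_rhs[OF has_derivative_mult_left[OF has_derivative_inner[OF has_derivative_ident has_derivative_ident]]])
      (simp add: inner_commute fun_eq_iff)
  have c: "((\<lambda>y. cut ((y \<bullet> y) / M\<^sup>2)) has_derivative (\<lambda>h. cut' ((y \<bullet> y) / M\<^sup>2) * ((2 * (y \<bullet> h)) / M\<^sup>2))) (at y)"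
    by (rule has_derivative_compose[OF s cut_deriv[unfolded has_field_derivative_def]])
  have n: "((\<lambda>y. y $ i) has_derivative (\<lambda>h. h $ i)) (at y)"
    by (rule bounded_linear_imp_has_derivative[OF bounded_linear_vec_nth])
  show ?thesis
    unfolding trunc_def vector_scaleR_component real_scaleR_def
    by (rule has_derivative_eq_rhs[OF has_derivative_mult[OF c n]])
      (simp add: fun_eq_iff trunc_grad_def inner_add_left inner_axis' algebra_simps)
qed

lemma norm_trunc:
  assumes "M > 0"
  shows "norm (trunc M y) \<le> 2 * M"
proof (cases "(y \<bullet> y) / M\<^sup>2 \<ge> 2")
  case False
  then have "y \<bullet> y \<le> 2 * M\<^sup>2" using assms by (simp add: field_simps)
  then have "y \<bullet> y \<le> 4 * M\<^sup>2" using zero_le_power2[of M] by linarith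
  then have "(norm y)\<^sup>2 \<le> (2 * M)\<^sup>2" by (simp add: power2_norm_eq_inner power_mult_distrib)
  then have "norm y \<le> 2 * M" by (rule power2_le_imp_le) (use assms in simp)
  moreover have "norm (trunc M y) \<le> 1 * norm y"
    unfolding trunc_def norm_scaleR using cut_range by (intro mult_right_mono) auto
  ultimately show ?thesis by simp
qed (use assms in \<open>simp add: trunc_def cut_0\<close>)

lemma trunc_eq:
  assumes "M > 0" "norm y \<le> M"
  shows "trunc M y = y" "trunc_jacobian M y J = J"
proof -
  have "(norm y)\<^sup>2 \<le> M\<^sup>2" using assms by (intro power_mono) auto
  then have s: "(y \<bullet> y) / M\<^sup>2 \<le> 1" using assms by (simp add: power2_norm_eq_inner)
  show "trunc M y = y" by (simp add: trunc_def cut_1[OF s])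
  have "(\<Sum>j\<in>UNIV. axis i 1 $ j *\<^sub>R (J $ j)) = J $ i" for i
    by (simp add: axis_def if_distrib[of "\<lambda>c. c *\<^sub>R _"] cong: if_cong)
  then show "trunc_jacobian M y J = J"
    by (simp add: trunc_jacobian_def trunc_grad_def cut_1[OF s] vec_eq_iff)
qed

lemma trunc_0:
  assumes "M > 0" "(norm y)\<^sup>2 \<ge> 2 * M\<^sup>2"
  shows "trunc_jacobian M y J = 0"
proof -
  have s: "(y \<bullet> y) / M\<^sup>2 \<ge> 2" using assms by (simp add: power2_norm_eq_inner field_simps)
  show ?thesis by (simp add: trunc_jacobian_def trunc_grad_def cut_0[OF s] vec_eq_iff)
qed

lemma cut'_term_bound:
  assumes "M > 0"
  shows "\<bar>cut' ((y \<bullet> y) / M\<^sup>2) * (2 / M\<^sup>2)\<bar> * (norm y)\<^sup>2 \<le> 16"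
proof (cases "(y \<bullet> y) / M\<^sup>2 \<ge> 2")
  case False
  then have s: "(norm y)\<^sup>2 / M\<^sup>2 \<le> 2" by (simp add: power2_norm_eq_inner)
  have "\<bar>cut' ((y \<bullet> y) / M\<^sup>2) * (2 / M\<^sup>2)\<bar> * (norm y)\<^sup>2 = \<bar>cut' ((y \<bullet> y) / M\<^sup>2)\<bar> * (2 * ((norm y)\<^sup>2 / M\<^sup>2))"
    by (simp add: abs_mult)
  also have "\<dots> \<le> 4 * (2 * 2)" using s cut'_bound by (intro mult_mono) auto
  finally show ?thesis by simp
qed (simp add: cut_0)

lemma norm_outer: "norm (\<chi> i. y $ i *\<^sub>R w) = norm y * norm w"
  for y :: "real^'m" and w :: "real^'n"
proof -
  have "norm (\<chi> i. y $ i *\<^sub>R w) = sqrt (\<Sum>i\<in>UNIV. (\<bar>y $ i\<bar> * norm w)\<^sup>2)"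
    unfolding norm_vec_def[of "\<chi> i. _ i"] L2_set_def by simp
  also have "(\<Sum>i\<in>UNIV. (\<bar>y $ i\<bar> * norm w)\<^sup>2) = (\<Sum>i\<in>UNIV. (y $ i)\<^sup>2) * (norm w)\<^sup>2"
    by (simp add: power_mult_distrib sum_distrib_right)
  finally show ?thesis by (simp add: real_sqrt_mult norm_vec_def[of y] L2_set_def)
qed

lemma norm_row_combination: "norm (\<Sum>j\<in>UNIV. y $ j *\<^sub>R (J $ j)) \<le> norm y * norm J"
  for y :: "real^'m" and J :: "real^'n^'m"
proof -
  have "norm (\<Sum>j\<in>UNIV. y $ j *\<^sub>R (J $ j)) \<le> (\<Sum>j\<in>UNIV. \<bar>y $ j\<bar> * \<bar>norm (J $ j)\<bar>)"
    by (rule order_trans[OF norm_sum]) simp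
  also have "\<dots> \<le> L2_set (\<lambda>j. y $ j) UNIV * L2_set (\<lambda>j. norm (J $ j)) UNIV" by (rule L2_set_mult_ineq)
  also have "\<dots> = norm y * norm J" by (simp add: norm_vec_def L2_set_def)
  finally show ?thesis .
qed

lemma trunc_grad_eq: "norm (trunc_grad M i y) \<le> 17" if "M > 0" for y :: "real^'m"
proof -
  have "norm (trunc_grad M i y) \<le> norm (cut ((y \<bullet> y) / M\<^sup>2) *\<^sub>R (axis i 1 :: real^'m)) + norm ((cut' ((y \<bullet> y) / M\<^sup>2) * (2 / M\<^sup>2) * y $ i) *\<^sub>R y)"
    unfolding trunc_grad_def by (rule norm_triangle_ineq)
  also have "norm (cut ((y \<bullet> y) / M\<^sup>2) *\<^sub>R (axis i 1 :: real^'m)) \<le> 1" using cut_range[of "(y \<bullet> y) / M\<^sup>2"] by simp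
  also have "norm ((cut' ((y \<bullet> y) / M\<^sup>2) * (2 / M\<^sup>2) * y $ i) *\<^sub>R y) = \<bar>cut' ((y \<bullet> y) / M\<^sup>2) * (2 / M\<^sup>2)\<bar> * (\<bar>y $ i\<bar> * norm y)"
    by (simp add: abs_mult)
  also have "\<dots> \<le> \<bar>cut' ((y \<bullet> y) / M\<^sup>2) * (2 / M\<^sup>2)\<bar> * (norm y)\<^sup>2"
    unfolding power2_eq_square by (intro mult_left_mono mult_right_mono component_le_norm_cart) auto
  also have "\<dots> \<le> 16" by (rule cut'_term_bound[OF that])
  finally show ?thesis by simp
qed

text \<open>The derivative is \<open>cut\<close> times the identity plus a term of rank one in
  \<open>y\<close>, of sizes 1 and 16, so 17 is their sum. The bound does not depend on
  \<open>M\<close>, which may therefore be selected later.\<close>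

lemma norm_trunc_jacobian:
  assumes M: "M > 0"
  shows "norm (trunc_jacobian M y J) \<le> 17 * norm J"
proof -
  let ?s = "(y \<bullet> y) / M\<^sup>2"
  let ?w = "\<Sum>j\<in>UNIV. y $ j *\<^sub>R (J $ j)"
  have row: "(\<Sum>j\<in>UNIV. (trunc_grad M i y $ j) *\<^sub>R (J $ j)) = cut ?s *\<^sub>R (J $ i) + (cut' ?s * (2 / M\<^sup>2)) *\<^sub>R (y $ i *\<^sub>R ?w)" for i
  proof -
    have a: "(\<Sum>j\<in>UNIV. axis i 1 $ j *\<^sub>R (J $ j)) = J $ i"
      by (simp add: axis_def if_distrib[of "\<lambda>c. c *\<^sub>R _"] cong: if_cong)
    have "(\<Sum>j\<in>UNIV. (trunc_grad M i y $ j) *\<^sub>R (J $ j))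
      = (\<Sum>j\<in>UNIV. cut ?s *\<^sub>R (axis i 1 $ j *\<^sub>R (J $ j)) + (cut' ?s * (2 / M\<^sup>2)) *\<^sub>R (y $ i *\<^sub>R (y $ j *\<^sub>R (J $ j))))"
      by (intro sum.cong refl) (simp add: trunc_grad_def scaleR_add_left mult.assoc)
    then show ?thesis by (simp only: sum.distrib scaleR_right.sum[symmetric] a)
  qed
  have "trunc_jacobian M y J = cut ?s *\<^sub>R J + (cut' ?s * (2 / M\<^sup>2)) *\<^sub>R (\<chi> i. y $ i *\<^sub>R ?w)"
    unfolding trunc_jacobian_def row by (simp add: vec_eq_iff)
  then have "norm (trunc_jacobian M y J) \<le> norm (cut ?s *\<^sub>R J) + norm ((cut' ?s * (2 / M\<^sup>2)) *\<^sub>R (\<chi> i. y $ i *\<^sub>R ?w))"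
    by (simp only: norm_triangle_ineq)
  also have "norm (cut ?s *\<^sub>R J) \<le> 1 * norm J" unfolding norm_scaleR using cut_range[of ?s] by (intro mult_right_mono) auto
  also have "norm ((cut' ?s * (2 / M\<^sup>2)) *\<^sub>R (\<chi> i. y $ i *\<^sub>R ?w)) = \<bar>cut' ?s * (2 / M\<^sup>2)\<bar> * (norm y * norm ?w)"
    by (simp add: norm_outer)
  also have "\<dots> \<le> \<bar>cut' ?s * (2 / M\<^sup>2)\<bar> * (norm y * (norm y * norm J))"
    by (intro mult_left_mono norm_row_combination) auto
  also have "\<dots> = (\<bar>cut' ?s * (2 / M\<^sup>2)\<bar> * (norm y)\<^sup>2) * norm J" by (simp add: power2_eq_square mult.assoc)
  also have "\<dots> \<le> 16 * norm J" by (intro mult_right_mono cut'_term_bound M) auto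
  finally show ?thesis by simp
qed

text \<open>One factor of the square is bounded by \<open>3 * M\<close>, the other by five times the
  distance before truncation. In this way a squared term in the energy is controlled by L1
  convergence.\<close>

lemma trunc_diff:
  assumes M: "M > 0" and b: "norm b \<le> M / 2"
  shows "(norm (trunc M y - b))\<^sup>2 \<le> 15 * M * norm (y - b)"
proof -
  have 1: "norm (trunc M y - b) \<le> 3 * M"
    using norm_triangle_ineq4[of "trunc M y" b] norm_trunc[OF M, of y] b M by linarith
  have 2: "norm (trunc M y - b) \<le> 5 * norm (y - b)"
  proof (cases "norm y \<le> M")
    case True
    then show ?thesis by (simp add: trunc_eq[OF M])
  next
    \<comment> \<open>Beyond the level the truncated value is within 5/2 of \<open>M\<close> from
      \<open>b\<close>, while \<open>y\<close> is at least \<open>M / 2\<close> away from it; the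
      quotient gives the factor 5.\<close>
    case False
    have "norm y \<le> norm (y - b) + norm b" using norm_triangle_sub[of y b] by simp
    moreover have "norm (trunc M y - b) \<le> 2 * M + M / 2"
      using norm_triangle_ineq4[of "trunc M y" b] norm_trunc[OF M, of y] b by linarith
    ultimately show ?thesis using False b by linarith
  qed
  have "(norm (trunc M y - b))\<^sup>2 \<le> (3 * M) * (5 * norm (y - b))"
    unfolding power2_eq_square using 1 2 M by (intro mult_mono) auto
  then show ?thesis by simp
qed

section \<open>Truncated Sobolev functions and scaled cutoffs\<close>

context mollifier
begin

lemma H1_trunc:
  fixes u :: "real^'n \<Rightarrow> real^'m"
  assumes A: "open A" "bounded A" and H: "\<And>i. H1 A (\<lambda>x. u x $ i) (\<lambda>x. J x $ i)" and M: "M > 0"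
  shows "H1 A (\<lambda>x. trunc M (u x) $ i) (\<lambda>x. trunc_jacobian M (u x) (J x) $ i)"
proof -
  have "H1 A (\<lambda>x. trunc M (u x) $ i) (\<lambda>x. \<Sum>j\<in>UNIV. (trunc_grad M i (u x) $ j) *\<^sub>R (J x $ j))"
  proof (rule H1_chain[OF A H trunc_has_derivative])
    show "continuous_on UNIV (trunc_grad M i)"
      unfolding trunc_grad_def divide_inverse
      by (intro continuous_intros continuous_on_compose2[OF continuous_cut(1)] continuous_on_compose2[OF continuous_cut(2)]) auto
    show "\<bar>trunc M y $ i\<bar> \<le> 2 * M" for y
      using component_le_norm_cart[of "trunc M y" i] norm_trunc[OF M, of y] by linarith
    show "norm (trunc_grad M i y) \<le> 17" for y by (rule trunc_grad_eq[OF M])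
  qed
  then show ?thesis by (simp add: trunc_jacobian_def)
qed

text \<open>One cutoff at unit scale is dilated, so that \<theta> and \<open>C\<close> are
  independent of \<open>T\<close> and the gradients decay like 1/T.\<close>

lemma cube_cutoff:
  fixes R :: "real^'n \<Rightarrow> real^'n"
  assumes R: "orthogonal_transformation R" and ab: "0 < a" "a < b"
  obtains \<theta> C where "C > 0" "\<And>T. T > 0 \<Longrightarrow> test_fun (cube R (b * T)) (\<lambda>x. \<theta> ((1 / T) *\<^sub>R x))"
    "\<And>x. 0 \<le> \<theta> x" "\<And>x. \<theta> x \<le> 1"
    "\<And>T x. T > 0 \<Longrightarrow> x \<in> cube R (a * T) \<Longrightarrow> \<theta> ((1 / T) *\<^sub>R x) = 1"
    "\<And>T x. T > 0 \<Longrightarrow> norm (grad (\<lambda>x. \<theta> ((1 / T) *\<^sub>R x)) x) \<le> C / T"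
proof -
  obtain \<theta> N where \<theta>: "test_fun (cube R b) \<theta>" "\<And>x. 0 \<le> \<theta> x" "\<And>x. \<theta> x \<le> 1" "closure (cube R a) \<subseteq> N" "\<And>x. x \<in> N \<Longrightarrow> \<theta> x = 1"
    using ex_cutoff[OF closure_cube_subset(1)[OF R ab] open_cube[OF R, of b] closure_cube_subset(2)[OF R ab]] ab by (metis less_trans)
  obtain r where r: "C1_comp r \<theta>" using test_fun_C1_comp[OF \<theta>(1)] by blast
  obtain C where C: "C > 0" "\<And>x. norm (grad \<theta> x) \<le> C" using bounded_comp_support[of "grad \<theta>" r] C1_compD(3,5)[OF r] by metis
  show ?thesis
  proof (rule that[of C \<theta>])
    fix T :: real assume T: "T > 0"
    have "{x. (1 / T) *\<^sub>R x + 0 \<in> cube R b} = cube R (b * T)"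
      using scaled_cube[OF R, of "1 / T" b] T ab by simp
    then show "test_fun (cube R (b * T)) (\<lambda>x. \<theta> ((1 / T) *\<^sub>R x))"
      using test_fun_affine[OF \<theta>(1), of "1 / T" 0] T by simp
    show "\<theta> ((1 / T) *\<^sub>R x) = 1" if "x \<in> cube R (a * T)" for x
    proof -
      have "{x. (1 / T) *\<^sub>R x \<in> cube R a} = cube R (a * T)" using scaled_cube[OF R, of "1 / T" a] T ab by simp
      then have "(1 / T) *\<^sub>R x \<in> cube R a" using that by blast
      then show ?thesis using \<theta>(4,5) closure_subset by blast
    qed
    show "norm (grad (\<lambda>x. \<theta> ((1 / T) *\<^sub>R x)) x) \<le> C / T" for x
    proof -
      have "grad (\<lambda>x. \<theta> ((1 / T) *\<^sub>R x + 0)) x = (1 / T) *\<^sub>R grad \<theta> ((1 / T) *\<^sub>R x + 0)"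
        by (rule grad_affine) (rule smooth_differentiable[OF test_fun_smooth[OF \<theta>(1)]])
      then show ?thesis using C(2)[of "(1 / T) *\<^sub>R x"] T by (simp add: divide_right_mono)
    qed
  qed (use C \<theta> in auto)
qed

end

section \<open>Modification near the boundary\<close>

lemma square_sum_weighted:
  fixes a b \<tau> :: real
  assumes "\<tau> > 0"
  shows "(a + b)\<^sup>2 \<le> (1 + \<tau>) * a\<^sup>2 + (1 + 1 / \<tau>) * b\<^sup>2"
proof -
  have "0 \<le> (\<tau> * a - b)\<^sup>2" by simp
  then have "2 * a * b * \<tau> \<le> \<tau>\<^sup>2 * a\<^sup>2 + b\<^sup>2" by (simp add: power2_eq_square algebra_simps)
  then have "2 * a * b \<le> \<tau> * a\<^sup>2 + b\<^sup>2 / \<tau>" using assms by (simp add: field_simps power2_eq_square)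
  then show ?thesis by (simp add: power2_sum algebra_simps)
qed

context cell_problem
begin

lemma degr_f_1_minus:
  assumes "0 < \<sigma>"
  shows "degr_f l (1 - \<sigma>) \<le> ennreal (l / \<sigma>)"
proof -
  have "l * (1 - \<sigma>) \<le> l * 1" using assms l by (intro mult_left_mono) auto
  then show ?thesis using assms by (auto simp: degr_f_def intro!: ennreal_leI divide_right_mono)
qed

text \<open>The constant 578 is twice the square of 17. For the part proportional to
  \<open>J\<close>, the two growth bounds of the recession function and monotonicity of the
  degradation suffice. The part with \<open>d\<close> comes from the gradient of a cutoff and is not
  controlled by the old energy, so there the degradation itself has to be bounded, by
  l/\<sigma>.\<close>

lemma bulk_layer:
  assumes J': "norm J' \<le> 17 * norm J + d" and d: "d \<ge> 0" and s: "s' \<le> s" and \<sigma>: "\<sigma> > 0" "s' \<le> 1 - \<sigma> \<or> d = 0"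
  shows "bulk l \<Psi> J' s' \<le> ennreal (578 * c\<^sup>2) * bulk l \<Psi> J s + ennreal (2 * c * (l / \<sigma>)\<^sup>2 * d\<^sup>2)"
proof -
  have c0: "c > 0" using c1 by simp
  have "(norm J')\<^sup>2 \<le> (17 * norm J + d)\<^sup>2" using J' by (intro power_mono) auto
  also have "\<dots> \<le> 578 * (norm J)\<^sup>2 + 2 * d\<^sup>2"
    using square_sum_weighted[of 1 "17 * norm J" d] by (simp add: power_mult_distrib)
  finally have "c * (norm J')\<^sup>2 \<le> c * (578 * (norm J)\<^sup>2 + 2 * d\<^sup>2)" using c0 by (intro mult_left_mono) auto
  then have rec: "recession \<Psi> J' \<le> 578 * c * (norm J)\<^sup>2 + 2 * c * d\<^sup>2"
    using recession_upper[of J'] by (simp add: algebra_simps)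
  have "bulk l \<Psi> J' s' \<le> (degr_f l s')\<^sup>2 * ennreal (recession \<Psi> J')" by (simp add: bulk_def)
  also have "\<dots> \<le> (degr_f l s')\<^sup>2 * (ennreal (578 * c * (norm J)\<^sup>2) + ennreal (2 * c * d\<^sup>2))"
    using rec c0 by (intro mult_left_mono) (auto simp: ennreal_plus[symmetric] ennreal_leI simp del: ennreal_plus)
  also have "\<dots> = (degr_f l s')\<^sup>2 * ennreal (578 * c * (norm J)\<^sup>2) + (degr_f l s')\<^sup>2 * ennreal (2 * c * d\<^sup>2)"
    by (rule distrib_left)
  also have "(degr_f l s')\<^sup>2 * ennreal (578 * c * (norm J)\<^sup>2) \<le> ennreal (578 * c\<^sup>2) * bulk l \<Psi> J s"
  proof (cases "J = 0")
    case False
    have "(norm J)\<^sup>2 \<le> c * recession \<Psi> J" using recession_lower[of J] c0 by (simp add: field_simps)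
    then have "578 * c * (norm J)\<^sup>2 \<le> 578 * c * (c * recession \<Psi> J)" using c0 by (intro mult_left_mono) auto
    then have "ennreal (578 * c * (norm J)\<^sup>2) \<le> ennreal (578 * c\<^sup>2) * ennreal (recession \<Psi> J)"
      using recession_nonneg by (simp add: ennreal_mult'[symmetric] ennreal_leI power2_eq_square mult_ac)
    moreover have "(degr_f l s')\<^sup>2 \<le> (degr_f l s)\<^sup>2" by (intro power_mono degr_f_mono l s) auto
    ultimately have "(degr_f l s')\<^sup>2 * ennreal (578 * c * (norm J)\<^sup>2) \<le> (degr_f l s)\<^sup>2 * (ennreal (578 * c\<^sup>2) * ennreal (recession \<Psi> J))"
      by (intro mult_mono) auto
    then show ?thesis using False by (simp add: bulk_def mult_ac)
  qed simp
  also have "(degr_f l s')\<^sup>2 * ennreal (2 * c * d\<^sup>2) \<le> ennreal (2 * c * (l / \<sigma>)\<^sup>2 * d\<^sup>2)"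
  proof (cases "d = 0")
    case False
    then have "degr_f l s' \<le> ennreal (l / \<sigma>)"
      using degr_f_mono[OF l, of s' "1 - \<sigma>"] degr_f_1_minus[OF \<sigma>(1)] \<sigma>(2) by (auto intro: order_trans)
    then have "(degr_f l s')\<^sup>2 \<le> (ennreal (l / \<sigma>))\<^sup>2" by (intro power_mono) auto
    also have "\<dots> = ennreal ((l / \<sigma>)\<^sup>2)" using l \<sigma> by (simp add: ennreal_power)
    finally have "(degr_f l s')\<^sup>2 * ennreal (2 * c * d\<^sup>2) \<le> ennreal ((l / \<sigma>)\<^sup>2) * ennreal (2 * c * d\<^sup>2)" by (rule mult_right_mono) simp
    also have "\<dots> = ennreal (2 * c * (l / \<sigma>)\<^sup>2 * d\<^sup>2)"
      by (subst ennreal_mult[symmetric]) (use c0 in \<open>auto simp: mult_ac\<close>)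
    finally show ?thesis .
  qed simp
  finally show ?thesis by (simp add: add_mono)
qed

text \<open>The nested sets separate three changes. From \<open>A0\<close> to \<open>B1\<close> the
  damage variable is lowered to a multiple of the damage profile; between \<open>B1\<close> and
  \<open>B2\<close> the truncated \<open>u\<close> is moved to the mollified jump; beyond
  \<open>B2\<close> the damage variable is moved to its boundary value. Wherever \<open>u\<close> is
  interpolated, the damage variable thus already vanishes next to the hyperplane and is at most 1 -
  \<sigma>. The error terms are, in order: truncation annulus and interpolation layer, L1 distance
  to the jump, the cost of \<sigma> and of the cutoff gradients over the whole cube, and the profile
  in the part of the slab off \<open>A0\<close>.\<close>

lemma modification:
  fixes u :: "real^'n \<Rightarrow> real^'m"
  assumes T: "T > 0" and J: "\<And>i. H1 (Q T) (\<lambda>x. u x $ i) (\<lambda>x. J x $ i)" and g: "H1 (Q T) v g"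
    and v: "AE x in lebesgue_on (Q T). 0 \<le> v x \<and> v x \<le> 1"
    and \<zeta>: "smooth \<zeta>" "\<And>x. 0 \<le> \<zeta> x" "\<And>x. \<zeta> x \<le> 1" "\<And>x. norm (grad \<zeta> x) \<le> D"
    and \<phi>1: "test_fun (Q T) \<phi>1" "\<And>x. 0 \<le> \<phi>1 x" "\<And>x. \<phi>1 x \<le> 1" "\<And>x. norm (grad \<phi>1 x) \<le> D"
    and \<phi>2: "test_fun (Q T) \<phi>2" "\<And>x. 0 \<le> \<phi>2 x" "\<And>x. \<phi>2 x \<le> 1" "\<And>x. norm (grad \<phi>2 x) \<le> D"
    and on: "\<And>x. x \<in> A0 \<Longrightarrow> \<zeta> x = 1" "\<And>x. x \<in> B1 \<Longrightarrow> \<phi>1 x = 1" "\<And>x. x \<in> B2 \<Longrightarrow> \<phi>2 x = 1"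
    and off: "\<And>x. x \<notin> B1 \<Longrightarrow> \<zeta> x = 0" "\<And>x. x \<notin> B2 \<Longrightarrow> \<phi>1 x = 0"
    and sets: "A0 \<subseteq> B1" "B1 \<subseteq> B2" "A0 \<in> sets lebesgue" "B1 \<in> sets lebesgue" "B2 \<in> sets lebesgue"
    and \<sigma>: "0 < \<sigma>" "\<sigma> < 1" and M: "M > 0" "norm z \<le> M / 2" and \<tau>: "\<tau> > 0"
    and B: "B > 0" "\<And>x. norm (grad damage_profile x) \<le> B"
  obtains u' v' where "(u', v') \<in> admissible \<phi> R z \<nu> T"
    "F_inf l \<Psi> 1 u' v' (Q T) \<le> ennreal (1 + \<tau>) * F_inf l \<Psi> 1 u v (Q T)
      + ennreal (578 * c\<^sup>2) * (\<integral>\<^sup>+ x. (indicator {y. M < norm y \<and> (norm y)\<^sup>2 < 2 * M\<^sup>2} (u x) + indicator (B2 - B1) x)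
          * bulk l \<Psi> (J x) (v x) \<partial>lebesgue_on (Q T))
      + ennreal (30 * c * (l / \<sigma>)\<^sup>2 * D\<^sup>2 * M) * (\<integral>\<^sup>+ x. ennreal (norm (u x - jump x)) \<partial>lebesgue_on (Q T))
      + ennreal (8 * (1 + 1 / \<tau>)) * (ennreal (\<sigma>\<^sup>2 + D\<^sup>2) * emeasure lebesgue (Q T)
          + ennreal (1 + B\<^sup>2) * emeasure lebesgue ({x \<in> Q T. \<bar>x \<bullet> \<nu>\<bar> < 3} - A0))"
proof -
  have D0: "D \<ge> 0" using \<zeta>(4)[of 0] norm_ge_zero order_trans by blast
  have QT: "Q T \<in> sets lebesgue" using T by (rule Q_lebesgue)
  note oQ = open_Q[OF T] note bQ = bounded_Q[of T]
  note sm = smooth_profile(2)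
  \<comment> \<open>\<open>W\<close> is one on \<open>A0\<close> and equals the damage profile off
    \<open>B1\<close>. Multiplying by it can only lower the damage variable, which keeps the
    degradation below its old value.\<close>
  define W where "W x = damage_profile x + \<zeta> x * (1 - damage_profile x)" for x
  define v1 where "v1 x = (1 - \<sigma>) * (W x * v x)" for x
  define g1 where "g1 x = (1 - \<sigma>) *\<^sub>R (W x *\<^sub>R g x + v x *\<^sub>R grad W x)" for x
  \<comment> \<open>Only beyond \<open>B2\<close>, where \<phi>2 may drop below one, can
    \<open>v'\<close> exceed \<open>v\<close>; there \<open>u'\<close> is already the mollified
    jump.\<close>
  define v' where "v' x = damage_profile x + \<phi>2 x * (v1 x - damage_profile x)" for x
  define g' where "g' x = grad damage_profile x + (\<phi>2 x *\<^sub>R (g1 x - grad damage_profile x) + (v1 x - damage_profile x) *\<^sub>R grad \<phi>2 x)" for x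
  \<comment> \<open>Truncation precedes interpolation, so that the function multiplying the cutoff
    gradient is bounded.\<close>
  define u' where "u' x = smooth_jump x + \<phi>1 x *\<^sub>R (trunc M (u x) - smooth_jump x)" for x
  define JT where "JT x = trunc_jacobian M (u x) (J x)" for x
  define J' where "J' x = (\<chi> i. jump_jacobian x $ i + (\<phi>1 x *\<^sub>R (JT x $ i - jump_jacobian x $ i) + (trunc M (u x) $ i - smooth_jump x $ i) *\<^sub>R grad \<phi>1 x))" for x
  have smW: "smooth W" unfolding W_def by (intro smooth_add smooth_mult smooth_diff smooth_const sm \<zeta>)
  have gW: "grad W x = (1 - \<zeta> x) *\<^sub>R grad damage_profile x + (1 - damage_profile x) *\<^sub>R grad \<zeta> x" for x
  proof -
    have d: "damage_profile differentiable at x" "\<zeta> differentiable at x" "(\<lambda>x. 1 - damage_profile x) differentiable at x"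
      "(\<lambda>x. \<zeta> x * (1 - damage_profile x)) differentiable at x"
      by (intro smooth_differentiable smooth_mult smooth_diff smooth_const sm \<zeta>)+
    have "grad (\<lambda>x. 1 - damage_profile x) x = - grad damage_profile x"
      using grad_diff[OF smooth_differentiable[OF smooth_const[of 1]] d(1)] grad_0_open[of UNIV x "\<lambda>x. 1" 1] by simp
    then show ?thesis
      unfolding W_def[abs_def] grad_add[OF d(1,4)] grad_mult[OF d(2,3)] by (simp add: algebra_simps)
  qed
  have Hv1: "H1 (Q T) v1 g1"
    unfolding v1_def g1_def by (intro H1_cmult H1_mult_smooth g bQ oQ smW QT)
  have HV: "H1 (Q T) damage_profile (grad damage_profile)" by (rule H1_smooth[OF sm bQ oQ])
  have HU: "H1 (Q T) (\<lambda>x. smooth_jump x $ i) (\<lambda>x. jump_jacobian x $ i)" for i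
    using H1_smooth[OF smooth_smooth_jump bQ oQ, of i] by (simp add: grad_smooth_jump[abs_def])
  \<comment> \<open>All boundary values are imposed in this form: smooth datum plus test function
    times difference. It gives gradient and trace at once.\<close>
  have perturb: "H1 (Q T) (\<lambda>x. P x + \<theta> x * f x) (\<lambda>x. grad P x + (\<theta> x *\<^sub>R F x + f x *\<^sub>R grad \<theta> x))
      \<and> has_trace R T (\<lambda>x. P x + \<theta> x * f x) P"
    if P: "smooth P" and \<theta>: "test_fun (Q T) \<theta>" and f: "H1 (Q T) f F" for P \<theta> f F
  proof -
    have H: "H1 UNIV (\<lambda>x. \<theta> x * f x) (\<lambda>x. \<theta> x *\<^sub>R F x + f x *\<^sub>R grad \<theta> x)" by (rule H1_mult_test[OF f QT \<theta>])
    obtain K where K: "compact K" "K \<subseteq> Q T" "\<And>x. x \<notin> K \<Longrightarrow> \<theta> x = 0" "\<And>x. x \<notin> K \<Longrightarrow> grad \<theta> x = 0"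
      using test_fun_support[OF \<theta>] by metis
    have "has_trace R T (\<lambda>x. P x + \<theta> x * f x) P"
      by (rule has_trace_compact_perturbation[OF R T P H K(1,2)]) (simp_all add: K)
    moreover have "H1 (Q T) (\<lambda>x. P x + \<theta> x * f x) (\<lambda>x. grad P x + (\<theta> x *\<^sub>R F x + f x *\<^sub>R grad \<theta> x))"
      by (intro H1_add H1_smooth P bQ oQ QT H1_mono[OF H]) auto
    ultimately show ?thesis by blast
  qed
  have Hv': "H1 (Q T) v' g'" "has_trace R T v' damage_profile"
    using perturb[OF sm \<phi>2(1) H1_diff[OF Hv1 HV QT]] unfolding v'_def g'_def by auto
  have Hu': "H1 (Q T) (\<lambda>x. u' x $ i) (\<lambda>x. J' x $ i)" "has_trace R T (\<lambda>x. u' x $ i) (\<lambda>x. smooth_jump x $ i)" for i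
    using perturb[OF smooth_smooth_jump \<phi>1(1) H1_diff[OF H1_trunc[OF oQ bQ J M(1)] HU QT], of i]
    unfolding u'_def J'_def JT_def by (simp_all add: grad_smooth_jump)
  define S3 where "S3 = {x \<in> Q T. \<bar>x \<bullet> \<nu>\<bar> < 3}"
  \<comment> \<open>The only part of the cube where the damage profile can increase the surface
    terms: on \<open>A0\<close> it does not enter, and at distance at least 3 from the hyperplane it
    is one with zero gradient.\<close>
  define ch where "ch = S3 - A0"
  have W01: "0 \<le> W x" "W x \<le> 1" "1 - W x = (1 - \<zeta> x) * (1 - damage_profile x)" for x
  proof -
    show e: "1 - W x = (1 - \<zeta> x) * (1 - damage_profile x)" by (simp add: W_def algebra_simps)
    have "0 \<le> (1 - \<zeta> x) * (1 - damage_profile x)" using \<zeta>(3)[of x] damage_profile_range[of x] by simp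
    then show "W x \<le> 1" using e by linarith
    show "0 \<le> W x" unfolding W_def using \<zeta>(2)[of x] damage_profile_range[of x] by simp
  qed
  have point: "energy_density l \<Psi> (J' x) (v' x) (g' x) \<le> ennreal (1 + \<tau>) * energy_density l \<Psi> (J x) (v x) (g x)
      + ennreal (578 * c\<^sup>2) * ((indicator {y. M < norm y \<and> (norm y)\<^sup>2 < 2 * M\<^sup>2} (u x) + indicator (B2 - B1) x) * bulk l \<Psi> (J x) (v x))
      + ennreal (30 * c * (l / \<sigma>)\<^sup>2 * D\<^sup>2 * M) * ennreal (norm (u x - jump x))
      + ennreal (8 * (1 + 1 / \<tau>)) * (ennreal (\<sigma>\<^sup>2 + D\<^sup>2) + ennreal (1 + B\<^sup>2) * indicator ch x)"
    and v'01: "0 \<le> v' x \<and> v' x \<le> 1"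
    if v01: "0 \<le> v x" "v x \<le> 1" and xQ: "x \<in> Q T" for x
  proof -
    let ?V = "damage_profile x"
    note V01 = damage_profile_range[of x]
    have Wv: "0 \<le> W x * v x" "W x * v x \<le> v x" using W01[of x] v01 by (auto intro: mult_left_le_one_le)
    have v1: "0 \<le> v1 x" "v1 x \<le> W x * v x" unfolding v1_def using \<sigma> Wv by (auto intro: mult_left_le_one_le)
    have v1v: "v1 x \<le> v x" "v1 x \<le> 1" using v1 Wv v01 by auto
    have v': "v' x = \<phi>2 x * v1 x + (1 - \<phi>2 x) * ?V" by (simp add: v'_def algebra_simps)
    have v'0: "0 \<le> v' x" unfolding v' using \<phi>2(2,3)[of x] v1 V01 by simp
    have v'1: "v' x \<le> 1"
    proof -
      have "\<phi>2 x * v1 x + (1 - \<phi>2 x) * ?V \<le> \<phi>2 x * 1 + (1 - \<phi>2 x) * 1"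
        using \<phi>2(2,3)[of x] v1v V01 by (intro add_mono mult_left_mono) auto
      then show ?thesis unfolding v' by simp
    qed
    show "0 \<le> v' x \<and> v' x \<le> 1" using v'0 v'1 by blast
    have \<zeta>ch: "(1 - \<zeta> x) * (1 - ?V) \<le> indicator ch x" "(1 - \<phi>2 x) * (1 - ?V) \<le> indicator ch x"
      "(1 - \<zeta> x) * norm (grad damage_profile x) \<le> B * indicator ch x" "(1 - \<phi>2 x) * norm (grad damage_profile x) \<le> B * indicator ch x"
    proof -
      have "x \<in> ch \<or> (\<zeta> x = 1 \<and> \<phi>2 x = 1) \<or> 3 \<le> \<bar>x \<bullet> \<nu>\<bar>"
        using on(1)[of x] on(3)[of x] sets xQ by (auto simp: ch_def S3_def)
      moreover have "(1 - \<zeta> x) * (1 - ?V) \<le> 1 * 1" "(1 - \<phi>2 x) * (1 - ?V) \<le> 1 * 1"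
        "(1 - \<zeta> x) * norm (grad damage_profile x) \<le> 1 * B" "(1 - \<phi>2 x) * norm (grad damage_profile x) \<le> 1 * B"
        using \<zeta>(2,3)[of x] \<phi>2(2,3)[of x] V01 B by (intro mult_mono; simp)+
      ultimately show "(1 - \<zeta> x) * (1 - ?V) \<le> indicator ch x" "(1 - \<phi>2 x) * (1 - ?V) \<le> indicator ch x"
        "(1 - \<zeta> x) * norm (grad damage_profile x) \<le> B * indicator ch x" "(1 - \<phi>2 x) * norm (grad damage_profile x) \<le> B * indicator ch x"
        using B(1) by (auto simp: damage_profile_1 grad_damage_profile_0 indicator_def)
    qed
    have E2: "(1 - v' x)\<^sup>2 \<le> (1 + \<tau>) * (1 - v x)\<^sup>2 + (1 + 1 / \<tau>) * (2 * \<sigma>\<^sup>2 + 8 * indicator ch x)"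
    proof -
      \<comment> \<open>All three factors of \<open>v1\<close> lie between 0 and 1, so their losses
        at most add up.\<close>
      have "1 - v1 x \<le> (1 - v x) + \<sigma> + (1 - W x)"
      proof -
        have "v x - W x * v x \<le> 1 - W x" using mult_right_mono[of "v x" 1 "1 - W x"] W01(2)[of x] v01 by (simp add: algebra_simps)
        moreover have "W x * v x - v1 x \<le> \<sigma>"
          using mult_left_mono[of "W x * v x" 1 \<sigma>] Wv v01 \<sigma> by (simp add: v1_def algebra_simps)
        ultimately show ?thesis by linarith
      qed
      then have "\<phi>2 x * (1 - v1 x) \<le> \<phi>2 x * ((1 - v x) + \<sigma> + (1 - \<zeta> x) * (1 - ?V))"
        using \<phi>2(2)[of x] W01(3)[of x] by (intro mult_left_mono) auto
      also have "\<dots> \<le> 1 * ((1 - v x) + \<sigma> + (1 - \<zeta> x) * (1 - ?V))"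
        using \<phi>2(3)[of x] v01 \<sigma> \<zeta>(3)[of x] V01 by (intro mult_right_mono) auto
      finally have "1 - v' x \<le> (1 - v x) + (\<sigma> + 2 * indicator ch x)"
        using \<zeta>ch(1,2) unfolding v' by (simp add: algebra_simps)
      then have "(1 - v' x)\<^sup>2 \<le> ((1 - v x) + (\<sigma> + 2 * indicator ch x))\<^sup>2"
        using v'1 by (intro power_mono) auto
      also have "\<dots> \<le> (1 + \<tau>) * (1 - v x)\<^sup>2 + (1 + 1 / \<tau>) * (\<sigma> + 2 * indicator ch x)\<^sup>2" by (rule square_sum_weighted[OF \<tau>])
      also have "(\<sigma> + 2 * indicator ch x)\<^sup>2 \<le> 2 * \<sigma>\<^sup>2 + 8 * indicator ch x"
        using square_sum_weighted[of 1 \<sigma> 2] square_sum_weighted[of 1 \<sigma> 0] by (cases "x \<in> ch") simp_all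
      finally show ?thesis using \<tau> by (simp add: mult_left_mono)
    qed
    have E3: "(norm (g' x))\<^sup>2 \<le> (1 + \<tau>) * (norm (g x))\<^sup>2 + (1 + 1 / \<tau>) * (8 * D\<^sup>2 + 8 * B\<^sup>2 * indicator ch x)"
    proof -
      have nW: "norm (grad W x) \<le> B * indicator ch x + D"
      proof -
        have "norm (grad W x) \<le> (1 - \<zeta> x) * norm (grad damage_profile x) + (1 - ?V) * norm (grad \<zeta> x)"
          unfolding gW using \<zeta>(3)[of x] V01 by (intro order_trans[OF norm_triangle_ineq]) simp
        moreover have "(1 - ?V) * norm (grad \<zeta> x) \<le> 1 * D" using V01 \<zeta>(4)[of x] by (intro mult_mono) auto
        ultimately show ?thesis using \<zeta>ch(3) by linarith
      qed
      have "norm (g1 x) \<le> 1 * norm (W x *\<^sub>R g x + v x *\<^sub>R grad W x)"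
        unfolding g1_def norm_scaleR using \<sigma> by (intro mult_right_mono) auto
      also have "\<dots> \<le> norm (W x *\<^sub>R g x) + norm (v x *\<^sub>R grad W x)"
        unfolding mult_1 by (rule norm_triangle_ineq)
      also have "norm (W x *\<^sub>R g x) \<le> 1 * norm (g x)" unfolding norm_scaleR using W01[of x] by (intro mult_right_mono) auto
      also have "norm (v x *\<^sub>R grad W x) \<le> 1 * norm (grad W x)" unfolding norm_scaleR using v01 by (intro mult_right_mono) auto
      finally have ng1: "norm (g1 x) \<le> norm (g x) + (B * indicator ch x + D)" using nW by simp
      have "g' x = \<phi>2 x *\<^sub>R g1 x + ((1 - \<phi>2 x) *\<^sub>R grad damage_profile x + (v1 x - ?V) *\<^sub>R grad \<phi>2 x)"
        by (simp add: g'_def algebra_simps)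
      then have "norm (g' x) \<le> norm (\<phi>2 x *\<^sub>R g1 x) + (norm ((1 - \<phi>2 x) *\<^sub>R grad damage_profile x) + norm ((v1 x - ?V) *\<^sub>R grad \<phi>2 x))"
        by (metis norm_triangle_ineq norm_triangle_mono order_refl)
      also have "norm (\<phi>2 x *\<^sub>R g1 x) \<le> 1 * norm (g1 x)" unfolding norm_scaleR using \<phi>2(2,3)[of x] by (intro mult_right_mono) auto
      also have "norm ((1 - \<phi>2 x) *\<^sub>R grad damage_profile x) \<le> B * indicator ch x" using \<zeta>ch(4) \<phi>2(3)[of x] by simp
      also have "norm ((v1 x - ?V) *\<^sub>R grad \<phi>2 x) \<le> 1 * D"
        unfolding norm_scaleR using v1 v1v V01 \<phi>2(4)[of x] by (intro mult_mono) auto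
      finally have "norm (g' x) \<le> norm (g x) + (2 * D + 2 * (B * indicator ch x))" using ng1 by simp
      then have "(norm (g' x))\<^sup>2 \<le> (norm (g x) + (2 * D + 2 * (B * indicator ch x)))\<^sup>2" by (intro power_mono) auto
      also have "\<dots> \<le> (1 + \<tau>) * (norm (g x))\<^sup>2 + (1 + 1 / \<tau>) * (2 * D + 2 * (B * indicator ch x))\<^sup>2" by (rule square_sum_weighted[OF \<tau>])
      also have "(2 * D + 2 * (B * indicator ch x))\<^sup>2 \<le> 8 * D\<^sup>2 + 8 * B\<^sup>2 * indicator ch x"
        using square_sum_weighted[of 1 "2 * D" "2 * B"] square_sum_weighted[of 1 "2 * D" 0]
        by (cases "x \<in> ch") (simp_all add: power_mult_distrib)
      finally show ?thesis using \<tau> by (simp add: mult_left_mono)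
    qed
    define an where "an = (indicator {y. M < norm y \<and> (norm y)\<^sup>2 < 2 * M\<^sup>2} (u x) + indicator (B2 - B1) x :: ennreal)"
    have E1: "bulk l \<Psi> (J' x) (v' x) \<le> bulk l \<Psi> (J x) (v x) + ennreal (578 * c\<^sup>2) * (an * bulk l \<Psi> (J x) (v x))
      + ennreal (30 * c * (l / \<sigma>)\<^sup>2 * D\<^sup>2 * M) * ennreal (norm (u x - jump x))"
    proof -
      have nJT: "norm (JT x) \<le> 17 * norm (J x)" unfolding JT_def by (rule norm_trunc_jacobian[OF M(1)])
      \<comment> \<open>In \<open>B1\<close> the only change of \<open>u\<close> is its truncation;
        in the layer it is interpolated; off \<open>B2\<close> it is the mollified jump.\<close>
      consider "x \<in> B1" | "x \<in> B2 - B1" | "x \<notin> B2" by blast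
      then show ?thesis
      proof cases
        case 1
        have "grad \<phi>1 x = 0"
          using on(2)[OF 1] \<phi>1 by (intro grad_0_extremum smooth_differentiable test_fun_smooth[OF \<phi>1(1)]) auto
        then have J'x: "J' x = JT x" using on(2)[OF 1] by (simp add: J'_def vec_eq_iff)
        have v'x: "v' x \<le> v x" using on(3)[of x] 1 sets v1v(1) by (auto simp: v')
        \<comment> \<open>Below the level nothing changes, far above it the new gradient is zero,
          and only the annulus between pays the factor from \<open>bulk_layer\<close>. There
          \<open>d = 0\<close>, so any positive \<sigma> may be passed.\<close>
        consider "norm (u x) \<le> M" | "(norm (u x))\<^sup>2 \<ge> 2 * M\<^sup>2" | "M < norm (u x)" "(norm (u x))\<^sup>2 < 2 * M\<^sup>2" by linarith
        then show ?thesis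
        proof cases
          case 1
          have "bulk l \<Psi> (J' x) (v' x) \<le> bulk l \<Psi> (J x) (v x)"
            unfolding J'x JT_def trunc_eq(2)[OF M(1) 1] bulk_def
            using degr_f_mono[OF l v'x] by (auto intro!: mult_right_mono power_mono)
          then show ?thesis by (simp add: add_increasing2 add.assoc)
        next
          case 2
          have "J' x = 0" unfolding J'x JT_def by (rule trunc_0[OF M(1) 2])
          then show ?thesis by (simp add: bulk_def)
        next
          case 3
          have "bulk l \<Psi> (J' x) (v' x) \<le> ennreal (578 * c\<^sup>2) * bulk l \<Psi> (J x) (v x)"
            using bulk_layer[of "J' x" "J x" 0 "v' x" "v x" 1] nJT v'x J'x by simp
          also have "\<dots> \<le> ennreal (578 * c\<^sup>2) * (an * bulk l \<Psi> (J x) (v x))"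
          proof (intro mult_left_mono)
            have "1 \<le> an" using 3 by (simp add: an_def)
            then show "bulk l \<Psi> (J x) (v x) \<le> an * bulk l \<Psi> (J x) (v x)" using mult_right_mono[of 1 an] by simp
          qed simp
          finally show ?thesis by (simp add: add_increasing add_increasing2)
        qed
      next
        case 2
        have \<zeta>0: "\<zeta> x = 0" and \<phi>21: "\<phi>2 x = 1" using 2 off(1) on(3) by auto
        have v'x: "v' x = (1 - \<sigma>) * (?V * v x)" using \<zeta>0 \<phi>21 by (simp add: v' v1_def W_def)
        show ?thesis
        \<comment> \<open>Next to the hyperplane the mollified jump differs from the jump and has a
          gradient, but the damage profile as a factor of \<open>v'\<close> removes the bulk energy.
          Further away the two jumps coincide and are locally constant up to the boundary of the
          strip.\<close>
        proof (cases "\<bar>x \<bullet> \<nu>\<bar> \<le> 1")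
          case True
          then have "v' x = 0" by (simp add: v'x damage_profile_0)
          then show ?thesis by (simp add: bulk_def)
        next
          case False
          then have jj: "jump_jacobian x = 0" and sj: "smooth_jump x = jump x"
            by (simp_all add: jump_jacobian_def grad_jump_profile_0 vec_eq_iff jump_eq)
          let ?d = "norm (trunc M (u x) - jump x)"
          have "J' x = \<phi>1 x *\<^sub>R JT x + (\<chi> i. (trunc M (u x) - jump x) $ i *\<^sub>R grad \<phi>1 x)"
            by (simp add: J'_def vec_eq_iff jj sj)
          then have "norm (J' x) \<le> norm (\<phi>1 x *\<^sub>R JT x) + norm (\<chi> i. (trunc M (u x) - jump x) $ i *\<^sub>R grad \<phi>1 x)"
            by (simp only: norm_triangle_ineq)
          also have "norm (\<phi>1 x *\<^sub>R JT x) \<le> 1 * norm (JT x)" unfolding norm_scaleR using \<phi>1(2,3)[of x] by (intro mult_right_mono) auto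
          also have "norm (\<chi> i. (trunc M (u x) - jump x) $ i *\<^sub>R grad \<phi>1 x) \<le> ?d * D"
            unfolding norm_outer by (intro mult_left_mono \<phi>1) auto
          finally have nJ': "norm (J' x) \<le> 17 * norm (J x) + ?d * D" using nJT by simp
          have "?V * v x \<le> 1 * 1" using V01 v01 by (intro mult_mono) auto
          then have "(1 - \<sigma>) * (?V * v x) \<le> (1 - \<sigma>) * 1" using \<sigma> by (intro mult_left_mono) auto
          then have v'\<sigma>: "v' x \<le> 1 - \<sigma>" by (simp add: v'x)
          have v'v: "v' x \<le> v x" using v1v(1) \<phi>21 by (simp add: v')
          have "norm (jump x) \<le> norm z" by (simp add: jump_def indicator_def)
          \<comment> \<open>The squared difference in front of the cutoff gradient becomes its first
            power times \<open>15 * M\<close>; with the factor 2 from \<open>bulk_layer\<close> this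
            is the constant 30.\<close>
          then have d2: "?d\<^sup>2 \<le> 15 * M * norm (u x - jump x)" using M by (intro trunc_diff) auto
          have "bulk l \<Psi> (J' x) (v' x) \<le> ennreal (578 * c\<^sup>2) * bulk l \<Psi> (J x) (v x) + ennreal (2 * c * (l / \<sigma>)\<^sup>2 * (?d * D)\<^sup>2)"
            using D0 v'\<sigma> by (intro bulk_layer[OF nJ' _ v'v \<sigma>(1)]) auto
          also have "ennreal (578 * c\<^sup>2) * bulk l \<Psi> (J x) (v x) \<le> ennreal (578 * c\<^sup>2) * (an * bulk l \<Psi> (J x) (v x))"
          proof (intro mult_left_mono)
            have "1 \<le> an" using 2 by (simp add: an_def add_increasing)
            then show "bulk l \<Psi> (J x) (v x) \<le> an * bulk l \<Psi> (J x) (v x)" using mult_right_mono[of 1 an] by simp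
          qed simp
          also have "ennreal (2 * c * (l / \<sigma>)\<^sup>2 * (?d * D)\<^sup>2) \<le> ennreal (30 * c * (l / \<sigma>)\<^sup>2 * D\<^sup>2 * M * norm (u x - jump x))"
          proof (rule ennreal_leI)
            have "(2 * c * (l / \<sigma>)\<^sup>2 * D\<^sup>2) * ?d\<^sup>2 \<le> (2 * c * (l / \<sigma>)\<^sup>2 * D\<^sup>2) * (15 * M * norm (u x - jump x))"
              using c1 by (intro mult_left_mono d2) auto
            then show "2 * c * (l / \<sigma>)\<^sup>2 * (?d * D)\<^sup>2 \<le> 30 * c * (l / \<sigma>)\<^sup>2 * D\<^sup>2 * M * norm (u x - jump x)"
              by (simp add: power_mult_distrib mult_ac)
          qed
          also have "\<dots> = ennreal (30 * c * (l / \<sigma>)\<^sup>2 * D\<^sup>2 * M) * ennreal (norm (u x - jump x))"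
            using c1 M(1) by (intro ennreal_mult) auto
          finally show ?thesis by (simp add: add_increasing add_mono add.assoc)
        qed
      next
        case 3
        have "grad \<phi>1 x = 0"
          using off(2)[OF 3] \<phi>1 by (intro grad_0_extremum smooth_differentiable test_fun_smooth[OF \<phi>1(1)]) auto
        then have J'x: "J' x = jump_jacobian x" using off(2)[OF 3] by (simp add: J'_def vec_eq_iff)
        \<comment> \<open>Here \<zeta> vanishes, so both summands of \<open>v'\<close> contain the
          damage profile as a factor, which is zero wherever the mollified jump has a
          gradient.\<close>
        have "bulk l \<Psi> (J' x) (v' x) = 0"
        proof (cases "1 \<le> \<bar>x \<bullet> \<nu>\<bar>")
          case True
          then have "J' x = 0" unfolding J'x by (simp add: jump_jacobian_def grad_jump_profile_0 vec_eq_iff)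
          then show ?thesis by (simp add: bulk_def)
        next
          case False
          then have "?V = 0" by (simp add: damage_profile_0)
          moreover have "\<zeta> x = 0" using off(1) 3 sets(2) by blast
          ultimately have "v' x = 0" by (simp add: v' v1_def W_def)
          then show ?thesis by (simp add: bulk_def)
        qed
        then show ?thesis by simp
      qed
    qed
    let ?k = "1 + 1 / \<tau>"
    have k0: "?k \<ge> 0" using \<tau> by simp
    define i where "i = (indicator ch x :: real)"
    have i0: "0 \<le> i" by (simp add: i_def)
    have E23: "ennreal ((1 - v' x)\<^sup>2 / 4) + ennreal ((norm (g' x))\<^sup>2) \<le> ennreal (1 + \<tau>) * (ennreal ((1 - v x)\<^sup>2 / 4) + ennreal ((norm (g x))\<^sup>2))
      + ennreal (8 * ?k) * (ennreal (\<sigma>\<^sup>2 + D\<^sup>2) + ennreal (1 + B\<^sup>2) * indicator ch x)"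
    proof -
      have "(1 - v' x)\<^sup>2 / 4 + (norm (g' x))\<^sup>2 \<le> (1 + \<tau>) * ((1 - v x)\<^sup>2 / 4 + (norm (g x))\<^sup>2)
        + ?k * ((2 * \<sigma>\<^sup>2 + 8 * i) / 4 + (8 * D\<^sup>2 + 8 * B\<^sup>2 * i))"
      proof -
        have "(1 - v' x)\<^sup>2 / 4 \<le> ((1 + \<tau>) * (1 - v x)\<^sup>2 + ?k * (2 * \<sigma>\<^sup>2 + 8 * i)) / 4"
          using E2 by (simp add: i_def)
        also have "\<dots> = (1 + \<tau>) * ((1 - v x)\<^sup>2 / 4) + ?k * ((2 * \<sigma>\<^sup>2 + 8 * i) / 4)" by (simp add: add_divide_distrib)
        finally have a: "(1 - v' x)\<^sup>2 / 4 \<le> (1 + \<tau>) * ((1 - v x)\<^sup>2 / 4) + ?k * ((2 * \<sigma>\<^sup>2 + 8 * i) / 4)" .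
        show ?thesis using add_mono[OF a E3[folded i_def]] by (simp only: distrib_left add_ac)
      qed
      also have "\<dots> \<le> (1 + \<tau>) * ((1 - v x)\<^sup>2 / 4 + (norm (g x))\<^sup>2) + ?k * (8 * ((\<sigma>\<^sup>2 + D\<^sup>2) + (1 + B\<^sup>2) * i))"
      proof (intro add_left_mono mult_left_mono k0)
        show "(2 * \<sigma>\<^sup>2 + 8 * i) / 4 + (8 * D\<^sup>2 + 8 * B\<^sup>2 * i) \<le> 8 * ((\<sigma>\<^sup>2 + D\<^sup>2) + (1 + B\<^sup>2) * i)"
          using i0 zero_le_power2[of \<sigma>] by (simp add: algebra_simps)
      qed
      also have "?k * (8 * ((\<sigma>\<^sup>2 + D\<^sup>2) + (1 + B\<^sup>2) * i)) = 8 * ?k * ((\<sigma>\<^sup>2 + D\<^sup>2) + (1 + B\<^sup>2) * i)"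
        by (simp only: mult.assoc mult.left_commute)
      finally have "(1 - v' x)\<^sup>2 / 4 + (norm (g' x))\<^sup>2 \<le> (1 + \<tau>) * ((1 - v x)\<^sup>2 / 4 + (norm (g x))\<^sup>2) + 8 * ?k * ((\<sigma>\<^sup>2 + D\<^sup>2) + (1 + B\<^sup>2) * i)" .
      then have "ennreal ((1 - v' x)\<^sup>2 / 4 + (norm (g' x))\<^sup>2) \<le> ennreal ((1 + \<tau>) * ((1 - v x)\<^sup>2 / 4 + (norm (g x))\<^sup>2) + 8 * ?k * ((\<sigma>\<^sup>2 + D\<^sup>2) + (1 + B\<^sup>2) * i))"
        by (rule ennreal_leI)
      also have "\<dots> = ennreal (1 + \<tau>) * (ennreal ((1 - v x)\<^sup>2 / 4) + ennreal ((norm (g x))\<^sup>2)) + ennreal (8 * ?k) * (ennreal (\<sigma>\<^sup>2 + D\<^sup>2) + ennreal (1 + B\<^sup>2) * ennreal i)"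
      proof -
        have "ennreal ((1 + \<tau>) * ((1 - v x)\<^sup>2 / 4 + (norm (g x))\<^sup>2)) = ennreal (1 + \<tau>) * (ennreal ((1 - v x)\<^sup>2 / 4) + ennreal ((norm (g x))\<^sup>2))"
          using \<tau> by (subst ennreal_mult) auto
        moreover have "ennreal (8 * ?k * ((\<sigma>\<^sup>2 + D\<^sup>2) + (1 + B\<^sup>2) * i)) = ennreal (8 * ?k) * (ennreal (\<sigma>\<^sup>2 + D\<^sup>2) + ennreal (1 + B\<^sup>2) * ennreal i)"
        proof -
          have "ennreal ((\<sigma>\<^sup>2 + D\<^sup>2) + (1 + B\<^sup>2) * i) = ennreal (\<sigma>\<^sup>2 + D\<^sup>2) + ennreal (1 + B\<^sup>2) * ennreal i"
            using i0 by (subst ennreal_plus) (auto simp: ennreal_mult)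
          then show ?thesis using k0 i0 by (subst ennreal_mult) auto
        qed
        ultimately show ?thesis using \<tau> i0 by (subst ennreal_plus) auto
      qed
      finally show ?thesis by (simp add: i_def ennreal_indicator)
    qed
    have "bulk l \<Psi> (J x) (v x) \<le> ennreal (1 + \<tau>) * bulk l \<Psi> (J x) (v x)"
    proof -
      have "1 \<le> ennreal (1 + \<tau>)" using \<tau> by (simp flip: ennreal_1 add: ennreal_leI)
      then show ?thesis using mult_right_mono[of 1 "ennreal (1 + \<tau>)"] by simp
    qed
    then have E1': "bulk l \<Psi> (J' x) (v' x) \<le> ennreal (1 + \<tau>) * bulk l \<Psi> (J x) (v x) + ennreal (578 * c\<^sup>2) * (an * bulk l \<Psi> (J x) (v x))
      + ennreal (30 * c * (l / \<sigma>)\<^sup>2 * D\<^sup>2 * M) * ennreal (norm (u x - jump x))"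
      by (intro order_trans[OF E1] add_mono) auto
    have "energy_density l \<Psi> (J' x) (v' x) (g' x) = bulk l \<Psi> (J' x) (v' x) + (ennreal ((1 - v' x)\<^sup>2 / 4) + ennreal ((norm (g' x))\<^sup>2))"
      by (simp only: energy_density_def add.assoc)
    also have "\<dots> \<le> (ennreal (1 + \<tau>) * bulk l \<Psi> (J x) (v x) + ennreal (578 * c\<^sup>2) * (an * bulk l \<Psi> (J x) (v x))
      + ennreal (30 * c * (l / \<sigma>)\<^sup>2 * D\<^sup>2 * M) * ennreal (norm (u x - jump x))) + (ennreal (1 + \<tau>) * (ennreal ((1 - v x)\<^sup>2 / 4) + ennreal ((norm (g x))\<^sup>2))
      + ennreal (8 * ?k) * (ennreal (\<sigma>\<^sup>2 + D\<^sup>2) + ennreal (1 + B\<^sup>2) * indicator ch x))"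
      by (rule add_mono[OF E1' E23])
    also have "\<dots> = ennreal (1 + \<tau>) * energy_density l \<Psi> (J x) (v x) (g x)
      + ennreal (578 * c\<^sup>2) * (an * bulk l \<Psi> (J x) (v x))
      + ennreal (30 * c * (l / \<sigma>)\<^sup>2 * D\<^sup>2 * M) * ennreal (norm (u x - jump x))
      + ennreal (8 * ?k) * (ennreal (\<sigma>\<^sup>2 + D\<^sup>2) + ennreal (1 + B\<^sup>2) * indicator ch x)"
      by (simp only: energy_density_def distrib_left add_ac)
    finally show "energy_density l \<Psi> (J' x) (v' x) (g' x) \<le> ennreal (1 + \<tau>) * energy_density l \<Psi> (J x) (v x) (g x)
      + ennreal (578 * c\<^sup>2) * ((indicator {y. M < norm y \<and> (norm y)\<^sup>2 < 2 * M\<^sup>2} (u x) + indicator (B2 - B1) x) * bulk l \<Psi> (J x) (v x))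
      + ennreal (30 * c * (l / \<sigma>)\<^sup>2 * D\<^sup>2 * M) * ennreal (norm (u x - jump x))
      + ennreal (8 * (1 + 1 / \<tau>)) * (ennreal (\<sigma>\<^sup>2 + D\<^sup>2) + ennreal (1 + B\<^sup>2) * indicator ch x)"
      unfolding an_def .
  qed
  have vQ: "AE x in lebesgue_on (Q T). x \<in> Q T \<and> 0 \<le> v x \<and> v x \<le> 1"
    using v AE_space[of "lebesgue_on (Q T)"] by eventually_elim auto
  have adm: "(u', v') \<in> admissible \<phi> R z \<nu> T"
    unfolding admissible_iff W12_vec_def W12_iff_H1
  proof (intro conjI allI)
    show "AE x in lebesgue_on (Q T). 0 \<le> v' x \<and> v' x \<le> 1" using vQ by eventually_elim (use v'01 in auto)
  qed (use Hu' Hv' in auto)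
  note [measurable] = H1_rows_measurable[OF J] sq_integrable_measurable[OF H1_sq_integrable(1)[OF g]] sq_integrable_measurable[OF H1_sq_integrable(2)[OF g]]
  have S3l: "S3 \<in> sets lebesgue"
  proof -
    have "open {x. \<bar>x \<bullet> \<nu>\<bar> < 3}" by (intro open_Collect_less continuous_intros)
    then have "open (Q T \<inter> {x. \<bar>x \<bullet> \<nu>\<bar> < 3})" using oQ by blast
    moreover have "Q T \<inter> {x. \<bar>x \<bullet> \<nu>\<bar> < 3} = S3" by (auto simp: S3_def)
    ultimately show ?thesis using open_lebesgue by metis
  qed
  have chl: "ch \<in> sets lebesgue" unfolding ch_def using S3l sets(3) by blast
  have chsub: "ch \<inter> Q T = ch" by (auto simp: ch_def S3_def)
  have mind: "(\<lambda>x. indicator S x :: ennreal) \<in> borel_measurable (lebesgue_on (Q T))" if "S \<in> sets lebesgue" for S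
    using that by (intro measurable_restrict_space1 borel_measurable_indicator)
  note [measurable] = mind[OF chl] mind[of "B2 - B1"]
  have B21: "B2 - B1 \<in> sets lebesgue" using sets by blast
  have anm: "(\<lambda>x. indicator {y. M < norm y \<and> (norm y)\<^sup>2 < 2 * M\<^sup>2} (u x) :: ennreal) \<in> borel_measurable (lebesgue_on (Q T))"
  proof (rule measurable_compose[OF H1_rows_measurable(1)[OF J] borel_measurable_indicator])
    have "open {y :: real^'m. M < norm y}" "open {y :: real^'m. (norm y)\<^sup>2 < 2 * M\<^sup>2}"
      by (intro open_Collect_less continuous_intros)+
    then show "{y :: real^'m. M < norm y \<and> (norm y)\<^sup>2 < 2 * M\<^sup>2} \<in> sets borel"
      by (intro borel_open open_Collect_conj)
  qed
  note [measurable] = mind[OF B21] anm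
  have edm: "(\<lambda>x. energy_density l \<Psi> (J x) (v x) (g x)) \<in> borel_measurable (lebesgue_on (Q T))"
    unfolding energy_density_def by measurable
  note [measurable] = edm
  have "F_inf l \<Psi> 1 u' v' (Q T) = (\<integral>\<^sup>+ x. energy_density l \<Psi> (J' x) (v' x) (g' x) \<partial>lebesgue_on (Q T))"
    by (rule F_inf_1[OF T Hu'(1) Hv'(1)])
  also have "\<dots> \<le> (\<integral>\<^sup>+ x. ennreal (1 + \<tau>) * energy_density l \<Psi> (J x) (v x) (g x)
      + ennreal (578 * c\<^sup>2) * ((indicator {y. M < norm y \<and> (norm y)\<^sup>2 < 2 * M\<^sup>2} (u x) + indicator (B2 - B1) x) * bulk l \<Psi> (J x) (v x))
      + ennreal (30 * c * (l / \<sigma>)\<^sup>2 * D\<^sup>2 * M) * ennreal (norm (u x - jump x))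
      + ennreal (8 * (1 + 1 / \<tau>)) * (ennreal (\<sigma>\<^sup>2 + D\<^sup>2) + ennreal (1 + B\<^sup>2) * indicator ch x) \<partial>lebesgue_on (Q T))"
  proof (rule nn_integral_mono_AE, use vQ in eventually_elim)
    case (elim x)
    then show ?case using point[of x] by blast
  qed
  also have "\<dots> = ennreal (1 + \<tau>) * F_inf l \<Psi> 1 u v (Q T)
      + ennreal (578 * c\<^sup>2) * (\<integral>\<^sup>+ x. (indicator {y. M < norm y \<and> (norm y)\<^sup>2 < 2 * M\<^sup>2} (u x) + indicator (B2 - B1) x)
          * bulk l \<Psi> (J x) (v x) \<partial>lebesgue_on (Q T))
      + ennreal (30 * c * (l / \<sigma>)\<^sup>2 * D\<^sup>2 * M) * (\<integral>\<^sup>+ x. ennreal (norm (u x - jump x)) \<partial>lebesgue_on (Q T))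
      + ennreal (8 * (1 + 1 / \<tau>)) * (\<integral>\<^sup>+ x. ennreal (\<sigma>\<^sup>2 + D\<^sup>2) + ennreal (1 + B\<^sup>2) * indicator ch x \<partial>lebesgue_on (Q T))"
  proof -
    define fa where "fa x = energy_density l \<Psi> (J x) (v x) (g x)" for x
    define fb where "fb x = (indicator {y. M < norm y \<and> (norm y)\<^sup>2 < 2 * M\<^sup>2} (u x) + indicator (B2 - B1) x) * bulk l \<Psi> (J x) (v x)" for x
    define fc where "fc x = ennreal (norm (u x - jump x))" for x
    define fd where "fd x = ennreal (\<sigma>\<^sup>2 + D\<^sup>2) + ennreal (1 + B\<^sup>2) * indicator ch x" for x
    have [measurable]: "fa \<in> borel_measurable (lebesgue_on (Q T))" "fb \<in> borel_measurable (lebesgue_on (Q T))"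
      "fc \<in> borel_measurable (lebesgue_on (Q T))" "fd \<in> borel_measurable (lebesgue_on (Q T))"
      unfolding fa_def fb_def fc_def fd_def by measurable
    have "(\<integral>\<^sup>+ x. ka * fa x + kb * fb x + kc * fc x + kd * fd x \<partial>lebesgue_on (Q T))
      = ka * (\<integral>\<^sup>+ x. fa x \<partial>lebesgue_on (Q T)) + kb * (\<integral>\<^sup>+ x. fb x \<partial>lebesgue_on (Q T))
        + kc * (\<integral>\<^sup>+ x. fc x \<partial>lebesgue_on (Q T)) + kd * (\<integral>\<^sup>+ x. fd x \<partial>lebesgue_on (Q T))" for ka kb kc kd
      by (simp add: nn_integral_add nn_integral_cmult)
    from this[of "ennreal (1 + \<tau>)" "ennreal (578 * c\<^sup>2)" "ennreal (30 * c * (l / \<sigma>)\<^sup>2 * D\<^sup>2 * M)" "ennreal (8 * (1 + 1 / \<tau>))"]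
    show ?thesis unfolding F_inf_1[OF T J g] fa_def fb_def fc_def fd_def .
  qed
  also have "(\<integral>\<^sup>+ x. ennreal (\<sigma>\<^sup>2 + D\<^sup>2) + ennreal (1 + B\<^sup>2) * indicator ch x \<partial>lebesgue_on (Q T))
    = ennreal (\<sigma>\<^sup>2 + D\<^sup>2) * emeasure lebesgue (Q T) + ennreal (1 + B\<^sup>2) * emeasure lebesgue ch"
  proof -
    have "(\<integral>\<^sup>+ x. indicator ch x \<partial>lebesgue_on (Q T)) = (\<integral>\<^sup>+ x. indicator ch x * indicator (Q T) x \<partial>lebesgue)"
      using QT by (simp add: nn_integral_restrict_space)
    also have "\<dots> = (\<integral>\<^sup>+ x. indicator (ch \<inter> Q T) x \<partial>lebesgue)" by (simp only: indicator_inter_arith)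
    also have "\<dots> = emeasure lebesgue ch" unfolding chsub using chl by (rule nn_integral_indicator)
    finally have i: "(\<integral>\<^sup>+ x. indicator ch x \<partial>lebesgue_on (Q T)) = emeasure lebesgue ch" .
    have "emeasure (lebesgue_on (Q T)) (Q T) = emeasure lebesgue (Q T)"
      using QT by (subst emeasure_restrict_space) (auto simp del: emeasure_completion)
    then show ?thesis using i
      by (subst nn_integral_add, measurable) (simp add: nn_integral_cmult del: emeasure_completion)
  qed
  finally have "F_inf l \<Psi> 1 u' v' (Q T) \<le> ennreal (1 + \<tau>) * F_inf l \<Psi> 1 u v (Q T)
      + ennreal (578 * c\<^sup>2) * (\<integral>\<^sup>+ x. (indicator {y. M < norm y \<and> (norm y)\<^sup>2 < 2 * M\<^sup>2} (u x) + indicator (B2 - B1) x)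
          * bulk l \<Psi> (J x) (v x) \<partial>lebesgue_on (Q T))
      + ennreal (30 * c * (l / \<sigma>)\<^sup>2 * D\<^sup>2 * M) * (\<integral>\<^sup>+ x. ennreal (norm (u x - jump x)) \<partial>lebesgue_on (Q T))
      + ennreal (8 * (1 + 1 / \<tau>)) * (ennreal (\<sigma>\<^sup>2 + D\<^sup>2) * emeasure lebesgue (Q T)
          + ennreal (1 + B\<^sup>2) * emeasure lebesgue ({x \<in> Q T. \<bar>x \<bullet> \<nu>\<bar> < 3} - A0))"
    unfolding ch_def S3_def .
  with adm show ?thesis using that by blast
qed

end

section \<open>Comparison of the two minimisation problems\<close>

lemma AE_scale:
  fixes P :: "real^'n \<Rightarrow> bool"
  assumes P: "AE x in lebesgue_on A. P x" and A: "A \<in> sets lebesgue" and a: "a > 0"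
  shows "AE x in lebesgue_on {x. a *\<^sub>R x \<in> A}. P (a *\<^sub>R x)"
proof -
  have m: "(\<lambda>x. 0 + a *\<^sub>R x) \<in> lebesgue \<rightarrow>\<^sub>M lebesgue"
    using similarity_lebesgue(1)[of "\<lambda>x::real^'n. x" a 0] a by simp
  have B: "{x. a *\<^sub>R x \<in> A} \<in> sets lebesgue"
    using measurable_sets[OF m A] by (simp add: vimage_def)
  have "AE x in lebesgue. x \<in> A \<longrightarrow> P x" using P A by (subst (asm) AE_restrict_space_iff) auto
  then obtain N where N: "N \<in> null_sets lebesgue" "\<And>x. \<not> (x \<in> A \<longrightarrow> P x) \<Longrightarrow> x \<in> N"
    unfolding eventually_ae_filter by auto
  have Nl: "N \<in> sets lebesgue" using N by auto
  have N': "{x. a *\<^sub>R x \<in> N} \<in> sets lebesgue"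
    using measurable_sets[OF m Nl] by (simp add: vimage_def)
  have "(\<integral>\<^sup>+ x. indicator N x \<partial>lebesgue) = ennreal (a ^ DIM(real^'n)) * (\<integral>\<^sup>+ x. indicator N (0 + a *\<^sub>R x) \<partial>lebesgue)"
    using nn_integral_similarity[of "\<lambda>x::real^'n. x" a "indicator N" 0] Nl a by simp
  moreover have "(\<integral>\<^sup>+ x. indicator N x \<partial>lebesgue) = 0" using N(1) by (simp add: null_sets_def del: emeasure_completion)
  ultimately have "(\<integral>\<^sup>+ x. indicator {x. a *\<^sub>R x \<in> N} x \<partial>lebesgue) = 0"
    using a by (auto simp: indicator_def)
  then have "emeasure lebesgue {x. a *\<^sub>R x \<in> N} = 0" using N' by (simp del: emeasure_completion)
  then have "{x. a *\<^sub>R x \<in> N} \<in> null_sets lebesgue" using N' by (rule null_setsI)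
  then have "AE x in lebesgue. x \<notin> {x. a *\<^sub>R x \<in> N}" by (rule AE_not_in)
  then have "AE x in lebesgue. x \<in> {x. a *\<^sub>R x \<in> A} \<longrightarrow> P (a *\<^sub>R x)"
    by eventually_elim (use N(2) in auto)
  then show ?thesis using B by (subst AE_restrict_space_iff) auto
qed

lemma sum_disjoint_indicator_le_1:
  assumes "finite I" "disjoint_family_on A I"
  shows "(\<Sum>i\<in>I. indicator (A i) x) \<le> (1 :: ennreal)"
proof -
  have "(\<Sum>i\<in>I. indicator (A i) x) = (indicator (\<Union>i\<in>I. A i) x :: ennreal)"
    using indicator_UN_disjoint[OF assms] by metis
  then show ?thesis by (simp add: indicator_def)
qed

section \<open>Imposing boundary values on an almost optimal pair\<close>

context cell_problem
begin

lemma power_dim: "T ^ CARD('n) = T * T ^ (CARD('n) - 1)" for T :: real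
proof -
  have "CARD('n) = Suc (CARD('n) - 1)" by simp
  then show ?thesis by (metis power_Suc)
qed

lemma emeasure_Q: "T > 0 \<Longrightarrow> emeasure lebesgue (Q T) = ennreal (T ^ CARD('n))"
proof -
  assume T: "T > 0"
  have "{x \<in> Q T. \<bar>x \<bullet> \<nu>\<bar> < T / 2} = Q T"
    using mem_cube[OF R T] Rk by auto
  then show ?thesis using slab_lebesgue(2)[OF T, of "T / 2"] T by (simp add: power_dim)
qed

text \<open>The condition \<open>6 \<le> a * T\<close> makes the slab a full box also in the inner
  cube, so that both volumes are products.\<close>

lemma emeasure_boundary_slab:
  assumes T: "T > 0" and a: "0 < a" "a < 1" "6 \<le> a * T"
  shows "emeasure lebesgue ({x \<in> Q T. \<bar>x \<bullet> \<nu>\<bar> < 3} - Q (a * T)) = ennreal (6 * T ^ (CARD('n) - 1) * (1 - a ^ (CARD('n) - 1)))"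
proof -
  have aT: "a * T > 0" "a * T < T" using T a by auto
  have sub: "Q (a * T) \<subseteq> Q T" using closure_cube_subset(2)[OF R aT] closure_subset by blast
  let ?S = "\<lambda>r. {x \<in> Q r. \<bar>x \<bullet> \<nu>\<bar> < 3}"
  have 1: "?S T \<in> sets lebesgue" "emeasure lebesgue (?S T) = ennreal (2 * 3 * T ^ (CARD('n) - 1))"
    using aT a by (intro slab_lebesgue T; simp)+
  have 2: "?S (a * T) \<in> sets lebesgue" "emeasure lebesgue (?S (a * T)) = ennreal (2 * 3 * (a * T) ^ (CARD('n) - 1))"
    using aT a by (intro slab_lebesgue; simp)+
  have "?S T - Q (a * T) = ?S T - ?S (a * T)" by auto
  moreover have "emeasure lebesgue (?S T - ?S (a * T)) = emeasure lebesgue (?S T) - emeasure lebesgue (?S (a * T))"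
  proof (rule emeasure_Diff)
    show "emeasure lebesgue (?S (a * T)) \<noteq> \<infinity>" unfolding 2 by simp
    show "?S (a * T) \<subseteq> ?S T" using sub by auto
  qed (fact 1 2)+
  ultimately have "emeasure lebesgue (?S T - Q (a * T)) = emeasure lebesgue (?S T) - emeasure lebesgue (?S (a * T))"
    by (simp only:)
  also have "\<dots> = ennreal (6 * T ^ (CARD('n) - 1) - 6 * (a * T) ^ (CARD('n) - 1))"
    unfolding 1 2 using aT by (subst ennreal_minus) auto
  finally show ?thesis by (simp add: power_mult_distrib algebra_simps)
qed

text \<open>All constants are fixed before \<open>T\<close>: the relative radii and levels depend on
  \<open>E0\<close> and \<delta> only, the cutoffs are dilated from unit scale, and \<eta> comes
  after everything that multiplies the L1 distance. Only \<sigma>, the gradient bound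
  \<open>D\<close> and the index selected by pigeonhole depend on the given cube or pair.\<close>

lemma recovery:
  assumes E0: "E0 \<ge> 0" and \<delta>: "\<delta> > 0"
  obtains \<eta> T0 where "\<eta> > 0" "T0 > 0"
    "\<And>T u v. T \<ge> T0 \<Longrightarrow> W12_vec (Q T) u \<Longrightarrow> W12 (Q T) v \<Longrightarrow> (AE x in lebesgue_on (Q T). 0 \<le> v x \<and> v x \<le> 1) \<Longrightarrow>
      F_inf l \<Psi> 1 u v (Q T) \<le> ennreal (E0 * T ^ (CARD('n) - 1)) \<Longrightarrow>
      (\<integral>\<^sup>+ x. ennreal (norm (u x - jump x)) \<partial>lebesgue_on (Q T)) \<le> ennreal (\<eta> * T ^ CARD('n)) \<Longrightarrow>
      \<exists>u' v'. (u', v') \<in> admissible \<phi> R z \<nu> T \<and>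
        F_inf l \<Psi> 1 u' v' (Q T) \<le> F_inf l \<Psi> 1 u v (Q T) + ennreal (\<delta> * T ^ (CARD('n) - 1))"
proof -
  let ?p = "CARD('n) - 1"
  have c0: "c > 0" using c1 by simp
  obtain B where B: "B > 0" "\<And>x. norm (grad damage_profile x) \<le> B" using grad_damage_profile_bounded by blast
  \<comment> \<open>Five errors are allotted a fifth of \<delta> each. The first is the factor 1 +
    \<tau> on the energy, which is at most \<open>E0\<close> after normalisation.\<close>
  define \<tau> where "\<tau> = \<delta> / (5 * (E0 + 1))"
  have \<tau>: "\<tau> > 0" using \<delta> E0 by (simp add: \<tau>_def)
  have \<tau>E: "\<tau> * E0 \<le> \<delta> / 5" using \<delta> E0 by (simp add: \<tau>_def field_simps)
  define k8 where "k8 = 8 * (1 + 1 / \<tau>)"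
  have k8: "k8 > 0" using \<tau> by (simp add: k8_def add_pos_pos)
  define L where "L = k8 * (1 + B\<^sup>2) * 6"
  have L: "L > 0" using k8 by (simp add: L_def add_pos_nonneg)
  \<comment> \<open>Relative width of the region next to the boundary. Bernoulli's inequality makes
    the slab outside the inner cube small, with \<open>L\<close> collecting the constants in front;
    \<open>e \<le> 1/2\<close> keeps that inner cube at least half as large as
    \<open>Q T\<close>.\<close>
  define e where "e = min (1/2) (\<delta> / (5 * L * (real ?p + 1)))"
  have e: "0 < e" "e \<le> 1/2" using \<delta> L by (auto simp: e_def)
  have Le: "L * (1 - (1 - e) ^ ?p) \<le> \<delta> / 5"
  proof -
    have "1 + real ?p * (- e) \<le> (1 + (- e)) ^ ?p" using e by (intro Bernoulli_inequality) simp
    then have "1 - (1 - e) ^ ?p \<le> (real ?p + 1) * e" using e by (simp add: algebra_simps)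
    then have "L * (1 - (1 - e) ^ ?p) \<le> L * ((real ?p + 1) * e)" using L by (intro mult_left_mono) auto
    also have "\<dots> \<le> L * ((real ?p + 1) * (\<delta> / (5 * L * (real ?p + 1))))"
      using L by (intro mult_left_mono) (auto simp: e_def)
    also have "\<dots> = \<delta> / 5" using L by (simp add: field_simps)
    finally show ?thesis .
  qed
  \<comment> \<open>The cost of \<sigma> over the volume gets one tenth of \<delta>; the other tenth
    of the same share is left for the squared cutoff gradients.\<close>
  define s where "s = sqrt (\<delta> / (10 * k8))"
  have s: "s > 0" using \<delta> k8 by (simp add: s_def)
  have s2: "k8 * s\<^sup>2 = \<delta> / 10" using \<delta> k8 by (simp add: s_def)
  \<comment> \<open>Number of candidates for the pigeonhole. The annuli are disjoint and so are the
    layers, so that all candidates together cost at most twice the bulk energy and the cheapest at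
    most \<open>2 * E0 / K\<close> after normalisation.\<close>
  obtain K :: nat where K: "578 * c\<^sup>2 * (2 * E0) * 5 / \<delta> + 1 \<le> real K" using real_arch_simple by blast
  have K1: "K \<ge> 1"
  proof -
    have "0 \<le> 578 * c\<^sup>2 * (2 * E0) * 5 / \<delta>" using E0 \<delta> by simp
    then have "1 \<le> real K" using K by linarith
    then show ?thesis by simp
  qed
  have KE: "578 * c\<^sup>2 * (2 * E0 / K) \<le> \<delta> / 5"
  proof -
    have "578 * c\<^sup>2 * (2 * E0) * 5 / \<delta> \<le> real K" using K by linarith
    then show ?thesis using \<delta> K1 by (simp add: field_simps)
  qed
  \<comment> \<open>Strictly increasing relative radii between 1 - e and 1; consecutive ones bound
    the layers in which \<open>u\<close> may be interpolated.\<close>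
  define b where "b i = 1 - e / real (i + 2)" for i :: nat
  have b: "1 - e < b i" "b i < b (Suc i)" "0 < b i" "b i < 1" for i
  proof -
    have "e / real (i + 2) < e / 1" using e by (intro divide_strict_left_mono) auto
    then show "1 - e < b i" by (simp add: b_def)
    then show "0 < b i" using e by linarith
    show "b i < b (Suc i)" unfolding b_def using e by (simp add: frac_less2)
    show "b i < 1" using e by (simp add: b_def)
  qed
  have bmono: "i \<le> j \<Longrightarrow> b i \<le> b j" for i j by (rule lift_Suc_mono_le) (use b(2) less_imp_le in blast)
  have e1: "0 < 1 - e" using e by simp
  obtain \<theta>0 C0 where th0: "C0 > 0" "\<And>T. T > 0 \<Longrightarrow> test_fun (Q (b 0 * T)) (\<lambda>x. \<theta>0 ((1 / T) *\<^sub>R x))"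
    "\<And>x. 0 \<le> \<theta>0 x" "\<And>x. \<theta>0 x \<le> 1" "\<And>T x. T > 0 \<Longrightarrow> x \<in> Q ((1 - e) * T) \<Longrightarrow> \<theta>0 ((1 / T) *\<^sub>R x) = 1"
    "\<And>T x. T > 0 \<Longrightarrow> norm (grad (\<lambda>x. \<theta>0 ((1 / T) *\<^sub>R x)) x) \<le> C0 / T"
    by (rule cube_cutoff[OF R e1 b(1)]) blast
  have "\<exists>\<theta> C. C > 0 \<and> (\<forall>T>0. test_fun (Q (b (Suc i) * T)) (\<lambda>x. \<theta> ((1 / T) *\<^sub>R x))) \<and> (\<forall>x. 0 \<le> \<theta> x \<and> \<theta> x \<le> 1)
    \<and> (\<forall>T>0. \<forall>x\<in>Q (b i * T). \<theta> ((1 / T) *\<^sub>R x) = 1) \<and> (\<forall>T>0. \<forall>x. norm (grad (\<lambda>x. \<theta> ((1 / T) *\<^sub>R x)) x) \<le> C / T)" for i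
    by (rule cube_cutoff[OF R b(3)[of i] b(2)[of i]]) blast
  then obtain \<theta>1 C1 where th1': "\<And>i. C1 i > 0 \<and> (\<forall>T>0. test_fun (Q (b (Suc i) * T)) (\<lambda>x. \<theta>1 i ((1 / T) *\<^sub>R x))) \<and> (\<forall>x. 0 \<le> \<theta>1 i x \<and> \<theta>1 i x \<le> 1)
    \<and> (\<forall>T>0. \<forall>x\<in>Q (b i * T). \<theta>1 i ((1 / T) *\<^sub>R x) = 1) \<and> (\<forall>T>0. \<forall>x. norm (grad (\<lambda>x. \<theta>1 i ((1 / T) *\<^sub>R x)) x) \<le> C1 i / T)"
    by metis
  have th1: "\<And>i. C1 i > 0" "\<And>i T. T > 0 \<Longrightarrow> test_fun (Q (b (Suc i) * T)) (\<lambda>x. \<theta>1 i ((1 / T) *\<^sub>R x))"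
    "\<And>i x. 0 \<le> \<theta>1 i x" "\<And>i x. \<theta>1 i x \<le> 1" "\<And>i T x. T > 0 \<Longrightarrow> x \<in> Q (b i * T) \<Longrightarrow> \<theta>1 i ((1 / T) *\<^sub>R x) = 1"
    "\<And>i T x. T > 0 \<Longrightarrow> norm (grad (\<lambda>x. \<theta>1 i ((1 / T) *\<^sub>R x)) x) \<le> C1 i / T"
    using th1' by blast+
  obtain \<theta>2 C2 where th2: "C2 > 0" "\<And>T. T > 0 \<Longrightarrow> test_fun (Q (1 * T)) (\<lambda>x. \<theta>2 ((1 / T) *\<^sub>R x))"
    "\<And>x. 0 \<le> \<theta>2 x" "\<And>x. \<theta>2 x \<le> 1" "\<And>T x. T > 0 \<Longrightarrow> x \<in> Q (b K * T) \<Longrightarrow> \<theta>2 ((1 / T) *\<^sub>R x) = 1"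
    "\<And>T x. T > 0 \<Longrightarrow> norm (grad (\<lambda>x. \<theta>2 ((1 / T) *\<^sub>R x)) x) \<le> C2 / T"
    by (rule cube_cutoff[OF R b(3)[of K] b(4)[of K]]) blast
  define C where "C = C0 + (\<Sum>i<K. C1 i) + C2"
  have sC1: "0 \<le> (\<Sum>i<K. C1 i)" using th1(1) by (intro sum_nonneg) (auto intro: less_imp_le)
  have C: "C > 0" "C0 \<le> C" "C2 \<le> C" "\<And>i. i < K \<Longrightarrow> C1 i \<le> C"
  proof -
    show "C > 0" "C0 \<le> C" "C2 \<le> C" using th0(1) th2(1) sC1 by (auto simp: C_def)
    fix i assume "i < K"
    then have "C1 i \<le> (\<Sum>i<K. C1 i)" using th1(1) by (intro member_le_sum) (auto intro: less_imp_le)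
    then show "C1 i \<le> C" using th0(1) th2(1) by (simp add: C_def)
  qed
  \<comment> \<open>Doubling levels have disjoint truncation annuli. The base
    \<open>2 * norm z + 1\<close> is positive and gives the inequality
    \<open>norm z \<le> M i / 2\<close> under which truncation is compared with the jump.\<close>
  define M where "M i = 2 ^ i * (2 * norm z + 1)" for i :: nat
  have M0: "2 * norm z + 1 \<le> M i" for i
  proof -
    have "1 * (2 * norm z + 1) \<le> 2 ^ i * (2 * norm z + 1)" by (intro mult_right_mono) auto
    then show ?thesis by (simp add: M_def)
  qed
  have M: "M i > 0" "norm z \<le> M i / 2" for i using M0[of i] norm_ge_zero[of z] by linarith+
  have MS: "M (Suc i) = 2 * M i" for i by (simp add: M_def)
  have Mmono: "i \<le> j \<Longrightarrow> M i \<le> M j" for i j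
    by (rule lift_Suc_mono_le) (use M(1) MS in \<open>auto simp: less_imp_le\<close>)
  \<comment> \<open>After inserting the sizes of \<sigma> and \<open>D\<close>, the coefficient of
    the L1 distance is at most \<open>G / T\<close>. The top level \<open>M K\<close> stands for
    whichever level will be selected, so that \<eta> can be fixed now.\<close>
  define G where "G = 30 * c * (l\<^sup>2 / s\<^sup>2) * C\<^sup>2 * M K"
  have G: "G > 0" using c0 l s C M by (simp add: G_def)
  define \<eta> where "\<eta> = \<delta> / (5 * G)"
  have \<eta>: "\<eta> > 0" using \<delta> G by (simp add: \<eta>_def)
  \<comment> \<open>The number 12 gives the inner cube side at least 6, \<open>s\<^sup>2 + 1\<close>
    makes \<sigma> less than one, and the last entry makes the squared cutoff gradients small over
    the volume.\<close>
  define T0 where "T0 = max (max 12 (s\<^sup>2 + 1)) (10 * k8 * C\<^sup>2 / \<delta>)"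
  have T0: "T0 > 0" by (simp add: T0_def)
  show ?thesis
  proof (rule that[OF \<eta> T0])
    fix T u v
    assume TT: "T \<ge> T0" and u: "W12_vec (Q T) u" and v: "W12 (Q T) v"
      and AE: "AE x in lebesgue_on (Q T). 0 \<le> v x \<and> v x \<le> 1"
      and F: "F_inf l \<Psi> 1 u v (Q T) \<le> ennreal (E0 * T ^ ?p)"
      and L1: "(\<integral>\<^sup>+ x. ennreal (norm (u x - jump x)) \<partial>lebesgue_on (Q T)) \<le> ennreal (\<eta> * T ^ CARD('n))"
    have T: "T > 0" "T \<ge> 12" "s\<^sup>2 < T" "10 * k8 * C\<^sup>2 / \<delta> \<le> T" using TT T0 by (auto simp: T0_def)
    obtain J where J: "\<And>i. H1 (Q T) (\<lambda>x. u x $ i) (\<lambda>x. J x $ i)" using W12_vec_H1[OF u] by blast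
    obtain g where g: "H1 (Q T) v g" using v W12_iff_H1 by blast
    note [measurable] = H1_rows_measurable[OF J] sq_integrable_measurable[OF H1_sq_integrable(1)[OF g]]
    define ann where "ann i = {y :: real^'m. M i < norm y \<and> (norm y)\<^sup>2 < 2 * (M i)\<^sup>2}" for i
    define lay where "lay i = Q (b (Suc i) * T) - Q (b i * T)" for i
    define I where "I i = (\<integral>\<^sup>+ x. (indicator (ann i) (u x) + indicator (lay i) x) * bulk l \<Psi> (J x) (v x) \<partial>lebesgue_on (Q T))" for i
    have Ql: "Q (b i * T) \<in> sets lebesgue" for i using b(3) T by (intro Q_lebesgue) simp
    have Qmono: "Q (b i * T) \<subseteq> Q (b j * T)" if "i \<le> j" for i j
    proof (cases "i = j")
      case False
      then have "b i * T < b j * T" using that b(2)[of i] bmono[of "Suc i" j] T by simp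
      then show ?thesis using closure_cube_subset(2)[OF R, of "b i * T" "b j * T"] closure_subset b(3) T by fastforce
    qed simp
    have ann_meas: "ann i \<in> sets borel" for i
    proof -
      have "open {y :: real^'m. M i < norm y}" "open {y :: real^'m. (norm y)\<^sup>2 < 2 * (M i)\<^sup>2}"
        by (intro open_Collect_less continuous_intros)+
      then show ?thesis unfolding ann_def by (intro borel_open open_Collect_conj)
    qed
    have meas1: "(\<lambda>x. indicator (ann i) (u x) :: ennreal) \<in> borel_measurable (lebesgue_on (Q T))" for i
      using ann_meas by (intro measurable_compose[OF H1_rows_measurable(1)[OF J]] borel_measurable_indicator)
    have meas2: "(\<lambda>x. indicator (lay i) x :: ennreal) \<in> borel_measurable (lebesgue_on (Q T))" for i
      unfolding lay_def using Ql by (intro measurable_restrict_space1 borel_measurable_indicator) blast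
    note [measurable] = meas1 meas2
    have ann_disj: "disjoint_family_on ann {..<K}"
    proof -
      have *: "ann i \<inter> ann j = {}" if "i < j" for i j
      proof -
        have "2 * M i \<le> M j" using Mmono[of "Suc i" j] that MS by simp
        moreover have "norm y < 2 * M i" if "y \<in> ann i" for y
        proof (rule power2_less_imp_less)
          have "(norm y)\<^sup>2 < 2 * (M i)\<^sup>2" using that by (simp add: ann_def)
          also have "\<dots> \<le> (2 * M i)\<^sup>2" by (simp add: power_mult_distrib)
          finally show "(norm y)\<^sup>2 < (2 * M i)\<^sup>2" .
        qed (use M(1)[of i] in simp)
        ultimately show ?thesis by (force simp: ann_def)
      qed
      show ?thesis unfolding disjoint_family_on_def using * by (metis Int_commute nat_neq_iff)
    qed
    have lay_disj: "disjoint_family_on lay {..<K}"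
    proof -
      have *: "lay i \<inter> lay j = {}" if "i < j" for i j
        using Qmono[of "Suc i" j] that by (auto simp: lay_def)
      show ?thesis unfolding disjoint_family_on_def using * by (metis Int_commute nat_neq_iff)
    qed
    have Isum: "(\<Sum>i<K. I i) \<le> 2 * F_inf l \<Psi> 1 u v (Q T)"
    proof -
      have "(\<Sum>i<K. I i) = (\<integral>\<^sup>+ x. (\<Sum>i<K. (indicator (ann i) (u x) + indicator (lay i) x) * bulk l \<Psi> (J x) (v x)) \<partial>lebesgue_on (Q T))"
        unfolding I_def by (subst nn_integral_sum) measurable
      also have "\<dots> \<le> (\<integral>\<^sup>+ x. 2 * energy_density l \<Psi> (J x) (v x) (g x) \<partial>lebesgue_on (Q T))"
      proof (intro nn_integral_mono)
        fix x
        have "(\<Sum>i<K. (indicator (ann i) (u x) + indicator (lay i) x) * bulk l \<Psi> (J x) (v x))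
          = ((\<Sum>i<K. indicator (ann i) (u x)) + (\<Sum>i<K. indicator (lay i) x)) * bulk l \<Psi> (J x) (v x)"
          by (simp only: sum_distrib_right[symmetric] sum.distrib)
        also have "\<dots> \<le> (1 + 1) * bulk l \<Psi> (J x) (v x)"
          by (intro mult_right_mono add_mono sum_disjoint_indicator_le_1 ann_disj lay_disj) auto
        also have "\<dots> \<le> 2 * energy_density l \<Psi> (J x) (v x) (g x)"
          unfolding one_add_one by (intro mult_left_mono) (auto simp: energy_density_def add.assoc)
        finally show "(\<Sum>i<K. (indicator (ann i) (u x) + indicator (lay i) x) * bulk l \<Psi> (J x) (v x)) \<le> 2 * energy_density l \<Psi> (J x) (v x) (g x)" .
      qed
      also have "\<dots> = 2 * F_inf l \<Psi> 1 u v (Q T)"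
      proof -
        note [measurable] = sq_integrable_measurable[OF H1_sq_integrable(2)[OF g]]
        have "(\<lambda>x. energy_density l \<Psi> (J x) (v x) (g x)) \<in> borel_measurable (lebesgue_on (Q T))"
          unfolding energy_density_def by measurable
        then show ?thesis unfolding F_inf_1[OF T(1) J g] by (rule nn_integral_cmult)
      qed
      finally show ?thesis .
    qed
    \<comment> \<open>One index selects level and layer together, because the two costs were added
      before minimising.\<close>
    obtain i where i: "i < K" "\<And>j. j < K \<Longrightarrow> I i \<le> I j"
    proof -
      have ne: "I ` {..<K} \<noteq> {}" using K1 by (auto simp: lessThan_empty_iff)
      then have "Min (I ` {..<K}) \<in> I ` {..<K}" by (intro Min_in) auto
      then obtain i where "i < K" "I i = Min (I ` {..<K})" by auto
      then show ?thesis using that[of i] by (auto intro: Min_le)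
    qed
    have Ii: "I i \<le> ennreal (2 * E0 / K * T ^ ?p)"
    proof -
      have "of_nat K * I i \<le> (\<Sum>i<K. I i)"
        using sum_bounded_below[of "{..<K}" "I i" I] i(2) by simp
      also have "\<dots> \<le> 2 * ennreal (E0 * T ^ ?p)" using Isum F by (meson order_trans mult_left_mono zero_le)
      also have "\<dots> = ennreal (2 * (E0 * T ^ ?p))" using E0 T by (simp add: ennreal_mult')
      finally have *: "of_nat K * I i \<le> ennreal (2 * (E0 * T ^ ?p))" .
      show ?thesis
      proof (cases "I i")
        case (real r)
        have "ennreal (real K * r) \<le> ennreal (2 * (E0 * T ^ ?p))"
          using * real by (simp add: ennreal_of_nat_eq_real_of_nat ennreal_mult')
        then have "real K * r \<le> 2 * (E0 * T ^ ?p)" using E0 T by (simp add: ennreal_le_iff)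
        then have "r \<le> 2 * E0 / K * T ^ ?p" using K1 by (simp add: field_simps)
        then show ?thesis using real by (simp add: ennreal_leI)
      next
        case top
        then have "of_nat K * I i = top" using K1 by (simp add: ennreal_mult_top)
        then show ?thesis using * by (simp add: top_unique)
      qed
    qed
    \<comment> \<open>The balance between the two effects of \<sigma>: its square times the volume
      and the L1 term, whose coefficient contains the inverse square of \<sigma> and the square of
      \<open>D\<close>, are both of order T^(n-1).\<close>
    define \<sigma> where "\<sigma> = s / sqrt T"
    have sT: "sqrt T > 0" "(sqrt T)\<^sup>2 = T" using T by auto
    have \<sigma>: "0 < \<sigma>" "\<sigma> < 1"
    proof -
      show "0 < \<sigma>" using s sT by (simp add: \<sigma>_def)
      have "s < sqrt T" using T(3) by (intro real_less_rsqrt)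
      then show "\<sigma> < 1" using sT by (simp add: \<sigma>_def)
    qed
    have \<sigma>2: "\<sigma>\<^sup>2 = s\<^sup>2 / T" using sT by (simp add: \<sigma>_def power_divide)
    define D where "D = C / T"
    have gD: "x \<le> Cx / T \<Longrightarrow> Cx \<le> C \<Longrightarrow> x \<le> D" for x Cx
      unfolding D_def using T by (meson divide_right_mono less_imp_le order_trans)
    have QK: "Q (b (Suc j) * T) \<subseteq> Q T" for j
      using closure_cube_subset(2)[OF R, of "b (Suc j) * T" T] closure_subset b(3,4) T by fastforce
    have sub0: "Q ((1 - e) * T) \<subseteq> Q (b i * T)"
    proof -
      have "(1 - e) * T < b i * T" using b(1) T by simp
      then show ?thesis using closure_cube_subset(2)[OF R, of "(1 - e) * T" "b i * T"] closure_subset e1 T by fastforce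
    qed
    have i2: "test_fun (Q T) (\<lambda>x. \<theta>2 ((1 / T) *\<^sub>R x))" using th2(2)[OF T(1)] by simp
    obtain u' v' where uv': "(u', v') \<in> admissible \<phi> R z \<nu> T" and F': "F_inf l \<Psi> 1 u' v' (Q T) \<le> ennreal (1 + \<tau>) * F_inf l \<Psi> 1 u v (Q T)
      + ennreal (578 * c\<^sup>2) * (\<integral>\<^sup>+ x. (indicator {y. M i < norm y \<and> (norm y)\<^sup>2 < 2 * (M i)\<^sup>2} (u x) + indicator (Q (b (Suc i) * T) - Q (b i * T)) x)
          * bulk l \<Psi> (J x) (v x) \<partial>lebesgue_on (Q T))
      + ennreal (30 * c * (l / \<sigma>)\<^sup>2 * D\<^sup>2 * M i) * (\<integral>\<^sup>+ x. ennreal (norm (u x - jump x)) \<partial>lebesgue_on (Q T))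
      + ennreal (8 * (1 + 1 / \<tau>)) * (ennreal (\<sigma>\<^sup>2 + D\<^sup>2) * emeasure lebesgue (Q T)
          + ennreal (1 + B\<^sup>2) * emeasure lebesgue ({x \<in> Q T. \<bar>x \<bullet> \<nu>\<bar> < 3} - Q ((1 - e) * T)))"
    proof (rule modification[OF T(1) J g AE, where \<zeta>="\<lambda>x. \<theta>0 ((1 / T) *\<^sub>R x)" and ?\<phi>1.0="\<lambda>x. \<theta>1 i ((1 / T) *\<^sub>R x)"
          and ?\<phi>2.0="\<lambda>x. \<theta>2 ((1 / T) *\<^sub>R x)" and ?A0.0="Q ((1 - e) * T)" and ?B1.0="Q (b i * T)" and ?B2.0="Q (b (Suc i) * T)"
          and \<sigma>=\<sigma> and M="M i" and \<tau>=\<tau> and B=B and D=D])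
      show "smooth (\<lambda>x. \<theta>0 ((1 / T) *\<^sub>R x))" using th0(2)[OF T(1)] by (rule test_fun_smooth)
      show "test_fun (Q T) (\<lambda>x. \<theta>1 i ((1 / T) *\<^sub>R x))" by (rule test_fun_mono[OF th1(2)[OF T(1)] QK])
      show "norm (grad (\<lambda>x. \<theta>0 ((1 / T) *\<^sub>R x)) x) \<le> D" for x by (rule gD[OF th0(6)[OF T(1)] C(2)])
      show "norm (grad (\<lambda>x. \<theta>1 i ((1 / T) *\<^sub>R x)) x) \<le> D" for x by (rule gD[OF th1(6)[OF T(1)] C(4)[OF i(1)]])
      show "norm (grad (\<lambda>x. \<theta>2 ((1 / T) *\<^sub>R x)) x) \<le> D" for x by (rule gD[OF th2(6)[OF T(1)] C(3)])
      show "\<theta>2 ((1 / T) *\<^sub>R x) = 1" if "x \<in> Q (b (Suc i) * T)" for x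
        using Qmono[of "Suc i" K] i(1) that by (intro th2(5)[OF T(1)]) auto
      show "\<theta>0 ((1 / T) *\<^sub>R x) = 0" if "x \<notin> Q (b i * T)" for x
        using test_fun_zero[OF th0(2)[OF T(1)]] Qmono[of 0 i] that by blast
      show "\<theta>1 i ((1 / T) *\<^sub>R x) = 0" if "x \<notin> Q (b (Suc i) * T)" for x
        using test_fun_zero[OF th1(2)[OF T(1)]] that by blast
      show "Q (b i * T) \<subseteq> Q (b (Suc i) * T)" by (rule Qmono) simp
      show "Q ((1 - e) * T) \<in> sets lebesgue" using e1 T by (intro Q_lebesgue) simp
    qed (rule th0(3,4) th1(3,4) th2(3,4) i2 sub0 Ql \<sigma> M \<tau> B th0(5)[OF T(1)] th1(5)[OF T(1)] | assumption)+
    have t1: "ennreal (1 + \<tau>) * F_inf l \<Psi> 1 u v (Q T) \<le> F_inf l \<Psi> 1 u v (Q T) + ennreal (\<delta> / 5 * T ^ ?p)"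
    proof -
      have "ennreal (1 + \<tau>) * F_inf l \<Psi> 1 u v (Q T) = F_inf l \<Psi> 1 u v (Q T) + ennreal \<tau> * F_inf l \<Psi> 1 u v (Q T)"
        using \<tau> by (simp add: distrib_right)
      also have "ennreal \<tau> * F_inf l \<Psi> 1 u v (Q T) \<le> ennreal \<tau> * ennreal (E0 * T ^ ?p)" by (intro mult_left_mono F) simp
      also have "\<dots> = ennreal (\<tau> * E0 * T ^ ?p)" using \<tau> by (simp add: ennreal_mult'[symmetric] mult.assoc)
      also have "\<dots> \<le> ennreal (\<delta> / 5 * T ^ ?p)" using \<tau>E T by (intro ennreal_leI mult_right_mono) auto
      finally show ?thesis by (simp add: add_left_mono)
    qed
    have t2: "ennreal (578 * c\<^sup>2) * I i \<le> ennreal (\<delta> / 5 * T ^ ?p)"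
    proof -
      have "ennreal (578 * c\<^sup>2) * I i \<le> ennreal (578 * c\<^sup>2) * ennreal (2 * E0 / K * T ^ ?p)" by (intro mult_left_mono Ii) simp
      also have "\<dots> = ennreal (578 * c\<^sup>2 * (2 * E0 / K) * T ^ ?p)" by (subst ennreal_mult'[symmetric]) (simp_all add: mult.assoc)
      also have "\<dots> \<le> ennreal (\<delta> / 5 * T ^ ?p)" using KE T by (intro ennreal_leI mult_right_mono) auto
      finally show ?thesis .
    qed
    have t3: "ennreal (30 * c * (l / \<sigma>)\<^sup>2 * D\<^sup>2 * M i) * (\<integral>\<^sup>+ x. ennreal (norm (u x - jump x)) \<partial>lebesgue_on (Q T)) \<le> ennreal (\<delta> / 5 * T ^ ?p)"
    proof -
      have "(l / \<sigma>)\<^sup>2 * D\<^sup>2 = l\<^sup>2 / s\<^sup>2 * C\<^sup>2 / T"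
        using T s by (simp add: power_divide \<sigma>2 D_def) (simp add: power2_eq_square field_simps)
      then have eq: "30 * c * (l / \<sigma>)\<^sup>2 * D\<^sup>2 * M i = 30 * c * (l\<^sup>2 / s\<^sup>2) * C\<^sup>2 * M i / T"
        by (simp add: mult.assoc)
      have "30 * c * (l\<^sup>2 / s\<^sup>2) * C\<^sup>2 * M i \<le> G"
        unfolding G_def using c0 i(1) Mmono[of i K] by (intro mult_left_mono) auto
      then have le: "30 * c * (l / \<sigma>)\<^sup>2 * D\<^sup>2 * M i \<le> G / T" unfolding eq using T by (intro divide_right_mono) auto
      have "ennreal (30 * c * (l / \<sigma>)\<^sup>2 * D\<^sup>2 * M i) * (\<integral>\<^sup>+ x. ennreal (norm (u x - jump x)) \<partial>lebesgue_on (Q T))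
        \<le> ennreal (G / T) * ennreal (\<eta> * T ^ CARD('n))"
        by (intro mult_mono ennreal_leI le L1) auto
      also have "\<dots> = ennreal (\<delta> / 5 * T ^ ?p)"
        using G T \<eta> by (subst ennreal_mult'[symmetric]) (auto simp: \<eta>_def power_dim)
      finally show ?thesis .
    qed
    have t4: "ennreal (8 * (1 + 1 / \<tau>)) * (ennreal (\<sigma>\<^sup>2 + D\<^sup>2) * emeasure lebesgue (Q T)
          + ennreal (1 + B\<^sup>2) * emeasure lebesgue ({x \<in> Q T. \<bar>x \<bullet> \<nu>\<bar> < 3} - Q ((1 - e) * T))) \<le> ennreal (\<delta> / 5 * T ^ ?p) + ennreal (\<delta> / 5 * T ^ ?p)"
    proof -
      have em: "emeasure lebesgue ({x \<in> Q T. \<bar>x \<bullet> \<nu>\<bar> < 3} - Q ((1 - e) * T)) = ennreal (6 * T ^ ?p * (1 - (1 - e) ^ ?p))"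
      proof (rule emeasure_boundary_slab[OF T(1)])
        have "(1/2) * 12 \<le> (1 - e) * T" using e T by (intro mult_mono) auto
        then show "6 \<le> (1 - e) * T" by simp
      qed (use e in auto)
      have pe: "(1 - e) ^ ?p \<le> 1" using e by (intro power_le_one) auto
      have a: "ennreal k8 * (ennreal (\<sigma>\<^sup>2 + D\<^sup>2) * emeasure lebesgue (Q T)) \<le> ennreal (\<delta> / 5 * T ^ ?p)"
      proof -
        have "ennreal k8 * (ennreal (\<sigma>\<^sup>2 + D\<^sup>2) * emeasure lebesgue (Q T)) = ennreal (k8 * ((\<sigma>\<^sup>2 + D\<^sup>2) * T ^ CARD('n)))"
          unfolding emeasure_Q[OF T(1)] using k8 by (simp add: ennreal_mult')
        also have "k8 * ((\<sigma>\<^sup>2 + D\<^sup>2) * T ^ CARD('n)) = (k8 * s\<^sup>2 + k8 * C\<^sup>2 / T) * T ^ ?p"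
          using T by (simp add: \<sigma>2 D_def power_dim power_divide) (simp add: field_simps power2_eq_square)
        also have "k8 * C\<^sup>2 / T \<le> \<delta> / 10" using T \<delta> by (simp add: field_simps)
        then have "(k8 * s\<^sup>2 + k8 * C\<^sup>2 / T) * T ^ ?p \<le> (\<delta> / 10 + \<delta> / 10) * T ^ ?p"
          using s2 T by (intro mult_right_mono add_mono) auto
        then have "ennreal ((k8 * s\<^sup>2 + k8 * C\<^sup>2 / T) * T ^ ?p) \<le> ennreal (\<delta> / 5 * T ^ ?p)" by (intro ennreal_leI) simp
        finally show ?thesis .
      qed
      have bb: "ennreal k8 * (ennreal (1 + B\<^sup>2) * ennreal (6 * T ^ ?p * (1 - (1 - e) ^ ?p))) \<le> ennreal (\<delta> / 5 * T ^ ?p)"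
      proof -
        have "ennreal k8 * (ennreal (1 + B\<^sup>2) * ennreal (6 * T ^ ?p * (1 - (1 - e) ^ ?p))) = ennreal (k8 * ((1 + B\<^sup>2) * (6 * T ^ ?p * (1 - (1 - e) ^ ?p))))"
          using k8 by (simp only: ennreal_mult'[symmetric] less_imp_le add_nonneg_nonneg zero_le_power2 zero_le_one)
        also have "k8 * ((1 + B\<^sup>2) * (6 * T ^ ?p * (1 - (1 - e) ^ ?p))) = (L * (1 - (1 - e) ^ ?p)) * T ^ ?p"
          by (simp only: L_def mult_ac)
        also have "ennreal ((L * (1 - (1 - e) ^ ?p)) * T ^ ?p) \<le> ennreal (\<delta> / 5 * T ^ ?p)"
          using Le T by (intro ennreal_leI mult_right_mono) auto
        finally show ?thesis .
      qed
      show ?thesis unfolding em k8_def[symmetric] unfolding distrib_left[of "ennreal k8"] by (rule add_mono[OF a bb])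
    qed
    have "F_inf l \<Psi> 1 u' v' (Q T) \<le> (F_inf l \<Psi> 1 u v (Q T) + ennreal (\<delta> / 5 * T ^ ?p)) + ennreal (\<delta> / 5 * T ^ ?p)
      + ennreal (\<delta> / 5 * T ^ ?p) + (ennreal (\<delta> / 5 * T ^ ?p) + ennreal (\<delta> / 5 * T ^ ?p))"
      by (rule order_trans[OF F']) (intro add_mono t1 t2[unfolded I_def ann_def lay_def] t3 t4)
    also have "\<dots> = F_inf l \<Psi> 1 u v (Q T) + ennreal (\<delta> * T ^ ?p)"
    proof -
      define q where "q = \<delta> / 5 * T ^ ?p"
      have q0: "q \<ge> 0" using \<delta> T by (simp add: q_def)
      have "\<delta> * T ^ ?p = q + q + q + (q + q)" by (simp add: q_def)
      then have "ennreal (\<delta> * T ^ ?p) = ennreal q + ennreal q + ennreal q + (ennreal q + ennreal q)"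
        using q0 by (simp only: ennreal_plus add_nonneg_nonneg)
      then show ?thesis unfolding q_def[symmetric] by (simp only: add.assoc)
    qed
    finally show "\<exists>u' v'. (u', v') \<in> admissible \<phi> R z \<nu> T \<and>
        F_inf l \<Psi> 1 u' v' (Q T) \<le> F_inf l \<Psi> 1 u v (Q T) + ennreal (\<delta> * T ^ ?p)"
      using uv' by blast
  qed
qed

end

section \<open>The two inequalities and the limit\<close>

context cell_problem
begin

abbreviation cell_energy :: "real \<Rightarrow> (real^'n \<Rightarrow> real^'m) \<Rightarrow> (real^'n \<Rightarrow> real) \<Rightarrow> ennreal" where
  "cell_energy T u v \<equiv> ennreal (1 / T ^ (CARD('n) - 1)) * F_inf l \<Psi> 1 u v (Q T)"

abbreviation deviation :: "real \<Rightarrow> (real^'n \<Rightarrow> real^'m) \<Rightarrow> ennreal" where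
  "deviation T u \<equiv> \<integral>\<^sup>+ x. ennreal (norm (u x - jump x)) \<partial>lebesgue_on (Q T)"

lemma jump_scale: "a > 0 \<Longrightarrow> jump (a *\<^sub>R x) = jump x"
  by (simp add: jump_def indicator_def zero_less_mult_iff)

lemma deviation_measurable:
  assumes "T > 0" "W12_vec (Q T) u"
  shows "(\<lambda>x. ennreal (norm (u x - jump x))) \<in> borel_measurable (lebesgue_on (Q T))"
proof -
  obtain J where J: "\<And>i. H1 (Q T) (\<lambda>x. u x $ i) (\<lambda>x. J x $ i)" using W12_vec_H1[OF assms(2)] by blast
  note [measurable] = H1_rows_measurable(1)[OF J]
  show ?thesis by measurable
qed

text \<open>On a bounded set the L1 norm is controlled through |y| \<le> 1 + y^2. Finiteness lets
  the distance of the rescaled tilings to the jump decay like 1/S.\<close>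

lemma deviation_finite:
  assumes T: "T > 0" and u: "W12_vec (Q T) u"
  shows "deviation T u < \<infinity>"
proof -
  have fin: "finite_measure (lebesgue_on (Q T))"
    using bounded_set_imp_lmeasurable[OF bounded_Q Q_lebesgue[OF T]] by (rule finite_measure_lebesgue_on)
  have sq: "integrable (lebesgue_on (Q T)) (\<lambda>x. (u x $ i)\<^sup>2)" for i
    using u by (simp add: W12_vec_def W12_def sq_integrable_def)
  have int: "integrable (lebesgue_on (Q T)) (\<lambda>x. (\<Sum>i\<in>UNIV. 1 + (u x $ i)\<^sup>2) + norm z)"
    by (intro Bochner_Integration.integrable_add Bochner_Integration.integrable_sum sq finite_measure.integrable_const fin)
  have "deviation T u \<le> (\<integral>\<^sup>+ x. ennreal ((\<Sum>i\<in>UNIV. 1 + (u x $ i)\<^sup>2) + norm z) \<partial>lebesgue_on (Q T))"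
  proof (intro nn_integral_mono ennreal_leI)
    fix x
    have "norm (u x - jump x) \<le> norm (u x) + norm (jump x)" by (rule norm_triangle_ineq4)
    also have "\<dots> \<le> (\<Sum>i\<in>UNIV. \<bar>u x $ i\<bar>) + norm z"
      by (intro add_mono norm_le_l1_cart) (simp add: jump_def indicator_def)
    also have "(\<Sum>i\<in>UNIV. \<bar>u x $ i\<bar>) \<le> (\<Sum>i\<in>UNIV. 1 + (u x $ i)\<^sup>2)"
    proof (intro sum_mono)
      show "\<bar>u x $ i\<bar> \<le> 1 + (u x $ i)\<^sup>2" for i
        using sum_squares_bound[of "\<bar>u x $ i\<bar>" 1] by simp
    qed
    finally show "norm (u x - jump x) \<le> (\<Sum>i\<in>UNIV. 1 + (u x $ i)\<^sup>2) + norm z" by simp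
  qed
  also have "\<dots> = ennreal (LINT x|lebesgue_on (Q T). (\<Sum>i\<in>UNIV. 1 + (u x $ i)\<^sup>2) + norm z)"
    by (intro nn_integral_eq_integral int AE_I2 add_nonneg_nonneg sum_nonneg) auto
  finally show ?thesis by (auto simp: less_top[symmetric] top_unique)
qed

lemma deviation_scale:
  assumes T: "T > 0" and u: "W12_vec (Q T) u" and a: "a > 0"
  shows "deviation (T / a) (\<lambda>x. u (a *\<^sub>R x)) = ennreal (1 / a ^ CARD('n)) * deviation T u"
  using nn_integral_scale_domain[OF deviation_measurable[OF T u] Q_lebesgue[OF T] a] scaled_cube[OF R a T] a
  by (simp add: jump_scale)

text \<open>The number of tiles divided by S^(n-1) is at most T^-(n-1), so the tiles contribute no
  more than the normalised energy of one cell. The deviation is normalised by the volume, one power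
  of \<open>S\<close> more, and therefore gains the factor 1/S.\<close>

lemma tiling_normalized:
  assumes T: "T \<ge> 6" and S: "S \<ge> 2 * T" and uv: "(u, v) \<in> admissible \<phi> R z \<nu> T" and C0: "C > 0"
    and C: "\<And>x. energy_density l \<Psi> (jump_jacobian x) (damage_profile x) (grad damage_profile x)
      \<le> ennreal C * indicator {y. \<bar>y \<bullet> \<nu>\<bar> < 3} x"
  shows "\<exists>u' v'. (u', v') \<in> admissible \<phi> R z \<nu> S \<and>
    cell_energy S u' v' \<le> cell_energy T u v + ennreal (6 * C * (1 - (1 - T / S) ^ (CARD('n) - 1))) \<and>
    ennreal (1 / S ^ CARD('n)) * deviation S u'
      \<le> ennreal (1 / S) * (ennreal (1 / T ^ (CARD('n) - 1)) * deviation T u + ennreal (2 * norm z))"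
proof -
  let ?p = "CARD('n) - 1"
  \<comment> \<open>The ceiling minus one, unlike the floor, gives \<open>N * T < S\<close> strictly
    also when \<open>S\<close> is a multiple of \<open>T\<close>; tiles must not touch the boundary
    of the large cube. From \<open>S \<ge> 2 * T\<close> there is at least one tile.\<close>
  define N where "N = nat \<lceil>S / T\<rceil> - 1"
  have T0: "T > 0" and S0: "S > 0" using T S by linarith+
  have "2 \<le> S / T" using S T0 by (simp add: field_simps)
  then have "2 \<le> \<lceil>S / T\<rceil>" by linarith
  then have "int N = \<lceil>S / T\<rceil> - 1" using \<open>2 \<le> \<lceil>S / T\<rceil>\<close> unfolding N_def by linarith
  then have N: "N \<ge> 1" "real N = real_of_int \<lceil>S / T\<rceil> - 1" using \<open>2 \<le> \<lceil>S / T\<rceil>\<close> by linarith+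
  have "real N < S / T" "S / T - 1 \<le> real N" using N(2) by linarith+
  then have NT: "real N * T < S" "S - T \<le> real N * T" using T0 by (auto simp: field_simps)
  \<comment> \<open>Covered fraction of each side of the cross-section; the uncovered fraction of
    its area is 1 - q^(n-1).\<close>
  define q where "q = real N * T / S"
  have "(S - T) / S \<le> q" unfolding q_def using NT S0 by (intro divide_right_mono) auto
  then have q: "1 - T / S \<le> q" "0 \<le> 1 - T / S" "0 \<le> q" "q \<le> 1" using NT(1) S T0 S0 by (auto simp: q_def diff_divide_distrib)
  have qp: "(1 - T / S) ^ ?p \<le> q ^ ?p" "q ^ ?p \<le> 1" "0 \<le> q ^ ?p" using q by (auto intro: power_mono power_le_one)
  have diff: "S ^ ?p - (real N * T) ^ ?p = S ^ ?p * (1 - q ^ ?p)"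
    using S0 by (simp add: q_def power_divide right_diff_distrib)
  have w: "ennreal (1 / S ^ ?p) * (of_nat (N ^ ?p) * X) \<le> ennreal (1 / T ^ ?p) * X" for X
  proof -
    have "real N ^ ?p * T ^ ?p = q ^ ?p * S ^ ?p" using S0 by (simp add: q_def power_divide power_mult_distrib)
    also have "\<dots> \<le> 1 * S ^ ?p" using qp S0 by (intro mult_right_mono) auto
    finally have "1 / S ^ ?p * real (N ^ ?p) \<le> 1 / T ^ ?p" using S0 T0 by (simp add: field_simps)
    then have "ennreal (1 / S ^ ?p * real (N ^ ?p)) \<le> ennreal (1 / T ^ ?p)" by (rule ennreal_leI)
    then have "ennreal (1 / S ^ ?p) * of_nat (N ^ ?p) \<le> ennreal (1 / T ^ ?p)"
      using S0 by (subst (asm) ennreal_mult') (auto simp: ennreal_of_nat_eq_real_of_nat)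
    then have "ennreal (1 / S ^ ?p) * of_nat (N ^ ?p) * X \<le> ennreal (1 / T ^ ?p) * X" by (rule mult_right_mono) simp
    then show ?thesis by (simp add: mult.assoc)
  qed
  have err: "ennreal (1 / S ^ ?p) * (ennreal A * ennreal (B * (S ^ ?p - (real N * T) ^ ?p))) = ennreal (A * B * (1 - q ^ ?p))"
    if "A \<ge> 0" "B \<ge> 0" for A B
  proof -
    have "ennreal (1 / S ^ ?p) * (ennreal A * ennreal (B * (S ^ ?p - (real N * T) ^ ?p)))
      = ennreal (1 / S ^ ?p * (A * (B * (S ^ ?p * (1 - q ^ ?p)))))"
      unfolding diff using S0 that by (subst ennreal_mult'[symmetric], simp)+ simp
    also have "1 / S ^ ?p * (A * (B * (S ^ ?p * (1 - q ^ ?p)))) = A * B * (1 - q ^ ?p)" using S0 by simp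
    finally show ?thesis .
  qed
  obtain u' v' where uv': "(u', v') \<in> admissible \<phi> R z \<nu> S"
    and F: "F_inf l \<Psi> 1 u' v' (Q S) \<le> of_nat (N ^ ?p) * F_inf l \<Psi> 1 u v (Q T) + ennreal C * ennreal (6 * (S ^ ?p - (N * T) ^ ?p))"
    and D: "deviation S u' \<le> of_nat (N ^ ?p) * deviation T u + ennreal (norm z) * ennreal (2 * (S ^ ?p - (N * T) ^ ?p))"
    by (rule tiling[OF T N(1) NT(1) uv C]) blast
  have "cell_energy S u' v' \<le> ennreal (1 / S ^ ?p) * (of_nat (N ^ ?p) * F_inf l \<Psi> 1 u v (Q T) + ennreal C * ennreal (6 * (S ^ ?p - (N * T) ^ ?p)))"
    by (intro mult_left_mono F) simp
  also have "\<dots> \<le> cell_energy T u v + ennreal (C * 6 * (1 - q ^ ?p))"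
    unfolding distrib_left[of "ennreal (1 / S ^ ?p)"] by (rule add_mono[OF w eq_refl[OF err]]) (use C0 in simp_all)
  also have "\<dots> \<le> cell_energy T u v + ennreal (6 * C * (1 - (1 - T / S) ^ ?p))"
    using qp C0 by (intro add_left_mono ennreal_leI) simp
  finally have 1: "cell_energy S u' v' \<le> cell_energy T u v + ennreal (6 * C * (1 - (1 - T / S) ^ ?p))" .
  have "ennreal (1 / S ^ ?p) * deviation S u' \<le> ennreal (1 / S ^ ?p) * (of_nat (N ^ ?p) * deviation T u + ennreal (norm z) * ennreal (2 * (S ^ ?p - (N * T) ^ ?p)))"
    by (intro mult_left_mono D) simp
  also have "\<dots> \<le> ennreal (1 / T ^ ?p) * deviation T u + ennreal (norm z * 2 * (1 - q ^ ?p))"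
    unfolding distrib_left[of "ennreal (1 / S ^ ?p)"] by (rule add_mono[OF w eq_refl[OF err]]) simp_all
  also have "\<dots> \<le> ennreal (1 / T ^ ?p) * deviation T u + ennreal (2 * norm z)"
  proof (intro add_left_mono ennreal_leI)
    have "norm z * 2 * (1 - q ^ ?p) \<le> norm z * 2 * 1" using qp by (intro mult_left_mono) auto
    then show "norm z * 2 * (1 - q ^ ?p) \<le> 2 * norm z" by simp
  qed
  finally have "ennreal (1 / S) * (ennreal (1 / S ^ ?p) * deviation S u')
    \<le> ennreal (1 / S) * (ennreal (1 / T ^ ?p) * deviation T u + ennreal (2 * norm z))" by (rule mult_left_mono) simp
  moreover have "ennreal (1 / S) * (ennreal (1 / S ^ ?p) * X) = ennreal (1 / S ^ CARD('n)) * X" for X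
    using S0 by (simp only: mult.assoc[symmetric]) (simp add: ennreal_mult'[symmetric] power_dim)
  ultimately show ?thesis using uv' 1 by auto
qed

lemma tiling_error_tendsto:
  "((\<lambda>S. X + ennreal (6 * C * (1 - (1 - T / S) ^ (CARD('n) - 1)))) \<longlongrightarrow> X) at_top"
proof -
  have "((\<lambda>S. T / S) \<longlongrightarrow> 0) at_top" by (intro tendsto_divide_0[OF tendsto_const] filterlim_at_top_imp_at_infinity filterlim_ident)
  then have "((\<lambda>S. X + ennreal (6 * C * (1 - (1 - T / S) ^ (CARD('n) - 1)))) \<longlongrightarrow> X + ennreal (6 * C * (1 - (1 - 0) ^ (CARD('n) - 1)))) at_top"
    by (intro tendsto_intros)
  then show ?thesis by simp
qed

text \<open>One good pair on one cube controls the infima on all sufficiently large cubes. This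
  replaces monotonicity in the size and yields the existence of the limit.\<close>

lemma cell_infimum_eventually_less:
  assumes T: "T \<ge> 6" and uv: "(u, v) \<in> admissible \<phi> R z \<nu> T" and a: "cell_energy T u v < a"
  shows "\<forall>\<^sub>F S in at_top. (INF (u, v) \<in> admissible \<phi> R z \<nu> S. cell_energy S u v) < a"
proof -
  obtain C where C: "C > 0" "\<And>x. energy_density l \<Psi> (jump_jacobian x) (damage_profile x) (grad damage_profile x)
    \<le> ennreal C * indicator {y. \<bar>y \<bullet> \<nu>\<bar> < 3} x" using profile_energy by blast
  show ?thesis
    using order_tendstoD(2)[OF tiling_error_tendsto a, of C T] eventually_ge_at_top[of "2 * T"]
  proof eventually_elim
    case (elim S)
    then obtain u' v' where "(u', v') \<in> admissible \<phi> R z \<nu> S"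
      "cell_energy S u' v' \<le> cell_energy T u v + ennreal (6 * C * (1 - (1 - T / S) ^ (CARD('n) - 1)))"
      using tiling_normalized[OF T _ uv C] by blast
    then have "(INF (u, v) \<in> admissible \<phi> R z \<nu> S. cell_energy S u v) \<le> cell_energy T u v + ennreal (6 * C * (1 - (1 - T / S) ^ (CARD('n) - 1)))"
      by (intro INF_lower2[of "(u', v')"]) auto
    then show ?case using elim by (meson le_less_trans)
  qed
qed

text \<open>Tilings of cubes of sides \<open>S j\<close> tending to infinity, scaled down to side
  one, compete in the definition of \<open>g\<close> with \<epsilon> equal to
  \<open>1 / S j\<close>. The tiling error vanishes in the limit, so the bound holds for each single
  cube and not only asymptotically.\<close>

lemma g_energy_le_cell_energy:
  assumes T: "T \<ge> 6" and uv: "(u, v) \<in> admissible \<phi> R z \<nu> T"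
  shows "g_energy l \<Psi> (Q 1) z \<nu> \<le> cell_energy T u v"
proof -
  let ?p = "CARD('n) - 1"
  have T0: "T > 0" using T by simp
  obtain C where C: "C > 0" "\<And>x. energy_density l \<Psi> (jump_jacobian x) (damage_profile x) (grad damage_profile x)
    \<le> ennreal C * indicator {y. \<bar>y \<bullet> \<nu>\<bar> < 3} x" using profile_energy by blast
  \<comment> \<open>Any sequence tending to infinity would serve; starting at \<open>2 * T\<close>
    guarantees a tile in every cube.\<close>
  define S where "S j = 2 * T + real j" for j
  have S: "S j \<ge> 2 * T" "S j > 0" for j using T0 by (simp_all add: S_def add_pos_nonneg)
  have Slim: "filterlim S at_top sequentially"
    unfolding S_def by (intro filterlim_tendsto_add_at_top[OF tendsto_const] filterlim_real_sequentially)
  have S1: "(\<lambda>j. 1 / S j) \<longlonglongrightarrow> 0" by (intro tendsto_divide_0[OF tendsto_const] filterlim_at_top_imp_at_infinity Slim)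
  have "ennreal (1 / T ^ ?p) * deviation T u + ennreal (2 * norm z) < \<infinity>"
    using deviation_finite[OF T0] uv by (auto simp: admissible_iff ennreal_mult_less_top)
  then obtain K where K: "ennreal (1 / T ^ ?p) * deviation T u + ennreal (2 * norm z) = ennreal K" "K \<ge> 0"
    by (cases "ennreal (1 / T ^ ?p) * deviation T u + ennreal (2 * norm z)") auto
  have "\<forall>j. \<exists>u' v'. (u', v') \<in> admissible \<phi> R z \<nu> (S j) \<and>
    cell_energy (S j) u' v' \<le> cell_energy T u v + ennreal (6 * C * (1 - (1 - T / S j) ^ ?p)) \<and>
    ennreal (1 / S j ^ CARD('n)) * deviation (S j) u' \<le> ennreal (1 / S j) * ennreal K"
    using tiling_normalized[OF T S(1) uv C] unfolding K by blast
  then obtain U V where UV: "\<And>j. (U j, V j) \<in> admissible \<phi> R z \<nu> (S j)"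
    "\<And>j. cell_energy (S j) (U j) (V j) \<le> cell_energy T u v + ennreal (6 * C * (1 - (1 - T / S j) ^ ?p))"
    "\<And>j. ennreal (1 / S j ^ CARD('n)) * deviation (S j) (U j) \<le> ennreal (1 / S j) * ennreal K"
    unfolding choice_iff by (elim exE) blast
  define u' where "u' j x = U j (S j *\<^sub>R x)" for j x
  define v' where "v' j x = V j (S j *\<^sub>R x)" for j x
  have Q1: "{x. S j *\<^sub>R x \<in> Q (S j)} = Q 1" for j using scaled_cube[OF R S(2)[of j] S(2)[of j]] S(2)[of j] by simp
  have W: "W12_vec (Q (S j)) (U j)" "W12 (Q (S j)) (V j)" "AE x in lebesgue_on (Q (S j)). 0 \<le> V j x \<and> V j x \<le> 1" for j
    using UV(1)[of j] by (auto simp: admissible_iff)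
  have sc: "F_inf l \<Psi> (1 / S j) (u' j) (v' j) (Q 1) = cell_energy (S j) (U j) (V j)" "W12_vec (Q 1) (u' j)" "W12 (Q 1) (v' j)" for j
    using F_inf_scale[OF open_Q[OF S(2)[of j]] W(1,2)[of j] S(2)[of j] zero_less_one]
    unfolding Q1 u'_def[abs_def] v'_def[abs_def] by blast+
  have AE: "AE x in lebesgue_on (Q 1). 0 \<le> v' j x \<and> v' j x \<le> 1" for j
    using AE_scale[OF W(3)[of j] Q_lebesgue[OF S(2)] S(2)[of j]] unfolding Q1 v'_def .
  have dev: "deviation 1 (u' j) \<le> ennreal (1 / S j * K)" for j
    using deviation_scale[OF S(2)[of j] W(1)[of j] S(2)[of j]] UV(3)[of j] S(2)[of j] K(2)
    by (simp add: u'_def[abs_def] ennreal_mult'[symmetric])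
  have devlim: "(\<lambda>j. deviation 1 (u' j)) \<longlonglongrightarrow> 0"
  proof (rule tendsto_sandwich[OF _ _ tendsto_const])
    have "(\<lambda>j. ennreal (1 / S j * K)) \<longlonglongrightarrow> ennreal (0 * K)" by (intro tendsto_intros S1)
    then show "(\<lambda>j. ennreal (1 / S j * K)) \<longlonglongrightarrow> 0" by simp
  qed (use dev in auto)
  have "g_energy l \<Psi> (Q 1) z \<nu> \<le> liminf (\<lambda>j. F_inf l \<Psi> (1 / S j) (u' j) (v' j) (Q 1))"
    unfolding g_energy_def
  proof (rule Inf_lower, intro CollectI exI conjI allI)
    show "liminf (\<lambda>j. F_inf l \<Psi> (1 / S j) (u' j) (v' j) (Q 1)) = liminf (\<lambda>j. F_inf l \<Psi> (1 / S j) (u' j) (v' j) (Q 1))" ..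
    show "(\<lambda>j. \<integral>\<^sup>+ x. ennreal (norm (u' j x - indicat_real {y. 0 < y \<bullet> \<nu>} x *\<^sub>R z)) \<partial>lebesgue_on (Q 1)) \<longlonglongrightarrow> 0"
      using devlim by (simp add: jump_def)
  qed (use S sc AE S1 in auto)
  also have "\<dots> \<le> liminf (\<lambda>j. cell_energy T u v + ennreal (6 * C * (1 - (1 - T / S j) ^ ?p)))"
    unfolding sc(1) by (intro Liminf_mono always_eventually allI UV(2))
  also have "\<dots> = cell_energy T u v"
    by (intro lim_imp_Liminf filterlim_compose[OF tiling_error_tendsto Slim]) simp
  finally show ?thesis .
qed

text \<open>A competitor for \<open>g\<close> with small \<epsilon> is blown up to side T =
  1/\<epsilon>. The L1 convergence on the unit cube becomes a deviation of at most \<eta> T^n, which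
  is exactly what \<open>recovery\<close> accepts.\<close>

lemma cell_energy_less:
  assumes a: "g_energy l \<Psi> (Q 1) z \<nu> < a"
  obtains T u v where "T \<ge> 6" "(u, v) \<in> admissible \<phi> R z \<nu> T" "cell_energy T u v < a"
proof -
  let ?p = "CARD('n) - 1"
  obtain \<epsilon> :: "nat \<Rightarrow> real" and u v where \<epsilon>: "\<And>j. \<epsilon> j > 0" "\<epsilon> \<longlonglongrightarrow> 0"
    and W: "\<And>j. W12_vec (Q 1) (u j)" "\<And>j. W12 (Q 1) (v j)" "\<And>j. AE x in lebesgue_on (Q 1). 0 \<le> v j x \<and> v j x \<le> 1"
    and dev: "(\<lambda>j. deviation 1 (u j)) \<longlonglongrightarrow> 0"
    and lim: "liminf (\<lambda>j. F_inf l \<Psi> (\<epsilon> j) (u j) (v j) (Q 1)) < a"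
    using a unfolding g_energy_def Inf_less_iff by (auto simp: jump_def)
  \<comment> \<open>Two intermediate levels: the first, finite, bounds the energy of the competitor;
    the gap \<open>E1 - E0\<close> to the second is the price allowed for imposing the boundary
    values.\<close>
  obtain b where b: "liminf (\<lambda>j. F_inf l \<Psi> (\<epsilon> j) (u j) (v j) (Q 1)) < b" "b < a" using dense[OF lim] by blast
  obtain b' where b': "b < b'" "b' < a" using dense[OF b(2)] by blast
  obtain E0 where E0: "b = ennreal E0" "E0 \<ge> 0" using b' by (cases b) (auto simp: top_unique)
  obtain E1 where E1: "b' = ennreal E1" "E1 \<ge> 0" using b' by (cases b') (auto simp: top_unique)
  have E01: "E0 < E1" using b'(1) E0 E1 by (simp add: ennreal_less_iff)
  obtain \<eta> T0 where \<eta>: "\<eta> > 0" and T0: "T0 > 0"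
    and rec: "\<And>T u v. T \<ge> T0 \<Longrightarrow> W12_vec (Q T) u \<Longrightarrow> W12 (Q T) v \<Longrightarrow> (AE x in lebesgue_on (Q T). 0 \<le> v x \<and> v x \<le> 1) \<Longrightarrow>
      F_inf l \<Psi> 1 u v (Q T) \<le> ennreal (E0 * T ^ ?p) \<Longrightarrow> deviation T u \<le> ennreal (\<eta> * T ^ CARD('n)) \<Longrightarrow>
      \<exists>u' v'. (u', v') \<in> admissible \<phi> R z \<nu> T \<and>
        F_inf l \<Psi> 1 u' v' (Q T) \<le> F_inf l \<Psi> 1 u v (Q T) + ennreal ((E1 - E0) * T ^ ?p)"
    by (rule recovery[OF E0(2), of "E1 - E0"]) (use E01 in auto)
  \<comment> \<open>A lower limit below \<open>b\<close> gives energies below \<open>b\<close> only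
    infinitely often, which still meets the conditions on \<epsilon> and the deviation that hold
    eventually.\<close>
  have fr: "\<exists>\<^sub>F j in sequentially. F_inf l \<Psi> (\<epsilon> j) (u j) (v j) (Q 1) < b"
  proof (rule ccontr)
    assume "\<not> (\<exists>\<^sub>F j in sequentially. F_inf l \<Psi> (\<epsilon> j) (u j) (v j) (Q 1) < b)"
    then have "b \<le> liminf (\<lambda>j. F_inf l \<Psi> (\<epsilon> j) (u j) (v j) (Q 1))"
      by (intro Liminf_bounded) (simp add: not_frequently not_less)
    then show False using b(1) by simp
  qed
  have "\<forall>\<^sub>F j in sequentially. \<epsilon> j < 1 / max T0 6"
    using order_tendstoD(2)[OF \<epsilon>(2), of "1 / max T0 6"] T0 by simp
  moreover have "\<forall>\<^sub>F j in sequentially. deviation 1 (u j) < ennreal \<eta>"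
    using order_tendstoD(2)[OF dev, of "ennreal \<eta>"] \<eta> by simp
  ultimately have "\<forall>\<^sub>F j in sequentially. \<epsilon> j < 1 / max T0 6 \<and> deviation 1 (u j) < ennreal \<eta>" by eventually_elim simp
  then obtain j where j: "F_inf l \<Psi> (\<epsilon> j) (u j) (v j) (Q 1) < b" "\<epsilon> j < 1 / max T0 6" "deviation 1 (u j) < ennreal \<eta>"
    using frequently_eventually_frequently[OF fr] frequently_ex by (smt (verit, best))
  define T where "T = 1 / \<epsilon> j"
  have T: "T > 0" "\<epsilon> j = 1 / T" using \<epsilon>(1)[of j] by (auto simp: T_def)
  have "max T0 6 > 0" by simp
  then have "max T0 6 < T" using j(2) \<epsilon>(1)[of j]
    by (simp add: T_def less_divide_eq mult.commute del: max_less_iff_conj less_max_iff_disj)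
  then have TT: "T \<ge> T0" "T \<ge> 6" by auto
  define U where "U x = u j (\<epsilon> j *\<^sub>R x)" for x
  define V where "V x = v j (\<epsilon> j *\<^sub>R x)" for x
  have QT: "{x. \<epsilon> j *\<^sub>R x \<in> Q 1} = Q T" using scaled_cube[OF R \<epsilon>(1)[of j] zero_less_one] by (simp add: T_def)
  note sc = F_inf_scale[OF open_Q[OF zero_less_one] W(1,2)[of j] \<epsilon>(1)[of j] \<epsilon>(1)[of j], unfolded QT, folded U_def[abs_def] V_def[abs_def]]
  have p: "1 / \<epsilon> j ^ ?p = T ^ ?p" "1 / \<epsilon> j ^ CARD('n) = T ^ CARD('n)" by (simp_all add: T_def power_divide)
  have F: "F_inf l \<Psi> 1 U V (Q T) = ennreal (T ^ ?p) * F_inf l \<Psi> (\<epsilon> j) (u j) (v j) (Q 1)"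
    using sc(1)[of l] \<epsilon>(1)[of j] unfolding p by simp
  have FE: "F_inf l \<Psi> 1 U V (Q T) \<le> ennreal (E0 * T ^ ?p)"
  proof -
    have "F_inf l \<Psi> 1 U V (Q T) \<le> ennreal (T ^ ?p) * ennreal E0"
      unfolding F using j(1) E0(1) by (intro mult_left_mono) auto
    then show ?thesis using E0 T by (simp add: ennreal_mult'[symmetric] mult.commute)
  qed
  have "deviation T U = ennreal (T ^ CARD('n)) * deviation 1 (u j)"
    using deviation_scale[OF zero_less_one W(1)[of j] \<epsilon>(1)[of j]] by (simp add: p T_def[symmetric] U_def[abs_def])
  also have "\<dots> \<le> ennreal (T ^ CARD('n)) * ennreal \<eta>" using j(3) by (intro mult_left_mono) auto
  also have "\<dots> = ennreal (\<eta> * T ^ CARD('n))" using T \<eta> by (simp add: ennreal_mult'[symmetric] mult.commute)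
  finally have D: "deviation T U \<le> ennreal (\<eta> * T ^ CARD('n))" .
  have AE: "AE x in lebesgue_on (Q T). 0 \<le> V x \<and> V x \<le> 1"
    using AE_scale[OF W(3)[of j] Q_lebesgue[OF zero_less_one] \<epsilon>(1)[of j]] unfolding QT V_def .
  obtain u' v' where uv': "(u', v') \<in> admissible \<phi> R z \<nu> T"
    and F': "F_inf l \<Psi> 1 u' v' (Q T) \<le> F_inf l \<Psi> 1 U V (Q T) + ennreal ((E1 - E0) * T ^ ?p)"
    using rec[OF TT(1) sc(2,3) AE FE D] by blast
  have "F_inf l \<Psi> 1 u' v' (Q T) \<le> ennreal (E0 * T ^ ?p) + ennreal ((E1 - E0) * T ^ ?p)"
    using F' FE by (meson add_right_mono order_trans)
  also have "\<dots> = ennreal (E1 * T ^ ?p)"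
    using E0 E01 T by (subst ennreal_plus[symmetric]) (auto simp: algebra_simps)
  finally have "cell_energy T u' v' \<le> ennreal (1 / T ^ ?p) * ennreal (E1 * T ^ ?p)" by (intro mult_left_mono) auto
  also have "\<dots> = ennreal E1" using T by (subst ennreal_mult'[symmetric]) auto
  also have "\<dots> < a" using b' E1 by simp
  finally show ?thesis using that TT(2) uv' by blast
qed

text \<open>Every infimum with \<open>T \<ge> 6\<close> is at least \<open>g\<close>, and any number
  above \<open>g\<close> exceeds some cell energy, hence eventually all infima. Limit and its
  existence follow together in the order topology, also when \<open>g\<close> is infinite.\<close>

theorem cell_formula:
  "((\<lambda>T. INF (u, v) \<in> admissible \<phi> R z \<nu> T. cell_energy T u v) \<longlongrightarrow> g_energy l \<Psi> (Q 1) z \<nu>) at_top"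
proof (rule order_tendstoI)
  fix a assume "a < g_energy l \<Psi> (Q 1) z \<nu>"
  moreover have "g_energy l \<Psi> (Q 1) z \<nu> \<le> (INF (u, v) \<in> admissible \<phi> R z \<nu> T. cell_energy T u v)" if "T \<ge> 6" for T
    using g_energy_le_cell_energy[OF that] by (intro INF_greatest) auto
  ultimately show "\<forall>\<^sub>F T in at_top. a < (INF (u, v) \<in> admissible \<phi> R z \<nu> T. cell_energy T u v)"
    by (intro eventually_mono[OF eventually_ge_at_top[of 6]]) (rule less_le_trans)
next
  fix a assume "g_energy l \<Psi> (Q 1) z \<nu> < a"
  then show "\<forall>\<^sub>F T in at_top. (INF (u, v) \<in> admissible \<phi> R z \<nu> T. cell_energy T u v) < a"
    by (rule cell_energy_less) (rule cell_infimum_eventually_less)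
qed

end

theorem proposition3p3:
  fixes \<Psi> :: "real^'n^'m \<Rightarrow> real" and l c :: real
    and R :: "real^'n \<Rightarrow> real^'n \<Rightarrow> real^'n"
    and \<phi> :: "real^'n \<Rightarrow> real"
    and z :: "real^'m" and \<nu> :: "real^'n"
  assumes "l > 0"
    and "continuous_on UNIV \<Psi>"
    and "c \<ge> 1"
    and "\<And>\<xi>. max ((norm \<xi>)\<^sup>2 / c - c) 0 \<le> \<Psi> \<xi>"
    and "\<And>\<xi>. \<Psi> \<xi> \<le> c * ((norm \<xi>)\<^sup>2 + 1)"
    and "uniform_limit (sphere 0 1) (\<lambda>t \<xi>. \<Psi> (t *\<^sub>R \<xi>) / t\<^sup>2) (recession \<Psi>) at_top"
    and "\<And>\<mu>. norm \<mu> = 1 \<Longrightarrow> cube_frame \<mu> (R \<mu>)"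
    and "test_fun (ball 0 1) \<phi>"
    and "\<And>x. \<phi> x \<ge> 0"
    and "(LINT x:ball 0 1|lborel. \<phi> x) = 1"
    and "norm \<nu> = 1"
  shows "((\<lambda>T. INF (u, v) \<in> admissible \<phi> (R \<nu>) z \<nu> T.
             ennreal (1 / T ^ (CARD('n) - 1)) * F_inf l \<Psi> 1 u v (cube (R \<nu>) T))
           \<longlongrightarrow> g_energy l \<Psi> (cube (R \<nu>) 1) z \<nu>) at_top"
proof -
  obtain k where k: "orthogonal_transformation (R \<nu>)" "R \<nu> (axis k 1) = \<nu>"
    using assms(7)[OF assms(11)] by (auto simp: cube_frame_def)
  interpret cell_problem \<phi> \<Psi> c \<nu> "R \<nu>" k l z
    by unfold_locales (rule assms k)+
  show ?thesis by (rule cell_formula)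
qed

end
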